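(* Let $K$ be an algebraically closed field, $r\ge2$ and $L\ge1$ integers, $Q$ the quiver with one vertex and $r$ loops, and $\Lambda=KQ/\langle\text{all paths of length }L+1\rangle$. Suppose $d>L+1$, and let $\mathbb S=(\mathbb S_0,\dots,\mathbb S_L)$ be the generic radical layering of the modules in an irreducible component $\mathcal C$ of $\mathbf{Rep}_d(\Lambda)$. Let $\widehat Q$ be the generalized Kronecker quiver with two vertices $1,2$ and $r$ arrows $\beta_1,\dots,\beta_r$ from $1$ to $2$. A sufficient condition for the modules in $\mathcal C$ to be generically indecomposable is as follows: There exists an index $l\in\{1,\dots,L\}$ such that the pair $(\dim\mathbb S_{l-1},\dim\mathbb S_l)$ is a Schur root of $\widehat Q$. Moreover: In case at least one of the varieties $\mathbf{Rep}_{(\dim\mathbb S_{l-1},\dim\mathbb S_l)}(K\widehat Q)$, $1\le l\le L$, contains infinitely many orbits of maximal dimension under the action of $\mathrm{GL}_{\dim\mathbb S_{l-1}}(K)\times\mathrm{GL}_{\dim\mathbb S_l}(K)$, then $\mathcal C$ contains infinitely many $\mathrm{GL}_d(K)$-orbits of maximal dimension.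
   Context: Modules are finite dimensional left modules; $J$ is the Jacobson radical of $\Lambda$, so $J^{L+1}=0$. Isomorphic semisimple modules are identified. The radical layering of a $\Lambda$-module $M$ is the sequence $\mathbb S(M)=(J^lM/J^{l+1}M)_{0\le l\le L}$. $\mathbf{Rep}_d(\Lambda)$ is the affine variety of $r$-tuples $(A_1,\dots,A_r)$ of $d\times d$ matrices over $K$ such that all $(L+1)$-fold products of the $A_i$ vanish, with $\mathrm{GL}_d(K)$ acting by simultaneous conjugation; a point $x=(A_i)$ corresponds to the module $M_x$ on $K^d$ on which the $i$-th loop acts as $A_i$. The generic radical layering of an irreducible component $\mathcal C$ is the value that $x\mapsto\mathbb S(M_x)$ takes constantly on a dense open subset of $\mathcal C$. The modules in $\mathcal C$ are generically indecomposable if $M_x$ is indecomposable for all $x$ in a dense open subset of $\mathcal C$. $\mathbf{Rep}_{(d_1,d_2)}(K\widehat Q)$ is the affine space of $r$-tuples of $K$-linear maps $K^{d_1}\to K^{d_2}$, with the action $(g_1,g_2).(B_i)=(g_2B_ig_1^{-1})$ of $\mathrm{GL}_{d_1}(K)\times\mathrm{GL}_{d_2}(K)$. A dimension vector $(d_1,d_2)$ is a Schur root of $\widehat Q$ if the representations in $\mathbf{Rep}_{(d_1,d_2)}(K\widehat Q)$ are generically indecomposable, i.e., indecomposable for all points of a dense open subset. *)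

theory Defs
  imports
    "HOL-Library.Extended_Nat"
    "HOL-Analysis.Abstract_Topology"
    "HOL-Algebra.QuotRing"
    "HOL-Algebra.Ideal_Product"
    "HOL-Algebra.Generated_Groups"
    "HOL-Algebra.Group_Action"
    "Jordan_Normal_Form.VS_Connect"
begin

section \<open>Affine spaces of matrix tuples and the Zariski topology\<close>

definition mat_tuples :: "nat \<Rightarrow> nat \<Rightarrow> nat \<Rightarrow> 'a mat list set" where
  "mat_tuples r m n = {x. length x = r \<and> set x \<subseteq> carrier_mat m n}"

inductive_set poly_funs :: "nat \<Rightarrow> nat \<Rightarrow> nat \<Rightarrow> ('a::field mat list \<Rightarrow> 'a) set"
  for r m n where
  const: "(\<lambda>_. c) \<in> poly_funs r m n"
| coord: "i < r \<Longrightarrow> j < m \<Longrightarrow> k < n \<Longrightarrow> (\<lambda>x. (x ! i) $$ (j, k)) \<in> poly_funs r m n"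
| add: "f \<in> poly_funs r m n \<Longrightarrow> g \<in> poly_funs r m n \<Longrightarrow> (\<lambda>x. f x + g x) \<in> poly_funs r m n"
| mult: "f \<in> poly_funs r m n \<Longrightarrow> g \<in> poly_funs r m n \<Longrightarrow> (\<lambda>x. f x * g x) \<in> poly_funs r m n"

definition zariski_open :: "nat \<Rightarrow> nat \<Rightarrow> nat \<Rightarrow> 'a::field mat list set \<Rightarrow> bool" where
  "zariski_open r m n U \<longleftrightarrow>
     (\<exists>F \<subseteq> poly_funs r m n. U = {x \<in> mat_tuples r m n. \<exists>f\<in>F. f x \<noteq> 0})"

definition zariski :: "nat \<Rightarrow> nat \<Rightarrow> nat \<Rightarrow> 'a::field mat list topology" where
  "zariski r m n = topology (zariski_open r m n)"

lemma istopology_zariski_open: "istopology (zariski_open r m n)"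
proof -
  have inter: "zariski_open r m n (S \<inter> T)"
    if S: "zariski_open r m n S" and T: "zariski_open r m n T" for S T :: "'a mat list set"
  proof -
    obtain F where F: "F \<subseteq> poly_funs r m n" "S = {x \<in> mat_tuples r m n. \<exists>f\<in>F. f x \<noteq> 0}"
      using S unfolding zariski_open_def by blast
    obtain G where G: "G \<subseteq> poly_funs r m n" "T = {x \<in> mat_tuples r m n. \<exists>g\<in>G. g x \<noteq> 0}"
      using T unfolding zariski_open_def by blast
    define H where "H = (\<Union>f\<in>F. (\<lambda>g x. f x * g x) ` G)"
    have sub: "H \<subseteq> poly_funs r m n"
      using F(1) G(1) unfolding H_def by (auto intro: poly_funs.mult)
    have "(\<exists>h\<in>H. h x \<noteq> 0) \<longleftrightarrow> (\<exists>f\<in>F. f x \<noteq> 0) \<and> (\<exists>g\<in>G. g x \<noteq> 0)" for x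
      unfolding H_def by simp
    then have "S \<inter> T = {x \<in> mat_tuples r m n. \<exists>h\<in>H. h x \<noteq> 0}"
      unfolding F(2) G(2) by (simp only: Collect_conj_eq[symmetric] conj_ac) simp
    with sub show ?thesis unfolding zariski_open_def by (intro exI[of _ H] conjI)
  qed
  have union: "zariski_open r m n (\<Union>\<K>)"
    if "\<forall>U\<in>\<K>. zariski_open r m n U" for \<K> :: "'a mat list set set"
  proof -
    have "\<forall>U\<in>\<K>. \<exists>F. F \<subseteq> poly_funs r m n \<and> U = {x \<in> mat_tuples r m n. \<exists>f\<in>F. f x \<noteq> 0}"
      using that unfolding zariski_open_def .
    then obtain F where F: "\<forall>U\<in>\<K>. F U \<subseteq> poly_funs r m n \<and>
        U = {x \<in> mat_tuples r m n. \<exists>f \<in> F U. f x \<noteq> 0}"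
      unfolding bchoice_iff by (elim exE)
    have "x \<in> \<Union>\<K> \<longleftrightarrow> x \<in> mat_tuples r m n \<and> (\<exists>f \<in> \<Union>(F ` \<K>). f x \<noteq> 0)" for x
    proof -
      have *: "x \<in> U \<longleftrightarrow> x \<in> mat_tuples r m n \<and> (\<exists>f \<in> F U. f x \<noteq> 0)" if U: "U \<in> \<K>" for U
        using arg_cong[OF conjunct2[OF bspec[OF F U]], of "\<lambda>A. x \<in> A"]
        unfolding mem_Collect_eq .
      have "x \<in> \<Union>\<K> \<longleftrightarrow> (\<exists>U\<in>\<K>. x \<in> mat_tuples r m n \<and> (\<exists>f \<in> F U. f x \<noteq> 0))"
        unfolding Union_iff by (rule bex_cong[OF refl *])
      then show ?thesis by simp
    qed
    then have "\<Union>\<K> = {x \<in> mat_tuples r m n. \<exists>f \<in> \<Union>(F ` \<K>). f x \<noteq> 0}"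
      by (simp only: set_eq_iff mem_Collect_eq simp_thms)
    moreover have "\<Union>(F ` \<K>) \<subseteq> poly_funs r m n"
      using F by (simp add: UN_subset_iff)
    ultimately show ?thesis unfolding zariski_open_def by (intro exI[of _ "\<Union>(F ` \<K>)"] conjI)
  qed
  show ?thesis unfolding istopology_def using inter union by simp
qed

lemma openin_zariski: "openin (zariski r m n) = zariski_open r m n"
  unfolding zariski_def by (rule topology_inverse'[OF istopology_zariski_open])

lemma topspace_zariski: "topspace (zariski r m n :: 'a::field mat list topology) = mat_tuples r m n"
proof (rule antisym)
  show "topspace (zariski r m n :: 'a mat list topology) \<subseteq> mat_tuples r m n"
    unfolding topspace_def openin_zariski zariski_open_def by auto
  have "zariski_open r m n (mat_tuples r m n :: 'a mat list set)"
    unfolding zariski_open_def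
    by (intro exI[of _ "{\<lambda>_. 1}"]) (auto intro: poly_funs.const)
  then show "mat_tuples r m n \<subseteq> topspace (zariski r m n :: 'a mat list topology)"
    unfolding openin_zariski[symmetric] by (rule openin_subset)
qed

definition irreducible_space :: "'b topology \<Rightarrow> bool" where
  "irreducible_space T \<longleftrightarrow> topspace T \<noteq> {} \<and>
     (\<forall>A B. closedin T A \<and> closedin T B \<and> A \<union> B = topspace T \<longrightarrow> A = topspace T \<or> B = topspace T)"

definition irreducible_component :: "'b topology \<Rightarrow> 'b set \<Rightarrow> bool" where
  "irreducible_component T C \<longleftrightarrow> C \<subseteq> topspace T \<and> irreducible_space (subtopology T C) \<and>
     (\<forall>D \<subseteq> topspace T. irreducible_space (subtopology T D) \<and> C \<subseteq> D \<longrightarrow> D = C)"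

definition krull_dim :: "'b topology \<Rightarrow> enat" where
  "krull_dim T = Sup {enat n | n. \<exists>Z :: nat \<Rightarrow> 'b set.
     (\<forall>i\<le>n. closedin T (Z i) \<and> irreducible_space (subtopology T (Z i))) \<and>
     (\<forall>i<n. Z i \<subset> Z (Suc i))}"

definition generically :: "'b topology \<Rightarrow> ('b \<Rightarrow> bool) \<Rightarrow> bool" where
  "generically T P \<longleftrightarrow> (\<exists>U. openin T U \<and> T closure_of U = topspace T \<and> (\<forall>x\<in>U. P x))"

definition max_dim_orbits :: "'b topology \<Rightarrow> 'b set set \<Rightarrow> 'b set set" where
  "max_dim_orbits T Orbs = {X \<in> Orbs. \<forall>Y\<in>Orbs.
     krull_dim (subtopology T Y) \<le> krull_dim (subtopology T X)}"

section \<open>Left modules over a not necessarily commutative ring\<close>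

text \<open>
  The record \<^typ>\<open>('r, 'm) module\<close> and the predicate \<^term>\<open>Module.submodule\<close> make sense over any
  ring; only the locale \<^locale>\<open>module\<close> insists on a commutative one and is therefore not used.
\<close>

definition left_ideal :: "('r, 'z) ring_scheme \<Rightarrow> 'r set \<Rightarrow> bool" where
  "left_ideal R I \<longleftrightarrow> additive_subgroup I R \<and> (\<forall>a \<in> carrier R. \<forall>x \<in> I. a \<otimes>\<^bsub>R\<^esub> x \<in> I)"

definition maximal_left_ideal :: "('r, 'z) ring_scheme \<Rightarrow> 'r set \<Rightarrow> bool" where
  "maximal_left_ideal R I \<longleftrightarrow> left_ideal R I \<and> I \<noteq> carrier R \<and>
     (\<forall>I'. left_ideal R I' \<and> I \<subseteq> I' \<longrightarrow> I' = I \<or> I' = carrier R)"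

definition jacobson_radical :: "('r, 'z) ring_scheme \<Rightarrow> 'r set" where
  "jacobson_radical R = {a \<in> carrier R. \<forall>I. maximal_left_ideal R I \<longrightarrow> a \<in> I}"

primrec ideal_power :: "('r, 'z) ring_scheme \<Rightarrow> 'r set \<Rightarrow> nat \<Rightarrow> 'r set" where
  "ideal_power R I 0 = carrier R"
| "ideal_power R I (Suc l) = ideal_prod R I (ideal_power R I l)"

definition ideal_smult :: "'r set \<Rightarrow> ('r, 'm) module \<Rightarrow> 'm set" where
  "ideal_smult I M = generate (add_monoid M) {a \<odot>\<^bsub>M\<^esub> m | a m. a \<in> I \<and> m \<in> carrier M}"

definition radical_submodule :: "('r, 'z) ring_scheme \<Rightarrow> ('r, 'm) module \<Rightarrow> nat \<Rightarrow> 'm set" where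
  "radical_submodule R M l = ideal_smult (ideal_power R (jacobson_radical R) l) M"

definition quot_module :: "('r, 'm) module \<Rightarrow> 'm set \<Rightarrow> ('r, 'm set) module" where
  "quot_module M N = \<lparr>carrier = a_rcosets\<^bsub>M\<^esub> N, mult = undefined, one = undefined,
     zero = N, add = set_add M, smult = (\<lambda>a X. \<Union>m\<in>X. N +>\<^bsub>M\<^esub> (a \<odot>\<^bsub>M\<^esub> m))\<rparr>"

definition radical_layer :: "('r, 'z) ring_scheme \<Rightarrow> ('r, 'm) module \<Rightarrow> nat \<Rightarrow> ('r, 'm set) module" where
  "radical_layer R M l =
     quot_module (M\<lparr>carrier := radical_submodule R M l\<rparr>) (radical_submodule R M (Suc l))"

definition isomorphic_modules ::
    "('r, 'z) ring_scheme \<Rightarrow> ('r, 'm) module \<Rightarrow> ('r, 'n) module \<Rightarrow> bool" where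
  "isomorphic_modules R M N \<longleftrightarrow> (\<exists>f. bij_betw f (carrier M) (carrier N) \<and> f \<zero>\<^bsub>M\<^esub> = \<zero>\<^bsub>N\<^esub> \<and>
     (\<forall>x \<in> carrier M. \<forall>y \<in> carrier M. f (x \<oplus>\<^bsub>M\<^esub> y) = f x \<oplus>\<^bsub>N\<^esub> f y) \<and>
     (\<forall>a \<in> carrier R. \<forall>x \<in> carrier M. f (a \<odot>\<^bsub>M\<^esub> x) = a \<odot>\<^bsub>N\<^esub> f x))"

definition internal_direct_sum :: "('r, 'm) module \<Rightarrow> 'm set \<Rightarrow> 'm set \<Rightarrow> bool" where
  "internal_direct_sum M U V \<longleftrightarrow> U <+>\<^bsub>M\<^esub> V = carrier M \<and> U \<inter> V = {\<zero>\<^bsub>M\<^esub>}"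

definition indecomposable_module :: "('r, 'z) ring_scheme \<Rightarrow> ('r, 'm) module \<Rightarrow> bool" where
  "indecomposable_module R M \<longleftrightarrow> carrier M \<noteq> {\<zero>\<^bsub>M\<^esub>} \<and>
     (\<forall>U V. Module.submodule U R M \<and> Module.submodule V R M \<and> internal_direct_sum M U V \<longrightarrow>
        U = {\<zero>\<^bsub>M\<^esub>} \<or> V = {\<zero>\<^bsub>M\<^esub>})"

section \<open>The local truncated path algebra\<close>

text \<open>
  Paths of the quiver with one vertex and loops \<open>0, \<dots>, r - 1\<close> are words in the loops, the empty
  word being the path of length \<open>0\<close>; an element of the path algebra is its coefficient function.
\<close>

definition path_algebra :: "nat \<Rightarrow> (nat list \<Rightarrow> 'a::field) ring" where
  "path_algebra r = \<lparr>
     carrier = {p. finite {w. p w \<noteq> 0} \<and> (\<forall>w. p w \<noteq> 0 \<longrightarrow> set w \<subseteq> {..<r})},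
     mult = (\<lambda>p q w. \<Sum>(u, v) \<in> {(u, v). u @ v = w}. p u * q v),
     one = (\<lambda>w. if w = [] then 1 else 0),
     zero = (\<lambda>w. 0),
     add = (\<lambda>p q w. p w + q w)\<rparr>"

lemma finite_splits: "finite {(u, v). u @ v = w}"
proof (rule finite_subset)
  show "{(u, v). u @ v = w} \<subseteq> (\<lambda>k. (take k w, drop k w)) ` {..length w}"
  proof (clarify)
    fix u v assume "w = u @ v"
    then show "(u, v) \<in> (\<lambda>k. (take k (u @ v), drop k (u @ v))) ` {..length (u @ v)}"
      by (intro image_eqI[of _ _ "length u"]) auto
  qed
qed simp

lemma ring_path_algebra: "ring (path_algebra r :: (nat list \<Rightarrow> 'a::field) ring)"
proof (rule ringI)
  let ?A = "path_algebra r :: (nat list \<Rightarrow> 'a) ring"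
  have mult_eq: "(p \<otimes>\<^bsub>?A\<^esub> q) w = (\<Sum>(u, v) \<in> {(u, v). u @ v = w}. p u * q v)" for p q w
    by (simp add: path_algebra_def)
  have mult_nz: "\<exists>u v. p u \<noteq> 0 \<and> q v \<noteq> 0 \<and> w = u @ v" if nz: "(p \<otimes>\<^bsub>?A\<^esub> q) w \<noteq> 0" for p q w
  proof (rule ccontr)
    assume "\<not> ?thesis"
    then have "(p \<otimes>\<^bsub>?A\<^esub> q) w = 0"
      unfolding mult_eq by (intro sum.neutral) auto
    with nz show False by simp
  qed
  show "abelian_group ?A"
  proof (rule abelian_groupI)
    fix p q assume "p \<in> carrier ?A" "q \<in> carrier ?A"
    moreover have "{w. p w + q w \<noteq> 0} \<subseteq> {w. p w \<noteq> 0} \<union> {w. q w \<noteq> 0}" by auto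
    ultimately show "p \<oplus>\<^bsub>?A\<^esub> q \<in> carrier ?A"
      unfolding path_algebra_def by (auto intro: finite_subset)
  next
    fix p assume "p \<in> carrier ?A"
    then show "\<exists>q\<in>carrier ?A. q \<oplus>\<^bsub>?A\<^esub> p = \<zero>\<^bsub>?A\<^esub>"
      by (intro bexI[of _ "\<lambda>w. - p w"]) (auto simp: path_algebra_def)
  qed (auto simp: path_algebra_def algebra_simps)
  show "monoid ?A"
  proof (rule monoidI)
    fix p q assume p: "p \<in> carrier ?A" and q: "q \<in> carrier ?A"
    have "{w. (p \<otimes>\<^bsub>?A\<^esub> q) w \<noteq> 0} \<subseteq> (\<lambda>(u, v). u @ v) ` ({u. p u \<noteq> 0} \<times> {v. q v \<noteq> 0})"
      using mult_nz by fastforce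
    moreover have "finite \<dots>" using p q by (simp add: path_algebra_def)
    ultimately have "finite {w. (p \<otimes>\<^bsub>?A\<^esub> q) w \<noteq> 0}" by (rule finite_subset)
    moreover have "set w \<subseteq> {..<r}" if nz: "(p \<otimes>\<^bsub>?A\<^esub> q) w \<noteq> 0" for w
    proof -
      obtain u v where "p u \<noteq> 0" "q v \<noteq> 0" "w = u @ v" using mult_nz[OF nz] by blast
      then show ?thesis using p q by (simp add: path_algebra_def)
    qed
    ultimately show "p \<otimes>\<^bsub>?A\<^esub> q \<in> carrier ?A"
      by (simp add: path_algebra_def)
  next
    show "\<one>\<^bsub>?A\<^esub> \<in> carrier ?A" by (simp add: path_algebra_def)
  next
    fix p q s :: "nat list \<Rightarrow> 'a"
    show "p \<otimes>\<^bsub>?A\<^esub> q \<otimes>\<^bsub>?A\<^esub> s = p \<otimes>\<^bsub>?A\<^esub> (q \<otimes>\<^bsub>?A\<^esub> s)"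
    proof
      fix w
      have "(p \<otimes>\<^bsub>?A\<^esub> q \<otimes>\<^bsub>?A\<^esub> s) w =
          (\<Sum>x \<in> {(u, v). u @ v = w}. \<Sum>y \<in> {(a, b). a @ b = fst x}. p (fst y) * q (snd y) * s (snd x))"
        unfolding mult_eq by (simp add: sum_distrib_right split_beta)
      also have "\<dots> = (\<Sum>z \<in> Sigma {(u, v). u @ v = w} (\<lambda>x. {(a, b). a @ b = fst x}).
          p (fst (snd z)) * q (snd (snd z)) * s (snd (fst z)))"
        by (subst sum.Sigma) (auto simp: finite_splits split_beta)
      also have "\<dots> = (\<Sum>z \<in> Sigma {(u, v). u @ v = w} (\<lambda>x. {(a, b). a @ b = snd x}).
          p (fst (fst z)) * (q (fst (snd z)) * s (snd (snd z))))"
        by (rule sum.reindex_bij_witness[of _ "\<lambda>((u, v), (a, b)). ((u @ a, b), (u, a))"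
              "\<lambda>((u, v), (a, b)). ((a, b @ v), (b, v))"]) (auto simp: algebra_simps)
      also have "\<dots> = (\<Sum>x \<in> {(u, v). u @ v = w}. \<Sum>y \<in> {(a, b). a @ b = snd x}.
          p (fst x) * (q (fst y) * s (snd y)))"
        by (subst sum.Sigma) (auto simp: finite_splits split_beta)
      also have "\<dots> = (p \<otimes>\<^bsub>?A\<^esub> (q \<otimes>\<^bsub>?A\<^esub> s)) w"
        unfolding mult_eq by (simp add: sum_distrib_left split_beta)
      finally show "(p \<otimes>\<^bsub>?A\<^esub> q \<otimes>\<^bsub>?A\<^esub> s) w = (p \<otimes>\<^bsub>?A\<^esub> (q \<otimes>\<^bsub>?A\<^esub> s)) w" .
    qed
  next
    fix p :: "nat list \<Rightarrow> 'a"
    show "\<one>\<^bsub>?A\<^esub> \<otimes>\<^bsub>?A\<^esub> p = p"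
    proof
      fix w
      have "(\<one>\<^bsub>?A\<^esub> \<otimes>\<^bsub>?A\<^esub> p) w = (\<Sum>(u, v) \<in> {([], w)}. \<one>\<^bsub>?A\<^esub> u * p v)"
        unfolding mult_eq
        by (rule sum.mono_neutral_right) (auto simp: finite_splits path_algebra_def split: if_splits)
      then show "(\<one>\<^bsub>?A\<^esub> \<otimes>\<^bsub>?A\<^esub> p) w = p w" by (simp add: path_algebra_def)
    qed
    show "p \<otimes>\<^bsub>?A\<^esub> \<one>\<^bsub>?A\<^esub> = p"
    proof
      fix w
      have "(p \<otimes>\<^bsub>?A\<^esub> \<one>\<^bsub>?A\<^esub>) w = (\<Sum>(u, v) \<in> {(w, [])}. p u * \<one>\<^bsub>?A\<^esub> v)"
        unfolding mult_eq
        by (rule sum.mono_neutral_right) (auto simp: finite_splits path_algebra_def split: if_splits)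
      then show "(p \<otimes>\<^bsub>?A\<^esub> \<one>\<^bsub>?A\<^esub>) w = p w" by (simp add: path_algebra_def)
    qed
  qed
qed (auto simp: path_algebra_def split_beta algebra_simps sum.distrib)

definition trunc_ideal :: "nat \<Rightarrow> nat \<Rightarrow> (nat list \<Rightarrow> 'a::field) set" where
  "trunc_ideal r L = genideal (path_algebra r)
     {(\<lambda>v. if v = w then 1 else 0) | w. length w = L + 1 \<and> set w \<subseteq> {..<r}}"

definition trunc_algebra :: "nat \<Rightarrow> nat \<Rightarrow> (nat list \<Rightarrow> 'a::field) set ring" where
  "trunc_algebra r L = path_algebra r Quot trunc_ideal r L"

text \<open>The dimension over the ground field, which acts through its image in the algebra.\<close>

definition ground_field_space ::
    "nat \<Rightarrow> nat \<Rightarrow> ((nat list \<Rightarrow> 'a::field) set, 'm) module \<Rightarrow> ('a, 'm) module" where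
  "ground_field_space r L M = \<lparr>carrier = carrier M, mult = undefined, one = undefined,
     zero = \<zero>\<^bsub>M\<^esub>, add = add M,
     smult = (\<lambda>c m.
       (trunc_ideal r L +>\<^bsub>path_algebra r\<^esub> (\<lambda>w. if w = [] then c else 0)) \<odot>\<^bsub>M\<^esub> m)\<rparr>"

definition module_dim :: "nat \<Rightarrow> nat \<Rightarrow> ((nat list \<Rightarrow> 'a::field) set, 'm) module \<Rightarrow> nat" where
  "module_dim r L M = vectorspace.dim class_ring (ground_field_space r L M)"

section \<open>The variety of modules\<close>

definition word_mat :: "nat \<Rightarrow> 'a::field mat list \<Rightarrow> nat list \<Rightarrow> 'a mat" where
  "word_mat d x w = foldr (\<lambda>i B. x ! i * B) w (1\<^sub>m d)"

definition Rep :: "nat \<Rightarrow> nat \<Rightarrow> nat \<Rightarrow> 'a::field mat list set" where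
  "Rep r L d = {x \<in> mat_tuples r d d.
     \<forall>w. length w = L + 1 \<and> set w \<subseteq> {..<r} \<longrightarrow> word_mat d x w = 0\<^sub>m d d}"

definition path_action :: "nat \<Rightarrow> 'a::field mat list \<Rightarrow> (nat list \<Rightarrow> 'a) \<Rightarrow> 'a vec \<Rightarrow> 'a vec" where
  "path_action d x p v = vec d (\<lambda>i. \<Sum>w | p w \<noteq> 0. p w * (word_mat d x w *\<^sub>v v) $ i)"

text \<open>
  Scalars are residue classes in the path algebra. For a point of \<^term>\<open>Rep r L d\<close> the truncation
  ideal acts as zero, so the choice of the representative in \<open>smult\<close> is immaterial.
\<close>

definition rep_module :: "nat \<Rightarrow> 'a::field mat list \<Rightarrow> ((nat list \<Rightarrow> 'a) set, 'a vec) module" where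
  "rep_module d x = \<lparr>carrier = carrier_vec d, mult = undefined, one = undefined,
     zero = 0\<^sub>v d, add = (+), smult = (\<lambda>a v. path_action d x (SOME p. p \<in> a) v)\<rparr>"

text \<open>
  Semisimple modules being identified when isomorphic, \<open>\<S>\<close> is the generic value of the radical
  layering if its entries are isomorphic to the layers at every point of a dense open subset.
\<close>

definition generic_radical_layering ::
    "nat \<Rightarrow> nat \<Rightarrow> nat \<Rightarrow> 'a::field mat list set \<Rightarrow> (nat \<Rightarrow> ((nat list \<Rightarrow> 'a) set, 'm) module) \<Rightarrow> bool" where
  "generic_radical_layering r L d C \<S> \<longleftrightarrow>
     generically (subtopology (zariski r d d) C) (\<lambda>x. \<forall>l\<le>L.
       isomorphic_modules (trunc_algebra r L)
         (radical_layer (trunc_algebra r L) (rep_module d x) l) (\<S> l))"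

definition generically_indecomposable :: "nat \<Rightarrow> nat \<Rightarrow> nat \<Rightarrow> 'a::field mat list set \<Rightarrow> bool" where
  "generically_indecomposable r L d C \<longleftrightarrow>
     generically (subtopology (zariski r d d) C)
       (\<lambda>x. indecomposable_module (trunc_algebra r L) (rep_module d x))"

definition GL :: "nat \<Rightarrow> 'a::field mat monoid" where
  "GL n = units_of (ring_mat TYPE('a) n ())"

definition conj_action :: "nat \<Rightarrow> 'a::field mat \<Rightarrow> 'a mat list \<Rightarrow> 'a mat list" where
  "conj_action d g x = map (\<lambda>A. g * A * inv\<^bsub>GL d\<^esub> g) x"

section \<open>Representations of the generalized Kronecker quiver\<close>

text \<open>
  A point of \<^term>\<open>mat_tuples r d2 d1\<close> is a representation with dimension vector \<open>(d1, d2)\<close>: the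
  \<open>r\<close> arrows act as matrices of linear maps from the \<open>d1\<close>- to the \<open>d2\<close>-dimensional space.
\<close>

definition kronecker_subrep ::
    "nat \<Rightarrow> nat \<Rightarrow> 'a::field mat list \<Rightarrow> 'a vec set \<times> 'a vec set \<Rightarrow> bool" where
  "kronecker_subrep d1 d2 B U \<longleftrightarrow>
     VectorSpace.subspace class_ring (fst U) (module_vec TYPE('a) d1) \<and>
     VectorSpace.subspace class_ring (snd U) (module_vec TYPE('a) d2) \<and>
     (\<forall>A \<in> set B. \<forall>v \<in> fst U. A *\<^sub>v v \<in> snd U)"

definition kronecker_indecomposable :: "nat \<Rightarrow> nat \<Rightarrow> 'a::field mat list \<Rightarrow> bool" where
  "kronecker_indecomposable d1 d2 B \<longleftrightarrow> (d1, d2) \<noteq> (0, 0) \<and>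
     (\<forall>U V. kronecker_subrep d1 d2 B U \<and> kronecker_subrep d1 d2 B V \<and>
        internal_direct_sum (module_vec TYPE('a) d1) (fst U) (fst V) \<and>
        internal_direct_sum (module_vec TYPE('a) d2) (snd U) (snd V) \<longrightarrow>
        U = ({0\<^sub>v d1}, {0\<^sub>v d2}) \<or> V = ({0\<^sub>v d1}, {0\<^sub>v d2}))"

text \<open>The type argument fixes the ground field, which the numerical arguments do not determine.\<close>

definition schur_root :: "'a::field itself \<Rightarrow> nat \<Rightarrow> nat \<Rightarrow> nat \<Rightarrow> bool" where
  "schur_root TYPE('a) r d1 d2 \<longleftrightarrow>
     generically (zariski r d2 d1 :: 'a mat list topology) (kronecker_indecomposable d1 d2)"

definition kronecker_action ::
    "nat \<Rightarrow> nat \<Rightarrow> 'a::field mat \<times> 'a mat \<Rightarrow> 'a mat list \<Rightarrow> 'a mat list" where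
  "kronecker_action d1 d2 g B = map (\<lambda>A. snd g * A * inv\<^bsub>GL d1\<^esub> (fst g)) B"

end

theory Submission
  imports Defs
begin

text \<open>
  A point of the component with generic radical layering is conjugate to a tuple \<open>p\<close> that is strictly
  triangular for a fixed level function, the vectors of level \<open>\<ge> j\<close> spanning the \<open>j\<close>-th radical power.
  Conversely all conjugates of such triangular tuples form an irreducible set, so by maximality they
  lie in the component; as the block of \<open>p\<close> between two consecutive levels can be prescribed
  arbitrarily, it is a generic Kronecker representation.

  An idempotent endomorphism of \<open>p\<close> induces one of the Kronecker block. If the latter is
  indecomposable, the idempotent or its complement vanishes on this block; a nonzero idempotent of this
  kind yields a vector of lower level, outside the next radical power, that is annihilated by all
  arrows. Raising the level of this vector
  shows that \<open>p\<close> is not general, unless the raised level function violates a dimension count; in that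
  case \<open>dim \<S>\<^sub>l = r * dim \<S>\<^sub>l\<^sub>-\<^sub>1\<close> with \<open>dim \<S>\<^sub>l\<^sub>-\<^sub>1\<close> divisible by \<open>r \<ge> 2\<close>, and \<open>(dim \<S>\<^sub>l\<^sub>-\<^sub>1, dim \<S>\<^sub>l)\<close> is
  not a Schur root.

  For the second part, the dimension of an orbit is the rank of its linearised orbit map, and a
  Kronecker space with infinitely many orbits of maximal dimension has no dense orbit. If the component
  had only finitely many orbits of maximal dimension, the generic Kronecker block would lie in finitely
  many nondense orbits.
\<close>

section \<open>Algebras of functions\<close>

text \<open>Irreducibility enters in one form: two polynomial functions, neither vanishing
  identically on the set, are nonzero at a common point of it. Rational curves joining any two
  points prove it, since a nonzero polynomial in one variable has finitely many zeros in an infinite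
  field.

  Orbit dimension is a topological Krull dimension in arbitrary characteristic, where the
  differential of an orbit map could lose rank. It does not here: both groups consist of the units
  of an algebra of matrix pairs, so intertwining two points is a linear condition on the group
  element, and an affine slice through the identity, complementary to the kernel of the
  differential, parametrises a dense part of the orbit rationally.

  The triangular form of a point depends on a basis. A basis adapted at one point extends to a
  matrix with polynomial entries whose columns stay in the prescribed radical powers; where it is
  invertible and the level counts are the generic ones, it is adapted again. In this way conditions
  on the Kronecker block become open conditions on the component.\<close>

locale function_algebra =
  fixes S :: "('t \<Rightarrow> 'a::field) set"
  assumes const [simp]: "(\<lambda>_. c) \<in> S"
    and add: "f \<in> S \<Longrightarrow> g \<in> S \<Longrightarrow> (\<lambda>t. f t + g t) \<in> S"
    and mult: "f \<in> S \<Longrightarrow> g \<in> S \<Longrightarrow> (\<lambda>t. f t * g t) \<in> S"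
begin

lemma uminus: "f \<in> S \<Longrightarrow> (\<lambda>t. - f t) \<in> S"
  using mult[OF const[of "-1"], of f] by simp

lemma diff: "f \<in> S \<Longrightarrow> g \<in> S \<Longrightarrow> (\<lambda>t. f t - g t) \<in> S"
  using add[of f "\<lambda>t. - g t"] uminus[of g] by simp

lemma sum: "(\<And>i. i \<in> I \<Longrightarrow> f i \<in> S) \<Longrightarrow> (\<lambda>t. \<Sum>i\<in>I. f i t) \<in> S"
proof (induction I rule: infinite_finite_induct)
  case (insert x F)
  then have "(\<lambda>t. f x t + (\<Sum>i\<in>F. f i t)) \<in> S" by (intro add) simp_all
  with insert show ?case by simp
qed simp_all

lemma prod: "(\<And>i. i \<in> I \<Longrightarrow> f i \<in> S) \<Longrightarrow> (\<lambda>t. \<Prod>i\<in>I. f i t) \<in> S"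
proof (induction I rule: infinite_finite_induct)
  case (insert x F)
  then have "(\<lambda>t. f x t * (\<Prod>i\<in>F. f i t)) \<in> S" by (intro mult) simp_all
  with insert show ?case by simp
qed simp_all

lemma power: "f \<in> S \<Longrightarrow> (\<lambda>t. f t ^ k) \<in> S"
proof (induction k)
  case (Suc k)
  then have "(\<lambda>t. f t * f t ^ k) \<in> S" by (intro mult)
  then show ?case by simp
qed simp

lemma det:
  assumes "\<And>t. M t \<in> carrier_mat n n"
    and "\<And>i j. i < n \<Longrightarrow> j < n \<Longrightarrow> (\<lambda>t. M t $$ (i, j)) \<in> S"
  shows "(\<lambda>t. det (M t)) \<in> S"
proof -
  have "(\<lambda>t. \<Sum>p\<in>{p. p permutes {0..<n}}. signof p * (\<Prod>i = 0..<n. M t $$ (i, p i))) \<in> S"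
  proof (rule sum, rule mult, rule const, rule prod)
    fix p i assume p: "p \<in> {p. p permutes {0..<n}}" and i: "i \<in> {0..<n}"
    then have "p i < n" using permutes_in_image[of p "{0..<n}" i] by simp
    with i show "(\<lambda>t. M t $$ (i, p i)) \<in> S" by (intro assms(2)) simp_all
  qed
  moreover have "det (M t) = (\<Sum>p\<in>{p. p permutes {0..<n}}. signof p * (\<Prod>i = 0..<n. M t $$ (i, p i)))" for t
    by (rule det_def'[OF assms(1)])
  ultimately show ?thesis by simp
qed

lemma adj_mat:
  assumes M: "\<And>t. M t \<in> carrier_mat n n"
    and e: "\<And>i j. i < n \<Longrightarrow> j < n \<Longrightarrow> (\<lambda>t. M t $$ (i, j)) \<in> S"
    and ij: "i < n" "j < n"
  shows "(\<lambda>t. adj_mat (M t) $$ (i, j)) \<in> S"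
proof -
  have "(\<lambda>t. (-1) ^ (j + i) * det (mat_delete (M t) j i)) \<in> S"
  proof (rule mult, rule const, rule det)
    show "mat_delete (M t) j i \<in> carrier_mat (n - 1) (n - 1)" for t
      using mat_delete_carrier[OF M] .
    fix a b assume ab: "a < n - 1" "b < n - 1"
    have "mat_delete (M t) j i $$ (a, b) = M t $$ (if a < j then a else Suc a, if b < i then b else Suc b)" for t
      using M[of t] ab ij by (auto simp: mat_delete_def)
    then show "(\<lambda>t. mat_delete (M t) j i $$ (a, b)) \<in> S"
      using ab ij by (simp add: e)
  qed
  moreover have "adj_mat (M t) $$ (i, j) = (-1) ^ (j + i) * det (mat_delete (M t) j i)" for t
    using M[of t] ij by (auto simp: adj_mat_def cofactor_def)
  ultimately show ?thesis by simp
qed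

lemma mult_mat:
  assumes "\<And>t. A t \<in> carrier_mat m k" "\<And>t. B t \<in> carrier_mat k n"
    and "\<And>i j. i < m \<Longrightarrow> j < k \<Longrightarrow> (\<lambda>t. A t $$ (i, j)) \<in> S"
    and "\<And>i j. i < k \<Longrightarrow> j < n \<Longrightarrow> (\<lambda>t. B t $$ (i, j)) \<in> S"
    and ij: "i < m" "j < n"
  shows "(\<lambda>t. (A t * B t) $$ (i, j)) \<in> S"
proof -
  have "(A t * B t) $$ (i, j) = (\<Sum>l\<in>{0..<k}. A t $$ (i, l) * B t $$ (l, j))" for t
    using assms(1,2)[of t] ij by (simp add: scalar_prod_def)
  moreover have "(\<lambda>t. \<Sum>l\<in>{0..<k}. A t $$ (i, l) * B t $$ (l, j)) \<in> S"
    by (rule sum, rule mult) (use assms in simp_all)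
  ultimately show ?thesis by simp
qed

lemma poly_fun_compose:
  assumes "f \<in> poly_funs r m n"
    and "\<And>i j k. i < r \<Longrightarrow> j < m \<Longrightarrow> k < n \<Longrightarrow> (\<lambda>t. (X t ! i) $$ (j, k)) \<in> S"
  shows "(\<lambda>t. f (X t)) \<in> S"
  using assms(1) by induction (simp_all add: assms(2) add mult)

end

interpretation poly_funs: function_algebra "poly_funs r m n"
  by unfold_locales (rule poly_funs.intros; assumption?)+

text \<open>Functions here are total, so the values at the zeros of \<open>\<delta>\<close> are left
  free. The exponent may depend on \<open>\<phi>\<close>; finitely many functions can be brought to
  a common one.\<close>

definition localize :: "('t \<Rightarrow> 'a::field) set \<Rightarrow> ('t \<Rightarrow> 'a) \<Rightarrow> ('t \<Rightarrow> 'a) set" where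
  "localize S \<delta> = {\<phi>. \<exists>N. \<exists>p\<in>S. \<forall>t. \<delta> t \<noteq> 0 \<longrightarrow> \<phi> t * \<delta> t ^ N = p t}"

context function_algebra begin

lemma subset_localize: "f \<in> S \<Longrightarrow> f \<in> localize S \<delta>"
  unfolding localize_def by (auto intro!: exI[of _ 0] bexI[of _ f])

lemma inverse_localize: "(\<lambda>t. inverse (\<delta> t)) \<in> localize S \<delta>"
  unfolding localize_def by (auto intro!: exI[of _ 1] bexI[of _ "\<lambda>_. 1"])

lemma localize_cong:
  assumes "\<psi> \<in> localize S \<delta>" "\<And>t. \<delta> t \<noteq> 0 \<Longrightarrow> \<phi> t = \<psi> t"
  shows "\<phi> \<in> localize S \<delta>"
  using assms unfolding localize_def by auto

lemma function_algebra_localize: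
  assumes \<delta>: "\<delta> \<in> S"
  shows "function_algebra (localize S \<delta>)"
proof
  show "(\<lambda>_. c) \<in> localize S \<delta>" for c by (rule subset_localize) simp
next
  fix f g assume "f \<in> localize S \<delta>" "g \<in> localize S \<delta>"
  then obtain N p M q where
    p: "p \<in> S" "\<And>t. \<delta> t \<noteq> 0 \<Longrightarrow> f t * \<delta> t ^ N = p t" and
    q: "q \<in> S" "\<And>t. \<delta> t \<noteq> 0 \<Longrightarrow> g t * \<delta> t ^ M = q t"
    unfolding localize_def by blast
  have "(f t + g t) * \<delta> t ^ (N + M) = p t * \<delta> t ^ M + q t * \<delta> t ^ N" if "\<delta> t \<noteq> 0" for t
    using p(2)[OF that, symmetric] q(2)[OF that, symmetric] by (simp add: algebra_simps power_add)
  moreover have "(\<lambda>t. p t * \<delta> t ^ M + q t * \<delta> t ^ N) \<in> S"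
    using p(1) q(1) \<delta> by (intro add mult power)
  ultimately show "(\<lambda>t. f t + g t) \<in> localize S \<delta>"
    unfolding localize_def mem_Collect_eq by (intro exI[of _ "N + M"]) (rule bexI; simp)
  have "(f t * g t) * \<delta> t ^ (N + M) = p t * q t" if "\<delta> t \<noteq> 0" for t
    using p(2)[OF that, symmetric] q(2)[OF that, symmetric] by (simp add: algebra_simps power_add)
  moreover have "(\<lambda>t. p t * q t) \<in> S"
    using p(1) q(1) by (rule mult)
  ultimately show "(\<lambda>t. f t * g t) \<in> localize S \<delta>"
    unfolding localize_def mem_Collect_eq by (intro exI[of _ "N + M"]) (rule bexI; simp)
qed

end

interpretation line_polys: function_algebra "range (poly :: 'a::field poly \<Rightarrow> 'a \<Rightarrow> 'a)"
proof
  show "(\<lambda>_. c) \<in> range poly" for c :: 'a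
    by (rule image_eqI[of _ _ "[:c:]"]) auto
  fix f g :: "'a \<Rightarrow> 'a" assume "f \<in> range poly" "g \<in> range poly"
  then obtain p q where "f = poly p" "g = poly q" by auto
  then show "(\<lambda>t. f t + g t) \<in> range poly" "(\<lambda>t. f t * g t) \<in> range poly"
    using image_eqI[of _ poly "p + q" UNIV] image_eqI[of _ poly "p * q" UNIV] by (simp_all add: fun_eq_iff)
qed

lemma line_polys_affine [simp]: "(\<lambda>t. (1 - t) * a + t * b) \<in> range (poly :: 'a::field poly \<Rightarrow> 'a \<Rightarrow> 'a)"
proof -
  have "(\<lambda>t. t) \<in> range (poly :: 'a poly \<Rightarrow> 'a \<Rightarrow> 'a)"
    by (rule image_eqI[of _ _ "[:0, 1:]"]) auto
  then show ?thesis
    by (intro line_polys.add line_polys.mult line_polys.diff line_polys.const)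
qed

lemma alg_closed_infinite: "infinite (UNIV :: 'a::alg_closed_field set)"
proof
  assume fin: "finite (UNIV :: 'a set)"
  \<comment> \<open>Euclid's argument: over a finite field \<open>1 + ?q\<close> would take the
    value 1 everywhere, although it has positive degree and therefore a root.\<close>
  let ?q = "\<Prod>a\<in>UNIV. [:- a, 1:] :: 'a poly"
  have "degree ?q = card (UNIV :: 'a set)"
    by (subst degree_prod_sum_eq) auto
  moreover have "card (UNIV :: 'a set) > 0" using fin by (simp add: card_gt_0_iff)
  ultimately have "degree (1 + ?q) > 0"
    by (metis degree_1 degree_add_eq_right)
  then obtain x where "poly (1 + ?q) x = 0"
    using alg_closed_imp_poly_has_root by blast
  moreover have "poly ?q x = 0" using fin by (simp add: poly_prod)
  ultimately show False by simp
qed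

text \<open>Multiplying by powers of \<open>\<delta>\<close> turns both functions into polynomials
  that are not zero. Together with \<open>\<delta>\<close> they have only finitely many roots, while
  the field is infinite.\<close>

lemma localize_line_common_nonzero:
  fixes \<phi> \<psi> \<delta> :: "'a::alg_closed_field \<Rightarrow> 'a"
  assumes \<delta>: "\<delta> \<in> range poly" and \<phi>: "\<phi> \<in> localize (range poly) \<delta>" and \<psi>: "\<psi> \<in> localize (range poly) \<delta>"
    and "\<delta> s \<noteq> 0" "\<phi> s \<noteq> 0" "\<delta> t \<noteq> 0" "\<psi> t \<noteq> 0"
  shows "\<exists>u. \<delta> u \<noteq> 0 \<and> \<phi> u \<noteq> 0 \<and> \<psi> u \<noteq> 0"
proof -
  obtain d N p M q where d: "\<delta> = poly d"
    and p: "\<And>t. \<delta> t \<noteq> 0 \<Longrightarrow> \<phi> t * \<delta> t ^ N = poly p t"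
    and q: "\<And>t. \<delta> t \<noteq> 0 \<Longrightarrow> \<psi> t * \<delta> t ^ M = poly q t"
    using assms(1-3) unfolding localize_def by blast
  have "poly p s \<noteq> 0" "poly q t \<noteq> 0" using p[of s] q[of t] assms by (metis mult_eq_0_iff power_not_zero)+
  then have "d * p * q \<noteq> 0" using assms(4) d by auto
  then have "finite {u. poly (d * p * q) u = 0}" by (rule poly_roots_finite)
  then obtain u where "poly (d * p * q) u \<noteq> 0"
    using alg_closed_infinite by (metis (mono_tags, lifting) UNIV_I finite_subset mem_Collect_eq subsetI)
  then have "\<delta> u \<noteq> 0" "poly p u \<noteq> 0" "poly q u \<noteq> 0" using d by auto
  then show ?thesis using p[of u] q[of u] by (metis mult_zero_left)
qed

section \<open>Irreducible sets of matrix tuples\<close>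

text \<open>Irreducibility tested on principal open sets only: any two that meet \<open>Z\<close>
  meet inside \<open>Z\<close>. This form pulls back along parametrisations;
  \<open>irreducible_space_iff_zirr\<close> ties it to the topological notion.\<close>

definition zirr :: "nat \<Rightarrow> nat \<Rightarrow> nat \<Rightarrow> 'a::field mat list set \<Rightarrow> bool" where
  "zirr r m n Z \<longleftrightarrow> Z \<noteq> {} \<and> Z \<subseteq> mat_tuples r m n \<and>
     (\<forall>f\<in>poly_funs r m n. \<forall>g\<in>poly_funs r m n.
        (\<exists>x\<in>Z. f x \<noteq> 0) \<longrightarrow> (\<exists>x\<in>Z. g x \<noteq> 0) \<longrightarrow> (\<exists>x\<in>Z. f x \<noteq> 0 \<and> g x \<noteq> 0))"

definition zcl :: "nat \<Rightarrow> nat \<Rightarrow> nat \<Rightarrow> 'a::field mat list set \<Rightarrow> 'a mat list set" where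
  "zcl r m n Z = {x \<in> mat_tuples r m n. \<forall>f\<in>poly_funs r m n. (\<forall>z\<in>Z. f z = 0) \<longrightarrow> f x = 0}"

lemma zirrD:
  assumes "zirr r m n Z" "f \<in> poly_funs r m n" "g \<in> poly_funs r m n"
    "\<exists>x\<in>Z. f x \<noteq> 0" "\<exists>x\<in>Z. g x \<noteq> 0"
  shows "\<exists>x\<in>Z. f x \<noteq> 0 \<and> g x \<noteq> 0"
  using assms unfolding zirr_def by blast

lemma zirr_prod:
  assumes Z: "zirr r m n Z" and "finite I"
    and "\<And>i. i \<in> I \<Longrightarrow> f i \<in> poly_funs r m n" "\<And>i. i \<in> I \<Longrightarrow> \<exists>x\<in>Z. f i x \<noteq> 0"
  shows "\<exists>x\<in>Z. (\<Prod>i\<in>I. f i x) \<noteq> 0"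
  using assms(2-)
proof (induction I)
  case empty then show ?case using Z by (auto simp: zirr_def)
next
  case (insert i I)
  have "\<exists>x\<in>Z. (\<Prod>i\<in>I. f i x) \<noteq> 0" using insert by auto
  then have "\<exists>x\<in>Z. f i x \<noteq> 0 \<and> (\<Prod>i\<in>I. f i x) \<noteq> 0"
    using insert by (intro zirrD[OF Z] poly_funs.prod) simp_all
  then show ?case using insert by auto
qed

lemma zcl_superset: "Z \<subseteq> mat_tuples r m n \<Longrightarrow> Z \<subseteq> zcl r m n Z"
  unfolding zcl_def by auto

lemma zirr_between:
  assumes "zirr r m n Z" "Z \<subseteq> Z'" "Z' \<subseteq> zcl r m n Z"
  shows "zirr r m n Z'"
  unfolding zirr_def
proof (intro conjI ballI impI)
  show "Z' \<noteq> {}" "Z' \<subseteq> mat_tuples r m n" using assms by (auto simp: zirr_def zcl_def)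
  fix f g assume f: "f \<in> poly_funs r m n" "\<exists>x\<in>Z'. f x \<noteq> 0" and g: "g \<in> poly_funs r m n" "\<exists>x\<in>Z'. g x \<noteq> 0"
  have "\<exists>x\<in>Z. f x \<noteq> 0" "\<exists>x\<in>Z. g x \<noteq> 0" using f g assms(3) unfolding zcl_def by blast+
  from zirrD[OF assms(1) f(1) g(1) this] show "\<exists>x\<in>Z'. f x \<noteq> 0 \<and> g x \<noteq> 0" using assms(2) by blast
qed

text \<open>Rational curves as certificates: pulled back to a curve through \<open>x\<close> and
  \<open>y\<close>, a function nonzero at \<open>x\<close> and one nonzero at \<open>y\<close>
  become rational functions of one variable, and these have a common nonzero value.\<close>

lemma zirr_by_lines:
  fixes Z :: "'a::alg_closed_field mat list set"
  assumes "Z \<noteq> {}" "Z \<subseteq> mat_tuples r m n"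
    and lines: "\<And>x y. x \<in> Z \<Longrightarrow> y \<in> Z \<Longrightarrow> \<exists>\<delta>\<in>range poly. \<exists>\<phi> s t. \<delta> s \<noteq> 0 \<and> \<delta> t \<noteq> 0 \<and> \<phi> s = x \<and> \<phi> t = y \<and>
      (\<forall>u. \<delta> u \<noteq> 0 \<longrightarrow> \<phi> u \<in> Z) \<and>
      (\<forall>i<r. \<forall>j<m. \<forall>k<n. (\<lambda>u. (\<phi> u ! i) $$ (j, k)) \<in> localize (range poly) \<delta>)"
  shows "zirr r m n Z"
  unfolding zirr_def
proof (intro conjI ballI impI)
  fix f g assume f: "f \<in> poly_funs r m n" "\<exists>x\<in>Z. f x \<noteq> 0" and g: "g \<in> poly_funs r m n" "\<exists>x\<in>Z. g x \<noteq> 0"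
  then obtain x y where xy: "x \<in> Z" "f x \<noteq> 0" "y \<in> Z" "g y \<noteq> 0" by blast
  from lines[OF xy(1,3)] obtain \<delta> \<phi> s t where \<delta>: "\<delta> \<in> range poly"
    and st: "\<delta> s \<noteq> 0" "\<delta> t \<noteq> 0" "\<phi> s = x" "\<phi> t = y" and Z: "\<forall>u. \<delta> u \<noteq> 0 \<longrightarrow> \<phi> u \<in> Z"
    and e: "\<forall>i<r. \<forall>j<m. \<forall>k<n. (\<lambda>u. (\<phi> u ! i) $$ (j, k)) \<in> localize (range poly) \<delta>"
    by blast
  interpret A: function_algebra "localize (range poly) \<delta>"
    by (rule line_polys.function_algebra_localize[OF \<delta>])
  have "(\<lambda>u. f (\<phi> u)) \<in> localize (range poly) \<delta>" "(\<lambda>u. g (\<phi> u)) \<in> localize (range poly) \<delta>"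
    by (rule A.poly_fun_compose[OF f(1)] A.poly_fun_compose[OF g(1)]; use e in simp)+
  from localize_line_common_nonzero[OF \<delta> this, of s t] st xy
  obtain u where "\<delta> u \<noteq> 0" "f (\<phi> u) \<noteq> 0" "g (\<phi> u) \<noteq> 0" by auto
  then show "\<exists>x\<in>Z. f x \<noteq> 0 \<and> g x \<noteq> 0" using Z by blast
qed (use assms in auto)

lemma mat_tuplesD:
  "x \<in> mat_tuples r m n \<Longrightarrow> length x = r"
  "x \<in> mat_tuples r m n \<Longrightarrow> i < r \<Longrightarrow> x ! i \<in> carrier_mat m n"
  unfolding mat_tuples_def by auto

lemma mat_tuplesI:
  "length x = r \<Longrightarrow> (\<And>i. i < r \<Longrightarrow> x ! i \<in> carrier_mat m n) \<Longrightarrow> x \<in> mat_tuples r m n"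
  unfolding mat_tuples_def by (auto simp: in_set_conv_nth)

lemma mat_tuples_eqI:
  assumes "x \<in> mat_tuples r m n" "y \<in> mat_tuples r m n"
    and "\<And>i j k. i < r \<Longrightarrow> j < m \<Longrightarrow> k < n \<Longrightarrow> (x ! i) $$ (j, k) = (y ! i) $$ (j, k)"
  shows "x = y"
proof (rule nth_equalityI)
  show "length x = length y" using assms mat_tuplesD by metis
  fix i assume "i < length x"
  then have i: "i < r" using assms mat_tuplesD by metis
  show "x ! i = y ! i"
    using mat_tuplesD(2)[OF assms(1) i] mat_tuplesD(2)[OF assms(2) i] assms(3)[OF i] by (auto intro!: eq_matI)
qed

lemma zirr_affine:
  fixes Z :: "'a::alg_closed_field mat list set"
  assumes "Z \<noteq> {}" "Z \<subseteq> mat_tuples r m n"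
    and aff: "\<And>x y t. x \<in> Z \<Longrightarrow> y \<in> Z \<Longrightarrow>
      map (\<lambda>i. mat m n (\<lambda>jk. (1 - t) * (x ! i) $$ jk + t * (y ! i) $$ jk)) [0..<r] \<in> Z"
  shows "zirr r m n Z"
proof (rule zirr_by_lines[OF assms(1,2)])
  fix x y assume x: "x \<in> Z" and y: "y \<in> Z"
  let ?\<phi> = "\<lambda>t. map (\<lambda>i. mat m n (\<lambda>jk. (1 - t) * (x ! i) $$ jk + t * (y ! i) $$ jk)) [0..<r]"
  have xm: "x \<in> mat_tuples r m n" "y \<in> mat_tuples r m n" using x y assms by auto
  have \<phi>m: "?\<phi> t \<in> mat_tuples r m n" for t by (rule mat_tuplesI) auto
  have "?\<phi> 0 = x" "?\<phi> 1 = y" by (rule mat_tuples_eqI[OF \<phi>m]; use xm in auto)+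
  then show "\<exists>\<delta>\<in>range poly. \<exists>\<phi> s t. \<delta> s \<noteq> 0 \<and> \<delta> t \<noteq> 0 \<and> \<phi> s = x \<and> \<phi> t = y \<and>
      (\<forall>u. \<delta> u \<noteq> 0 \<longrightarrow> \<phi> u \<in> Z) \<and>
      (\<forall>i<r. \<forall>j<m. \<forall>k<n. (\<lambda>u. (\<phi> u ! i) $$ (j, k)) \<in> localize (range poly) \<delta>)"
    using aff[OF x y]
    by (intro bexI[of _ "\<lambda>_. 1"] exI[of _ ?\<phi>] exI[of _ 0] exI[of _ 1])
      (simp_all add: line_polys.subset_localize)
qed

lemma zirr_mat_tuples: "zirr r m n (mat_tuples r m n :: 'a::alg_closed_field mat list set)"
proof (rule zirr_affine)
  have "replicate r (0\<^sub>m m n) \<in> mat_tuples r m n" by (rule mat_tuplesI) auto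
  then show "mat_tuples r m n \<noteq> ({} :: 'a mat list set)" by auto
qed (auto intro: mat_tuplesI)

section \<open>Relation with the Zariski topology\<close>

lemma openin_sub_zariski:
  assumes "Z \<subseteq> mat_tuples r m n"
  shows "openin (subtopology (zariski r m n) Z) A \<longleftrightarrow>
    (\<exists>F\<subseteq>poly_funs r m n. A = {x \<in> Z. \<exists>f\<in>F. f x \<noteq> 0})"
proof
  assume "openin (subtopology (zariski r m n) Z) A"
  then obtain U where U: "zariski_open r m n U" "A = U \<inter> Z"
    unfolding openin_subtopology openin_zariski by blast
  then obtain F where "F\<subseteq>poly_funs r m n" "U = {x \<in> mat_tuples r m n. \<exists>f\<in>F. f x \<noteq> 0}"
    unfolding zariski_open_def by blast
  then show "\<exists>F\<subseteq>poly_funs r m n. A = {x \<in> Z. \<exists>f\<in>F. f x \<noteq> 0}"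
    using assms U by (intro exI[of _ F]) auto
next
  assume "\<exists>F\<subseteq>poly_funs r m n. A = {x \<in> Z. \<exists>f\<in>F. f x \<noteq> 0}"
  then obtain F where F: "F\<subseteq>poly_funs r m n" "A = {x \<in> Z. \<exists>f\<in>F. f x \<noteq> 0}" by blast
  then show "openin (subtopology (zariski r m n) Z) A"
    unfolding openin_subtopology openin_zariski zariski_open_def using assms
    by (intro exI[of _ "{x \<in> mat_tuples r m n. \<exists>f\<in>F. f x \<noteq> 0}"]) auto
qed

lemma topspace_sub_zariski:
  "Z \<subseteq> mat_tuples r m n \<Longrightarrow> topspace (subtopology (zariski r m n) Z) = Z"
  by (auto simp: topspace_zariski)

lemma closedin_sub_zariski:
  assumes "Z \<subseteq> mat_tuples r m n"
  shows "closedin (subtopology (zariski r m n) Z) A \<longleftrightarrow>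
    (\<exists>F\<subseteq>poly_funs r m n. A = {x \<in> Z. \<forall>f\<in>F. f x = 0})"
proof -
  have *: "A \<subseteq> Z \<and> Z - A = {x \<in> Z. \<exists>f\<in>F. f x \<noteq> 0} \<longleftrightarrow> A = {x \<in> Z. \<forall>f\<in>F. f x = 0}" for F
    by auto
  show ?thesis
    unfolding closedin_def topspace_sub_zariski[OF assms] openin_sub_zariski[OF assms] *[symmetric]
    by auto
qed

lemma irreducible_space_iff_zirr:
  assumes Z: "Z \<subseteq> mat_tuples r m n"
  shows "irreducible_space (subtopology (zariski r m n) Z) \<longleftrightarrow> zirr r m n Z"
proof
  assume irr: "irreducible_space (subtopology (zariski r m n) Z)"
  show "zirr r m n Z"
    unfolding zirr_def
  proof (intro conjI ballI impI)
    show "Z \<noteq> {}" "Z \<subseteq> mat_tuples r m n"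
      using irr Z by (auto simp: irreducible_space_def topspace_sub_zariski)
    fix f g assume f: "f \<in> poly_funs r m n" "\<exists>x\<in>Z. f x \<noteq> 0" and g: "g \<in> poly_funs r m n" "\<exists>x\<in>Z. g x \<noteq> 0"
    let ?A = "{x\<in>Z. \<forall>h\<in>{f}. h x = 0}" and ?B = "{x\<in>Z. \<forall>h\<in>{g}. h x = 0}"
    have A: "closedin (subtopology (zariski r m n) Z) ?A" and B: "closedin (subtopology (zariski r m n) Z) ?B"
      unfolding closedin_sub_zariski[OF Z] using f(1) g(1) by blast+
    have "?A \<noteq> Z" "?B \<noteq> Z" using f g by auto
    then have "?A \<union> ?B \<noteq> Z"
      using irr A B unfolding irreducible_space_def topspace_sub_zariski[OF Z] by blast
    then show "\<exists>x\<in>Z. f x \<noteq> 0 \<and> g x \<noteq> 0" by auto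
  qed
next
  assume irr: "zirr r m n Z"
  show "irreducible_space (subtopology (zariski r m n) Z)"
    unfolding irreducible_space_def topspace_sub_zariski[OF Z] closedin_sub_zariski[OF Z]
  proof (intro conjI allI impI)
    show "Z \<noteq> {}" using irr by (auto simp: zirr_def)
    fix A B assume AB: "(\<exists>F\<subseteq>poly_funs r m n. A = {x \<in> Z. \<forall>f\<in>F. f x = 0}) \<and>
      (\<exists>F\<subseteq>poly_funs r m n. B = {x \<in> Z. \<forall>f\<in>F. f x = 0}) \<and> A \<union> B = Z"
    then obtain F G where F: "F\<subseteq>poly_funs r m n" "A = {x \<in> Z. \<forall>f\<in>F. f x = 0}"
      and G: "G\<subseteq>poly_funs r m n" "B = {x \<in> Z. \<forall>f\<in>G. f x = 0}" by blast
    show "A = Z \<or> B = Z"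
    proof (rule ccontr)
      assume "\<not> (A = Z \<or> B = Z)"
      then obtain f g where "f \<in> F" "g \<in> G" "\<exists>x\<in>Z. f x \<noteq> 0" "\<exists>x\<in>Z. g x \<noteq> 0"
        unfolding F G by blast
      then obtain x where "x \<in> Z" "f x \<noteq> 0" "g x \<noteq> 0"
        using zirrD[OF irr, of f g] F(1) G(1) by blast
      then have "x \<notin> A \<union> B" using F G \<open>f \<in> F\<close> \<open>g \<in> G\<close> by auto
      then show False using AB \<open>x \<in> Z\<close> by auto
    qed
  qed
qed

text \<open>On an irreducible set every nonempty open subset is dense, and each contains a nonempty
  principal open set. Hence a generic property is certified by a single polynomial function, and
  finitely many certificates can be multiplied.\<close>

lemma generically_iff:
  assumes C: "zirr r m n C"
  shows "generically (subtopology (zariski r m n) C) P \<longleftrightarrow>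
    (\<exists>f\<in>poly_funs r m n. (\<exists>x\<in>C. f x \<noteq> 0) \<and> (\<forall>x\<in>C. f x \<noteq> 0 \<longrightarrow> P x))"
proof -
  have Cm: "C \<subseteq> mat_tuples r m n" and ne: "C \<noteq> {}" using C by (auto simp: zirr_def)
  let ?T = "subtopology (zariski r m n) C"
  note top = topspace_sub_zariski[OF Cm]
  show ?thesis
  proof
    assume "generically ?T P"
    then obtain U where U: "openin ?T U" "?T closure_of U = C" "\<forall>x\<in>U. P x"
      unfolding generically_def top by blast
    have "U \<noteq> {}" using U(2) ne by auto
    moreover obtain F where "F \<subseteq> poly_funs r m n" "U = {x \<in> C. \<exists>f\<in>F. f x \<noteq> 0}"
      using U(1) unfolding openin_sub_zariski[OF Cm] by blast
    ultimately show "\<exists>f\<in>poly_funs r m n. (\<exists>x\<in>C. f x \<noteq> 0) \<and> (\<forall>x\<in>C. f x \<noteq> 0 \<longrightarrow> P x)"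
      using U(3) by blast
  next
    assume "\<exists>f\<in>poly_funs r m n. (\<exists>x\<in>C. f x \<noteq> 0) \<and> (\<forall>x\<in>C. f x \<noteq> 0 \<longrightarrow> P x)"
    then obtain f where f: "f \<in> poly_funs r m n" "\<exists>x\<in>C. f x \<noteq> 0" "\<forall>x\<in>C. f x \<noteq> 0 \<longrightarrow> P x" by blast
    let ?U = "{x \<in> C. \<exists>h\<in>{f}. h x \<noteq> 0}"
    have "openin ?T ?U" unfolding openin_sub_zariski[OF Cm] using f(1) by blast
    moreover have "?T closure_of ?U = topspace ?T"
    proof (rule subset_antisym[OF closure_of_subset_topspace])
      have cl: "closedin ?T (?T closure_of ?U)" by simp
      then obtain F where F: "F \<subseteq> poly_funs r m n" "?T closure_of ?U = {x \<in> C. \<forall>f\<in>F. f x = 0}"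
        unfolding closedin_sub_zariski[OF Cm] by blast
      have sub: "?U \<subseteq> ?T closure_of ?U"
        by (rule closure_of_subset) (auto simp: topspace_zariski dest: subsetD[OF Cm])
      have "h x = 0" if h: "h \<in> F" and x: "x \<in> C" for h x
      proof (rule ccontr)
        assume "h x \<noteq> 0"
        then obtain y where "y \<in> C" "f y \<noteq> 0" "h y \<noteq> 0"
          using zirrD[OF C f(1), of h] F(1) h x f(2) by blast
        then show False using sub h unfolding F(2) by blast
      qed
      then show "topspace ?T \<subseteq> ?T closure_of ?U" unfolding top F(2) by blast
    qed
    ultimately show "generically ?T P" unfolding generically_def using f(3) by blast
  qed
qed

text \<open>The last claim is the form in which maximality is used: the closure of \<open>D\<close>
  in \<open>R\<close> is irreducible and contains both \<open>C\<close> and \<open>D\<close>, so it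
  must equal \<open>C\<close>.\<close>

lemma irreducible_component_iff_zirr:
  assumes R: "R \<subseteq> mat_tuples r m n"
    and C: "irreducible_component (subtopology (zariski r m n) R) C"
  shows "C \<subseteq> R" "zirr r m n C"
    and "\<And>D. zirr r m n D \<Longrightarrow> D \<subseteq> R \<Longrightarrow> C \<subseteq> zcl r m n D \<Longrightarrow> D \<subseteq> C"
proof -
  have top: "topspace (subtopology (zariski r m n) R) = R" by (rule topspace_sub_zariski[OF R])
  have irr: "irreducible_space (subtopology (subtopology (zariski r m n) R) D) \<longleftrightarrow> zirr r m n D"
    if "D \<subseteq> R" for D
    using that R by (simp add: subtopology_subtopology Int_absorb1 irreducible_space_iff_zirr)
  show CR: "C \<subseteq> R" using C unfolding irreducible_component_def top by blast
  show zC: "zirr r m n C" using C irr[OF CR] unfolding irreducible_component_def by blast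
  fix D assume D: "zirr r m n D" "D \<subseteq> R" "C \<subseteq> zcl r m n D"
  have DE: "D \<subseteq> zcl r m n D \<inter> R" using D zcl_superset R by blast
  have "zirr r m n (zcl r m n D \<inter> R)" by (rule zirr_between[OF D(1) DE]) auto
  then have "irreducible_space (subtopology (subtopology (zariski r m n) R) (zcl r m n D \<inter> R))"
    using irr[of "zcl r m n D \<inter> R"] by simp
  moreover have "C \<subseteq> zcl r m n D \<inter> R" "zcl r m n D \<inter> R \<subseteq> R" using D(3) CR by simp_all
  moreover have "\<forall>E\<subseteq>R. irreducible_space (subtopology (subtopology (zariski r m n) R) E) \<and> C \<subseteq> E \<longrightarrow> E = C"
    using C unfolding irreducible_component_def top by simp
  ultimately have "zcl r m n D \<inter> R = C" by simp
  then show "D \<subseteq> C" using DE by simp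
qed

section \<open>Linear algebra of finitely supported coordinate families\<close>

lemma sum_mult_delta:
  fixes f :: "'i \<Rightarrow> 'a::semiring_1"
  assumes "finite A"
  shows "(\<Sum>s\<in>A. f s * (if s = i then 1 else 0)) = (if i \<in> A then f i else 0)"
    "(\<Sum>s\<in>A. f s * (if i = s then 1 else 0)) = (if i \<in> A then f i else 0)"
proof -
  have "(\<Sum>s\<in>A. f s * (if s = i then 1 else 0)) = (\<Sum>s\<in>A. if s = i then f s else 0)"
    by (rule sum.cong) auto
  then show 1: "(\<Sum>s\<in>A. f s * (if s = i then 1 else 0)) = (if i \<in> A then f i else 0)"
    using assms by simp
  show "(\<Sum>s\<in>A. f s * (if i = s then 1 else 0)) = (if i \<in> A then f i else 0)"
    unfolding 1[symmetric] by (rule sum.cong) auto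
qed

text \<open>Gaussian elimination, one equation at a time. All dimension counts of the development
  reduce to this statement.\<close>

lemma homogeneous_system:
  fixes a :: "'i \<Rightarrow> 'j \<Rightarrow> 'a::field"
  assumes "finite J" "finite I" "card J < card I"
  shows "\<exists>c. (\<exists>i\<in>I. c i \<noteq> 0) \<and> (\<forall>j\<in>J. (\<Sum>i\<in>I. c i * a i j) = 0)"
  using assms
proof (induction J arbitrary: I a rule: finite_induct)
  case empty
  then show ?case by (intro exI[of _ "\<lambda>_. 1"]) (auto simp: card_gt_0_iff)
next
  case (insert j J)
  show ?case
  proof (cases "\<forall>i\<in>I. a i j = 0")
    case True
    have "card J < card I" using insert by simp
    from insert.IH[OF insert.prems(1) this, of a] obtain c where
      "\<exists>i\<in>I. c i \<noteq> 0" "\<forall>j\<in>J. (\<Sum>i\<in>I. c i * a i j) = 0" by auto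
    then show ?thesis using True by (intro exI[of _ c]) auto
  next
    case False
    then obtain p where p: "p \<in> I" "a p j \<noteq> 0" by auto
    \<comment> \<open>The equation \<open>j\<close> is solved for the unknown at the pivot
      \<open>p\<close> and substituted into the other equations; \<open>d\<close> restores the
      eliminated unknown.\<close>
    let ?I = "I - {p}" and ?a = "\<lambda>i k. a i k - a i j / a p j * a p k"
    have "card J < card ?I" using insert p by simp
    from insert.IH[OF _ this, of ?a] insert.prems obtain c where
      c: "\<exists>i\<in>?I. c i \<noteq> 0" "\<forall>k\<in>J. (\<Sum>i\<in>?I. c i * ?a i k) = 0" by auto
    define d where "d = c(p := - (\<Sum>i\<in>?I. c i * a i j / a p j))"
    have eq: "(\<Sum>i\<in>I. d i * a i k) = (\<Sum>i\<in>?I. c i * ?a i k)" for k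
    proof -
      have "(\<Sum>i\<in>I. d i * a i k) = d p * a p k + (\<Sum>i\<in>?I. d i * a i k)"
        using p insert.prems(1) by (simp add: sum.remove)
      also have "(\<Sum>i\<in>?I. d i * a i k) = (\<Sum>i\<in>?I. c i * a i k)"
        by (rule sum.cong) (auto simp: d_def)
      also have "d p * a p k + \<dots> = (\<Sum>i\<in>?I. c i * ?a i k)"
        by (simp add: d_def sum_distrib_left sum_distrib_right algebra_simps sum_subtractf)
      finally show ?thesis .
    qed
    have "(\<Sum>i\<in>?I. c i * ?a i j) = 0"
      using p by (intro sum.neutral) auto
    then have "\<forall>k\<in>insert j J. (\<Sum>i\<in>I. d i * a i k) = 0" unfolding eq using c by auto
    moreover have "\<exists>i\<in>I. d i \<noteq> 0" using c by (auto simp: d_def)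
    ultimately show ?thesis by blast
  qed
qed

definition pairing :: "'q set \<Rightarrow> ('q \<Rightarrow> 'a::field) \<Rightarrow> ('q \<Rightarrow> 'a) \<Rightarrow> 'a" where
  "pairing I l v = (\<Sum>q\<in>I. l q * v q)"

lemma pairing_sum: "pairing I l (\<lambda>q. \<Sum>s\<in>J. c s * v s q) = (\<Sum>s\<in>J. c s * pairing I l (v s))"
  unfolding pairing_def sum_distrib_left
  by (subst sum.swap) (simp add: algebra_simps)

lemma pairing_sum_left: "pairing I (\<lambda>q. \<Sum>s\<in>J. c s * l s q) v = (\<Sum>s\<in>J. c s * pairing I (l s) v)"
  unfolding pairing_def sum_distrib_left sum_distrib_right
  by (subst sum.swap) (simp add: algebra_simps)

lemma pairing_add: "pairing I l (\<lambda>q. v q + w q) = pairing I l v + pairing I l w"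
  by (simp add: pairing_def algebra_simps sum.distrib)

lemma pairing_zero: "(\<And>q. q \<in> I \<Longrightarrow> v q = 0) \<Longrightarrow> pairing I l v = 0"
  unfolding pairing_def by (rule sum.neutral) auto

text \<open>A family \<open>b\<close> with dual functionals \<open>l\<close>. The functionals
  certify independence and compute coordinates by explicit sums, which remain polynomial when they
  are applied to vectors depending polynomially on a point.\<close>

definition biorth :: "'q set \<Rightarrow> nat \<Rightarrow> (nat \<Rightarrow> 'q \<Rightarrow> 'a::field) \<Rightarrow> (nat \<Rightarrow> 'q \<Rightarrow> 'a) \<Rightarrow> bool" where
  "biorth I k b l \<longleftrightarrow> (\<forall>i<k. \<forall>j<k. pairing I (l i) (b j) = (if i = j then 1 else 0))"

lemma biorth_indep:
  assumes "biorth I k b l" "\<And>q. q \<in> I \<Longrightarrow> (\<Sum>s<k. c s * b s q) = 0" "i < k"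
  shows "c i = 0"
proof -
  have "0 = pairing I (l i) (\<lambda>q. \<Sum>s<k. c s * b s q)"
    using assms(2) by (simp add: pairing_zero)
  also have "\<dots> = (\<Sum>s<k. c s * (if i = s then 1 else 0))"
    unfolding pairing_sum using assms(1,3) by (intro sum.cong) (auto simp: biorth_def)
  also have "\<dots> = c i" using assms(3) by (simp add: sum_mult_delta)
  finally show ?thesis by simp
qed

lemma biorth_card_le:
  assumes b: "biorth I k b l" and J: "finite J"
    and span: "\<And>i q. i < k \<Longrightarrow> q \<in> I \<Longrightarrow> b i q = (\<Sum>j\<in>J. a i j * w j q)"
  shows "k \<le> card J"
proof (rule ccontr)
  assume "\<not> ?thesis"
  then have "card J < card {..<k}" by simp
  from homogeneous_system[OF J _ this, of a] obtain c where
    c: "\<exists>i\<in>{..<k}. c i \<noteq> 0" "\<forall>j\<in>J. (\<Sum>i<k. c i * a i j) = 0" by auto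
  have "(\<Sum>i<k. c i * b i q) = 0" if q: "q \<in> I" for q
  proof -
    have "(\<Sum>i<k. c i * b i q) = (\<Sum>i<k. \<Sum>j\<in>J. c i * a i j * w j q)"
      using q by (simp add: span sum_distrib_left mult.assoc)
    also have "\<dots> = (\<Sum>j\<in>J. (\<Sum>i<k. c i * a i j) * w j q)"
      unfolding sum_distrib_right by (rule sum.swap)
    also have "\<dots> = 0" using c(2) by simp
    finally show ?thesis .
  qed
  from biorth_indep[OF b this] c(1) show False by auto
qed

lemma biorth_le_card:
  assumes "biorth I k b l" "finite I"
  shows "k \<le> card I"
proof (rule biorth_card_le[OF assms, where a = b and w = "\<lambda>j q. if j = q then 1 else 0"])
  show "b i q = (\<Sum>j\<in>I. b i j * (if j = q then 1 else 0))" if "q \<in> I" for i q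
    using that sum_mult_delta(1)[OF assms(2), of "b i" q] by simp
qed

text \<open>As long as some \<open>v\<close> in \<open>G\<close> differs from its expansion,
  \<open>v\<close> itself is appended, so the new members stay in \<open>G\<close>; this ends
  because the size is bounded by \<open>card I\<close>. Keeping the old members is what allows a
  flag to be refined step by step.\<close>

lemma biorth_extend:
  assumes "finite I" "biorth I k b l" "\<And>i. i < k \<Longrightarrow> b i \<in> G"
  shows "\<exists>k' b' l'. k \<le> k' \<and> (\<forall>i<k. b' i = b i) \<and> (\<forall>i<k'. b' i \<in> G) \<and> biorth I k' b' l' \<and>
    (\<forall>v\<in>G. \<forall>q\<in>I. v q = (\<Sum>i<k'. pairing I (l' i) v * b' i q))"
  using assms(2,3)
proof (induction "card I - k" arbitrary: k b l rule: less_induct)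
  case less
  show ?case
  proof (cases "\<forall>v\<in>G. \<forall>q\<in>I. v q = (\<Sum>i<k. pairing I (l i) v * b i q)")
    case True
    show ?thesis
      by (rule exI[of _ k], rule exI[of _ b], rule exI[of _ l], intro conjI) (use less.prems True in simp_all)
  next
    case False
    then obtain v p where v: "v \<in> G" "p \<in> I" "v p \<noteq> (\<Sum>i<k. pairing I (l i) v * b i p)" by blast
    define w where "w q = v q - (\<Sum>i<k. pairing I (l i) v * b i q)" for q
    have wp: "w p \<noteq> 0" using v by (simp add: w_def)
    \<comment> \<open>\<open>ln\<close> takes the coordinate at \<open>p\<close> of what is left of
      a vector after expansion in \<open>b\<close>. It therefore kills the old members, and division
      by \<open>w p\<close> makes it 1 on \<open>v\<close>.\<close>
    define ln where "ln q = ((if q = p then 1 else 0) - (\<Sum>i<k. b i p * l i q)) / w p" for q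
    have ln: "pairing I ln x = (x p - (\<Sum>i<k. b i p * pairing I (l i) x)) / w p" for x
    proof -
      have "pairing I ln x = pairing I (\<lambda>q. (if q = p then 1 else 0) - (\<Sum>i<k. b i p * l i q)) x / w p"
        unfolding pairing_def ln_def by (simp add: sum_divide_distrib)
      also have "pairing I (\<lambda>q. (if q = p then 1 else 0) - (\<Sum>i<k. b i p * l i q)) x
          = (\<Sum>q\<in>I. if q = p then x q else 0) - pairing I (\<lambda>q. \<Sum>i<k. b i p * l i q) x"
        unfolding pairing_def sum_subtractf[symmetric]
        by (rule sum.cong) (auto simp: algebra_simps)
      also have "\<dots> = x p - (\<Sum>i<k. b i p * pairing I (l i) x)"
        using v(2) assms(1) by (simp add: pairing_sum_left)
      finally show ?thesis .
    qed
    define b' where "b' = b(k := v)"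
    \<comment> \<open>Subtracting a multiple of \<open>ln\<close> makes the old functionals vanish
      on \<open>v\<close> without changing their values on the old members.\<close>
    define l' where "l' i q = (if i = k then ln q else l i q - pairing I (l i) v * ln q)" for i q
    have lb: "pairing I (l i) (b j) = (if i = j then 1 else 0)" if "i < k" "j < k" for i j
      using less.prems(1) that by (auto simp: biorth_def)
    have lnb: "pairing I ln (b j) = 0" if "j < k" for j
    proof -
      have "(\<Sum>i<k. b i p * pairing I (l i) (b j)) = (\<Sum>i<k. b i p * (if i = j then 1 else 0))"
        using that by (intro sum.cong) (auto simp: lb)
      also have "\<dots> = b j p" using that by (simp add: sum_mult_delta)
      finally show ?thesis by (simp add: ln)
    qed
    have "(\<Sum>i<k. b i p * pairing I (l i) v) = v p - w p" by (simp add: w_def mult.commute)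
    then have lnv: "pairing I ln v = 1" using wp by (simp add: ln)
    have l': "pairing I (l' i) x = (if i = k then pairing I ln x else pairing I (l i) x - pairing I (l i) v * pairing I ln x)" for i x
      by (auto simp: l'_def[abs_def] pairing_def left_diff_distrib sum_subtractf sum_distrib_left mult.assoc)
    have bi: "biorth I (Suc k) b' l'"
      unfolding biorth_def l' b'_def by (auto simp: less_Suc_eq lnb lnv lb)
    have "Suc k \<le> card I" using biorth_le_card[OF bi assms(1)] .
    then have lt: "card I - Suc k < card I - k" by simp
    have bG: "b' i \<in> G" if "i < Suc k" for i
      using that less.prems(2) v(1) by (simp add: b'_def)
    have "\<exists>k'' b'' l''. Suc k \<le> k'' \<and> (\<forall>i<Suc k. b'' i = b' i) \<and> (\<forall>i<k''. b'' i \<in> G) \<and>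
      biorth I k'' b'' l'' \<and> (\<forall>v\<in>G. \<forall>q\<in>I. v q = (\<Sum>i<k''. pairing I (l'' i) v * b'' i q))"
      by (rule less.hyps[OF lt bi]) (rule bG)
    then obtain k'' b'' l'' where ext: "Suc k \<le> k'' \<and> (\<forall>i<Suc k. b'' i = b' i) \<and> (\<forall>i<k''. b'' i \<in> G) \<and>
      biorth I k'' b'' l'' \<and> (\<forall>v\<in>G. \<forall>q\<in>I. v q = (\<Sum>i<k''. pairing I (l'' i) v * b'' i q))"
      by (elim exE) (rule that)
    moreover have "\<forall>i<k. b'' i = b i" using ext by (simp add: b'_def)
    ultimately show ?thesis
      by - (rule exI[of _ k''], rule exI[of _ b''], rule exI[of _ l''], intro conjI; (elim conjE)?; simp)
  qed
qed

text \<open>The inverse of the pairing matrix turns \<open>l\<close> into dual functionals. Since a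
  nonzero determinant is an open condition, this is the source of the semicontinuity of
  ranks.\<close>

lemma biorth_of_det:
  assumes "det (mat k k (\<lambda>(i, j). pairing I (l i) (v j))) \<noteq> 0"
  shows "\<exists>l'. biorth I k v l'"
proof -
  let ?M = "mat k k (\<lambda>(i, j). pairing I (l i) (v j))"
  have M: "?M \<in> carrier_mat k k" by simp
  have "?M \<in> Units (ring_mat TYPE('a) k ())" by (rule det_non_zero_imp_unit[OF M assms])
  then obtain N where N: "N \<in> carrier_mat k k" "N * ?M = 1\<^sub>m k"
    unfolding Units_def by (auto simp: ring_mat_def)
  have "pairing I (\<lambda>q. \<Sum>s<k. N $$ (i, s) * l s q) (v j) = (if i = j then 1 else 0)" if ij: "i < k" "j < k" for i j
  proof -
    have "pairing I (\<lambda>q. \<Sum>s<k. N $$ (i, s) * l s q) (v j) = (\<Sum>s\<in>{0..<k}. N $$ (i, s) * ?M $$ (s, j))"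
      unfolding pairing_sum_left using ij by (auto intro!: sum.cong simp: atLeast0LessThan)
    also have "\<dots> = (N * ?M) $$ (i, j)" using N(1) ij by (simp add: scalar_prod_def)
    finally show ?thesis unfolding N(2) using ij by simp
  qed
  then show ?thesis unfolding biorth_def by (intro exI[of _ "\<lambda>i q. \<Sum>s<k. N $$ (i, s) * l s q"]) auto
qed

section \<open>Linear group actions on matrix tuples\<close>

text \<open>\<open>\<alpha>\<close> names the parameter that stands at each entry, so the matrix
  depends linearly on one parameter vector. Two matrices built from the same vector may share their
  parameters or use disjoint ones.\<close>

definition coord_mat :: "nat \<Rightarrow> (nat \<Rightarrow> nat \<Rightarrow> nat) \<Rightarrow> (nat \<Rightarrow> 'a) \<Rightarrow> 'a mat" where
  "coord_mat n \<alpha> c = mat n n (\<lambda>(i, j). c (\<alpha> i j))"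

lemma coord_mat_carrier [simp]: "coord_mat n \<alpha> c \<in> carrier_mat n n"
  by (simp add: coord_mat_def)

lemma dim_coord_mat [simp]: "dim_row (coord_mat n \<alpha> c) = n" "dim_col (coord_mat n \<alpha> c) = n"
  by (simp_all add: coord_mat_def)

lemma index_coord_mat [simp]: "i < n \<Longrightarrow> j < n \<Longrightarrow> coord_mat n \<alpha> c $$ (i, j) = c (\<alpha> i j)"
  by (simp add: coord_mat_def)

lemma index_mult_mat_sum:
  assumes "A \<in> carrier_mat m k" "B \<in> carrier_mat k n" "i < m" "j < n"
  shows "(A * B) $$ (i, j) = (\<Sum>l<k. A $$ (i, l) * B $$ (l, j))"
  using assms by (simp add: scalar_prod_def atLeast0LessThan)

lemma det_nonzero_inverse:
  assumes "A \<in> carrier_mat n n" "det A \<noteq> (0::'a::field)"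
  shows "\<exists>B\<in>carrier_mat n n. A * B = 1\<^sub>m n \<and> B * A = 1\<^sub>m n"
  using det_non_zero_imp_unit[OF assms, of "()"] unfolding Units_def by (auto simp: ring_mat_def)

lemma det_nonzero_of_inverse:
  assumes "A \<in> carrier_mat n n" "B \<in> carrier_mat n n" "A * B = 1\<^sub>m n"
  shows "det A \<noteq> (0::'a::field)"
  using det_mult[OF assms(1,2)] assms(3) by auto

text \<open>A common frame for conjugation and the Kronecker action: the pairs of matrices described
  by a parameter vector form an algebra, and its units act by multiplication on the left and by the
  inverse of the second component on the right.\<close>

locale linear_action =
  fixes r m n :: nat and \<alpha> \<beta> :: "nat \<Rightarrow> nat \<Rightarrow> nat" and ty :: "'a::alg_closed_field itself"
  assumes unit: "\<exists>c :: nat \<Rightarrow> 'a. coord_mat m \<alpha> c = 1\<^sub>m m \<and> coord_mat n \<beta> c = 1\<^sub>m n"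
    and mult: "\<And>a b :: nat \<Rightarrow> 'a. \<exists>c. coord_mat m \<alpha> c = coord_mat m \<alpha> a * coord_mat m \<alpha> b \<and>
      coord_mat n \<beta> c = coord_mat n \<beta> a * coord_mat n \<beta> b"
    and inv: "\<And>a :: nat \<Rightarrow> 'a. det (coord_mat m \<alpha> a) \<noteq> 0 \<Longrightarrow> det (coord_mat n \<beta> a) \<noteq> 0 \<Longrightarrow>
      \<exists>c. coord_mat m \<alpha> a * coord_mat m \<alpha> c = 1\<^sub>m m \<and> coord_mat n \<beta> a * coord_mat n \<beta> c = 1\<^sub>m n"
begin

abbreviation H2 :: "(nat \<Rightarrow> 'a) \<Rightarrow> 'a mat" where "H2 \<equiv> coord_mat m \<alpha>"
abbreviation H1 :: "(nat \<Rightarrow> 'a) \<Rightarrow> 'a mat" where "H1 \<equiv> coord_mat n \<beta>"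

abbreviation X :: "'a mat list set" where "X \<equiv> mat_tuples r m n"

definition Q :: "(nat \<times> nat \<times> nat) set" where "Q = {..<r} \<times> {..<m} \<times> {..<n}"

lemma finite_Q [simp]: "finite Q" and card_Q: "card Q = r * (m * n)"
  by (simp_all add: Q_def card_cartesian_product)

definition invertible_param :: "(nat \<Rightarrow> 'a) \<Rightarrow> bool" where
  "invertible_param c \<longleftrightarrow> det (H2 c) \<noteq> 0 \<and> det (H1 c) \<noteq> 0"

text \<open>\<open>D x y c\<close> consists of the entries of \<open>H2 c * x\<^sub>i - y\<^sub>i * H1 c\<close>; it vanishes iff \<open>c\<close>
  intertwines \<open>x\<close> and \<open>y\<close>.\<close>

definition D :: "'a mat list \<Rightarrow> 'a mat list \<Rightarrow> (nat \<Rightarrow> 'a) \<Rightarrow> nat \<times> nat \<times> nat \<Rightarrow> 'a" where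
  "D x y c = (\<lambda>(i, j, k). (\<Sum>l<m. c (\<alpha> j l) * (x ! i) $$ (l, k)) - (\<Sum>l<n. (y ! i) $$ (j, l) * c (\<beta> l k)))"

lemma D_mat:
  assumes "x \<in> X" "y \<in> X" "i < r" "j < m" "k < n"
  shows "D x y c (i, j, k) = (H2 c * x ! i) $$ (j, k) - (y ! i * H1 c) $$ (j, k)"
proof -
  have "(H2 c * x ! i) $$ (j, k) = (\<Sum>l<m. H2 c $$ (j, l) * (x ! i) $$ (l, k))"
    by (rule index_mult_mat_sum[of _ m m _ n]) (use assms mat_tuplesD in auto)
  moreover have "(y ! i * H1 c) $$ (j, k) = (\<Sum>l<n. (y ! i) $$ (j, l) * H1 c $$ (l, k))"
    by (rule index_mult_mat_sum[of _ m n _ n]) (use assms mat_tuplesD in auto)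
  ultimately show ?thesis using assms(3-5) by (simp add: D_def)
qed

lemma D_add: "D x y (\<lambda>t. c t + c' t) q = D x y c q + D x y c' q"
  by (cases q) (simp add: D_def algebra_simps sum.distrib)

lemma D_scale: "D x y (\<lambda>t. a * c t) q = a * D x y c q"
  by (cases q) (simp add: D_def algebra_simps sum_distrib_left)

lemma D_sum: "D x y (\<lambda>t. \<Sum>s\<in>J. w s * u s t) q = (\<Sum>s\<in>J. w s * D x y (u s) q)"
proof (induction J rule: infinite_finite_induct)
  case (insert s J)
  then show ?case
    using D_add[of x y "\<lambda>t. w s * u s t" "\<lambda>t. \<Sum>s\<in>J. w s * u s t"] by (simp add: D_scale)
qed (cases q; simp add: D_def)+

lemma D_poly:
  assumes "q \<in> Q"
  shows "(\<lambda>y. D x y c q) \<in> poly_funs r m n" "(\<lambda>y. D y y c q) \<in> poly_funs r m n"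
proof -
  obtain i j k where q: "q = (i, j, k)" "i < r" "j < m" "k < n" using assms by (auto simp: Q_def)
  have e: "(\<lambda>y. (y ! i) $$ (j', k')) \<in> poly_funs r m n" if "j' < m" "k' < n" for j' k'
    using that q(2) by (rule poly_funs.coord[rotated])
  have 1: "(\<lambda>y. \<Sum>l<n. (y ! i) $$ (j, l) * c (\<beta> l k)) \<in> poly_funs r m n"
    by (rule poly_funs.sum, rule poly_funs.mult) (simp_all add: e q poly_funs.const)
  have 2: "(\<lambda>y. \<Sum>l<m. c (\<alpha> j l) * (y ! i) $$ (l, k)) \<in> poly_funs r m n"
    by (rule poly_funs.sum, rule poly_funs.mult) (simp_all add: e q poly_funs.const)
  show "(\<lambda>y. D x y c q) \<in> poly_funs r m n"
    unfolding D_def q(1) prod.case by (rule poly_funs.diff[OF poly_funs.const 1])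
  show "(\<lambda>y. D y y c q) \<in> poly_funs r m n"
    unfolding D_def q(1) prod.case by (rule poly_funs.diff[OF 2 1])
qed

lemma pairing_D_poly:
  "(\<lambda>y. pairing Q l (D x y c)) \<in> poly_funs r m n" "(\<lambda>y. pairing Q l (D y y c)) \<in> poly_funs r m n"
  unfolding pairing_def by (rule poly_funs.sum, rule poly_funs.mult[OF poly_funs.const D_poly(1)], assumption)
    (rule poly_funs.sum, rule poly_funs.mult[OF poly_funs.const D_poly(2)], assumption)

text \<open>The inverse of \<open>H1 c\<close> is written as adjugate over determinant, so that the
  entries are visibly rational in \<open>c\<close> and \<open>act\<close> is a total
  function.\<close>

definition act :: "(nat \<Rightarrow> 'a) \<Rightarrow> 'a mat list \<Rightarrow> 'a mat list" where
  "act c x = map (\<lambda>A. inverse (det (H1 c)) \<cdot>\<^sub>m (H2 c * A * adj_mat (H1 c))) x"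

definition orb :: "'a mat list \<Rightarrow> 'a mat list set" where
  "orb x = {y \<in> X. \<exists>c. invertible_param c \<and> (\<forall>q\<in>Q. D x y c q = 0)}"

lemma D_zero_iff:
  assumes "x \<in> X" "y \<in> X"
  shows "(\<forall>q\<in>Q. D x y c q = 0) \<longleftrightarrow> (\<forall>i<r. H2 c * x ! i = y ! i * H1 c)"
proof
  assume z: "\<forall>q\<in>Q. D x y c q = 0"
  show "\<forall>i<r. H2 c * x ! i = y ! i * H1 c"
  proof (intro allI impI eq_matI)
    fix i j k assume i: "i < r" and jk: "j < dim_row (y ! i * H1 c)" "k < dim_col (y ! i * H1 c)"
    then have "j < m" "k < n" using mat_tuplesD[OF assms(2)] by auto
    then show "(H2 c * x ! i) $$ (j, k) = (y ! i * H1 c) $$ (j, k)"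
      using z D_mat[OF assms i, of j k c] i by (auto simp: Q_def)
  qed (use assms mat_tuplesD(2)[of x r m n] mat_tuplesD(2)[of y r m n] in auto)
next
  assume "\<forall>i<r. H2 c * x ! i = y ! i * H1 c"
  then show "\<forall>q\<in>Q. D x y c q = 0" using D_mat[OF assms] by (auto simp: Q_def)
qed

lemma act_mem: "x \<in> X \<Longrightarrow> act c x \<in> X"
proof (rule mat_tuplesI)
  assume x: "x \<in> X"
  then show "length (act c x) = r" by (simp add: act_def mat_tuplesD)
  fix i assume i: "i < r"
  have "H2 c * x ! i * adj_mat (H1 c) \<in> carrier_mat m n"
    using mat_tuplesD(2)[OF x i] adj_mat(1)[of "H1 c" n] by (intro mult_carrier_mat[of _ m n] mult_carrier_mat[of _ m m]) simp_all
  then show "act c x ! i \<in> carrier_mat m n" using i mat_tuplesD(1)[OF x] by (simp add: act_def)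
qed

lemma mult_right_cancel_mat:
  assumes "A \<in> carrier_mat m' n" "B \<in> carrier_mat m' n" "C \<in> carrier_mat n n" "det C \<noteq> (0::'a)" "A * C = B * C"
  shows "A = B"
proof -
  obtain N where N: "N \<in> carrier_mat n n" "C * N = 1\<^sub>m n" using det_nonzero_inverse[OF assms(3,4)] by auto
  have "A = (A * C) * N" using assms(1,3) N by (simp add: assoc_mult_mat[of A m' n C n N n])
  also have "\<dots> = B" unfolding assms(5) using assms(2,3) N by (simp add: assoc_mult_mat[of B m' n C n N n])
  finally show ?thesis .
qed

lemma act_intertwines:
  assumes "x \<in> X" "invertible_param c" "i < r"
  shows "act c x ! i * H1 c = H2 c * x ! i"
proof -
  have xi: "x ! i \<in> carrier_mat m n" using assms mat_tuplesD by blast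
  have hx: "H2 c * x ! i \<in> carrier_mat m n" by (rule mult_carrier_mat[OF coord_mat_carrier xi])
  have d: "det (H1 c) \<noteq> 0" using assms by (simp add: invertible_param_def)
  have ad: "adj_mat (H1 c) \<in> carrier_mat n n" by (rule adj_mat) simp
  have "act c x ! i * H1 c = inverse (det (H1 c)) \<cdot>\<^sub>m (H2 c * x ! i * adj_mat (H1 c) * H1 c)"
    using assms(3) mat_tuplesD(1)[OF assms(1)] xi ad
    by (simp add: act_def, intro mult_smult_assoc_mat[of _ m n _ n] mult_carrier_mat[of _ m n] mult_carrier_mat[of _ m m]) simp_all
  also have "H2 c * x ! i * adj_mat (H1 c) * H1 c = H2 c * x ! i * (adj_mat (H1 c) * H1 c)"
    by (rule assoc_mult_mat[of _ m n _ n _ n]) (use xi ad in auto)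
  also have "adj_mat (H1 c) * H1 c = det (H1 c) \<cdot>\<^sub>m 1\<^sub>m n" by (rule adj_mat) simp
  also have "H2 c * x ! i * (det (H1 c) \<cdot>\<^sub>m 1\<^sub>m n) = det (H1 c) \<cdot>\<^sub>m (H2 c * x ! i)"
    using mult_smult_distrib[OF hx one_carrier_mat] right_mult_one_mat[OF hx] by simp
  finally show ?thesis by (simp only:) (rule eq_matI, use d hx in simp_all)
qed

lemma act_unique:
  assumes x: "x \<in> X" and y: "y \<in> X" and c: "invertible_param c"
  shows "(\<forall>q\<in>Q. D x y c q = 0) \<longleftrightarrow> y = act c x"
proof
  assume "\<forall>q\<in>Q. D x y c q = 0"
  then have eq: "H2 c * x ! i = y ! i * H1 c" if "i < r" for i using that D_zero_iff[OF x y] by auto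
  show "y = act c x"
  proof (rule nth_equalityI)
    show "length y = length (act c x)" using y act_mem[OF x, of c] mat_tuplesD by metis
    fix i assume "i < length y"
    then have i: "i < r" using mat_tuplesD(1)[OF y] by simp
    show "y ! i = act c x ! i"
      by (rule mult_right_cancel_mat[of _ m _ "H1 c"])
        (use i c x y eq[OF i] act_intertwines[OF x c i] mat_tuplesD(2)[OF y i] mat_tuplesD(2)[OF act_mem[OF x] i]
         in \<open>auto simp: invertible_param_def\<close>)
  qed
next
  assume "y = act c x"
  then show "\<forall>q\<in>Q. D x y c q = 0"
    using D_zero_iff[OF x y] act_intertwines[OF x c] by auto
qed

lemma orb_act: "x \<in> X \<Longrightarrow> orb x = {act c x | c. invertible_param c}"
  unfolding orb_def using act_unique act_mem by blast

lemma orb_subset: "orb x \<subseteq> X"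
  by (auto simp: orb_def)

lemma mem_orbI:
  assumes "x \<in> X" "y \<in> X" "invertible_param c" "\<And>i. i < r \<Longrightarrow> H2 c * x ! i = y ! i * H1 c"
  shows "y \<in> orb x"
  using assms D_zero_iff[OF assms(1,2), of c] by (auto simp: orb_def)

lemma mem_orbE:
  assumes "y \<in> orb x" "x \<in> X"
  obtains c where "invertible_param c" "\<And>i. i < r \<Longrightarrow> H2 c * x ! i = y ! i * H1 c" "y \<in> X"
  using assms D_zero_iff[OF assms(2)] unfolding orb_def by blast

lemma orb_refl: "x \<in> X \<Longrightarrow> x \<in> orb x"
proof -
  assume x: "x \<in> X"
  obtain c where c: "H2 c = 1\<^sub>m m" "H1 c = 1\<^sub>m n" using unit by blast
  show ?thesis
    by (rule mem_orbI[OF x x, of c])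
      (use c left_mult_one_mat[OF mat_tuplesD(2)[OF x]] right_mult_one_mat[OF mat_tuplesD(2)[OF x]]
       in \<open>simp_all add: invertible_param_def\<close>)
qed

lemma inv_param:
  assumes "invertible_param a"
  obtains c where "invertible_param c" "H2 a * H2 c = 1\<^sub>m m" "H1 a * H1 c = 1\<^sub>m n"
    "H2 c * H2 a = 1\<^sub>m m" "H1 c * H1 a = 1\<^sub>m n"
proof -
  obtain c where c: "H2 a * H2 c = 1\<^sub>m m" "H1 a * H1 c = 1\<^sub>m n"
    using inv assms unfolding invertible_param_def by blast
  then have c': "H2 c * H2 a = 1\<^sub>m m" "H1 c * H1 a = 1\<^sub>m n"
    by (auto intro: mat_mult_left_right_inverse[OF _ _ c(1)] mat_mult_left_right_inverse[OF _ _ c(2)])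
  then have "invertible_param c" unfolding invertible_param_def
    using det_nonzero_of_inverse[OF _ _ c'(1)] det_nonzero_of_inverse[OF _ _ c'(2)] by auto
  then show thesis using that c c' by blast
qed

lemma orb_sym:
  assumes x: "x \<in> X" and y: "y \<in> orb x"
  shows "x \<in> orb y"
proof -
  obtain a where a: "invertible_param a" "\<And>i. i < r \<Longrightarrow> H2 a * x ! i = y ! i * H1 a" and yX: "y \<in> X"
    using mem_orbE[OF y x] by blast
  obtain c where c: "invertible_param c" "H1 a * H1 c = 1\<^sub>m n" "H2 c * H2 a = 1\<^sub>m m"
    using inv_param[OF a(1)] by blast
  show ?thesis
  proof (rule mem_orbI[OF yX x c(1)])
    fix i assume i: "i < r"
    note xi = mat_tuplesD(2)[OF x i] and yi = mat_tuplesD(2)[OF yX i]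
    have "H2 c * y ! i = H2 c * (y ! i * H1 a * H1 c)"
      using yi c(2) by (simp add: assoc_mult_mat[of _ m n _ n _ n])
    also have "\<dots> = H2 c * (H2 a * x ! i * H1 c)" using a(2)[OF i] by simp
    also have "\<dots> = (H2 c * H2 a) * (x ! i * H1 c)"
      using xi by (simp add: assoc_mult_mat[of _ m m _ n _ n] assoc_mult_mat[of _ m m _ m _ n])
    also have "\<dots> = x ! i * H1 c" using xi c(3) by simp
    finally show "H2 c * y ! i = x ! i * H1 c" .
  qed
qed

lemma orb_trans:
  assumes x: "x \<in> X" and y: "y \<in> orb x" and z: "z \<in> orb y"
  shows "z \<in> orb x"
proof -
  obtain a where a: "invertible_param a" "\<And>i. i < r \<Longrightarrow> H2 a * x ! i = y ! i * H1 a" and yX: "y \<in> X"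
    using mem_orbE[OF y x] by blast
  obtain b where b: "invertible_param b" "\<And>i. i < r \<Longrightarrow> H2 b * y ! i = z ! i * H1 b" and zX: "z \<in> X"
    using mem_orbE[OF z yX] by blast
  obtain c where c: "H2 c = H2 b * H2 a" "H1 c = H1 b * H1 a" using mult by blast
  have ci: "invertible_param c" using a b unfolding invertible_param_def c
    by (simp add: det_mult[of _ m] det_mult[of _ n])
  show ?thesis
  proof (rule mem_orbI[OF x zX ci])
    fix i assume i: "i < r"
    note xi = mat_tuplesD(2)[OF x i] and yi = mat_tuplesD(2)[OF yX i] and zi = mat_tuplesD(2)[OF zX i]
    have "H2 c * x ! i = H2 b * (H2 a * x ! i)"
      unfolding c using xi by (simp add: assoc_mult_mat[of _ m m _ m _ n])
    also have "\<dots> = H2 b * y ! i * H1 a" unfolding a(2)[OF i] using yi by (simp add: assoc_mult_mat[of _ m m _ n _ n])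
    also have "\<dots> = z ! i * H1 c" unfolding b(2)[OF i] c using zi by (simp add: assoc_mult_mat[of _ m n _ n _ n])
    finally show "H2 c * x ! i = z ! i * H1 c" .
  qed
qed

lemma orb_eq:
  assumes x: "x \<in> X" and y: "y \<in> orb x"
  shows "orb y = orb x"
proof
  have yX: "y \<in> X" using y orb_subset by blast
  show "orb y \<subseteq> orb x" using orb_trans[OF x y] by blast
  show "orb x \<subseteq> orb y" using orb_trans[OF yX orb_sym[OF x y]] by blast
qed

end

text \<open>Cramer's rule for both orders of multiplication, without division by the determinant, so
  that solutions keep polynomial numerators.\<close>

lemma cramer:
  assumes M: "(M :: 'a::field mat) \<in> carrier_mat k k"
  shows "t < k \<Longrightarrow> (\<Sum>a<k. adj_mat M $$ (t, a) * (\<Sum>b<k. M $$ (a, b) * w b)) = det M * w t"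
    and "t < k \<Longrightarrow> (\<Sum>a<k. M $$ (t, a) * (\<Sum>b<k. adj_mat M $$ (a, b) * w b)) = det M * w t"
proof -
  note adj = adj_mat[OF M]
  have gen: "(\<Sum>a<k. A $$ (t, a) * (\<Sum>b<k. B $$ (a, b) * w b)) = det M * w t"
    if A: "A \<in> carrier_mat k k" and B: "B \<in> carrier_mat k k" and AB: "A * B = det M \<cdot>\<^sub>m 1\<^sub>m k" and t: "t < k" for A B
  proof -
    have "(\<Sum>a<k. A $$ (t, a) * (\<Sum>b<k. B $$ (a, b) * w b)) = (\<Sum>b<k. (\<Sum>a<k. A $$ (t, a) * B $$ (a, b)) * w b)"
      unfolding sum_distrib_left sum_distrib_right by (subst sum.swap) (simp add: mult.assoc)
    also have "\<dots> = (\<Sum>b<k. (A * B) $$ (t, b) * w b)"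
      by (rule sum.cong) (simp_all add: index_mult_mat_sum[OF A B t])
    also have "\<dots> = (\<Sum>b<k. (det M * w b) * (if b = t then 1 else 0))"
      unfolding AB by (rule sum.cong) (use t in auto)
    also have "\<dots> = det M * w t" using t by (simp only: sum_mult_delta finite_lessThan) simp
    finally show ?thesis .
  qed
  show "t < k \<Longrightarrow> (\<Sum>a<k. adj_mat M $$ (t, a) * (\<Sum>b<k. M $$ (a, b) * w b)) = det M * w t"
    by (rule gen[OF adj(1) M adj(3)])
  show "t < k \<Longrightarrow> (\<Sum>a<k. M $$ (t, a) * (\<Sum>b<k. adj_mat M $$ (a, b) * w b)) = det M * w t"
    by (rule gen[OF M adj(1) adj(2)])
qed

section \<open>The rank of the linearised orbit map\<close>

context linear_action
begin

text \<open>The map sending \<open>c\<close> to \<open>D x x c\<close> is the differential at the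
  identity of the orbit map of \<open>x\<close>. The parameters \<open>u s\<close> lift a basis of
  its image and \<open>l\<close> is dual to that basis, so \<open>k\<close> is the rank of the
  differential.\<close>

definition rank_data :: "'a mat list \<Rightarrow> nat \<Rightarrow> (nat \<Rightarrow> nat \<Rightarrow> 'a) \<Rightarrow> (nat \<Rightarrow> nat \<times> nat \<times> nat \<Rightarrow> 'a) \<Rightarrow> bool" where
  "rank_data x k u l \<longleftrightarrow> biorth Q k (\<lambda>s. D x x (u s)) l \<and>
     (\<forall>c. \<forall>q\<in>Q. D x x c q = (\<Sum>s<k. pairing Q (l s) (D x x c) * D x x (u s) q))"

lemma rank_data_exists: "\<exists>k u l. rank_data x k u l"
proof -
  have "biorth Q 0 (\<lambda>_. D x x (\<lambda>_. 0)) (\<lambda>_ _. 0)" by (simp add: biorth_def)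
  from biorth_extend[OF finite_Q this, of "range (D x x)"] obtain k b l where
    b: "\<forall>i<k. b i \<in> range (D x x)" "biorth Q k b l"
    and span: "\<forall>v\<in>range (D x x). \<forall>q\<in>Q. v q = (\<Sum>i<k. pairing Q (l i) v * b i q)"
    by auto
  from b(1) have "\<forall>i. \<exists>u. i < k \<longrightarrow> b i = D x x u" by auto
  then obtain u where u: "\<And>i. i < k \<Longrightarrow> b i = D x x (u i)" by metis
  have "rank_data x k u l"
    unfolding rank_data_def
  proof (intro conjI allI ballI)
    show "biorth Q k (\<lambda>s. D x x (u s)) l" using b(2) u by (simp add: biorth_def)
    fix c q assume "q \<in> Q"
    then have "D x x c q = (\<Sum>i<k. pairing Q (l i) (D x x c) * b i q)" using span by blast
    also have "\<dots> = (\<Sum>i<k. pairing Q (l i) (D x x c) * D x x (u i) q)"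
      by (rule sum.cong) (simp_all add: u)
    finally show "D x x c q = (\<Sum>i<k. pairing Q (l i) (D x x c) * D x x (u i) q)" .
  qed
  then show ?thesis by blast
qed

lemma rank_dep:
  assumes "rank_data x k u l" "finite J" "k < card J"
  shows "\<exists>\<mu>. (\<exists>s\<in>J. \<mu> s \<noteq> 0) \<and> (\<forall>q\<in>Q. (\<Sum>s\<in>J. \<mu> s * D x x (c s) q) = 0)"
proof -
  have "card {..<k} < card J" using assms by simp
  from homogeneous_system[OF _ assms(2) this, of "\<lambda>s t. pairing Q (l t) (D x x (c s))"]
  obtain \<mu> where mu: "\<exists>s\<in>J. \<mu> s \<noteq> 0" "\<forall>t<k. (\<Sum>s\<in>J. \<mu> s * pairing Q (l t) (D x x (c s))) = 0"
    by auto
  have "(\<Sum>s\<in>J. \<mu> s * D x x (c s) q) = 0" if q: "q \<in> Q" for q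
  proof -
    have "D x x (c s) q = (\<Sum>t<k. pairing Q (l t) (D x x (c s)) * D x x (u t) q)" for s
      using assms(1) q unfolding rank_data_def by blast
    then have "(\<Sum>s\<in>J. \<mu> s * D x x (c s) q) = (\<Sum>s\<in>J. \<Sum>t<k. \<mu> s * pairing Q (l t) (D x x (c s)) * D x x (u t) q)"
      by (simp add: sum_distrib_left mult.assoc)
    also have "\<dots> = (\<Sum>t<k. (\<Sum>s\<in>J. \<mu> s * pairing Q (l t) (D x x (c s))) * D x x (u t) q)"
      unfolding sum_distrib_right by (rule sum.swap)
    also have "\<dots> = 0" using mu(2) by simp
    finally show ?thesis .
  qed
  then show ?thesis using mu(1) by blast
qed

text \<open>If \<open>g\<close> carries \<open>x\<close> to \<open>y\<close>, then
  \<open>D x y c\<close> is \<open>H2 g\<close> applied to \<open>D x x c'\<close>, where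
  \<open>c'\<close> represents the product of the inverse of \<open>g\<close> with \<open>c\<close>.
  So linear relations among values of \<open>D x x\<close> carry over to \<open>D x y\<close>, whose
  rank is at most \<open>k\<close> along the orbit.\<close>

lemma orb_dep:
  assumes x: "x \<in> X" and y: "y \<in> orb x" and "rank_data x k u l" "finite J" "k < card J"
  shows "\<exists>\<mu>. (\<exists>s\<in>J. \<mu> s \<noteq> 0) \<and> (\<forall>q\<in>Q. (\<Sum>s\<in>J. \<mu> s * D x y (c s) q) = 0)"
proof -
  obtain g where g: "invertible_param g" "\<And>i. i < r \<Longrightarrow> H2 g * x ! i = y ! i * H1 g" and yX: "y \<in> X"
    using mem_orbE[OF y x] by blast
  obtain g' where g': "H2 g * H2 g' = 1\<^sub>m m" "H1 g * H1 g' = 1\<^sub>m n" using inv_param[OF g(1)] by blast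
  have "\<forall>s. \<exists>c'. H2 c' = H2 g' * H2 (c s) \<and> H1 c' = H1 g' * H1 (c s)" using mult by blast
  then obtain c' where c': "\<And>s. H2 (c' s) = H2 g' * H2 (c s)" "\<And>s. H1 (c' s) = H1 g' * H1 (c s)" by metis
  have key: "D x y (c s) (i, j, k) = (\<Sum>t<m. H2 g $$ (j, t) * D x x (c' s) (i, t, k))"
    if ijk: "i < r" "j < m" "k < n" for s i j k
  proof -
    note xi = mat_tuplesD(2)[OF x ijk(1)] and yi = mat_tuplesD(2)[OF yX ijk(1)]
    let ?A = "H2 (c' s) * x ! i - x ! i * H1 (c' s)"
    have c1: "H2 (c' s) * x ! i \<in> carrier_mat m n" "x ! i * H1 (c' s) \<in> carrier_mat m n"
      by (rule mult_carrier_mat[OF coord_mat_carrier xi], rule mult_carrier_mat[OF xi coord_mat_carrier])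
    have A: "?A \<in> carrier_mat m n" by (rule minus_carrier_mat[OF c1(2)])
    have "H2 g * ?A = H2 g * (H2 (c' s) * x ! i) - H2 g * (x ! i * H1 (c' s))"
      by (rule mult_minus_distrib_mat[OF coord_mat_carrier c1])
    also have "H2 g * (H2 (c' s) * x ! i) = (H2 g * H2 g') * (H2 (c s) * x ! i)"
      unfolding c' using xi mult_carrier_mat[OF coord_mat_carrier xi, of \<alpha> "c s"]
      by (simp add: assoc_mult_mat[of _ m m _ m _ n])
    also have "\<dots> = H2 (c s) * x ! i" unfolding g' using left_mult_one_mat[OF mult_carrier_mat[OF coord_mat_carrier xi]] by simp
    also have "H2 g * (x ! i * H1 (c' s)) = (H2 g * x ! i) * H1 (c' s)"
      using xi by (simp add: assoc_mult_mat[of _ m m _ n _ n])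
    also have "\<dots> = y ! i * (H1 g * H1 (c' s))"
      unfolding g(2)[OF ijk(1)] using yi by (simp add: assoc_mult_mat[of _ m n _ n _ n])
    also have "H1 g * H1 (c' s) = H1 (c s)"
      unfolding c' using g'(2) by (simp add: assoc_mult_mat[of _ n n _ n _ n, symmetric])
    finally have "(H2 g * ?A) $$ (j, k) = (H2 (c s) * x ! i - y ! i * H1 (c s)) $$ (j, k)" by simp
    also have "\<dots> = D x y (c s) (i, j, k)"
      using D_mat[OF x yX ijk] ijk carrier_matD[OF yi] by simp
    finally have "D x y (c s) (i, j, k) = (\<Sum>t<m. H2 g $$ (j, t) * ?A $$ (t, k))"
      using index_mult_mat_sum[OF coord_mat_carrier A ijk(2,3)] by simp
    also have "\<dots> = (\<Sum>t<m. H2 g $$ (j, t) * D x x (c' s) (i, t, k))"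
      by (rule sum.cong) (use D_mat[OF x x ijk(1) _ ijk(3)] ijk carrier_matD[OF xi] in simp_all)
    finally show ?thesis .
  qed
  obtain \<mu> where mu: "\<exists>s\<in>J. \<mu> s \<noteq> 0" "\<forall>q\<in>Q. (\<Sum>s\<in>J. \<mu> s * D x x (c' s) q) = 0"
    using rank_dep[OF assms(3-5), of c'] by blast
  have "(\<Sum>s\<in>J. \<mu> s * D x y (c s) q) = 0" if qQ: "q \<in> Q" for q
  proof -
    obtain i j k where q: "q = (i, j, k)" "i < r" "j < m" "k < n" using qQ by (auto simp: Q_def)
    have "(\<Sum>s\<in>J. \<mu> s * D x y (c s) q) = (\<Sum>s\<in>J. \<Sum>t<m. H2 g $$ (j, t) * (\<mu> s * D x x (c' s) (i, t, k)))"
      unfolding q(1) using key[OF q(2-4)] by (simp add: sum_distrib_left algebra_simps)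
    also have "\<dots> = (\<Sum>t<m. H2 g $$ (j, t) * (\<Sum>s\<in>J. \<mu> s * D x x (c' s) (i, t, k)))"
      unfolding sum_distrib_left by (rule sum.swap)
    also have "\<dots> = 0" using mu(2) q by (simp add: Q_def)
    finally show ?thesis .
  qed
  then show ?thesis using mu(1) by blast
qed

lemma biorth_le_rank:
  assumes "rank_data x k u l" "biorth Q k' (\<lambda>s. D x x (u' s)) l'"
  shows "k' \<le> k"
proof (rule ccontr)
  assume "\<not> ?thesis"
  then have "k < card {..<k'}" by simp
  from rank_dep[OF assms(1) _ this, of u'] obtain \<mu> where
    "\<exists>s\<in>{..<k'}. \<mu> s \<noteq> 0" "\<forall>q\<in>Q. (\<Sum>s<k'. \<mu> s * D x x (u' s) q) = 0" by auto
  then show False using biorth_indep[OF assms(2), of \<mu>] by auto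
qed

definition rk :: "'a mat list \<Rightarrow> nat" where "rk x = (THE k. \<exists>u l. rank_data x k u l)"

lemma rk_eq: "rank_data x k u l \<Longrightarrow> rk x = k"
  unfolding rk_def
proof (rule the_equality)
  fix k' assume *: "rank_data x k u l" and "\<exists>u l. rank_data x k' u l"
  then obtain u' l' where **: "rank_data x k' u' l'" by blast
  show "k' = k"
  proof (rule antisym)
    show "k' \<le> k" using biorth_le_rank[OF *, of k' u' l'] ** by (simp add: rank_data_def)
    show "k \<le> k'" using biorth_le_rank[OF **, of k u l] * by (simp add: rank_data_def)
  qed
qed blast

lemma rank_data_rk: "\<exists>u l. rank_data x (rk x) u l"
  using rank_data_exists rk_eq by metis

lemma rk_le: "rk x \<le> card Q"
proof -
  obtain u l where "rank_data x (rk x) u l" using rank_data_rk by blast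
  then show ?thesis using biorth_le_card[of Q "rk x"] by (auto simp: rank_data_def)
qed

text \<open>\<open>f\<close> is the determinant of the pairings of \<open>D y y (u j)\<close> with
  functionals \<open>l\<close>, where \<open>u\<close> and \<open>l\<close> are chosen at
  \<open>x\<close>. At \<open>x\<close> the matrix is the identity, and wherever its determinant is
  nonzero \<open>rk x\<close> independent values survive.\<close>

lemma rk_semicontinuous:
  "\<exists>f\<in>poly_funs r m n. f x \<noteq> 0 \<and> (\<forall>y. f y \<noteq> 0 \<longrightarrow> rk x \<le> rk y)"
proof -
  obtain u l where rx: "rank_data x (rk x) u l" using rank_data_rk by blast
  let ?k = "rk x"
  let ?M = "\<lambda>y. mat ?k ?k (\<lambda>(i, j). pairing Q (l i) (D y y (u j)))"
  let ?f = "\<lambda>y. det (?M y)"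
  have f: "?f \<in> poly_funs r m n"
    by (rule poly_funs.det[of _ ?k]) (simp_all add: pairing_D_poly)
  have "?M x = 1\<^sub>m ?k" using rx by (intro eq_matI) (auto simp: rank_data_def biorth_def)
  then have fx: "?f x \<noteq> 0" by simp
  have "?k \<le> rk y" if fy: "?f y \<noteq> 0" for y
  proof -
    obtain l' where b: "biorth Q ?k (\<lambda>j. D y y (u j)) l'" using biorth_of_det[OF fy] by blast
    obtain u' l'' where "rank_data y (rk y) u' l''" using rank_data_rk by blast
    then show ?thesis using biorth_le_rank[OF _ b] by blast
  qed
  then show ?thesis using f fx by (intro bexI[of _ ?f]) auto
qed

section \<open>Rational slices of an orbit\<close>

lemma act_localize_family:
  assumes "function_algebra S" and c: "\<And>a. (\<lambda>t. c t a) \<in> S" and x: "\<And>t. x t \<in> X"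
    and xe: "\<And>i j k. i < r \<Longrightarrow> j < m \<Longrightarrow> k < n \<Longrightarrow> (\<lambda>t. (x t ! i) $$ (j, k)) \<in> S" and ijk: "i < r" "j < m" "k < n"
  shows "(\<lambda>t. det (H2 (c t)) * det (H1 (c t))) \<in> S"
    and "(\<lambda>t. (act (c t) (x t) ! i) $$ (j, k)) \<in> localize S (\<lambda>t. det (H2 (c t)) * det (H1 (c t)))"
proof -
  interpret S: function_algebra S by fact
  let ?\<delta> = "\<lambda>t. det (H2 (c t)) * det (H1 (c t))"
  have d2: "(\<lambda>t. det (H2 (c t))) \<in> S" by (rule S.det[of _ m]) (simp_all add: c)
  have d1: "(\<lambda>t. det (H1 (c t))) \<in> S" by (rule S.det[of _ n]) (simp_all add: c)
  show \<delta>: "?\<delta> \<in> S" by (rule S.mult[OF d2 d1])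
  interpret L: function_algebra "localize S ?\<delta>" by (rule S.function_algebra_localize[OF \<delta>])
  have xi: "x t ! i \<in> carrier_mat m n" for t by (rule mat_tuplesD(2)[OF x ijk(1)])
  have hx: "H2 (c t) * x t ! i \<in> carrier_mat m n" for t by (rule mult_carrier_mat[OF coord_mat_carrier xi])
  have ad: "adj_mat (H1 (c t)) \<in> carrier_mat n n" for t by (rule adj_mat) simp
  have e1: "(\<lambda>t. (H2 (c t) * x t ! i) $$ (a, b)) \<in> S" if "a < m" "b < n" for a b
    by (rule S.mult_mat[of _ m m _ n]) (use that xi xe[OF ijk(1)] in \<open>simp_all add: c\<close>)
  have "(\<lambda>t. (H2 (c t) * x t ! i * adj_mat (H1 (c t))) $$ (j, k)) \<in> S"
    by (rule S.mult_mat[of _ m n _ n, OF hx ad]) (use e1 ijk in \<open>simp_all add: S.adj_mat[of _ n] c\<close>)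
  \<comment> \<open>\<open>act\<close> divides by \<open>det (H1 c)\<close> alone, but the common
    denominator \<open>?\<delta>\<close> also contains \<open>det (H2 c)\<close>, so that its
    nonvanishing means \<open>invertible_param\<close>. The surplus factor is multiplied back
    in.\<close>
  then have "(\<lambda>t. (det (H2 (c t)) * inverse (?\<delta> t)) * (H2 (c t) * x t ! i * adj_mat (H1 (c t))) $$ (j, k)) \<in> localize S ?\<delta>"
    by (intro L.mult S.inverse_localize S.subset_localize d2)
  then show "(\<lambda>t. (act (c t) (x t) ! i) $$ (j, k)) \<in> localize S ?\<delta>"
  proof (rule S.localize_cong)
    fix t assume nz: "?\<delta> t \<noteq> 0"
    have "act (c t) (x t) ! i = inverse (det (H1 (c t))) \<cdot>\<^sub>m (H2 (c t) * x t ! i * adj_mat (H1 (c t)))"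
      using mat_tuplesD(1)[OF x] ijk(1) by (simp add: act_def)
    then show "(act (c t) (x t) ! i) $$ (j, k) = (det (H2 (c t)) * inverse (?\<delta> t)) * (H2 (c t) * x t ! i * adj_mat (H1 (c t))) $$ (j, k)"
      using nz carrier_matD[OF mult_carrier_mat[OF hx ad, of t t]] ijk by simp
  qed
qed

lemma act_localize:
  assumes "function_algebra S" and c: "\<And>a. (\<lambda>t. c t a) \<in> S" and x: "x \<in> X" and ijk: "i < r" "j < m" "k < n"
  shows "(\<lambda>t. det (H2 (c t)) * det (H1 (c t))) \<in> S"
    and "(\<lambda>t. (act (c t) x ! i) $$ (j, k)) \<in> localize S (\<lambda>t. det (H2 (c t)) * det (H1 (c t)))"
proof -
  note fam = act_localize_family[OF assms(1) c _ _ ijk, of "\<lambda>_. x"]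
  show "(\<lambda>t. det (H2 (c t)) * det (H1 (c t))) \<in> S"
    by (rule fam(1)) (simp_all add: x function_algebra.const[OF assms(1)])
  show "(\<lambda>t. (act (c t) x ! i) $$ (j, k)) \<in> localize S (\<lambda>t. det (H2 (c t)) * det (H1 (c t)))"
    by (rule fam(2)) (simp_all add: x function_algebra.const[OF assms(1)])
qed

text \<open>Parameters are joined by straight lines. Away from the zeros of the two determinants a
  line consists of invertible parameters, and \<open>act\<close> maps it to a rational
  curve.\<close>

lemma zirr_param:
  assumes x: "x \<in> X" and ne: "\<exists>c\<in>P. invertible_param c"
    and aff: "\<And>c c' t. c \<in> P \<Longrightarrow> c' \<in> P \<Longrightarrow> (\<lambda>a. (1 - t) * c a + t * c' a) \<in> P"
  shows "zirr r m n {act c x | c. c \<in> P \<and> invertible_param c}"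
proof (rule zirr_by_lines)
  show "{act c x |c. c \<in> P \<and> invertible_param c} \<noteq> {}" using ne by blast
  show "{act c x |c. c \<in> P \<and> invertible_param c} \<subseteq> X" using act_mem[OF x] by blast
  fix y z assume "y \<in> {act c x |c. c \<in> P \<and> invertible_param c}" "z \<in> {act c x |c. c \<in> P \<and> invertible_param c}"
  then obtain c c' where c: "y = act c x" "c \<in> P" "invertible_param c"
    and c': "z = act c' x" "c' \<in> P" "invertible_param c'" by blast
  let ?c = "\<lambda>t a. (1 - t) * c a + t * c' a"
  let ?\<delta> = "\<lambda>t. det (H2 (?c t)) * det (H1 (?c t))"
  have loc: "?\<delta> \<in> range poly \<and> (\<lambda>t. (act (?c t) x ! i) $$ (j, k)) \<in> localize (range poly) ?\<delta>"
    if "i < r" "j < m" "k < n" for i j k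
    using act_localize[OF line_polys.function_algebra_axioms _ x that, of ?c] by simp
  have \<delta>: "?\<delta> \<in> range poly"
    by (rule line_polys.mult; rule line_polys.det) (rule coord_mat_carrier, simp)+
  show "\<exists>\<delta>\<in>range poly. \<exists>\<phi> s t. \<delta> s \<noteq> 0 \<and> \<delta> t \<noteq> 0 \<and> \<phi> s = y \<and> \<phi> t = z \<and>
      (\<forall>u. \<delta> u \<noteq> 0 \<longrightarrow> \<phi> u \<in> {act c x |c. c \<in> P \<and> invertible_param c}) \<and>
      (\<forall>i<r. \<forall>j<m. \<forall>k<n. (\<lambda>u. (\<phi> u ! i) $$ (j, k)) \<in> localize (range poly) \<delta>)"
  proof (rule bexI[OF _ \<delta>], rule exI[of _ "\<lambda>t. act (?c t) x"], rule exI[of _ 0], rule exI[of _ 1], intro conjI allI impI)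
    show "?\<delta> 0 \<noteq> 0" "?\<delta> 1 \<noteq> 0" using c(3) c'(3) by (simp_all add: invertible_param_def)
    show "act (?c 0) x = y" "act (?c 1) x = z" using c c' by simp_all
    show "act (?c u) x \<in> {act c x |c. c \<in> P \<and> invertible_param c}" if "?\<delta> u \<noteq> 0" for u
      using that aff[OF c(2) c'(2), of u] by (auto simp: invertible_param_def)
    show "(\<lambda>u. (act (?c u) x ! i) $$ (j, k)) \<in> localize (range poly) ?\<delta>" if "i < r" "j < m" "k < n" for i j k
      using loc[OF that] by simp
  qed
qed

lemma zirr_orb:
  assumes x: "x \<in> X"
  shows "zirr r m n (orb x)"
proof -
  obtain c where "H2 c = 1\<^sub>m m" "H1 c = 1\<^sub>m n" using unit by blast
  then have "invertible_param c" by (simp add: invertible_param_def)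
  then have "\<exists>c\<in>UNIV. invertible_param c" by blast
  from zirr_param[OF x this] show ?thesis unfolding orb_act[OF x] by simp
qed

end

text \<open>Through the identity \<open>c1\<close> runs the affine slice \<open>par w\<close>, in
  directions complementary to the kernel of the differential. The slice parameter carrying
  \<open>x\<close> to \<open>y\<close> solves a linear system with matrix \<open>\<Theta> y\<close>,
  and by Cramer's rule its coordinates are \<open>num y t / den y\<close>.\<close>

locale orbit_slice = linear_action r m n \<alpha> \<beta> ty for r m n \<alpha> \<beta> and ty :: "'a::alg_closed_field itself" +
  fixes x :: "'a mat list" and k u l c1
  assumes x: "x \<in> X" and rd: "rank_data x k u l" and c1: "H2 c1 = 1\<^sub>m m" "H1 c1 = 1\<^sub>m n"
begin

definition par :: "(nat \<Rightarrow> 'a) \<Rightarrow> nat \<Rightarrow> 'a" where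
  "par w = (\<lambda>t. c1 t + (\<Sum>s<k. w s * u s t))"

definition \<Theta> :: "'a mat list \<Rightarrow> 'a mat" where
  "\<Theta> y = mat k k (\<lambda>(a, b). pairing Q (l a) (D x y (u b)))"

definition num :: "'a mat list \<Rightarrow> nat \<Rightarrow> 'a" where
  "num y t = (\<Sum>a<k. adj_mat (\<Theta> y) $$ (t, a) * - pairing Q (l a) (D x y c1))"

definition den :: "'a mat list \<Rightarrow> 'a" where "den y = det (\<Theta> y)"

text \<open>The slice parameter of \<open>y\<close> is scaled by \<open>den y\<close> before its
  determinants are taken. This keeps the function polynomial, and where \<open>den y\<close> is
  nonzero the scaled parameter is invertible exactly when the original one is.\<close>

definition good :: "'a mat list \<Rightarrow> 'a" where
  "good y = den y * (det (H2 (\<lambda>t. den y * c1 t + (\<Sum>s<k. num y s * u s t))) *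
     det (H1 (\<lambda>t. den y * c1 t + (\<Sum>s<k. num y s * u s t))))"

lemma Theta_carrier [simp]: "\<Theta> y \<in> carrier_mat k k" by (simp add: \<Theta>_def)

lemma den_poly: "den \<in> poly_funs r m n"
  unfolding den_def[abs_def]
  by (rule poly_funs.det[of _ k]) (simp_all add: \<Theta>_def pairing_D_poly)

lemma num_poly: "t < k \<Longrightarrow> (\<lambda>y. num y t) \<in> poly_funs r m n"
  unfolding num_def
  by (rule poly_funs.sum, rule poly_funs.mult, rule poly_funs.adj_mat[of _ k])
    (simp_all add: poly_funs.uminus pairing_D_poly, simp add: \<Theta>_def pairing_D_poly)

lemma good_poly: "good \<in> poly_funs r m n"
proof -
  have "(\<lambda>y. den y * c1 t + (\<Sum>s<k. num y s * u s t)) \<in> poly_funs r m n" for t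
    by (rule poly_funs.add, rule poly_funs.mult[OF den_poly poly_funs.const], rule poly_funs.sum)
      (simp add: num_poly poly_funs.mult)
  then have "(\<lambda>y. det (H2 (\<lambda>t. den y * c1 t + (\<Sum>s<k. num y s * u s t)))) \<in> poly_funs r m n"
    "(\<lambda>y. det (H1 (\<lambda>t. den y * c1 t + (\<Sum>s<k. num y s * u s t)))) \<in> poly_funs r m n"
    by (intro poly_funs.det[of _ m] poly_funs.det[of _ n]; simp)+
  then show ?thesis unfolding good_def[abs_def]
    by (intro poly_funs.mult den_poly)
qed

lemma D_par: "D x y (par w) q = D x y c1 q + (\<Sum>s<k. w s * D x y (u s) q)"
  unfolding par_def D_add D_sum ..

lemma pairing_D_par:
  assumes "a < k"
  shows "pairing Q (l a) (D x y (par w)) = pairing Q (l a) (D x y c1) + (\<Sum>s<k. \<Theta> y $$ (a, s) * w s)"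
proof -
  have "D x y (par w) = (\<lambda>q. D x y c1 q + (\<Sum>s<k. w s * D x y (u s) q))" by (rule ext) (rule D_par)
  then show ?thesis using assms
    by (simp add: pairing_add pairing_sum \<Theta>_def mult.commute)
qed

lemma Dx_c1: "q \<in> Q \<Longrightarrow> D x x c1 q = 0"
  using D_zero_iff[OF x x, of c1] c1 left_mult_one_mat[OF mat_tuplesD(2)[OF x]] right_mult_one_mat[OF mat_tuplesD(2)[OF x]]
  by simp

lemma den_x: "den x = 1"
proof -
  have "\<Theta> x = 1\<^sub>m k" using rd by (intro eq_matI) (auto simp: \<Theta>_def rank_data_def biorth_def)
  then show ?thesis by (simp add: den_def)
qed

lemma good_x: "good x \<noteq> 0"
proof -
  have "num x t = 0" for t by (simp add: num_def pairing_zero Dx_c1)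
  then show ?thesis by (simp add: good_def den_x c1)
qed

lemma num_slice:
  assumes "\<forall>q\<in>Q. D x y (par w) q = 0" "t < k"
  shows "num y t = den y * w t"
proof -
  have "- pairing Q (l a) (D x y c1) = (\<Sum>s<k. \<Theta> y $$ (a, s) * w s)" if "a < k" for a
    using pairing_D_par[OF that, of y w] pairing_zero[of Q "D x y (par w)" "l a"] assms(1)
    by (simp add: eq_neg_iff_add_eq_0 add.commute neg_eq_iff_add_eq_0)
  then have "num y t = (\<Sum>a<k. adj_mat (\<Theta> y) $$ (t, a) * (\<Sum>s<k. \<Theta> y $$ (a, s) * w s))"
    by (simp add: num_def)
  also have "\<dots> = den y * w t" unfolding den_def by (rule cramer(1)[OF Theta_carrier assms(2)])
  finally show ?thesis .
qed

lemma Theta_inj: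
  assumes "den y \<noteq> 0" "\<And>a. a < k \<Longrightarrow> (\<Sum>s<k. \<Theta> y $$ (a, s) * v s) = 0" "t < k"
  shows "v t = 0"
  using cramer(1)[OF Theta_carrier assms(3), of y v] assms by (simp add: den_def)

text \<open>On the orbit \<open>D x y\<close> has rank at most \<open>k\<close>. Where
  \<open>den y\<close> is nonzero, the \<open>k\<close> functionals already separate the span of the
  \<open>k\<close> vectors \<open>D x y (u s)\<close>, which is then the whole image.\<close>

lemma slice_separated:
  assumes y: "y \<in> orb x" and d: "den y \<noteq> 0" and c: "\<And>a. a < k \<Longrightarrow> pairing Q (l a) (D x y c) = 0" and q: "q \<in> Q"
  shows "D x y c q = 0"
proof -
  obtain \<mu> where mu: "\<exists>s\<in>{..k}. \<mu> s \<noteq> 0"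
    "\<forall>q\<in>Q. (\<Sum>s\<le>k. \<mu> s * D x y (if s < k then u s else c) q) = 0"
    using orb_dep[OF x y rd, of "{..k}" "\<lambda>s. if s < k then u s else c"] by auto
  have split: "(\<Sum>s\<le>k. \<mu> s * D x y (if s < k then u s else c) q) = (\<Sum>s<k. \<mu> s * D x y (u s) q) + \<mu> k * D x y c q" for q
    by (simp add: lessThan_Suc_atMost[symmetric])
  have "(\<Sum>s<k. \<Theta> y $$ (a, s) * \<mu> s) = 0" if a: "a < k" for a
  proof -
    have "0 = pairing Q (l a) (\<lambda>q. (\<Sum>s<k. \<mu> s * D x y (u s) q) + \<mu> k * D x y c q)"
      using mu(2) unfolding split by (simp add: pairing_zero)
    also have "\<dots> = (\<Sum>s<k. \<mu> s * pairing Q (l a) (D x y (u s))) + pairing Q (l a) (\<lambda>q. \<mu> k * D x y c q)"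
      by (simp add: pairing_add pairing_sum)
    also have "pairing Q (l a) (\<lambda>q. \<mu> k * D x y c q) = \<mu> k * pairing Q (l a) (D x y c)"
      by (simp add: pairing_def sum_distrib_left algebra_simps)
    also have "\<dots> = 0" using c[OF a] by simp
    finally show ?thesis using a by (simp add: \<Theta>_def mult.commute)
  qed
  then have z: "\<mu> s = 0" if "s < k" for s using Theta_inj[OF d _ that, of \<mu>] by blast
  then have "\<mu> k \<noteq> 0" using mu(1) by (auto simp: le_less)
  moreover have "\<mu> k * D x y c q = 0" using bspec[OF mu(2) q] unfolding split by (simp add: z)
  ultimately show ?thesis by simp
qed

text \<open>Cramer's rule yields only that the \<open>k\<close> functionals vanish on
  \<open>D x y (par w)\<close>; the assumption \<open>sep\<close> upgrades this to an honest
  intertwining relation.\<close>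

lemma good_imp_slice:
  assumes y: "y \<in> X" and g: "good y \<noteq> 0"
    and sep: "\<And>c. (\<And>a. a < k \<Longrightarrow> pairing Q (l a) (D x y c) = 0) \<Longrightarrow> \<forall>q\<in>Q. D x y c q = 0"
  shows "\<exists>w. invertible_param (par w) \<and> y = act (par w) x"
proof -
  have d: "den y \<noteq> 0" using g by (auto simp: good_def)
  define w where "w t = num y t / den y" for t
  have "pairing Q (l a) (D x y (par w)) = 0" if a: "a < k" for a
  proof -
    have "(\<Sum>s<k. \<Theta> y $$ (a, s) * w s) = (\<Sum>s<k. \<Theta> y $$ (a, s) * num y s) / den y"
      by (simp add: w_def sum_divide_distrib)
    also have "(\<Sum>s<k. \<Theta> y $$ (a, s) * num y s) = den y * - pairing Q (l a) (D x y c1)"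
      unfolding num_def den_def by (rule cramer(2)[OF Theta_carrier a])
    finally show ?thesis using pairing_D_par[OF a, of y w] d by simp
  qed
  then have z: "\<forall>q\<in>Q. D x y (par w) q = 0" by (rule sep)
  have eq: "(\<lambda>t. den y * c1 t + (\<Sum>s<k. num y s * u s t)) = (\<lambda>t. den y * par w t)"
    using d by (simp add: par_def w_def distrib_left sum_distrib_left fun_eq_iff)
  have "coord_mat N \<gamma> (\<lambda>t. den y * par w t) = den y \<cdot>\<^sub>m coord_mat N \<gamma> (par w)" for N \<gamma>
    by (rule eq_matI) auto
  then have "invertible_param (par w)" using g unfolding good_def eq by (simp add: invertible_param_def)
  then show ?thesis using act_unique[OF x y] z by blast
qed

end

section \<open>Algebraic dependence by counting monomials\<close>

text \<open>An exponent list \<open>j # js\<close> assigns the exponent \<open>j\<close> to the function with index \<open>length js\<close>, so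
  that the head of the list belongs to the last variable.\<close>

fun list_monomial :: "(nat \<Rightarrow> 't \<Rightarrow> 'a::field) \<Rightarrow> nat list \<Rightarrow> 't \<Rightarrow> 'a" where
  "list_monomial f [] t = 1"
| "list_monomial f (j # js) t = f (length js) t ^ j * list_monomial f js t"

lemma list_monomial_Nil: "list_monomial f [] = (\<lambda>_. 1)"
  and list_monomial_Cons: "list_monomial f (j # js) = (\<lambda>t. f (length js) t ^ j * list_monomial f js t)"
  by (rule ext, simp)+

definition expo :: "nat \<Rightarrow> nat \<Rightarrow> nat list set" where
  "expo k n = {xs. set xs \<subseteq> {..n} \<and> length xs = k}"

lemma finite_expo [simp]: "finite (expo k n)"
  unfolding expo_def by (rule finite_lists_length_eq) simp

lemma card_expo: "card (expo k n) = (n + 1) ^ k"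
  unfolding expo_def by (subst card_lists_length_eq) simp_all

lemma expo_0: "expo 0 n = {[]}"
  by (auto simp: expo_def)

lemma expo_Suc: "expo (Suc k) n = (\<lambda>(j, js). j # js) ` ({..n} \<times> expo k n)"
  by (auto simp: expo_def length_Suc_conv image_iff)

lemma sum_expo_Suc: "(\<Sum>xs\<in>expo (Suc k) n. F xs) = (\<Sum>j\<le>n. \<Sum>js\<in>expo k n. F (j # js))"
  unfolding expo_Suc
  by (subst sum.reindex) (auto simp: inj_on_def sum.cartesian_product split_beta)

lemma sum_list_expo_le: "xs \<in> expo k n \<Longrightarrow> sum_list xs \<le> k * n"
proof (induction k arbitrary: xs)
  case (Suc k)
  then obtain j js where "xs = j # js" "j \<le> n" "js \<in> expo k n" by (auto simp: expo_Suc)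
  then show ?case using Suc.IH[of js] by simp
qed (simp add: expo_0)

lemma mono_cong: "(\<And>i. i < length xs \<Longrightarrow> f i t = g i t') \<Longrightarrow> list_monomial f xs t = list_monomial g xs t'"
  by (induction xs) auto

lemma mono_scale: "list_monomial (\<lambda>i t. f i t * d t) xs t = list_monomial f xs t * d t ^ sum_list xs"
  by (induction xs) (simp_all add: power_mult_distrib power_add algebra_simps)

lemma (in function_algebra) mono:
  "(\<And>i. i < length xs \<Longrightarrow> f i \<in> S) \<Longrightarrow> (\<lambda>t. list_monomial f xs t) \<in> S"
proof (induction xs)
  case (Cons j js)
  then have "(\<lambda>t. f (length js) t ^ j * list_monomial f js t) \<in> S"
    by (intro mult power) simp_all
  then show ?case by (simp add: list_monomial_Cons)
qed (simp add: list_monomial_Nil)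

text \<open>Polynomials in \<open>p\<close> variables bounded by \<open>n\<close> in each variable
  separately. With this bound the monomials are counted by a plain power, and bounds add up under
  multiplication.\<close>

definition MP :: "nat \<Rightarrow> nat \<Rightarrow> ((nat \<Rightarrow> 'a::field) \<Rightarrow> 'a) set" where
  "MP p n = {g. \<exists>c. \<forall>w. g w = (\<Sum>xs\<in>expo p n. c xs * list_monomial (\<lambda>i w. w i) xs w)}"

lemma MP_mono_mem: "xs \<in> expo p n \<Longrightarrow> (\<lambda>w. list_monomial (\<lambda>i w. w i) xs w) \<in> MP p n"
  unfolding MP_def
  by (auto intro!: exI[of _ "\<lambda>ys. if ys = xs then 1 else 0"] simp: if_distrib[of "\<lambda>z. z * _"] cong: if_cong)

lemma MP_add: "f \<in> MP p n \<Longrightarrow> g \<in> MP p n \<Longrightarrow> (\<lambda>w. f w + g w) \<in> MP p n"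
proof -
  assume "f \<in> MP p n" "g \<in> MP p n"
  then obtain c d where "\<forall>w. f w = (\<Sum>xs\<in>expo p n. c xs * list_monomial (\<lambda>i w. w i) xs w)"
    "\<forall>w. g w = (\<Sum>xs\<in>expo p n. d xs * list_monomial (\<lambda>i w. w i) xs w)" unfolding MP_def by blast
  then have "\<forall>w. f w + g w = (\<Sum>xs\<in>expo p n. (c xs + d xs) * list_monomial (\<lambda>i w. w i) xs w)"
    by (simp add: distrib_right sum.distrib)
  then show ?thesis unfolding MP_def mem_Collect_eq by (rule exI[of _ "\<lambda>xs. c xs + d xs"])
qed

lemma MP_scale: "f \<in> MP p n \<Longrightarrow> (\<lambda>w. a * f w) \<in> MP p n"
proof -
  assume "f \<in> MP p n"
  then obtain c where "\<forall>w. f w = (\<Sum>xs\<in>expo p n. c xs * list_monomial (\<lambda>i w. w i) xs w)" unfolding MP_def by blast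
  then have "\<forall>w. a * f w = (\<Sum>xs\<in>expo p n. (a * c xs) * list_monomial (\<lambda>i w. w i) xs w)"
    by (simp add: sum_distrib_left mult.assoc)
  then show ?thesis unfolding MP_def mem_Collect_eq by (rule exI[of _ "\<lambda>xs. a * c xs"])
qed

lemma MP_zero: "(\<lambda>w. 0) \<in> MP p n"
  unfolding MP_def by (auto intro!: exI[of _ "\<lambda>_. 0"])

lemma MP_sum: "(\<And>s. s \<in> J \<Longrightarrow> f s \<in> MP p n) \<Longrightarrow> (\<lambda>w. \<Sum>s\<in>J. f s w) \<in> MP p n"
proof (induction J rule: infinite_finite_induct)
  case (insert s J)
  then have "(\<lambda>w. f s w + (\<Sum>s\<in>J. f s w)) \<in> MP p n" by (intro MP_add) simp_all
  with insert show ?case by simp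
qed (simp_all add: MP_zero)

lemma MP_subset: "n \<le> n' \<Longrightarrow> MP p n \<subseteq> MP p n'"
proof
  fix g assume "n \<le> n'" "g \<in> MP p n"
  then obtain c where g: "\<forall>w. g w = (\<Sum>xs\<in>expo p n. c xs * list_monomial (\<lambda>i w. w i) xs w)" unfolding MP_def by blast
  have "expo p n \<subseteq> expo p n'" using \<open>n \<le> n'\<close> by (auto simp: expo_def)
  then have "(\<lambda>w. \<Sum>xs\<in>expo p n. c xs * list_monomial (\<lambda>i w. w i) xs w) \<in> MP p n'"
    by (intro MP_sum MP_scale MP_mono_mem) auto
  then show "g \<in> MP p n'" using g by presburger
qed

lemma mono_map2:
  "length xs = length ys \<Longrightarrow> list_monomial f xs t * list_monomial f ys t = list_monomial f (map2 (+) xs ys) t"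
proof (induction xs ys rule: list_induct2)
  case (Cons x xs y ys)
  then show ?case by (simp add: power_add mult_ac)
qed simp

lemma map2_expo:
  assumes "xs \<in> expo p n" "ys \<in> expo p n'"
  shows "map2 (+) xs ys \<in> expo p (n + n')"
proof -
  have "x \<le> n" "y \<le> n'" if "(x, y) \<in> set (zip xs ys)" for x y
    using set_zip_leftD[OF that] set_zip_rightD[OF that] assms by (auto simp: expo_def)
  then show ?thesis using assms by (force simp: expo_def intro: add_mono)
qed

lemma MP_mult:
  assumes "f \<in> MP p n" "g \<in> MP p n'"
  shows "(\<lambda>w. f w * g w) \<in> MP p (n + n')"
proof -
  obtain c d where f: "\<forall>w. f w = (\<Sum>xs\<in>expo p n. c xs * list_monomial (\<lambda>i w. w i) xs w)"
    and g: "\<forall>w. g w = (\<Sum>xs\<in>expo p n'. d xs * list_monomial (\<lambda>i w. w i) xs w)"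
    using assms unfolding MP_def by blast
  have "f w * g w = (\<Sum>xs\<in>expo p n. \<Sum>ys\<in>expo p n'. (c xs * d ys) * list_monomial (\<lambda>i w. w i) (map2 (+) xs ys) w)" for w
    unfolding f[rule_format] g[rule_format] sum_product
    by (intro sum.cong refl) (simp add: mono_map2[symmetric] expo_def)
  moreover have "(\<lambda>w. \<Sum>xs\<in>expo p n. \<Sum>ys\<in>expo p n'. (c xs * d ys) * list_monomial (\<lambda>i w. w i) (map2 (+) xs ys) w) \<in> MP p (n + n')"
    by (intro MP_sum MP_scale MP_mono_mem map2_expo)
  ultimately show ?thesis by presburger
qed

lemma MP_const: "(\<lambda>w. a :: 'a::field) \<in> MP p 0"
proof -
  have "(\<lambda>w :: nat \<Rightarrow> 'a. list_monomial (\<lambda>i w. w i) (replicate p 0) w) \<in> MP p 0"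
    by (rule MP_mono_mem) (auto simp: expo_def)
  moreover have "list_monomial (\<lambda>i w. w i) (replicate p 0) = (\<lambda>w :: nat \<Rightarrow> 'a. 1)"
    by (induction p) (simp_all add: list_monomial_Nil list_monomial_Cons)
  ultimately have "(\<lambda>w. 1 :: 'a) \<in> MP p 0" by simp
  then show ?thesis using MP_scale[of "\<lambda>w. 1" p 0 a] by simp
qed

lemma MP_var:
  assumes "i < p"
  shows "(\<lambda>w. w i :: 'a::field) \<in> MP p 1"
  using assms
proof (induction p)
  case (Suc p)
  have z: "list_monomial (\<lambda>i w. w i) (replicate q 0) = (\<lambda>w :: nat \<Rightarrow> 'a. 1)" for q
    by (induction q) (simp_all add: list_monomial_Nil list_monomial_Cons)
  show ?case
  proof (cases "i = p")
    case True
    have "(\<lambda>w :: nat \<Rightarrow> 'a. list_monomial (\<lambda>i w. w i) (1 # replicate p 0) w) \<in> MP (Suc p) 1"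
      by (rule MP_mono_mem) (auto simp: expo_def)
    then show ?thesis using True by (simp add: list_monomial_Cons z)
  next
    case False
    then have "(\<lambda>w. w i :: 'a) \<in> MP p 1" using Suc by simp
    then obtain c where "\<forall>w :: nat \<Rightarrow> 'a. w i = (\<Sum>xs\<in>expo p 1. c xs * list_monomial (\<lambda>i w. w i) xs w)" unfolding MP_def by blast
    then have "(\<lambda>w. w i :: 'a) = (\<lambda>w. \<Sum>xs\<in>expo p 1. c xs * list_monomial (\<lambda>i w. w i) (0 # xs) w)" by simp
    also have "\<dots> \<in> MP (Suc p) 1"
      by (intro MP_sum MP_scale MP_mono_mem) (auto simp: expo_def)
    finally show ?thesis .
  qed
qed simp

lemma MP_power: "f \<in> MP p n \<Longrightarrow> (\<lambda>w. f w ^ j) \<in> MP p (j * n)"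
proof (induction j)
  case (Suc j)
  then show ?case using MP_mult[of f p n "\<lambda>w. f w ^ j" "j * n"] by simp
qed (simp add: MP_const)

lemma MP_mono:
  assumes "\<And>i. i < length xs \<Longrightarrow> f i \<in> MP p n"
  shows "(\<lambda>w. list_monomial f xs w) \<in> MP p (sum_list xs * n)"
  using assms
proof (induction xs)
  case (Cons j js)
  then have "(\<lambda>w. f (length js) w ^ j * list_monomial f js w) \<in> MP p (j * n + sum_list js * n)"
    by (intro MP_mult MP_power) simp_all
  then show ?case by (simp add: list_monomial_Cons add_mult_distrib)
qed (simp add: list_monomial_Nil MP_const)

definition param_polys :: "nat \<Rightarrow> ((nat \<Rightarrow> 'a::field) \<Rightarrow> 'a) set" where "param_polys p = (\<Union>n. MP p n)"

lemma function_algebra_param_polys: "function_algebra (param_polys p)"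
proof
  show "(\<lambda>_. c) \<in> param_polys p" for c unfolding param_polys_def using MP_const by blast
  fix f g :: "(nat \<Rightarrow> 'a) \<Rightarrow> 'a" assume "f \<in> param_polys p" "g \<in> param_polys p"
  then obtain n n' where n: "f \<in> MP p n" "g \<in> MP p n'" by (auto simp: param_polys_def)
  then have "f \<in> MP p (n + n')" "g \<in> MP p (n + n')"
    using MP_subset[of n "n + n'" p] MP_subset[of n' "n + n'" p] by auto
  from MP_add[OF this] show "(\<lambda>t. f t + g t) \<in> param_polys p" unfolding param_polys_def by blast
  show "(\<lambda>t. f t * g t) \<in> param_polys p" using MP_mult[OF n] unfolding param_polys_def by blast
qed

text \<open>For fixed \<open>M\<close> the left side grows like the \<open>p\<close>-th power of
  \<open>n\<close> and the right side like the \<open>k\<close>-th, so there are eventually more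
  products of \<open>k\<close> functions than monomials in \<open>p\<close> variables.\<close>

lemma counting_bound: "p < k \<Longrightarrow> \<exists>n. (M * n + 1) ^ p < (n + 1) ^ k" for M :: nat
proof -
  assume pk: "p < k"
  \<comment> \<open>This choice absorbs the constant: \<open>(M + 1) ^ p\<close> becomes
    \<open>n\<close>, which is smaller than the extra factor \<open>n + 1\<close> on the
    right.\<close>
  define n where "n = (M + 1) ^ p"
  have "(M * n + 1) ^ p \<le> ((M + 1) * (n + 1)) ^ p" by (intro power_mono) auto
  also have "\<dots> = n * (n + 1) ^ p" unfolding power_mult_distrib n_def ..
  also have "\<dots> < (n + 1) ^ Suc p" by simp
  also have "\<dots> \<le> (n + 1) ^ k" using pk by (intro power_increasing) auto
  finally show ?thesis by blast
qed

text \<open>Each power product is padded with powers of \<open>\<delta>\<close> to total degree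
  \<open>k * n\<close>. All padded products then lie in one space of polynomials that is too small
  for them, and the relation survives division of every \<open>f i\<close> by
  \<open>\<delta>\<close>.\<close>

lemma homogeneous_dependence:
  assumes "p < k" and f: "\<And>i. i < k \<Longrightarrow> f i \<in> param_polys p" and \<delta>: "\<delta> \<in> param_polys p"
  shows "\<exists>n c. (\<exists>xs\<in>expo k n. c xs \<noteq> 0) \<and>
    (\<forall>w. (\<Sum>xs\<in>expo k n. c xs * (list_monomial f xs w * \<delta> w ^ (k * n - sum_list xs))) = 0)"
proof -
  have "\<forall>i. \<exists>e. i < k \<longrightarrow> f i \<in> MP p e" using f unfolding param_polys_def by blast
  from choice[OF this] obtain e where e: "\<And>i. i < k \<Longrightarrow> f i \<in> MP p (e i)" by blast
  obtain e' where e': "\<delta> \<in> MP p e'" using \<delta> unfolding param_polys_def by blast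
  define E where "E = e' + (\<Sum>i<k. e i)"
  have E: "f i \<in> MP p E" if "i < k" for i
  proof -
    have "e i \<le> (\<Sum>i<k. e i)" using that by (intro member_le_sum) auto
    then show ?thesis using MP_subset[of "e i" E p] e[OF that] by (auto simp: E_def)
  qed
  have E': "\<delta> \<in> MP p E" using MP_subset[of e' E p] e' by (auto simp: E_def)
  obtain n where n: "(E * k * n + 1) ^ p < (n + 1) ^ k" using counting_bound[OF assms(1)] by blast
  let ?F = "\<lambda>xs w. list_monomial f xs w * \<delta> w ^ (k * n - sum_list xs)"
  have "\<exists>a. xs \<in> expo k n \<longrightarrow> (\<forall>w. ?F xs w = (\<Sum>ys\<in>expo p (E * k * n). a ys * list_monomial (\<lambda>i w. w i) ys w))" for xs
  proof (cases "xs \<in> expo k n")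
    case xs: True
    have "(\<lambda>w. list_monomial f xs w * \<delta> w ^ (k * n - sum_list xs)) \<in> MP p (sum_list xs * E + (k * n - sum_list xs) * E)"
      by (intro MP_mult MP_mono MP_power E E') (use xs in \<open>auto simp: expo_def\<close>)
    also have "sum_list xs * E + (k * n - sum_list xs) * E = E * k * n"
      using sum_list_expo_le[OF xs] by (simp add: add_mult_distrib[symmetric])
    finally show ?thesis unfolding MP_def by blast
  qed simp
  then have "\<forall>xs. \<exists>a. xs \<in> expo k n \<longrightarrow> (\<forall>w. ?F xs w = (\<Sum>ys\<in>expo p (E * k * n). a ys * list_monomial (\<lambda>i w. w i) ys w))"
    by (rule allI)
  from choice[OF this] obtain a where a: "\<And>xs w. xs \<in> expo k n \<Longrightarrow> ?F xs w = (\<Sum>ys\<in>expo p (E * k * n). a xs ys * list_monomial (\<lambda>i w. w i) ys w)"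
    by blast
  have "card (expo p (E * k * n)) < card (expo k n)" using n by (simp add: card_expo)
  from homogeneous_system[OF _ _ this, of a] obtain c where c: "\<exists>xs\<in>expo k n. c xs \<noteq> 0"
    "\<forall>ys\<in>expo p (E * k * n). (\<Sum>xs\<in>expo k n. c xs * a xs ys) = 0" by auto
  have "(\<Sum>xs\<in>expo k n. c xs * ?F xs w) = 0" for w
  proof -
    have "(\<Sum>xs\<in>expo k n. c xs * ?F xs w) = (\<Sum>xs\<in>expo k n. \<Sum>ys\<in>expo p (E * k * n). c xs * a xs ys * list_monomial (\<lambda>i w. w i) ys w)"
      by (rule sum.cong) (simp_all add: a sum_distrib_left mult.assoc)
    also have "\<dots> = (\<Sum>ys\<in>expo p (E * k * n). (\<Sum>xs\<in>expo k n. c xs * a xs ys) * list_monomial (\<lambda>i w. w i) ys w)"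
      unfolding sum_distrib_right by (rule sum.swap)
    also have "\<dots> = 0" using c(2) by simp
    finally show ?thesis .
  qed
  then show ?thesis using c(1) by blast
qed

text \<open>Strictly increasing irreducible sets give algebraically independent functions. A
  relation is read as a polynomial in the last function \<open>f k\<close>; irreducibility of the
  top set allows powers of \<open>f k\<close> to be cancelled, and restriction to \<open>Z k\<close>
  isolates the lowest coefficient, to which the induction applies.\<close>

lemma chain_independent:
  assumes irr: "\<And>i. i \<le> k \<Longrightarrow> zirr r m n (Z i)" and mono: "\<And>i. i < k \<Longrightarrow> Z i \<subseteq> Z (Suc i)"
    and f: "\<And>i. i < k \<Longrightarrow> f i \<in> poly_funs r m n" "\<And>i x. i < k \<Longrightarrow> x \<in> Z i \<Longrightarrow> f i x = 0"
      "\<And>i. i < k \<Longrightarrow> \<exists>x\<in>Z (Suc i). f i x \<noteq> 0"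
    and rel: "\<And>y. y \<in> Z k \<Longrightarrow> (\<Sum>xs\<in>expo k N. c xs * list_monomial f xs y) = 0"
    and xs: "xs \<in> expo k N"
  shows "c xs = 0"
  using assms
proof (induction k arbitrary: c xs)
  case 0
  then obtain y where "y \<in> Z 0" by (auto simp: zirr_def)
  with "0.prems"(6)[of y] "0.prems"(7) show ?case by (simp add: expo_0)
next
  case (Suc k)
  define g where "g j y = (\<Sum>js\<in>expo k N. c (j # js) * list_monomial f js y)" for j y
  have gp: "g j \<in> poly_funs r m n" for j
    unfolding g_def[abs_def]
    by (rule poly_funs.sum, rule poly_funs.mult[OF poly_funs.const], rule poly_funs.mono)
      (use Suc.prems(3) in \<open>auto simp: expo_def\<close>)
  have rel': "(\<Sum>j\<le>N. f k y ^ j * g j y) = 0" if y: "y \<in> Z (Suc k)" for y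
  proof -
    have "(\<Sum>j\<le>N. f k y ^ j * g j y) = (\<Sum>j\<le>N. \<Sum>js\<in>expo k N. c (j # js) * list_monomial f (j # js) y)"
      unfolding g_def sum_distrib_left by (intro sum.cong refl) (auto simp: expo_def algebra_simps)
    also have "\<dots> = 0" using Suc.prems(6)[OF y] by (simp add: sum_expo_Suc)
    finally show ?thesis .
  qed
  have all: "j \<le> N \<longrightarrow> (\<forall>js\<in>expo k N. c (j # js) = 0)" for j
  proof (induction j rule: less_induct)
    case (less j)
    show ?case
    proof
      assume j: "j \<le> N"
      \<comment> \<open>The relation divided by \<open>f k\<close> to the power \<open>j\<close>;
        the coefficients below \<open>j\<close> are already known to vanish.\<close>
      define h where "h y = (\<Sum>i\<in>{j..N}. f k y ^ (i - j) * g i y)" for y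
      have hp: "h \<in> poly_funs r m n"
        unfolding h_def[abs_def]
        by (rule poly_funs.sum, rule poly_funs.mult[OF poly_funs.power gp]) (use Suc.prems(3) in simp)
      have g0: "g i y = 0" if "i < j" for i y
        using less.IH[OF that] that j by (simp add: g_def)
      have fh: "f k y ^ j * h y = 0" if y: "y \<in> Z (Suc k)" for y
      proof -
        have "f k y ^ j * h y = (\<Sum>i\<in>{j..N}. f k y ^ i * g i y)"
          unfolding h_def sum_distrib_left
          by (rule sum.cong) (auto simp: mult.assoc[symmetric] power_add[symmetric])
        also have "\<dots> = (\<Sum>i\<le>N. f k y ^ i * g i y)"
          by (rule sum.mono_neutral_left) (auto simp: g0)
        finally show ?thesis using rel'[OF y] by simp
      qed
      have h0: "h y = 0" if "y \<in> Z (Suc k)" for y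
      proof (rule ccontr)
        assume "h y \<noteq> 0"
        with that have "\<exists>z\<in>Z (Suc k). h z \<noteq> 0" by (rule bexI[rotated])
        from zirrD[OF Suc.prems(1)[OF order_refl] Suc.prems(3)[OF lessI] hp Suc.prems(5)[OF lessI] this]
        obtain z where z: "z \<in> Z (Suc k)" "f k z \<noteq> 0" "h z \<noteq> 0" by (elim bexE conjE)
        then show False using fh[OF z(1)] by simp
      qed
      \<comment> \<open>Since \<open>f k\<close> vanishes on \<open>Z k\<close>, only the term
        \<open>i = j\<close> of \<open>h\<close> is left there, with exponent zero.\<close>
      have rel_j: "(\<Sum>js\<in>expo k N. c (j # js) * list_monomial f js y) = 0" if y: "y \<in> Z k" for y
      proof -
        have "h y = f k y ^ (j - j) * g j y + (\<Sum>i\<in>{Suc j..N}. f k y ^ (i - j) * g i y)"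
          unfolding h_def using j by (simp add: sum.atLeast_Suc_atMost)
        also have "(\<Sum>i\<in>{Suc j..N}. f k y ^ (i - j) * g i y) = 0"
          by (rule sum.neutral) (use Suc.prems(4)[of k y] y in auto)
        finally have "g j y = h y" by simp
        also have "\<dots> = 0" by (rule h0) (use y Suc.prems(2)[of k] in auto)
        finally show ?thesis by (simp add: g_def)
      qed
      show "\<forall>js\<in>expo k N. c (j # js) = 0"
      proof
        fix js assume js: "js \<in> expo k N"
        show "c (j # js) = 0"
        proof (rule Suc.IH[of "\<lambda>js. c (j # js)" js])
          show "zirr r m n (Z i)" if "i \<le> k" for i using Suc.prems(1)[of i] that by simp
          show "Z i \<subseteq> Z (Suc i)" if "i < k" for i using Suc.prems(2)[of i] that by simp
          show "f i \<in> poly_funs r m n" if "i < k" for i using Suc.prems(3)[of i] that by simp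
          show "f i y = 0" if "i < k" "y \<in> Z i" for i y using Suc.prems(4)[of i y] that by simp
          show "\<exists>x\<in>Z (Suc i). f i x \<noteq> 0" if "i < k" for i using Suc.prems(5)[of i] that by simp
        qed (fact rel_j, fact js)
      qed
    qed
  qed
  from Suc.prems(7) obtain j js where "xs = j # js" "j \<le> N" "js \<in> expo k N" by (auto simp: expo_Suc)
  then show ?case using all by simp
qed

section \<open>The dimension of an orbit\<close>

context orbit_slice
begin

lemma par_param_polys: "(\<lambda>w. par w a) \<in> param_polys k"
proof -
  interpret S: function_algebra "param_polys k :: ((nat \<Rightarrow> 'a) \<Rightarrow> 'a) set" by (rule function_algebra_param_polys)
  have "(\<lambda>w. w s) \<in> param_polys k" if "s < k" for s using MP_var[OF that] by (auto simp: param_polys_def)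
  then show ?thesis unfolding par_def
    by (intro S.add S.const S.sum) (rule S.mult, simp_all)
qed

text \<open>On the slice the functions are rational in only \<open>k\<close> variables.
  Multiplication by one common power of \<open>?\<delta>\<close> makes them polynomial, and the
  padding in \<open>homogeneous_dependence\<close> lets this power be divided out of the relation
  again.\<close>

lemma slice_dependent:
  assumes kK: "k < K" and f: "\<And>i. i < K \<Longrightarrow> f i \<in> poly_funs r m n"
  shows "\<exists>N c. (\<exists>xs\<in>expo K N. c xs \<noteq> 0) \<and>
    (\<forall>w. invertible_param (par w) \<longrightarrow> (\<Sum>xs\<in>expo K N. c xs * list_monomial f xs (act (par w) x)) = 0)"
proof -
  let ?S = "param_polys k :: ((nat \<Rightarrow> 'a) \<Rightarrow> 'a) set"
  interpret S: function_algebra ?S by (rule function_algebra_param_polys)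
  let ?\<delta> = "\<lambda>w. det (H2 (par w)) * det (H1 (par w))"
  have \<delta>: "?\<delta> \<in> ?S"
    by (rule S.mult; rule S.det) (rule coord_mat_carrier, simp add: par_param_polys)+
  interpret L: function_algebra "localize ?S ?\<delta>" by (rule S.function_algebra_localize[OF \<delta>])
  have "(\<lambda>w. f i (act (par w) x)) \<in> localize ?S ?\<delta>" if i: "i < K" for i
    by (rule L.poly_fun_compose[OF f[OF i]], rule act_localize(2)[OF S.function_algebra_axioms par_param_polys x])
  then have "\<forall>i. \<exists>e p. i < K \<longrightarrow> p \<in> ?S \<and> (\<forall>w. ?\<delta> w \<noteq> 0 \<longrightarrow> f i (act (par w) x) * ?\<delta> w ^ e = p w)"
    unfolding localize_def by blast
  from choice[OF this] obtain e where
    "\<forall>i. \<exists>p. i < K \<longrightarrow> p \<in> ?S \<and> (\<forall>w. ?\<delta> w \<noteq> 0 \<longrightarrow> f i (act (par w) x) * ?\<delta> w ^ e i = p w)" by (elim exE) (rule that)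
  from choice[OF this] obtain p where
    p: "\<forall>i. i < K \<longrightarrow> p i \<in> ?S \<and> (\<forall>w. ?\<delta> w \<noteq> 0 \<longrightarrow> f i (act (par w) x) * ?\<delta> w ^ e i = p i w)" by (elim exE) (rule that)
  have ep: "\<And>i. i < K \<Longrightarrow> p i \<in> ?S"
    "\<And>i w. i < K \<Longrightarrow> ?\<delta> w \<noteq> 0 \<Longrightarrow> f i (act (par w) x) * ?\<delta> w ^ e i = p i w" using p by simp_all
  define E where "E = (\<Sum>i<K. e i)"
  have eE: "e i \<le> E" if "i < K" for i unfolding E_def using that by (intro member_le_sum) auto
  define q where "q i w = p i w * ?\<delta> w ^ (E - e i)" for i w
  have qS: "q i \<in> ?S" if "i < K" for i
    unfolding q_def[abs_def] by (intro S.mult S.power ep(1)[OF that] \<delta>[THEN S.power])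
  have q: "q i w = f i (act (par w) x) * ?\<delta> w ^ E" if "i < K" "?\<delta> w \<noteq> 0" for i w
    unfolding q_def ep(2)[OF that, symmetric] mult.assoc power_add[symmetric] using eE[OF that(1)] by simp
  have "\<exists>N c. (\<exists>xs\<in>expo K N. c xs \<noteq> 0) \<and>
    (\<forall>w. (\<Sum>xs\<in>expo K N. c xs * (list_monomial q xs w * (?\<delta> w ^ E) ^ (K * N - sum_list xs))) = 0)"
    by (rule homogeneous_dependence[OF kK]) (fact qS, rule S.power[OF \<delta>])
  then obtain N c where cc: "(\<exists>xs\<in>expo K N. c xs \<noteq> 0) \<and>
    (\<forall>w. (\<Sum>xs\<in>expo K N. c xs * (list_monomial q xs w * (?\<delta> w ^ E) ^ (K * N - sum_list xs))) = 0)"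
    by (elim exE) (rule that)
  note c = conjunct1[OF cc] spec[OF conjunct2[OF cc]]
  have "(\<Sum>xs\<in>expo K N. c xs * list_monomial f xs (act (par w) x)) = 0" if w: "invertible_param (par w)" for w
  proof -
    have nz: "?\<delta> w \<noteq> 0" using w by (simp add: invertible_param_def)
    have "list_monomial q xs w * (?\<delta> w ^ E) ^ (K * N - sum_list xs) = list_monomial f xs (act (par w) x) * (?\<delta> w ^ E) ^ (K * N)"
      if xs: "xs \<in> expo K N" for xs
    proof -
      have "list_monomial q xs w = list_monomial (\<lambda>i w. f i (act (par w) x) * ?\<delta> w ^ E) xs w"
        by (rule mono_cong) (use xs q nz in \<open>auto simp: expo_def\<close>)
      also have "\<dots> = list_monomial (\<lambda>i w. f i (act (par w) x)) xs w * (?\<delta> w ^ E) ^ sum_list xs" by (rule mono_scale)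
      also have "list_monomial (\<lambda>i w. f i (act (par w) x)) xs w = list_monomial f xs (act (par w) x)" by (rule mono_cong) simp
      finally show ?thesis using sum_list_expo_le[OF xs] by (simp add: mult.assoc power_add[symmetric])
    qed
    then have "(\<Sum>xs\<in>expo K N. c xs * list_monomial f xs (act (par w) x)) * (?\<delta> w ^ E) ^ (K * N) = 0"
      using c(2)[of w] by (simp add: sum_distrib_right mult.assoc)
    then show ?thesis using nz by simp
  qed
  then show ?thesis using c(1) by (intro exI[of _ N] exI[of _ c]) simp
qed

text \<open>A relation valid on the slice holds wherever \<open>good\<close> is nonzero on the
  orbit. As the orbit is irreducible and \<open>good x\<close> is nonzero, it holds on the whole
  orbit.\<close>

lemma orbit_dependent:
  assumes kK: "k < K" and f: "\<And>i. i < K \<Longrightarrow> f i \<in> poly_funs r m n"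
  shows "\<exists>N c. (\<exists>xs\<in>expo K N. c xs \<noteq> 0) \<and> (\<forall>y\<in>orb x. (\<Sum>xs\<in>expo K N. c xs * list_monomial f xs y) = 0)"
proof -
  have "\<exists>N c. (\<exists>xs\<in>expo K N. c xs \<noteq> 0) \<and>
    (\<forall>w. invertible_param (par w) \<longrightarrow> (\<Sum>xs\<in>expo K N. c xs * list_monomial f xs (act (par w) x)) = 0)"
    by (rule slice_dependent[OF kK]) (rule f)
  then obtain N c where cc: "(\<exists>xs\<in>expo K N. c xs \<noteq> 0) \<and>
    (\<forall>w. invertible_param (par w) \<longrightarrow> (\<Sum>xs\<in>expo K N. c xs * list_monomial f xs (act (par w) x)) = 0)"
    by (elim exE) (rule that)
  note c = conjunct1[OF cc] mp[OF spec[OF conjunct2[OF cc]]]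
  let ?F = "\<lambda>y. \<Sum>xs\<in>expo K N. c xs * list_monomial f xs y"
  have F: "?F \<in> poly_funs r m n"
    by (rule poly_funs.sum, rule poly_funs.mult[OF poly_funs.const], rule poly_funs.mono)
      (use f in \<open>auto simp: expo_def\<close>)
  have "?F y = 0" if y: "y \<in> orb x" for y
  proof (rule ccontr)
    assume "?F y \<noteq> 0"
    then have "\<exists>z\<in>orb x. ?F z \<noteq> 0" using y by (rule bexI)
    moreover have "\<exists>z\<in>orb x. good z \<noteq> 0" using good_x orb_refl[OF x] by (rule bexI)
    ultimately have "\<exists>z\<in>orb x. ?F z \<noteq> 0 \<and> good z \<noteq> 0" by (rule zirrD[OF zirr_orb[OF x] F good_poly])
    then obtain z where z: "z \<in> orb x" "?F z \<noteq> 0" "good z \<noteq> 0" by (elim bexE conjE) (rule that)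
    have "den z \<noteq> 0" using z(3) by (auto simp: good_def)
    then have "\<exists>w. invertible_param (par w) \<and> z = act (par w) x"
      using good_imp_slice[of z] z orb_subset slice_separated[OF z(1)] by blast
    then obtain w where w: "invertible_param (par w)" "z = act (par w) x" by blast
    show False using c(2)[OF w(1)] z(2) w(2) by simp
  qed
  then show ?thesis using c(1) by (intro exI[of _ N] exI[of _ c]) simp
qed

text \<open>Each proper inclusion in a chain supplies a function vanishing on the smaller set but
  not on the larger. These functions are algebraically independent, and the orbit admits at most
  \<open>k\<close> such.\<close>

lemma krull_dim_orb_le: "krull_dim (subtopology (zariski r m n) (orb x)) \<le> enat k"
  unfolding krull_dim_def
proof (rule Sup_least)
  fix d assume "d \<in> {enat K |K. \<exists>Z. (\<forall>i\<le>K. closedin (subtopology (zariski r m n) (orb x)) (Z i) \<and>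
    irreducible_space (subtopology (subtopology (zariski r m n) (orb x)) (Z i))) \<and> (\<forall>i<K. Z i \<subset> Z (Suc i))}"
  then obtain K Z where d: "d = enat K"
    and cl: "\<And>i. i \<le> K \<Longrightarrow> closedin (subtopology (zariski r m n) (orb x)) (Z i)"
    and irr: "\<And>i. i \<le> K \<Longrightarrow> irreducible_space (subtopology (subtopology (zariski r m n) (orb x)) (Z i))"
    and mono: "\<And>i. i < K \<Longrightarrow> Z i \<subset> Z (Suc i)" by blast
  note clz = closedin_sub_zariski[OF orb_subset[of x]]
  have sub: "Z i \<subseteq> orb x" if "i \<le> K" for i using cl[OF that] unfolding clz by blast
  have zirr: "zirr r m n (Z i)" if "i \<le> K" for i
  proof -
    have "subtopology (subtopology (zariski r m n) (orb x)) (Z i) = subtopology (zariski r m n) (Z i)"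
      using sub[OF that] by (simp add: subtopology_subtopology Int_absorb1)
    then show ?thesis using irr[OF that] irreducible_space_iff_zirr[of "Z i" r m n] sub[OF that] orb_subset[of x] by auto
  qed
  have "\<forall>i. \<exists>f. i < K \<longrightarrow> f \<in> poly_funs r m n \<and> (\<forall>y\<in>Z i. f y = 0) \<and> (\<exists>y\<in>Z (Suc i). f y \<noteq> 0)"
  proof (intro allI)
    fix i show "\<exists>f. i < K \<longrightarrow> f \<in> poly_funs r m n \<and> (\<forall>y\<in>Z i. f y = 0) \<and> (\<exists>y\<in>Z (Suc i). f y \<noteq> 0)"
    proof (cases "i < K")
      case True
      obtain F where F: "F \<subseteq> poly_funs r m n" "Z i = {y \<in> orb x. \<forall>f\<in>F. f y = 0}"
        using cl[of i] True unfolding clz by auto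
      obtain y where y: "y \<in> Z (Suc i)" "y \<notin> Z i" using mono[OF True] by blast
      then obtain f where "f \<in> F" "f y \<noteq> 0" using F sub[of "Suc i"] True by auto
      then show ?thesis using F y by blast
    qed simp
  qed
  from choice[OF this] obtain f where
    "\<forall>i. i < K \<longrightarrow> f i \<in> poly_funs r m n \<and> (\<forall>y\<in>Z i. f i y = 0) \<and> (\<exists>y\<in>Z (Suc i). f i y \<noteq> 0)" by (elim exE) (rule that)
  then have f: "\<And>i. i < K \<Longrightarrow> f i \<in> poly_funs r m n" "\<And>i y. i < K \<Longrightarrow> y \<in> Z i \<Longrightarrow> f i y = 0"
    "\<And>i. i < K \<Longrightarrow> \<exists>y\<in>Z (Suc i). f i y \<noteq> 0" by simp_all
  have "K \<le> k"
  proof (rule ccontr)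
    assume "\<not> K \<le> k"
    then have "k < K" by simp
    then have "\<exists>N c. (\<exists>xs\<in>expo K N. c xs \<noteq> 0) \<and> (\<forall>y\<in>orb x. (\<Sum>xs\<in>expo K N. c xs * list_monomial f xs y) = 0)"
      by (rule orbit_dependent) (rule f(1))
    then obtain N c where cc: "(\<exists>xs\<in>expo K N. c xs \<noteq> 0) \<and> (\<forall>y\<in>orb x. (\<Sum>xs\<in>expo K N. c xs * list_monomial f xs y) = 0)"
      by (elim exE) (rule that)
    have "c xs = 0" if xs: "xs \<in> expo K N" for xs
    proof (rule chain_independent[where r = r and m = m and n = n and k = K and Z = Z and f = f and N = N and c = c and xs = xs])
      show "Z i \<subseteq> Z (Suc i)" if "i < K" for i using mono[OF that] by blast
      show "(\<Sum>xs\<in>expo K N. c xs * list_monomial f xs y) = 0" if "y \<in> Z K" for y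
        using cc that sub[of K] by auto
    qed (fact zirr, fact f(1), fact f(2), fact f(3), fact xs)
    then show False using cc by auto
  qed
  then show "d \<le> enat k" using d by simp
qed

text \<open>The part of the slice in which only the first \<open>i\<close> coordinates move. The
  closures of these pieces in the orbit form a chain of length \<open>k\<close>; the numerator
  \<open>num y i\<close> of a slice coordinate tells consecutive ones apart.\<close>

definition flag_piece :: "nat \<Rightarrow> 'a mat list set" where
  "flag_piece i = {act c x | c. c \<in> {par w | w. \<forall>s\<ge>i. w s = 0} \<and> invertible_param c}"

lemma par_zero: "par (\<lambda>_. 0) = c1" by (simp add: par_def)

lemma c1_invertible: "invertible_param c1" by (simp add: invertible_param_def c1)

lemma zirr_flag_piece: "zirr r m n (flag_piece i)"
  unfolding flag_piece_def
proof (rule zirr_param[OF x])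
  have "c1 \<in> {par w | w. \<forall>s\<ge>i. w s = 0}"
    using par_zero[symmetric] by blast
  then show "\<exists>c\<in>{par w | w. \<forall>s\<ge>i. w s = 0}. invertible_param c"
    using c1_invertible by blast
  fix c c' :: "nat \<Rightarrow> 'a" and t :: 'a
  assume "c \<in> {par w | w. \<forall>s\<ge>i. w s = 0}" "c' \<in> {par w | w. \<forall>s\<ge>i. w s = 0}"
  then obtain w w' where w: "c = par w" "\<forall>s\<ge>i. w s = 0" "c' = par w'" "\<forall>s\<ge>i. w' s = 0" by blast
  have "(\<lambda>a. (1 - t) * c a + t * c' a) = par (\<lambda>s. (1 - t) * w s + t * w' s)"
    unfolding w par_def by (rule ext) (simp add: algebra_simps sum.distrib sum_distrib_left sum_subtractf)
  then show "(\<lambda>a. (1 - t) * c a + t * c' a) \<in> {par w | w. \<forall>s\<ge>i. w s = 0}" using w by auto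
qed

lemma flag_piece_subset: "flag_piece i \<subseteq> orb x"
  unfolding flag_piece_def orb_act[OF x] by blast

lemma num_flag_piece:
  assumes "invertible_param (par w)" "t < k"
  shows "num (act (par w) x) t = den (act (par w) x) * w t"
  using num_slice[OF _ assms(2)] act_unique[OF x act_mem[OF x] assms(1)] by blast

lemma flag_piece_strict:
  assumes i: "i < k"
  shows "\<exists>y\<in>flag_piece (Suc i). num y i \<noteq> 0"
proof -
  let ?w = "\<lambda>\<tau> s. if s = i then \<tau> else 0 :: 'a"
  let ?c = "\<lambda>\<tau>. par (?w \<tau>)"
  have cp: "?c \<tau> a = (1 - \<tau>) * c1 a + \<tau> * (c1 a + u i a)" for \<tau> a
  proof -
    have "(\<Sum>s<k. ?w \<tau> s * u s a) = (\<Sum>s<k. if s = i then \<tau> * u i a else 0)" by (rule sum.cong) auto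
    then show ?thesis using i by (simp add: par_def algebra_simps)
  qed
  have cS: "(\<lambda>\<tau>. ?c \<tau> a) \<in> range poly" for a unfolding cp by (rule line_polys_affine)
  let ?\<delta> = "\<lambda>\<tau>. det (H2 (?c \<tau>)) * det (H1 (?c \<tau>))"
  have \<delta>: "?\<delta> \<in> range poly"
    by (rule line_polys.mult; rule line_polys.det) (rule coord_mat_carrier, simp add: cS)+
  interpret L: function_algebra "localize (range poly) ?\<delta>" by (rule line_polys.function_algebra_localize[OF \<delta>])
  have c0: "?c 0 = c1" by (simp add: par_zero)
  have d0: "?\<delta> 0 \<noteq> 0" unfolding c0 by (simp add: c1)
  have den: "(\<lambda>\<tau>. den (act (?c \<tau>) x)) \<in> localize (range poly) ?\<delta>"
    by (rule L.poly_fun_compose[OF den_poly], rule act_localize(2)[OF line_polys.function_algebra_axioms cS x])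
  have "act c1 x = x"
  proof -
    have "\<forall>q\<in>Q. D x x c1 q = 0" using Dx_c1 by blast
    then show ?thesis using act_unique[OF x x c1_invertible] by simp
  qed
  then have den0: "den (act (?c 0) x) \<noteq> 0" unfolding c0 by (simp add: den_x)
  have id: "(\<lambda>\<tau>::'a. \<tau>) \<in> range poly" using line_polys_affine[of 0 1] by simp
  have one: "(\<lambda>\<tau>::'a. 1) \<in> range poly" by (rule line_polys.const)
  \<comment> \<open>Three open conditions on the line are combined two at a time:
    \<open>\<sigma>\<close> is a nonzero invertible parameter, and \<open>\<tau>\<close> in addition
    avoids the zeros of \<open>den\<close>, which is nonzero at the parameter 0.\<close>
  obtain \<sigma> where s: "?\<delta> \<sigma> \<noteq> 0" "\<sigma> \<noteq> 0"
    using localize_line_common_nonzero[OF one line_polys.subset_localize[OF \<delta>] line_polys.subset_localize[OF id], of 0 1] d0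
    by auto
  obtain \<tau> where t: "?\<delta> \<tau> \<noteq> 0" "den (act (?c \<tau>) x) \<noteq> 0" "\<tau> \<noteq> 0"
    using localize_line_common_nonzero[OF \<delta> den line_polys.subset_localize[OF id], of 0 \<sigma>] d0 den0 s by auto
  have inv: "invertible_param (?c \<tau>)" using t(1) by (simp add: invertible_param_def)
  have "act (?c \<tau>) x \<in> flag_piece (Suc i)" unfolding flag_piece_def using inv by fastforce
  moreover have "num (act (?c \<tau>) x) i \<noteq> 0" using num_flag_piece[OF inv i] t by simp
  ultimately show ?thesis by blast
qed

lemma krull_dim_orb_ge: "enat k \<le> krull_dim (subtopology (zariski r m n) (orb x))"
  unfolding krull_dim_def
proof (rule Sup_upper, rule CollectI, rule exI[of _ k], intro conjI refl)
  let ?Z = "\<lambda>i. zcl r m n (flag_piece i) \<inter> orb x"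
  show "\<exists>Z. (\<forall>i\<le>k. closedin (subtopology (zariski r m n) (orb x)) (Z i) \<and>
    irreducible_space (subtopology (subtopology (zariski r m n) (orb x)) (Z i))) \<and> (\<forall>i<k. Z i \<subset> Z (Suc i))"
  proof (rule exI[of _ ?Z], intro conjI allI impI)
    fix i
    have sub: "flag_piece i \<subseteq> ?Z i"
      using flag_piece_subset zcl_superset[of "flag_piece i" r m n] orb_subset by blast
    have "?Z i = {y \<in> orb x. \<forall>f\<in>{f \<in> poly_funs r m n. \<forall>z\<in>flag_piece i. f z = 0}. f y = 0}"
      using orb_subset by (auto simp: zcl_def)
    then show "closedin (subtopology (zariski r m n) (orb x)) (?Z i)"
      unfolding closedin_sub_zariski[OF orb_subset] by (intro exI[of _ "{f \<in> poly_funs r m n. \<forall>z\<in>flag_piece i. f z = 0}"]) auto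
    have "zirr r m n (?Z i)" by (rule zirr_between[OF zirr_flag_piece sub]) auto
    moreover have "subtopology (subtopology (zariski r m n) (orb x)) (?Z i) = subtopology (zariski r m n) (?Z i)"
      by (simp add: subtopology_subtopology Int_absorb1)
    ultimately show "irreducible_space (subtopology (subtopology (zariski r m n) (orb x)) (?Z i))"
      using irreducible_space_iff_zirr[of "?Z i" r m n] by (auto simp: zcl_def)
  next
    fix i assume i: "i < k"
    have le: "flag_piece i \<subseteq> flag_piece (Suc i)" unfolding flag_piece_def by fastforce
    then have "?Z i \<subseteq> ?Z (Suc i)" by (auto simp: zcl_def)
    moreover obtain y where y: "y \<in> flag_piece (Suc i)" "num y i \<noteq> 0" using flag_piece_strict[OF i] by blast
    have "num z i = 0" if "z \<in> flag_piece i" for z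
      using that num_flag_piece[OF _ i] by (auto simp: flag_piece_def)
    then have "num z i = 0" if "z \<in> zcl r m n (flag_piece i)" for z
      using that bspec[OF _ num_poly[OF i]] unfolding zcl_def by auto
    then have "y \<notin> ?Z i" using y(2) by (metis IntD1)
    moreover have "y \<in> ?Z (Suc i)"
      using y flag_piece_subset zcl_superset[of "flag_piece (Suc i)" r m n] orb_subset by blast
    ultimately show "?Z i \<subset> ?Z (Suc i)" by blast
  qed
qed

text \<open>With \<open>k = card Q\<close> the functionals form a full set of coordinates, so
  vanishing pairings force \<open>D x y c = 0\<close> at every \<open>y\<close> and not only on the
  orbit. The orbit thus contains a nonempty principal open set.\<close>

lemma full_rank_open:
  assumes k: "k = card Q" and y: "y \<in> X" and g: "good y \<noteq> 0"
  shows "y \<in> orb x"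
proof -
  have "D x y c q = 0" if c: "\<And>a. a < k \<Longrightarrow> pairing Q (l a) (D x y c) = 0" and q: "q \<in> Q" for c q
  proof -
    let ?v = "\<lambda>s. if s < k then D x x (u s) else D x y c"
    have "card Q < card {..k}" using k by simp
    from homogeneous_system[OF finite_Q _ this, of ?v] obtain \<mu> where
      mu: "\<exists>s\<in>{..k}. \<mu> s \<noteq> 0" "\<forall>q\<in>Q. (\<Sum>s\<le>k. \<mu> s * ?v s q) = 0" by auto
    have split: "(\<Sum>s\<le>k. \<mu> s * ?v s q) = (\<Sum>s<k. \<mu> s * D x x (u s) q) + \<mu> k * D x y c q" for q
      by (simp add: lessThan_Suc_atMost[symmetric])
    have z: "\<mu> a = 0" if a: "a < k" for a
    proof -
      have "0 = pairing Q (l a) (\<lambda>q. (\<Sum>s<k. \<mu> s * D x x (u s) q) + \<mu> k * D x y c q)"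
        using mu(2) unfolding split by (simp add: pairing_zero)
      also have "\<dots> = (\<Sum>s<k. \<mu> s * pairing Q (l a) (D x x (u s))) + pairing Q (l a) (\<lambda>q. \<mu> k * D x y c q)"
        by (simp add: pairing_add pairing_sum)
      also have "pairing Q (l a) (\<lambda>q. \<mu> k * D x y c q) = \<mu> k * pairing Q (l a) (D x y c)"
        by (simp add: pairing_def sum_distrib_left algebra_simps)
      also have "\<dots> = 0" using c[OF a] by simp
      also have "(\<Sum>s<k. \<mu> s * pairing Q (l a) (D x x (u s))) = (\<Sum>s<k. \<mu> s * (if a = s then 1 else 0))"
        by (rule sum.cong) (use rd a in \<open>auto simp: rank_data_def biorth_def\<close>)
      also have "\<dots> = \<mu> a" using a sum_mult_delta(2)[of "{..<k}" \<mu> a] by simp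
      finally show ?thesis by simp
    qed
    then have "\<mu> k \<noteq> 0" using mu(1) by (auto simp: le_less)
    moreover have "\<mu> k * D x y c q = 0" using bspec[OF mu(2) q] unfolding split by (simp add: z)
    ultimately show ?thesis by simp
  qed
  then obtain w where "invertible_param (par w)" "y = act (par w) x"
    using good_imp_slice[OF y g] by blast
  then show ?thesis unfolding orb_act[OF x] by blast
qed

end

section \<open>Orbits of full rank and of smaller rank\<close>

context linear_action
begin

lemma orbit_slice_exists:
  assumes "x \<in> X"
  shows "\<exists>u l c1. orbit_slice r m n \<alpha> \<beta> x (rk x) u l c1"
proof -
  obtain u l where "rank_data x (rk x) u l" using rank_data_rk by blast
  moreover obtain c where "H2 c = 1\<^sub>m m" "H1 c = 1\<^sub>m n" using unit by blast
  ultimately have "orbit_slice r m n \<alpha> \<beta> x (rk x) u l c"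
    using assms by unfold_locales auto
  then show ?thesis by blast
qed

theorem krull_dim_orb:
  assumes "x \<in> X"
  shows "krull_dim (subtopology (zariski r m n) (orb x)) = enat (rk x)"
proof -
  obtain u l c where "orbit_slice r m n \<alpha> \<beta> x (rk x) u l c" using orbit_slice_exists[OF assms] by blast
  then interpret orbit_slice r m n \<alpha> \<beta> ty x "rk x" u l c .
  show ?thesis using krull_dim_orb_le krull_dim_orb_ge by (rule antisym)
qed

text \<open>Both orbits contain nonempty open subsets of an irreducible affine space, and these
  meet.\<close>

lemma full_rank_orbs_eq:
  assumes x: "x \<in> X" "rk x = card Q" and y: "y \<in> X" "rk y = card Q"
  shows "orb x = orb y"
proof -
  obtain u l c where "orbit_slice r m n \<alpha> \<beta> x (rk x) u l c" using orbit_slice_exists[OF x(1)] by blast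
  then interpret xs: orbit_slice r m n \<alpha> \<beta> ty x "rk x" u l c .
  obtain u' l' c' where "orbit_slice r m n \<alpha> \<beta> y (rk y) u' l' c'" using orbit_slice_exists[OF y(1)] by blast
  then interpret ys: orbit_slice r m n \<alpha> \<beta> ty y "rk y" u' l' c' .
  obtain z where z: "z \<in> X" "xs.good z \<noteq> 0" "ys.good z \<noteq> 0"
    using zirrD[OF zirr_mat_tuples xs.good_poly ys.good_poly] xs.good_x ys.good_x x y by blast
  have "orb z = orb x" "orb z = orb y"
    using orb_eq[OF x(1) xs.full_rank_open[OF x(2) z(1,2)]] orb_eq[OF y(1) ys.full_rank_open[OF y(2) z(1,3)]] .
  then show ?thesis by simp
qed

text \<open>The coordinate functions outnumber the parameters of the slice and hence satisfy a
  relation on the orbit. It is not identically zero on the affine space, where the coordinates are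
  algebraically independent.\<close>

lemma small_orb_not_dense:
  assumes x: "x \<in> X" and lt: "rk x < card Q"
  shows "\<exists>F\<in>poly_funs r m n. (\<forall>y\<in>orb x. F y = 0) \<and> (\<exists>y\<in>X. F y \<noteq> 0)"
proof -
  obtain u l c where "orbit_slice r m n \<alpha> \<beta> x (rk x) u l c" using orbit_slice_exists[OF x] by blast
  then interpret xs: orbit_slice r m n \<alpha> \<beta> ty x "rk x" u l c .
  let ?K = "card Q"
  obtain h where h: "bij_betw h {..<?K} Q"
    using ex_bij_betw_nat_finite[of Q] by (auto simp: atLeast0LessThan)
  define f where "f s y = (y ! fst (h s)) $$ snd (h s)" for s and y :: "'a mat list"
  have hQ: "h s \<in> Q" if "s < ?K" for s using h that by (auto simp: bij_betw_def)
  have fp: "f s \<in> poly_funs r m n" if s: "s < ?K" for s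
  proof -
    obtain i j k where "h s = (i, j, k)" "i < r" "j < m" "k < n" using hQ[OF s] by (auto simp: Q_def)
    then show ?thesis unfolding f_def[abs_def] using poly_funs.coord[of i r j m k n] by simp
  qed
  have "\<exists>N c. (\<exists>xs\<in>expo ?K N. c xs \<noteq> 0) \<and> (\<forall>y\<in>orb x. (\<Sum>xs\<in>expo ?K N. c xs * list_monomial f xs y) = 0)"
    by (rule xs.orbit_dependent[OF lt]) (rule fp)
  then obtain N c where cc: "(\<exists>xs\<in>expo ?K N. c xs \<noteq> 0) \<and> (\<forall>y\<in>orb x. (\<Sum>xs\<in>expo ?K N. c xs * list_monomial f xs y) = 0)"
    by (elim exE) (rule that)
  note c = conjunct1[OF cc] bspec[OF conjunct2[OF cc]]
  let ?F = "\<lambda>y. \<Sum>xs\<in>expo ?K N. c xs * list_monomial f xs y"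
  have F: "?F \<in> poly_funs r m n"
    by (rule poly_funs.sum, rule poly_funs.mult[OF poly_funs.const], rule poly_funs.mono)
      (use fp in \<open>auto simp: expo_def\<close>)
  \<comment> \<open>Coordinate subspaces in which only the first \<open>t\<close> coordinates are
    free: the chain that feeds \<open>chain_independent\<close>.\<close>
  define Z where "Z t = {y \<in> X. \<forall>s. t \<le> s \<and> s < ?K \<longrightarrow> f s y = 0}" for t
  have lin: "f s (map (\<lambda>i. mat m n (\<lambda>jk. a * (y ! i) $$ jk + b * (z ! i) $$ jk)) [0..<r]) = a * f s y + b * f s z"
    if s: "s < ?K" for s y z a b
    using hQ[OF s] by (auto simp: f_def Q_def)
  have irr: "zirr r m n (Z t)" for t
  proof (rule zirr_affine)
    have "replicate r (0\<^sub>m m n) \<in> Z t"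
      using hQ by (force simp: Z_def f_def Q_def intro!: mat_tuplesI)
    then show "Z t \<noteq> {}" by blast
    show "Z t \<subseteq> X" by (auto simp: Z_def)
    fix y z :: "'a mat list" and t' assume "y \<in> Z t" "z \<in> Z t"
    then show "map (\<lambda>i. mat m n (\<lambda>jk. (1 - t') * (y ! i) $$ jk + t' * (z ! i) $$ jk)) [0..<r] \<in> Z t"
      unfolding Z_def by (auto simp: lin intro!: mat_tuplesI)
  qed
  have "\<exists>y\<in>X. ?F y \<noteq> 0"
  proof (rule ccontr)
    assume "\<not> ?thesis"
    then have z: "?F y = 0" if "y \<in> X" for y using that by blast
    have nz: "\<exists>y\<in>Z (Suc s). f s y \<noteq> 0" if s: "s < ?K" for s
    proof -
      obtain i j k where q: "h s = (i, j, k)" "i < r" "j < m" "k < n" using hQ[OF s] by (auto simp: Q_def)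
      define y where "y = map (\<lambda>i'. mat m n (\<lambda>(j', k'). if (i', j', k') = h s then 1 else 0 :: 'a)) [0..<r]"
      have fy: "f s' y = (if h s' = h s then 1 else 0)" if "s' < ?K" for s'
        using hQ[OF that] by (auto simp: f_def y_def Q_def)
      have "f s' y = 0" if "Suc s \<le> s'" "s' < ?K" for s'
        using fy[OF that(2)] inj_onD[OF bij_betw_imp_inj_on[OF h], of s' s] s that by auto
      moreover have "y \<in> X" by (rule mat_tuplesI) (auto simp: y_def)
      ultimately show ?thesis using fy[OF s] by (intro bexI[of _ y]) (auto simp: Z_def)
    qed
    have "c xs = 0" if xs: "xs \<in> expo ?K N" for xs
    proof (rule chain_independent[where r = r and m = m and n = n and k = ?K and Z = Z and f = f and N = N and c = c and xs = xs])
      show "Z i \<subseteq> Z (Suc i)" for i by (auto simp: Z_def)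
      show "f i y = 0" if "i < ?K" "y \<in> Z i" for i y using that by (auto simp: Z_def)
      show "?F y = 0" if "y \<in> Z ?K" for y using that by (intro z) (auto simp: Z_def)
    qed (rule irr, fact fp, fact nz, fact xs)
    then show False using c(1) by auto
  qed
  then show ?thesis using F c(2) by (intro bexI[of _ ?F]) auto
qed

end

section \<open>Radical filtrations and level functions\<close>

lemma mult_mat_vec_index:
  assumes "A \<in> carrier_mat m n" "v \<in> carrier_vec n" "i < m"
  shows "(A *\<^sub>v v) $ i = (\<Sum>k<n. A $$ (i, k) * v $ k)"
  using assms by (simp add: scalar_prod_def atLeast0LessThan)

definition vsum :: "nat \<Rightarrow> ('i \<Rightarrow> 'a::comm_monoid_add vec) \<Rightarrow> 'i set \<Rightarrow> 'a vec" where
  "vsum d f J = vec d (\<lambda>i. \<Sum>j\<in>J. f j $ i)"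

lemma vsum_carrier [simp]: "vsum d f J \<in> carrier_vec d" and index_vsum [simp]: "i < d \<Longrightarrow> vsum d f J $ i = (\<Sum>j\<in>J. f j $ i)"
  and dim_vsum [simp]: "dim_vec (vsum d f J) = d"
  by (simp_all add: vsum_def)

lemma vsum_insert: "finite J \<Longrightarrow> j \<notin> J \<Longrightarrow> f j \<in> carrier_vec d \<Longrightarrow> vsum d f (insert j J) = f j + vsum d f J"
  by (rule eq_vecI) auto

lemma mult_mat_vsum:
  fixes A :: "'a::comm_semiring_0 mat"
  assumes A: "A \<in> carrier_mat n d" and f: "\<And>j. j \<in> J \<Longrightarrow> f j \<in> carrier_vec d"
  shows "A *\<^sub>v vsum d f J = vsum n (\<lambda>j. A *\<^sub>v f j) J"
proof (rule eq_vecI)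
  fix i assume "i < dim_vec (vsum n (\<lambda>j. A *\<^sub>v f j) J)"
  then have i: "i < n" by simp
  have "(A *\<^sub>v vsum d f J) $ i = (\<Sum>k<d. \<Sum>j\<in>J. A $$ (i, k) * f j $ k)"
    using mult_mat_vec_index[OF A vsum_carrier i] by (simp add: sum_distrib_left)
  also have "\<dots> = (\<Sum>j\<in>J. \<Sum>k<d. A $$ (i, k) * f j $ k)" by (rule sum.swap)
  also have "\<dots> = (\<Sum>j\<in>J. (A *\<^sub>v f j) $ i)"
    by (rule sum.cong) (simp_all add: mult_mat_vec_index[OF A f i])
  finally show "(A *\<^sub>v vsum d f J) $ i = vsum n (\<lambda>j. A *\<^sub>v f j) J $ i" using i by simp
qed (use A in simp)

text \<open>A concrete form of the radical powers of the module, identified with them in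
  \<open>radical_submodule_eq\<close>. One summand per arrow suffices because each
  \<open>rad r d x j\<close> is a subspace.\<close>

primrec rad :: "nat \<Rightarrow> nat \<Rightarrow> 'a::field mat list \<Rightarrow> nat \<Rightarrow> 'a vec set" where
  "rad r d x 0 = carrier_vec d"
| "rad r d x (Suc j) = {vsum d (\<lambda>a. x ! a *\<^sub>v u a) {..<r} | u. \<forall>a<r. u a \<in> rad r d x j}"

definition vec_subspace :: "nat \<Rightarrow> 'a::field vec set \<Rightarrow> bool" where
  "vec_subspace d U \<longleftrightarrow> U \<subseteq> carrier_vec d \<and> 0\<^sub>v d \<in> U \<and> (\<forall>u\<in>U. \<forall>v\<in>U. u + v \<in> U) \<and> (\<forall>c. \<forall>u\<in>U. c \<cdot>\<^sub>v u \<in> U)"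

lemma vec_subspaceD:
  assumes "vec_subspace d U"
  shows "u \<in> U \<Longrightarrow> u \<in> carrier_vec d" "0\<^sub>v d \<in> U" "u \<in> U \<Longrightarrow> v \<in> U \<Longrightarrow> u + v \<in> U" "u \<in> U \<Longrightarrow> c \<cdot>\<^sub>v u \<in> U"
  using assms unfolding vec_subspace_def by auto

lemma vec_subspace_vsum:
  assumes U: "vec_subspace d U" and f: "\<And>j. j \<in> J \<Longrightarrow> f j \<in> U"
  shows "vsum d f J \<in> U"
  using f
proof (induction J rule: infinite_finite_induct)
  case (insert j J)
  then have "f j + vsum d f J \<in> U" using vec_subspaceD(3)[OF U] by simp
  then show ?case using insert vec_subspaceD(1)[OF U] by (simp add: vsum_insert)
next
  case (infinite J)
  then have "vsum d f J = 0\<^sub>v d" by (intro eq_vecI) auto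
  then show ?case using vec_subspaceD(2)[OF U] by simp
next
  case empty
  have "vsum d f {} = 0\<^sub>v d" by (intro eq_vecI) auto
  then show ?case using vec_subspaceD(2)[OF U] by simp
qed

lemma rad_subset: "rad r d x j \<subseteq> carrier_vec d"
  by (cases j) auto

lemma rad_mult:
  assumes x: "x \<in> mat_tuples r d d" and a: "a < r" and v: "v \<in> rad r d x j"
  shows "x ! a *\<^sub>v v \<in> rad r d x (Suc j)"
proof -
  define u where "u b = (if b = a then v else 0\<^sub>v d)" for b
  have z: "0\<^sub>v d \<in> rad r d x j" for j
  proof (induction j)
    case (Suc j)
    have "0\<^sub>v d = vsum d (\<lambda>a. x ! a *\<^sub>v 0\<^sub>v d) {..<r}"
    proof (rule eq_vecI)
      fix i assume "i < dim_vec (vsum d (\<lambda>a. x ! a *\<^sub>v 0\<^sub>v d) {..<r})"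
      then have i: "i < d" by simp
      have "(x ! a *\<^sub>v 0\<^sub>v d) $ i = 0" if "a < r" for a
        using mult_mat_vec_index[OF mat_tuplesD(2)[OF x that] zero_carrier_vec i] by simp
      then show "0\<^sub>v d $ i = vsum d (\<lambda>a. x ! a *\<^sub>v 0\<^sub>v d) {..<r} $ i" using i by simp
    qed simp
    then show ?case unfolding rad.simps mem_Collect_eq using Suc
      by (intro exI[of _ "\<lambda>_. 0\<^sub>v d"]) simp
  qed simp
  have vc: "v \<in> carrier_vec d" using v rad_subset by blast
  have "x ! a *\<^sub>v v = vsum d (\<lambda>b. x ! b *\<^sub>v u b) {..<r}"
  proof (rule eq_vecI)
    fix i assume "i < dim_vec (vsum d (\<lambda>b. x ! b *\<^sub>v u b) {..<r})"
    then have i: "i < d" by simp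
    have "(x ! b *\<^sub>v u b) $ i = (if b = a then (x ! a *\<^sub>v v) $ i else 0)" if "b < r" for b
      using mult_mat_vec_index[OF mat_tuplesD(2)[OF x that] zero_carrier_vec i] by (simp add: u_def)
    then show "(x ! a *\<^sub>v v) $ i = vsum d (\<lambda>b. x ! b *\<^sub>v u b) {..<r} $ i" using i a by simp
  qed (use mat_tuplesD(2)[OF x a] in simp)
  then show ?thesis unfolding rad.simps mem_Collect_eq using v z
    by (intro exI[of _ u]) (simp add: u_def)
qed

lemma rad_subspace:
  assumes x: "x \<in> mat_tuples r d d"
  shows "vec_subspace d (rad r d x j)"
proof (induction j)
  case 0 then show ?case by (auto simp: vec_subspace_def)
next
  case (Suc j)
  show ?case unfolding vec_subspace_def
  proof (intro conjI ballI allI)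
    show "rad r d x (Suc j) \<subseteq> carrier_vec d" by (rule rad_subset)
    fix v assume "v \<in> rad r d x (Suc j)"
    then obtain u where v: "v = vsum d (\<lambda>a. x ! a *\<^sub>v u a) {..<r}" and u: "\<forall>a<r. u a \<in> rad r d x j" by auto
    have uc: "a < r \<Longrightarrow> u a \<in> carrier_vec d" for a using u rad_subset by blast
    fix w assume "w \<in> rad r d x (Suc j)"
    then obtain u' where w: "w = vsum d (\<lambda>a. x ! a *\<^sub>v u' a) {..<r}" and u': "\<forall>a<r. u' a \<in> rad r d x j" by auto
    have u'c: "a < r \<Longrightarrow> u' a \<in> carrier_vec d" for a using u' rad_subset by blast
    have "v + w = vsum d (\<lambda>a. x ! a *\<^sub>v (u a + u' a)) {..<r}"
    proof (rule eq_vecI)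
      fix i assume "i < dim_vec (vsum d (\<lambda>a. x ! a *\<^sub>v (u a + u' a)) {..<r})"
      then have i: "i < d" by simp
      have "(x ! a *\<^sub>v (u a + u' a)) $ i = (x ! a *\<^sub>v u a) $ i + (x ! a *\<^sub>v u' a) $ i" if "a < r" for a
        using mult_add_distrib_mat_vec[OF mat_tuplesD(2)[OF x that] uc[OF that] u'c[OF that]] i mat_tuplesD(2)[OF x that] by simp
      then show "(v + w) $ i = vsum d (\<lambda>a. x ! a *\<^sub>v (u a + u' a)) {..<r} $ i"
        using i by (simp add: v w sum.distrib)
    qed (simp add: v w)
    moreover have "\<forall>a<r. u a + u' a \<in> rad r d x j" using u u' vec_subspaceD(3)[OF Suc] by blast
    ultimately show "v + w \<in> rad r d x (Suc j)" unfolding rad.simps mem_Collect_eq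
      by (intro exI[of _ "\<lambda>a. u a + u' a"]) simp
  next
    fix c v assume "v \<in> rad r d x (Suc j)"
    then obtain u where v: "v = vsum d (\<lambda>a. x ! a *\<^sub>v u a) {..<r}" and u: "\<forall>a<r. u a \<in> rad r d x j" by auto
    have uc: "a < r \<Longrightarrow> u a \<in> carrier_vec d" for a using u rad_subset by blast
    have "c \<cdot>\<^sub>v v = vsum d (\<lambda>a. x ! a *\<^sub>v (c \<cdot>\<^sub>v u a)) {..<r}"
    proof (rule eq_vecI)
      fix i assume "i < dim_vec (vsum d (\<lambda>a. x ! a *\<^sub>v (c \<cdot>\<^sub>v u a)) {..<r})"
      then have i: "i < d" by simp
      have "(x ! a *\<^sub>v (c \<cdot>\<^sub>v u a)) $ i = c * (x ! a *\<^sub>v u a) $ i" if "a < r" for a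
        using mult_mat_vec[OF mat_tuplesD(2)[OF x that] uc[OF that]] i mat_tuplesD(2)[OF x that] by simp
      then show "(c \<cdot>\<^sub>v v) $ i = vsum d (\<lambda>a. x ! a *\<^sub>v (c \<cdot>\<^sub>v u a)) {..<r} $ i"
        using i by (simp add: v sum_distrib_left)
    qed (simp add: v)
    moreover have "\<forall>a<r. c \<cdot>\<^sub>v u a \<in> rad r d x j" using u vec_subspaceD(4)[OF Suc] by blast
    ultimately show "c \<cdot>\<^sub>v v \<in> rad r d x (Suc j)" unfolding rad.simps mem_Collect_eq
      by (intro exI[of _ "\<lambda>a. c \<cdot>\<^sub>v u a"]) simp
  next
    have "0\<^sub>v d \<in> rad r d x (Suc j)"
    proof (cases "r = 0")
      case True
      have "0\<^sub>v d = vsum d (\<lambda>a. x ! a *\<^sub>v 0\<^sub>v d) {..<r}" by (rule eq_vecI) (simp_all add: True)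
      then show ?thesis unfolding rad.simps mem_Collect_eq using True by (intro exI[of _ "\<lambda>_. 0\<^sub>v d"]) simp
    next
      case False
      have "x ! 0 *\<^sub>v 0\<^sub>v d = 0\<^sub>v d"
      proof (rule eq_vecI)
        fix i assume "i < dim_vec (0\<^sub>v d :: 'a vec)"
        then show "(x ! 0 *\<^sub>v 0\<^sub>v d) $ i = 0\<^sub>v d $ i"
          using mult_mat_vec_index[OF mat_tuplesD(2)[OF x] zero_carrier_vec, of 0 i] False by simp
      qed (use mat_tuplesD(2)[OF x, of 0] False in simp)
      then show ?thesis using rad_mult[OF x, of 0 "0\<^sub>v d" j] vec_subspaceD(2)[OF Suc] False by simp
    qed
    then show "0\<^sub>v d \<in> rad r d x (Suc j)" .
  qed
qed

lemma rad_Suc_subset: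
  assumes x: "x \<in> mat_tuples r d d"
  shows "rad r d x (Suc j) \<subseteq> rad r d x j"
proof (induction j)
  case 0 show ?case unfolding rad.simps(1) by (rule rad_subset)
next
  case (Suc j)
  show ?case
  proof
    fix v assume "v \<in> rad r d x (Suc (Suc j))"
    then obtain u where v: "v = vsum d (\<lambda>a. x ! a *\<^sub>v u a) {..<r}" and u: "\<forall>a<r. u a \<in> rad r d x (Suc j)"
      unfolding rad.simps(2)[of r d x "Suc j"] by blast
    then show "v \<in> rad r d x (Suc j)" using Suc unfolding rad.simps(2)[of r d x j] by blast
  qed
qed

lemma rad_antimono: "x \<in> mat_tuples r d d \<Longrightarrow> i \<le> j \<Longrightarrow> rad r d x j \<subseteq> rad r d x i"
  by (rule lift_Suc_antimono_le[of "rad r d x"]) (rule rad_Suc_subset)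

lemma rad_hom:
  assumes x: "x \<in> mat_tuples r d d" and y: "y \<in> mat_tuples r d d" and g: "g \<in> carrier_mat d d"
    and int: "\<And>a. a < r \<Longrightarrow> g * x ! a = y ! a * g"
    and v: "v \<in> rad r d x j"
  shows "g *\<^sub>v v \<in> rad r d y j"
  using v
proof (induction j arbitrary: v)
  case 0 then show ?case using g by simp
next
  case (Suc j)
  then obtain u where v: "v = vsum d (\<lambda>a. x ! a *\<^sub>v u a) {..<r}" and u: "\<forall>a<r. u a \<in> rad r d x j" by auto
  have uc: "a < r \<Longrightarrow> u a \<in> carrier_vec d" for a using u rad_subset by blast
  have "g *\<^sub>v v = vsum d (\<lambda>a. g *\<^sub>v (x ! a *\<^sub>v u a)) {..<r}"
    unfolding v by (rule mult_mat_vsum[OF g]) (rule mult_mat_vec_carrier[OF mat_tuplesD(2)[OF x] uc]; simp)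
  also have "\<dots> = vsum d (\<lambda>a. y ! a *\<^sub>v (g *\<^sub>v u a)) {..<r}"
  proof (rule eq_vecI)
    fix i assume "i < dim_vec (vsum d (\<lambda>a. y ! a *\<^sub>v (g *\<^sub>v u a)) {..<r})"
    then have i: "i < d" by simp
    have "g *\<^sub>v (x ! a *\<^sub>v u a) = y ! a *\<^sub>v (g *\<^sub>v u a)" if a: "a < r" for a
      using assoc_mult_mat_vec[OF g mat_tuplesD(2)[OF x a] uc[OF a]]
        assoc_mult_mat_vec[OF mat_tuplesD(2)[OF y a] g uc[OF a]] int[OF a] by simp
    then show "vsum d (\<lambda>a. g *\<^sub>v (x ! a *\<^sub>v u a)) {..<r} $ i = vsum d (\<lambda>a. y ! a *\<^sub>v (g *\<^sub>v u a)) {..<r} $ i"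
      using i by simp
  qed simp
  finally have "g *\<^sub>v v = vsum d (\<lambda>a. y ! a *\<^sub>v (g *\<^sub>v u a)) {..<r}" .
  moreover have "\<forall>a<r. g *\<^sub>v u a \<in> rad r d y j" using u Suc.IH by blast
  ultimately show ?case unfolding rad.simps(2) mem_Collect_eq by (intro exI[of _ "\<lambda>a. g *\<^sub>v u a"]) simp
qed

definition inverse_mats :: "nat \<Rightarrow> 'a::field mat \<Rightarrow> 'a mat \<Rightarrow> bool" where
  "inverse_mats d g h \<longleftrightarrow> g \<in> carrier_mat d d \<and> h \<in> carrier_mat d d \<and> g * h = 1\<^sub>m d \<and> h * g = 1\<^sub>m d"

lemma inverse_mats_sym: "inverse_mats d g h \<Longrightarrow> inverse_mats d h g"
  by (auto simp: inverse_mats_def)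

lemma inverse_mats_vec:
  assumes "inverse_mats d g h" "v \<in> carrier_vec d"
  shows "g *\<^sub>v (h *\<^sub>v v) = v"
  using assms assoc_mult_mat_vec[of g d d h d v] by (simp add: inverse_mats_def)

lemma rad_conj:
  assumes x: "x \<in> mat_tuples r d d" and y: "y \<in> mat_tuples r d d" and gh: "inverse_mats d g h"
    and int: "\<And>a. a < r \<Longrightarrow> g * x ! a = y ! a * g"
  shows "rad r d y j = (*\<^sub>v) g ` rad r d x j"
proof
  have g: "g \<in> carrier_mat d d" and h: "h \<in> carrier_mat d d" and 1: "g * h = 1\<^sub>m d" "h * g = 1\<^sub>m d"
    using gh by (auto simp: inverse_mats_def)
  show "(*\<^sub>v) g ` rad r d x j \<subseteq> rad r d y j" using rad_hom[OF x y g int] by blast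
  have int': "h * y ! a = x ! a * h" if a: "a < r" for a
  proof -
    note xa = mat_tuplesD(2)[OF x a] and ya = mat_tuplesD(2)[OF y a]
    have "h * y ! a = h * (y ! a * g * h)" using ya g h 1 by (simp add: assoc_mult_mat[of _ d d _ d _ d])
    also have "\<dots> = h * (g * x ! a * h)" using int[OF a] by simp
    also have "\<dots> = (h * g) * (x ! a * h)" using xa g h by (simp add: assoc_mult_mat[of _ d d _ d _ d])
    also have "\<dots> = x ! a * h" using xa h 1 by simp
    finally show ?thesis .
  qed
  show "rad r d y j \<subseteq> (*\<^sub>v) g ` rad r d x j"
  proof
    fix v assume v: "v \<in> rad r d y j"
    have "h *\<^sub>v v \<in> rad r d x j" by (intro rad_hom[OF y x h] int' v)
    moreover have "v = g *\<^sub>v (h *\<^sub>v v)" using inverse_mats_vec[OF gh] v rad_subset by fastforce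
    ultimately show "v \<in> (*\<^sub>v) g ` rad r d x j" by blast
  qed
qed

text \<open>The coordinate model of a radical filtration: \<open>lv i\<close> is the deepest term of
  the flag that contains the \<open>i\<close>-th unit vector.\<close>

definition lvl_space :: "nat \<Rightarrow> (nat \<Rightarrow> nat) \<Rightarrow> nat \<Rightarrow> 'a::field vec set" where
  "lvl_space d lv j = {v \<in> carrier_vec d. \<forall>i<d. v $ i \<noteq> 0 \<longrightarrow> j \<le> lv i}"

definition lvl_tuples :: "nat \<Rightarrow> nat \<Rightarrow> (nat \<Rightarrow> nat) \<Rightarrow> 'a::field mat list set" where
  "lvl_tuples r d lv = {x \<in> mat_tuples r d d. \<forall>a<r. \<forall>i<d. \<forall>k<d. (x ! a) $$ (i, k) \<noteq> 0 \<longrightarrow> lv k < lv i}"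

lemma lvl_space_subspace: "vec_subspace d (lvl_space d lv j)"
  unfolding vec_subspace_def lvl_space_def by auto

lemma unit_vec_lvl_space: "i < d \<Longrightarrow> j \<le> lv i \<Longrightarrow> unit_vec d i \<in> lvl_space d lv j"
  by (auto simp: lvl_space_def unit_vec_def)

lemma rad_lvl_tuples:
  assumes x: "x \<in> lvl_tuples r d lv"
  shows "rad r d x j \<subseteq> lvl_space d lv j"
proof (induction j)
  case 0 then show ?case by (auto simp: lvl_space_def)
next
  case (Suc j)
  show ?case
  proof
    fix v assume "v \<in> rad r d x (Suc j)"
    then obtain u where v: "v = vsum d (\<lambda>a. x ! a *\<^sub>v u a) {..<r}" and u: "\<forall>a<r. u a \<in> rad r d x j" by auto
    have xm: "x \<in> mat_tuples r d d" using x by (simp add: lvl_tuples_def)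
    have "x ! a *\<^sub>v u a \<in> lvl_space d lv (Suc j)" if a: "a < r" for a
    proof -
      have ua: "u a \<in> lvl_space d lv j" using u a Suc by blast
      then have uc: "u a \<in> carrier_vec d" by (simp add: lvl_space_def)
      have "Suc j \<le> lv i" if i: "i < d" and nz: "(x ! a *\<^sub>v u a) $ i \<noteq> 0" for i
      proof -
        obtain k where "k < d" "(x ! a) $$ (i, k) * u a $ k \<noteq> 0"
          using nz unfolding mult_mat_vec_index[OF mat_tuplesD(2)[OF xm a] uc i]
          by (meson lessThan_iff sum.neutral)
        then have "lv k < lv i" "j \<le> lv k" using x ua a i by (auto simp: lvl_tuples_def lvl_space_def)
        then show ?thesis by simp
      qed
      then show ?thesis using mat_tuplesD(2)[OF xm a] uc by (auto simp: lvl_space_def)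
    qed
    then show "v \<in> lvl_space d lv (Suc j)"
      unfolding v by (intro vec_subspace_vsum[OF lvl_space_subspace]) simp
  qed
qed

lemma mat_eq_zeroI:
  fixes A :: "'a::field mat"
  assumes A: "A \<in> carrier_mat d d" and z: "\<And>v. v \<in> carrier_vec d \<Longrightarrow> A *\<^sub>v v = 0\<^sub>v d"
  shows "A = 0\<^sub>m d d"
proof (rule eq_matI)
  fix i j assume ij: "i < dim_row (0\<^sub>m d d :: 'a mat)" "j < dim_col (0\<^sub>m d d :: 'a mat)"
  then have "A $$ (i, j) = (A *\<^sub>v unit_vec d j) $ i"
    using A by (simp add: scalar_prod_right_unit)
  then show "A $$ (i, j) = 0\<^sub>m d d $$ (i, j)" using z[of "unit_vec d j"] ij by simp
qed (use A in auto)

lemma word_mat_carrier: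
  "x \<in> mat_tuples r d d \<Longrightarrow> set w \<subseteq> {..<r} \<Longrightarrow> word_mat d x w \<in> carrier_mat d d"
  by (induction w) (auto simp: word_mat_def intro: mult_carrier_mat mat_tuplesD(2))

lemma word_mat_Cons: "word_mat d x (a # w) = x ! a * word_mat d x w"
  by (simp add: word_mat_def)

lemma word_mat_Nil: "word_mat d x [] = 1\<^sub>m d"
  by (simp add: word_mat_def)

lemma word_mat_append:
  assumes x: "x \<in> mat_tuples r d d" and "set w \<subseteq> {..<r}" "set w' \<subseteq> {..<r}"
  shows "word_mat d x (w @ w') = word_mat d x w * word_mat d x w'"
  using assms(2)
proof (induction w)
  case Nil then show ?case using word_mat_carrier[OF x assms(3)] by (simp add: word_mat_Nil)
next
  case (Cons a w)
  then show ?case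
    using assoc_mult_mat[OF mat_tuplesD(2)[OF x, of a] word_mat_carrier[OF x, of w] word_mat_carrier[OF x assms(3)]]
    by (simp add: word_mat_Cons)
qed

lemma word_mat_rad:
  assumes x: "x \<in> mat_tuples r d d" and "set w \<subseteq> {..<r}" "v \<in> rad r d x j"
  shows "word_mat d x w *\<^sub>v v \<in> rad r d x (length w + j)"
  using assms(2)
proof (induction w)
  case Nil then show ?case using assms(3) rad_subset[of r d x j] by (auto simp: word_mat_Nil)
next
  case (Cons a w)
  have "word_mat d x (a # w) *\<^sub>v v = x ! a *\<^sub>v (word_mat d x w *\<^sub>v v)"
    unfolding word_mat_Cons
    by (rule assoc_mult_mat_vec[of _ d d _ d]) (use Cons assms(3) rad_subset[of r d x j] in \<open>auto intro: mat_tuplesD(2)[OF x] word_mat_carrier[OF x]\<close>)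
  then show ?case using rad_mult[OF x _ Cons.IH] Cons.prems by simp
qed

lemma Rep_iff_rad:
  assumes x: "x \<in> mat_tuples r d d"
  shows "x \<in> Rep r L d \<longleftrightarrow> rad r d x (L + 1) = {0\<^sub>v d}"
proof
  assume "rad r d x (L + 1) = {0\<^sub>v d}"
  then have "word_mat d x w = 0\<^sub>m d d" if "length w = L + 1" "set w \<subseteq> {..<r}" for w
    using word_mat_rad[OF x that(2), of _ 0] that(1) by (intro mat_eq_zeroI word_mat_carrier[OF x that(2)]) auto
  then show "x \<in> Rep r L d" using x by (simp add: Rep_def)
next
  assume xR: "x \<in> Rep r L d"
  \<comment> \<open>Word length is traded for radical depth: an arrow is stripped from the vector
    and appended to the word, which keeps \<open>length w + j\<close> constant until the word has
    length \<open>L + 1\<close>.\<close>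
  have *: "word_mat d x w *\<^sub>v v = 0\<^sub>v d" if "v \<in> rad r d x j" "length w + j = L + 1" "set w \<subseteq> {..<r}" for v w j
    using that
  proof (induction j arbitrary: v w)
    case 0
    then have "word_mat d x w = 0\<^sub>m d d" using xR by (simp add: Rep_def)
    then show ?case using 0 by (auto intro!: eq_vecI simp: scalar_prod_def)
  next
    case (Suc j)
    then obtain u where v: "v = vsum d (\<lambda>a. x ! a *\<^sub>v u a) {..<r}" and u: "\<forall>a<r. u a \<in> rad r d x j" by auto
    have uc: "a < r \<Longrightarrow> u a \<in> carrier_vec d" for a using u rad_subset by blast
    note wc = word_mat_carrier[OF x Suc.prems(3)]
    have "word_mat d x w *\<^sub>v v = vsum d (\<lambda>a. word_mat d x w *\<^sub>v (x ! a *\<^sub>v u a)) {..<r}"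
      unfolding v by (rule mult_mat_vsum[OF wc]) (rule mult_mat_vec_carrier[OF mat_tuplesD(2)[OF x] uc]; simp)
    also have "\<dots> = 0\<^sub>v d"
    proof (rule eq_vecI)
      fix i assume "i < dim_vec (0\<^sub>v d :: 'a vec)"
      then have i: "i < d" by simp
      have "word_mat d x w *\<^sub>v (x ! a *\<^sub>v u a) = 0\<^sub>v d" if a: "a < r" for a
      proof -
        have xa: "word_mat d x [a] = x ! a" using mat_tuplesD(2)[OF x a] by (simp add: word_mat_Cons word_mat_Nil)
        have "word_mat d x w *\<^sub>v (x ! a *\<^sub>v u a) = word_mat d x (w @ [a]) *\<^sub>v u a"
          using word_mat_append[OF x Suc.prems(3), of "[a]"] a assoc_mult_mat_vec[OF wc mat_tuplesD(2)[OF x a] uc[OF a]]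
          by (simp add: xa)
        also have "\<dots> = 0\<^sub>v d" by (rule Suc.IH) (use u a Suc.prems in auto)
        finally show ?thesis .
      qed
      then show "vsum d (\<lambda>a. word_mat d x w *\<^sub>v (x ! a *\<^sub>v u a)) {..<r} $ i = 0\<^sub>v d $ i" using i by simp
    qed simp
    finally show ?case .
  qed
  have "v = 0\<^sub>v d" if v: "v \<in> rad r d x (L + 1)" for v
  proof -
    have "v \<in> carrier_vec d" using v rad_subset by blast
    then show ?thesis using *[OF v, of "[]"] by (simp add: word_mat_Nil)
  qed
  then show "rad r d x (L + 1) = {0\<^sub>v d}" using vec_subspaceD(2)[OF rad_subspace[OF x]] by blast
qed

lemma lvl_tuples_Rep:
  assumes x: "x \<in> lvl_tuples r d lv" and lv: "\<And>i. i < d \<Longrightarrow> lv i \<le> L"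
  shows "x \<in> Rep r L d"
proof -
  have xm: "x \<in> mat_tuples r d d" using x by (simp add: lvl_tuples_def)
  have "v = 0\<^sub>v d" if "v \<in> rad r d x (L + 1)" for v
  proof -
    have v: "v \<in> lvl_space d lv (L + 1)" using subsetD[OF rad_lvl_tuples[OF x] that] .
    show ?thesis
    proof (rule eq_vecI)
      fix i assume "i < dim_vec (0\<^sub>v d :: 'a vec)"
      then show "v $ i = 0\<^sub>v d $ i" using v lv[of i] by (auto simp: lvl_space_def)
    qed (use v in \<open>simp add: lvl_space_def\<close>)
  qed
  then show ?thesis using Rep_iff_rad[OF xm] vec_subspaceD(2)[OF rad_subspace[OF xm]] by blast
qed

lemma Rep_conj:
  assumes x: "x \<in> Rep r L d" and y: "y \<in> mat_tuples r d d" and gh: "inverse_mats d g h"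
    and int: "\<And>a. a < r \<Longrightarrow> g * x ! a = y ! a * g"
  shows "y \<in> Rep r L d"
proof -
  have xm: "x \<in> mat_tuples r d d" using x by (simp add: Rep_def)
  have "g *\<^sub>v 0\<^sub>v d = 0\<^sub>v d"
    using gh by (intro eq_vecI) (auto simp: inverse_mats_def scalar_prod_def)
  then show ?thesis
    using x rad_conj[OF xm y gh int, of "L + 1"] unfolding Rep_iff_rad[OF xm] Rep_iff_rad[OF y] by simp
qed

section \<open>Adapted bases\<close>

definition adapted :: "nat \<Rightarrow> nat \<Rightarrow> 'a::field mat list \<Rightarrow> (nat \<Rightarrow> nat) \<Rightarrow> 'a mat \<Rightarrow> 'a mat \<Rightarrow> bool" where
  "adapted r d x lv g h \<longleftrightarrow> inverse_mats d g h \<and> (\<forall>j. rad r d x j = (*\<^sub>v) g ` lvl_space d lv j)"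

lemma vec_combination:
  assumes "\<And>i. i \<in> J \<Longrightarrow> f i \<in> carrier_vec d" "v \<in> carrier_vec d"
    "\<And>q. q < d \<Longrightarrow> v $ q = (\<Sum>i\<in>J. c i * f i $ q)"
  shows "v = vsum d (\<lambda>i. c i \<cdot>\<^sub>v f i) J"
proof (rule eq_vecI)
  fix q assume "q < dim_vec (vsum d (\<lambda>i. c i \<cdot>\<^sub>v f i) J)"
  then have q: "q < d" by simp
  have "(c i \<cdot>\<^sub>v f i) $ q = c i * f i $ q" if "i \<in> J" for i using assms(1)[OF that] q by simp
  then show "v $ q = vsum d (\<lambda>i. c i \<cdot>\<^sub>v f i) J $ q" using assms(3)[OF q] q by simp
qed (use assms(2) in simp)

text \<open>Descending induction along the radical powers: a basis of one power is extended inside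
  the next larger one, and the new members receive the level of that power.\<close>

lemma adapted_exists:
  assumes xR: "x \<in> Rep r L d"
  shows "\<exists>lv g h. adapted r d x lv g h \<and> (\<forall>i<d. lv i \<le> L)"
proof -
  have x: "x \<in> mat_tuples r d d" using xR by (simp add: Rep_def)
  let ?I = "{..<d}"
  let ?G = "\<lambda>j. (\<lambda>v i. v $ i) ` rad r d x j"
  \<comment> \<open>\<open>?P j\<close> describes a basis of the \<open>j\<close>-th radical power
    that is compatible with all deeper powers: the members of level at least \<open>j'\<close> span
    the \<open>j'\<close>-th one. Vectors are replaced by their coordinate functions to fit
    \<open>biorth\<close>.\<close>
  let ?P = "\<lambda>j k b l lvl. biorth ?I k b l \<and> (\<forall>i<k. lvl i \<le> L \<and> j \<le> lvl i \<and> b i \<in> ?G (lvl i)) \<and>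
    (\<forall>j'\<ge>j. \<forall>v\<in>?G j'. \<exists>c. \<forall>q\<in>?I. v q = (\<Sum>i\<in>{i. i < k \<and> j' \<le> lvl i}. c i * b i q))"
  have base: "\<exists>k b l lvl. ?P (L + 1) k b l lvl"
  proof -
    have "v q = 0" if "L + 1 \<le> j'" "v \<in> ?G j'" "q \<in> ?I" for j' v q
      using that rad_antimono[OF x that(1)] xR unfolding Rep_iff_rad[OF x] by auto
    then have "?P (L + 1) 0 (\<lambda>_ _. 0) (\<lambda>_ _. 0) (\<lambda>_. 0)" by (simp add: biorth_def)
    then show ?thesis by (intro exI)
  qed
  have step: "\<exists>k b l lvl. ?P j k b l lvl" if IH: "\<exists>k b l lvl. ?P (Suc j) k b l lvl" and j: "j \<le> L" for j
  proof -
    obtain k b l lvl where P: "?P (Suc j) k b l lvl" using IH by (elim exE) (rule that)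
    have b: "biorth ?I k b l" and lvl: "\<And>i. i < k \<Longrightarrow> lvl i \<le> L \<and> Suc j \<le> lvl i \<and> b i \<in> ?G (lvl i)"
      and sp: "\<And>j' v. Suc j \<le> j' \<Longrightarrow> v \<in> ?G j' \<Longrightarrow> \<exists>c. \<forall>q\<in>?I. v q = (\<Sum>i\<in>{i. i < k \<and> j' \<le> lvl i}. c i * b i q)"
    proof -
      show "biorth ?I k b l" using conjunct1[OF P] .
      show "lvl i \<le> L \<and> Suc j \<le> lvl i \<and> b i \<in> ?G (lvl i)" if "i < k" for i
        using conjunct1[OF conjunct2[OF P]] that by blast
      show "\<exists>c. \<forall>q\<in>?I. v q = (\<Sum>i\<in>{i. i < k \<and> j' \<le> lvl i}. c i * b i q)"
        if "Suc j \<le> j'" "v \<in> ?G j'" for j' v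
        by (rule bspec[OF mp[OF spec[OF conjunct2[OF conjunct2[OF P]]] that(1)] that(2)])
    qed
    have "b i \<in> ?G j" if "i < k" for i
      using lvl[OF that] rad_antimono[OF x, of j "lvl i"] by auto
    with biorth_extend[OF finite_lessThan b] have "\<exists>k' b' l'. k \<le> k' \<and> (\<forall>i<k. b' i = b i) \<and> (\<forall>i<k'. b' i \<in> ?G j) \<and>
      biorth ?I k' b' l' \<and> (\<forall>v\<in>?G j. \<forall>q\<in>?I. v q = (\<Sum>i<k'. pairing ?I (l' i) v * b' i q))" by this
    then obtain k' b' l' where ext: "k \<le> k' \<and> (\<forall>i<k. b' i = b i) \<and> (\<forall>i<k'. b' i \<in> ?G j) \<and>
      biorth ?I k' b' l' \<and> (\<forall>v\<in>?G j. \<forall>q\<in>?I. v q = (\<Sum>i<k'. pairing ?I (l' i) v * b' i q))"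
      by (elim exE) (rule that)
    define lvl' where "lvl' i = (if i < k then lvl i else j)" for i
    have "?P j k' b' l' lvl'"
    proof (intro conjI allI impI ballI)
      show "biorth ?I k' b' l'" using ext by simp
      fix i assume i: "i < k'"
      show "lvl' i \<le> L" "j \<le> lvl' i" using lvl[of i] j by (auto simp: lvl'_def)
      show "b' i \<in> ?G (lvl' i)"
      proof (cases "i < k")
        case True then show ?thesis using ext lvl[OF True] by (simp add: lvl'_def)
      next
        case False then show ?thesis using ext i by (simp add: lvl'_def)
      qed
    next
      fix j' v assume j': "j \<le> j'" and v: "v \<in> ?G j'"
      show "\<exists>c. \<forall>q\<in>?I. v q = (\<Sum>i\<in>{i. i < k' \<and> j' \<le> lvl' i}. c i * b' i q)"
      proof (cases "j' = j")
        case True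
        have "j \<le> lvl i" if "i < k" for i using lvl[OF that] by simp
        then have "{i. i < k' \<and> j' \<le> lvl' i} = {..<k'}" using True by (auto simp: lvl'_def)
        moreover have "\<forall>q\<in>?I. v q = (\<Sum>i<k'. pairing ?I (l' i) v * b' i q)"
          by (rule bspec[OF conjunct2[OF conjunct2[OF conjunct2[OF conjunct2[OF ext]]]]]) (use v True in simp)
        ultimately show ?thesis using True by (intro exI[of _ "\<lambda>i. pairing ?I (l' i) v"]) simp
      next
        case False
        then have le: "Suc j \<le> j'" using j' by simp
        have eq: "{i. i < k' \<and> j' \<le> lvl' i} = {i. i < k \<and> j' \<le> lvl i}" using le ext by (auto simp: lvl'_def)
        obtain c where c: "\<forall>q\<in>?I. v q = (\<Sum>i\<in>{i. i < k \<and> j' \<le> lvl i}. c i * b i q)"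
          using sp[OF le v] by (elim exE) (rule that)
        have "(\<Sum>i\<in>{i. i < k \<and> j' \<le> lvl i}. c i * b i q) = (\<Sum>i\<in>{i. i < k \<and> j' \<le> lvl i}. c i * b' i q)" for q
          by (rule sum.cong) (use ext in auto)
        then show ?thesis unfolding eq using c by (intro exI[of _ c]) simp
      qed
    qed
    then show ?thesis by (rule_tac exI[of _ k'], rule_tac exI[of _ b'], rule_tac exI[of _ l'], rule_tac exI[of _ lvl'])
  qed
  have "\<exists>k b l lvl. ?P 0 k b l lvl"
  proof (rule inc_induct[of 0 "L + 1"])
    show "0 \<le> L + 1" by simp
    show "\<exists>k b l lvl. ?P (L + 1) k b l lvl" by (rule base)
    show "\<exists>k b l lvl. ?P j k b l lvl" if "j < L + 1" "\<exists>k b l lvl. ?P (Suc j) k b l lvl" for j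
      by (rule step[OF that(2)]) (use that(1) in simp)
  qed
  then obtain k b l lvl where P: "?P 0 k b l lvl" by (elim exE) (rule that)
  have b: "biorth ?I k b l" and lvl: "\<And>i. i < k \<Longrightarrow> lvl i \<le> L" and bG: "\<And>i. i < k \<Longrightarrow> b i \<in> ?G (lvl i)"
    and sp: "\<And>j v. v \<in> ?G j \<Longrightarrow> \<exists>c. \<forall>q\<in>?I. v q = (\<Sum>i\<in>{i. i < k \<and> j \<le> lvl i}. c i * b i q)"
  proof -
    show "biorth ?I k b l" using conjunct1[OF P] .
    show "lvl i \<le> L" "b i \<in> ?G (lvl i)" if "i < k" for i
      using conjunct1[OF conjunct2[OF P]] that by blast+
    show "\<exists>c. \<forall>q\<in>?I. v q = (\<Sum>i\<in>{i. i < k \<and> j \<le> lvl i}. c i * b i q)" if "v \<in> ?G j" for j v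
      by (rule bspec[OF mp[OF spec[OF conjunct2[OF conjunct2[OF P]]] le0] that])
  qed
  have kd: "k = d"
  proof (rule antisym)
    show "k \<le> d" using biorth_le_card[OF b] by simp
    let ?e = "\<lambda>i q. if q = i then 1 else 0 :: 'a"
    have be: "biorth ?I d ?e ?e"
      by (auto simp: biorth_def pairing_def if_distrib[of "\<lambda>z. _ * z"] cong: if_cong)
    have "\<forall>i. \<exists>c. i < d \<longrightarrow> (\<forall>q\<in>?I. ?e i q = (\<Sum>s<k. c s * b s q))"
    proof
      fix i show "\<exists>c. i < d \<longrightarrow> (\<forall>q\<in>?I. ?e i q = (\<Sum>s<k. c s * b s q))"
      proof (cases "i < d")
        case True
        have "(\<lambda>q. unit_vec d i $ q) \<in> ?G 0" by auto
        from sp[OF this] obtain c where "\<forall>q\<in>?I. unit_vec d i $ q = (\<Sum>s\<in>{s. s < k \<and> 0 \<le> lvl s}. c s * b s q)"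
          by (elim exE) (rule that)
        then show ?thesis using True by (intro exI[of _ c]) (simp add: lessThan_def)
      qed simp
    qed
    from choice[OF this] obtain c where c: "\<forall>i. i < d \<longrightarrow> (\<forall>q\<in>?I. ?e i q = (\<Sum>s<k. c i s * b s q))"
      by (elim exE) (rule that)
    have "d \<le> card {..<k}"
      by (rule biorth_card_le[OF be, where a = c and w = b]) (use c in auto)
    then show "d \<le> k" by simp
  qed
  define g where "g = mat d d (\<lambda>(i, s). b s i)"
  define h where "h = mat d d (\<lambda>(s, i). l s i)"
  have gc: "g \<in> carrier_mat d d" and hc: "h \<in> carrier_mat d d" by (simp_all add: g_def h_def)
  have hg: "h * g = 1\<^sub>m d"
  proof (rule eq_matI)
    fix i j assume ij: "i < dim_row (1\<^sub>m d :: 'a mat)" "j < dim_col (1\<^sub>m d :: 'a mat)"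
    have "(h * g) $$ (i, j) = pairing ?I (l i) (b j)"
      using ij index_mult_mat_sum[OF hc gc, of i j] by (simp add: pairing_def g_def h_def)
    then show "(h * g) $$ (i, j) = 1\<^sub>m d $$ (i, j)" using b ij kd by (simp add: biorth_def)
  qed (use gc hc in auto)
  have gh: "g * h = 1\<^sub>m d" by (rule mat_mult_left_right_inverse[OF hc gc hg])
  have inv: "inverse_mats d g h" using gc hc hg gh by (simp add: inverse_mats_def)
  have gv: "(g *\<^sub>v v) $ q = (\<Sum>s<d. b s q * v $ s)" if "v \<in> carrier_vec d" "q < d" for v q
    using mult_mat_vec_index[OF gc that] that by (simp add: g_def)
  have bv: "\<exists>u\<in>rad r d x (lvl i). \<forall>q. b i q = u $ q" if "i < d" for i
    using bG[of i] that kd by auto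
  have "rad r d x j = (*\<^sub>v) g ` lvl_space d lvl j" for j
  proof
    show "rad r d x j \<subseteq> (*\<^sub>v) g ` lvl_space d lvl j"
    proof
      fix v assume v: "v \<in> rad r d x j"
      then have "(\<lambda>q. v $ q) \<in> ?G j" by blast
      from sp[OF this] obtain c where c: "\<forall>q\<in>?I. v $ q = (\<Sum>s\<in>{s. s < k \<and> j \<le> lvl s}. c s * b s q)"
        by (elim exE) (rule that)
      define u where "u = vec d (\<lambda>s. if j \<le> lvl s then c s else 0)"
      have "u \<in> lvl_space d lvl j" by (auto simp: lvl_space_def u_def split: if_splits)
      moreover have "v = g *\<^sub>v u"
      proof (rule eq_vecI)
        fix q assume "q < dim_vec (g *\<^sub>v u)"
        then have q: "q < d" using gc by simp
        have "v $ q = (\<Sum>s\<in>{s. s < k \<and> j \<le> lvl s}. c s * b s q)" using c q by simp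
        also have "\<dots> = (\<Sum>s<d. b s q * u $ s)"
          by (rule sum.mono_neutral_cong_left) (auto simp: u_def kd)
        also have "\<dots> = (g *\<^sub>v u) $ q" using gv[of u q] q by (simp add: u_def)
        finally show "v $ q = (g *\<^sub>v u) $ q" .
      qed (use gc v rad_subset[of r d x j] in auto)
      ultimately show "v \<in> (*\<^sub>v) g ` lvl_space d lvl j" by blast
    qed
    show "(*\<^sub>v) g ` lvl_space d lvl j \<subseteq> rad r d x j"
    proof
      fix v assume "v \<in> (*\<^sub>v) g ` lvl_space d lvl j"
      then obtain u where u: "u \<in> lvl_space d lvl j" "v = g *\<^sub>v u" by blast
      have uc: "u \<in> carrier_vec d" using u by (simp add: lvl_space_def)
      have "\<forall>i. \<exists>t. i < d \<longrightarrow> t \<in> rad r d x (lvl i) \<and> (\<forall>q. b i q = t $ q)" using bv by blast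
      from choice[OF this] obtain t where t: "\<forall>i. i < d \<longrightarrow> t i \<in> rad r d x (lvl i) \<and> (\<forall>q. b i q = t i $ q)"
        by (elim exE) (rule that)
      have tc: "t i \<in> carrier_vec d" if "i < d" for i using t that rad_subset by blast
      have "v = vsum d (\<lambda>s. u $ s \<cdot>\<^sub>v t s) {s. s < d \<and> j \<le> lvl s}"
      proof (rule vec_combination)
        show "v \<in> carrier_vec d" using u(2) gc uc by simp
        show "t i \<in> carrier_vec d" if "i \<in> {s. s < d \<and> j \<le> lvl s}" for i using tc that by simp
        fix q assume q: "q < d"
        have "v $ q = (\<Sum>s<d. b s q * u $ s)" using gv[OF uc q] u(2) by simp
        also have "\<dots> = (\<Sum>s\<in>{s. s < d \<and> j \<le> lvl s}. u $ s * t s $ q)"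
          by (rule sum.mono_neutral_cong_right) (use u(1) t in \<open>auto simp: lvl_space_def\<close>)
        finally show "v $ q = (\<Sum>s\<in>{s. s < d \<and> j \<le> lvl s}. u $ s * t s $ q)" .
      qed
      also have "\<dots> \<in> rad r d x j"
        using t rad_antimono[OF x] by (intro vec_subspace_vsum[OF rad_subspace[OF x]] vec_subspaceD(4)[OF rad_subspace[OF x]]) blast
      finally show "v \<in> rad r d x j" .
    qed
  qed
  then have "adapted r d x lvl g h" using inv by (simp add: adapted_def)
  moreover have "\<forall>i<d. lvl i \<le> L" using lvl kd by simp
  ultimately show ?thesis by blast
qed

text \<open>Only the number of basis vectors on each level matters: a permutation of the indices
  that matches levels composes with the given basis. Hence one level function can serve all general
  points.\<close>

lemma adapted_permute:
  assumes ad: "adapted r d x lv g h"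
    and cnt: "\<And>j. card {i. i < d \<and> lv' i = j} = card {i. i < d \<and> lv i = j}"
  shows "\<exists>g' h'. adapted r d x lv' g' h'"
proof -
  have "\<forall>j. \<exists>f. bij_betw f {i. i < d \<and> lv' i = j} {i. i < d \<and> lv i = j}"
    using cnt by (auto intro: finite_same_card_bij)
  from choice[OF this] obtain f where f: "\<And>j. bij_betw (f j) {i. i < d \<and> lv' i = j} {i. i < d \<and> lv i = j}"
    by blast
  define \<pi> where "\<pi> i = f (lv' i) i" for i
  have \<pi>: "\<pi> i < d" "lv (\<pi> i) = lv' i" if "i < d" for i
    using f[of "lv' i"] that by (auto simp: bij_betw_def \<pi>_def)
  have inj: "inj_on \<pi> {..<d}"
  proof (rule inj_onI)
    fix i k assume ik: "i \<in> {..<d}" "k \<in> {..<d}" "\<pi> i = \<pi> k"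
    then have eq: "lv' i = lv' k" using \<pi>(2)[of i] \<pi>(2)[of k] by auto
    then show "i = k" using inj_onD[OF bij_betw_imp_inj_on[OF f[of "lv' i"]], of i k] ik by (simp add: \<pi>_def)
  qed
  have img: "\<pi> ` {..<d} = {..<d}" by (rule endo_inj_surj) (use inj \<pi> in auto)
  define \<rho> where "\<rho> = inv_into {..<d} \<pi>"
  have \<rho>: "\<rho> i < d" "\<pi> (\<rho> i) = i" if "i < d" for i
    using that img inv_into_into[of i \<pi> "{..<d}"] f_inv_into_f[of i \<pi> "{..<d}"] by (auto simp: \<rho>_def)
  define p where "p = mat d d (\<lambda>(i, k). if i = \<pi> k then 1 else 0 :: 'a)"
  define q where "q = mat d d (\<lambda>(k, i). if i = \<pi> k then 1 else 0 :: 'a)"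
  have pc: "p \<in> carrier_mat d d" and qc: "q \<in> carrier_mat d d" by (simp_all add: p_def q_def)
  have qp: "q * p = 1\<^sub>m d"
  proof (rule eq_matI)
    fix i j assume ij: "i < dim_row (1\<^sub>m d :: 'a mat)" "j < dim_col (1\<^sub>m d :: 'a mat)"
    have "(q * p) $$ (i, j) = (\<Sum>s<d. (if s = \<pi> j then 1 else 0) * (if s = \<pi> i then 1 else 0))"
      using ij index_mult_mat_sum[OF qc pc, of i j] by (simp add: p_def q_def mult.commute)
    also have "\<dots> = (if \<pi> i = \<pi> j then 1 else 0)"
      using sum_mult_delta(1)[of "{..<d}" "\<lambda>s. if s = \<pi> j then 1 else 0 :: 'a" "\<pi> i"] \<pi>(1)[of i] ij by simp
    finally show "(q * p) $$ (i, j) = 1\<^sub>m d $$ (i, j)" using ij inj_onD[OF inj, of i j] by auto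
  qed (use pc qc in auto)
  have pq: "p * q = 1\<^sub>m d" by (rule mat_mult_left_right_inverse[OF qc pc qp])
  have gh: "g \<in> carrier_mat d d" "h \<in> carrier_mat d d" "g * h = 1\<^sub>m d" "h * g = 1\<^sub>m d"
    using ad by (auto simp: adapted_def inverse_mats_def)
  have "g * p * (q * h) = g * (p * q) * h" using gh pc qc by (simp add: assoc_mult_mat[of _ d d _ d _ d])
  also have "\<dots> = 1\<^sub>m d" using gh pq by simp
  finally have 1: "g * p * (q * h) = 1\<^sub>m d" .
  have 2: "q * h * (g * p) = 1\<^sub>m d"
    by (rule mat_mult_left_right_inverse[OF _ _ 1]) (use gh pc qc in auto)
  have inv: "inverse_mats d (g * p) (q * h)" using 1 2 gh pc qc by (auto simp: inverse_mats_def)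
  have pv: "(p *\<^sub>v v) $ i = v $ \<rho> i" if v: "v \<in> carrier_vec d" and i: "i < d" for v i
  proof -
    have "(p *\<^sub>v v) $ i = (\<Sum>k<d. p $$ (i, k) * v $ k)" by (rule mult_mat_vec_index[OF pc v i])
    also have "\<dots> = (\<Sum>k<d. v $ k * (if k = \<rho> i then 1 else 0))"
    proof (rule sum.cong)
      fix k assume "k \<in> {..<d}"
      then have "i = \<pi> k \<longleftrightarrow> k = \<rho> i"
        using inj_onD[OF inj, of k "\<rho> i"] \<rho>[OF i] by auto
      then show "p $$ (i, k) * v $ k = v $ k * (if k = \<rho> i then 1 else 0)"
        using i \<open>k \<in> {..<d}\<close> by (simp add: p_def)
    qed simp
    also have "\<dots> = v $ \<rho> i" using \<rho>(1)[OF i] sum_mult_delta(1)[of "{..<d}" "\<lambda>k. v $ k" "\<rho> i"] by simp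
    finally show ?thesis .
  qed
  have qv: "(q *\<^sub>v v) $ k = v $ \<pi> k" if v: "v \<in> carrier_vec d" and k: "k < d" for v k
  proof -
    have "(q *\<^sub>v v) $ k = (\<Sum>i<d. q $$ (k, i) * v $ i)" by (rule mult_mat_vec_index[OF qc v k])
    also have "\<dots> = (\<Sum>i<d. v $ i * (if i = \<pi> k then 1 else 0))"
      unfolding q_def by (rule sum.cong) (use k in auto)
    also have "\<dots> = v $ \<pi> k" using \<pi>(1)[OF k] sum_mult_delta(1)[of "{..<d}" "\<lambda>k. v $ k" "\<pi> k"] by simp
    finally show ?thesis .
  qed
  have img: "(*\<^sub>v) p ` lvl_space d lv' j = lvl_space d lv j" for j
  proof
    show "(*\<^sub>v) p ` lvl_space d lv' j \<subseteq> lvl_space d lv j"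
    proof
      fix w assume "w \<in> (*\<^sub>v) p ` lvl_space d lv' j"
      then obtain v where v: "v \<in> lvl_space d lv' j" "w = p *\<^sub>v v" by blast
      have vc: "v \<in> carrier_vec d" using v by (simp add: lvl_space_def)
      have "j \<le> lv i" if "i < d" "w $ i \<noteq> 0" for i
        using that v pv[OF vc that(1)] \<rho>[OF that(1)] \<pi>(2)[of "\<rho> i"] by (auto simp: lvl_space_def)
      then show "w \<in> lvl_space d lv j" using v(2) pc vc by (simp add: lvl_space_def)
    qed
    show "lvl_space d lv j \<subseteq> (*\<^sub>v) p ` lvl_space d lv' j"
    proof
      fix v assume v: "v \<in> (lvl_space d lv j :: 'a vec set)"
      have vc: "v \<in> carrier_vec d" using v by (simp add: lvl_space_def)
      have "j \<le> lv' i" if "i < d" "(q *\<^sub>v v) $ i \<noteq> 0" for i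
        using that v qv[OF vc that(1)] \<pi>[OF that(1)] by (auto simp: lvl_space_def)
      then have "q *\<^sub>v v \<in> lvl_space d lv' j" using qc vc by (simp add: lvl_space_def)
      moreover have "v = p *\<^sub>v (q *\<^sub>v v)" using assoc_mult_mat_vec[OF pc qc vc] pq vc by simp
      ultimately show "v \<in> (*\<^sub>v) p ` lvl_space d lv' j" by blast
    qed
  qed
  have "rad r d x j = (*\<^sub>v) (g * p) ` lvl_space d lv' j" for j
  proof -
    have "rad r d x j = (*\<^sub>v) g ` (*\<^sub>v) p ` lvl_space d lv' j" using ad unfolding img adapted_def by blast
    also have "\<dots> = (*\<^sub>v) (g * p) ` lvl_space d lv' j"
      unfolding image_image
      by (rule image_cong) (use gh pc assoc_mult_mat_vec[OF gh(1) pc] in \<open>auto simp: lvl_space_def\<close>)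
    finally show ?thesis .
  qed
  then have "adapted r d x lv' (g * p) (q * h)" using inv by (simp add: adapted_def)
  then show ?thesis by blast
qed

text \<open>Were the target smaller, a nonzero combination of basis vectors of the source would be
  sent to zero, against invertibility of \<open>g\<close>.\<close>

lemma lvl_space_card_le:
  assumes gh: "inverse_mats d g h" and sub: "\<And>v. v \<in> lvl_space d lv j \<Longrightarrow> g *\<^sub>v v \<in> lvl_space d lv' j'"
  shows "card {i. i < d \<and> j \<le> lv i} \<le> card {i. i < d \<and> j' \<le> lv' i}"
proof (rule ccontr)
  let ?I = "{i. i < d \<and> j \<le> lv i}" and ?J = "{i. i < d \<and> j' \<le> lv' i}"
  assume "\<not> ?thesis"
  then have "card ?J < card ?I" by simp
  from homogeneous_system[OF _ _ this, of "\<lambda>i k. g $$ (k, i)"] obtain c where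
    c: "\<exists>i\<in>?I. c i \<noteq> 0" "\<forall>k\<in>?J. (\<Sum>i\<in>?I. c i * g $$ (k, i)) = 0" by auto
  define v where "v = vec d (\<lambda>i. if j \<le> lv i then c i else 0)"
  have v: "v \<in> lvl_space d lv j" by (auto simp: v_def lvl_space_def split: if_splits)
  have vc: "v \<in> carrier_vec d" by (simp add: v_def)
  have g: "g \<in> carrier_mat d d" using gh by (simp add: inverse_mats_def)
  have "(g *\<^sub>v v) $ k = 0" if k: "k < d" for k
  proof (cases "j' \<le> lv' k")
    case True
    have "(g *\<^sub>v v) $ k = (\<Sum>i<d. g $$ (k, i) * v $ i)" by (rule mult_mat_vec_index[OF g vc k])
    also have "\<dots> = (\<Sum>i\<in>?I. c i * g $$ (k, i))"
      by (rule sum.mono_neutral_cong_right) (auto simp: v_def)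
    finally show ?thesis using c(2) True k by simp
  next
    case False
    then show ?thesis using sub[OF v] k by (auto simp: lvl_space_def)
  qed
  then have "g *\<^sub>v v = 0\<^sub>v d" using g by (intro eq_vecI) auto
  then have "v = h *\<^sub>v 0\<^sub>v d" using inverse_mats_vec[OF inverse_mats_sym[OF gh] vc] by simp
  also have "\<dots> = 0\<^sub>v d" using gh by (intro eq_vecI) (auto simp: inverse_mats_def scalar_prod_def)
  finally have z: "v $ i = 0" if "i < d" for i using that by simp
  obtain i where "i \<in> ?I" "c i \<noteq> 0" using c(1) by blast
  then show False using z[of i] by (simp add: v_def)
qed

text \<open>An injective linear map sending a level space into itself also sends it onto itself, so its
  inverse preserves it as well.\<close>

lemma lvl_space_inverse:
  assumes gh: "inverse_mats d g h" and sub: "\<And>v. v \<in> lvl_space d lv j \<Longrightarrow> g *\<^sub>v v \<in> lvl_space d lv j"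
    and v: "v \<in> lvl_space d lv j"
  shows "h *\<^sub>v v \<in> lvl_space d lv j"
proof (rule ccontr)
  let ?I = "{i. i < d \<and> j \<le> lv i}"
  assume not: "h *\<^sub>v v \<notin> lvl_space d lv j"
  have g: "g \<in> carrier_mat d d" and h: "h \<in> carrier_mat d d" using gh by (simp_all add: inverse_mats_def)
  have vc: "v \<in> carrier_vec d" using v by (simp add: lvl_space_def)
  have dI: "d \<notin> ?I" by simp
  \<comment> \<open>\<open>d\<close> is no coordinate index and stands for the extra vector
    \<open>v\<close>: together with the images of the basis vectors of the level space there is one
    vector more than that space has coordinates.\<close>
  have "card ?I < card (insert d ?I)" by (simp add: card_insert_disjoint)
  from homogeneous_system[OF _ _ this, of "\<lambda>i k. if i = d then v $ k else g $$ (k, i)"] obtain c where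
    c: "\<exists>i\<in>insert d ?I. c i \<noteq> 0"
    "\<forall>k\<in>?I. (\<Sum>i\<in>insert d ?I. c i * (if i = d then v $ k else g $$ (k, i))) = 0" by auto
  define u where "u = vec d (\<lambda>i. if j \<le> lv i then c i else 0)"
  have u: "u \<in> lvl_space d lv j" by (auto simp: u_def lvl_space_def split: if_splits)
  have uc: "u \<in> carrier_vec d" by (simp add: u_def)
  have gu: "(g *\<^sub>v u) $ k + c d * v $ k = 0" if k: "k < d" for k
  proof (cases "j \<le> lv k")
    case True
    have "(g *\<^sub>v u) $ k = (\<Sum>i<d. g $$ (k, i) * u $ i)" by (rule mult_mat_vec_index[OF g uc k])
    also have "\<dots> = (\<Sum>i\<in>?I. c i * (if i = d then v $ k else g $$ (k, i)))"
      by (rule sum.mono_neutral_cong_right) (auto simp: u_def)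
    finally show ?thesis using c(2) True k dI by (simp add: add.commute)
  next
    case False
    then show ?thesis using sub[OF u] v k by (auto simp: lvl_space_def)
  qed
  have "g *\<^sub>v u + c d \<cdot>\<^sub>v v = 0\<^sub>v d" using gu g vc by (intro eq_vecI) auto
  then have "h *\<^sub>v (g *\<^sub>v u + c d \<cdot>\<^sub>v v) = 0\<^sub>v d"
    using h by (auto intro!: eq_vecI simp: scalar_prod_def)
  moreover have "h *\<^sub>v (g *\<^sub>v u + c d \<cdot>\<^sub>v v) = u + c d \<cdot>\<^sub>v (h *\<^sub>v v)"
    using mult_add_distrib_mat_vec[OF h, of "g *\<^sub>v u" "c d \<cdot>\<^sub>v v"] g uc vc h
      inverse_mats_vec[OF inverse_mats_sym[OF gh] uc] mult_mat_vec[OF h vc] by simp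
  ultimately have z: "u $ k + c d * (h *\<^sub>v v) $ k = 0" if "k < d" for k
    using that h uc by (metis index_add_vec(1) index_smult_vec(1) index_zero_vec(1) dim_mult_mat_vec carrier_matD(1) index_smult_vec(2))
  show False
  proof (cases "c d = 0")
    case True
    then have uz: "u $ k = 0" if "k < d" for k using z[OF that] by simp
    obtain i where "i \<in> ?I" "c i \<noteq> 0" using c(1) True by blast
    then show False using uz[of i] by (simp add: u_def)
  next
    case False
    have "(h *\<^sub>v v) $ k \<noteq> 0 \<longrightarrow> j \<le> lv k" if k: "k < d" for k
      using z[OF k] False u k by (auto simp: lvl_space_def)
    then show False using not h vc by (auto simp: lvl_space_def)
  qed
qed

section \<open>Conjugation and the Kronecker action as linear actions\<close>

lemma coord_mat_square:
  assumes "M \<in> carrier_mat d d"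
  shows "coord_mat d (\<lambda>i j. i * d + j) (\<lambda>k. M $$ (k div d, k mod d)) = M"
  by (rule eq_matI) (use assms in auto)

text \<open>Both components read the same parameters, in row-major order, so the acting pair has
  equal components.\<close>

lemma linear_action_conj:
  "linear_action TYPE('a::alg_closed_field) d d (\<lambda>i j. i * d + j) (\<lambda>i j. i * d + j)"
proof
  let ?H = "coord_mat d (\<lambda>i j. i * d + j) :: (nat \<Rightarrow> 'a) \<Rightarrow> 'a mat"
  have surj: "\<exists>c. ?H c = M" if "M \<in> carrier_mat d d" for M using coord_mat_square[OF that] by blast
  show "\<exists>c. ?H c = 1\<^sub>m d \<and> ?H c = 1\<^sub>m d" using surj by simp
  show "\<exists>c. ?H c = ?H a * ?H b \<and> ?H c = ?H a * ?H b" for a b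
    using surj[of "?H a * ?H b"] by (simp add: mult_carrier_mat[of _ d d])
  show "\<exists>c. ?H a * ?H c = 1\<^sub>m d \<and> ?H a * ?H c = 1\<^sub>m d" if "det (?H a) \<noteq> 0" for a
  proof -
    from det_nonzero_inverse[OF coord_mat_carrier that] obtain B where
      B: "B \<in> carrier_mat d d" "?H a * B = 1\<^sub>m d" by (elim bexE conjE)
    from surj[OF B(1)] obtain c where "?H c = B" by (elim exE)
    then show ?thesis using B(2) by (intro exI[of _ c]) simp
  qed
qed

lemma coord_mat_pair:
  fixes M2 M1 :: "'a mat"
  assumes "M2 \<in> carrier_mat d2 d2" "M1 \<in> carrier_mat d1 d1"
  shows "\<exists>c. coord_mat d2 (\<lambda>i j. i * d2 + j) c = M2 \<and> coord_mat d1 (\<lambda>i j. d2 * d2 + (i * d1 + j)) c = M1"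
proof -
  define c where "c k = (if k < d2 * d2 then M2 $$ (k div d2, k mod d2)
    else M1 $$ ((k - d2 * d2) div d1, (k - d2 * d2) mod d1))" for k
  have lt: "i * d2 + j < d2 * d2" if "i < d2" "j < d2" for i j
  proof -
    have "i * d2 + j < Suc i * d2" using that by simp
    also have "\<dots> \<le> d2 * d2" using that by (intro mult_right_mono) auto
    finally show ?thesis .
  qed
  show ?thesis
  proof (intro exI[of _ c] conjI)
    show "coord_mat d2 (\<lambda>i j. i * d2 + j) c = M2"
      by (rule eq_matI) (use assms lt in \<open>auto simp: c_def\<close>)
    show "coord_mat d1 (\<lambda>i j. d2 * d2 + (i * d1 + j)) c = M1"
      by (rule eq_matI) (use assms in \<open>auto simp: c_def\<close>)
  qed
qed

text \<open>The offset \<open>d2 * d2\<close> separates the parameters of the two factors, so every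
  pair of matrices of the right sizes occurs.\<close>

lemma linear_action_kronecker:
  "linear_action TYPE('a::alg_closed_field) d2 d1 (\<lambda>i j. i * d2 + j) (\<lambda>i j. d2 * d2 + (i * d1 + j))"
proof
  let ?H2 = "coord_mat d2 (\<lambda>i j. i * d2 + j) :: (nat \<Rightarrow> 'a) \<Rightarrow> 'a mat"
  let ?H1 = "coord_mat d1 (\<lambda>i j. d2 * d2 + (i * d1 + j)) :: (nat \<Rightarrow> 'a) \<Rightarrow> 'a mat"
  show "\<exists>c. ?H2 c = 1\<^sub>m d2 \<and> ?H1 c = 1\<^sub>m d1" by (rule coord_mat_pair) simp_all
  show "\<exists>c. ?H2 c = ?H2 a * ?H2 b \<and> ?H1 c = ?H1 a * ?H1 b" for a b
    by (rule coord_mat_pair; rule mult_carrier_mat[OF coord_mat_carrier coord_mat_carrier])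
  show "\<exists>c. ?H2 a * ?H2 c = 1\<^sub>m d2 \<and> ?H1 a * ?H1 c = 1\<^sub>m d1"
    if d: "det (?H2 a) \<noteq> 0" "det (?H1 a) \<noteq> 0" for a
  proof -
    obtain B2 where B2: "B2 \<in> carrier_mat d2 d2" "?H2 a * B2 = 1\<^sub>m d2"
      using det_nonzero_inverse[OF coord_mat_carrier d(1)] by (elim bexE conjE)
    obtain B1 where B1: "B1 \<in> carrier_mat d1 d1" "?H1 a * B1 = 1\<^sub>m d1"
      using det_nonzero_inverse[OF coord_mat_carrier d(2)] by (elim bexE conjE)
    from coord_mat_pair[OF B2(1) B1(1)] obtain c where "?H2 c = B2" "?H1 c = B1" by (elim exE conjE)
    then show ?thesis using B2(2) B1(2) by (intro exI[of _ c]) simp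
  qed
qed

lemma GL_carrier: "carrier (GL n) = {g \<in> carrier_mat n n. det (g :: 'a::field mat) \<noteq> 0}"
proof -
  have "Units (ring_mat TYPE('a) n ()) = {g \<in> carrier_mat n n. det g \<noteq> 0}"
    using det_non_zero_imp_unit[of _ n "()"] unit_imp_det_non_zero[of _ n "()"]
    by (auto simp: Units_def ring_mat_def)
  then show ?thesis by (simp add: GL_def units_of_def)
qed

lemma GL_inv:
  assumes "g \<in> carrier (GL n)"
  shows "inverse_mats n g (inv\<^bsub>GL n\<^esub> (g :: 'a::field mat))"
proof -
  interpret R: ring "ring_mat TYPE('a) n ()" by (rule ring_mat)
  interpret G: group "GL n :: 'a mat monoid" unfolding GL_def by (rule R.units_group)
  have mult: "x \<otimes>\<^bsub>GL n\<^esub> y = x * y" for x y :: "'a mat" by (simp add: GL_def units_of_def ring_mat_def)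
  have one: "\<one>\<^bsub>GL n\<^esub> = (1\<^sub>m n :: 'a mat)" by (simp add: GL_def units_of_def ring_mat_def)
  have "inv\<^bsub>GL n\<^esub> g \<in> carrier (GL n)" using assms by (rule G.inv_closed)
  then show ?thesis
    using assms G.l_inv[OF assms] G.r_inv[OF assms] unfolding mult one GL_carrier
    by (simp add: inverse_mats_def)
qed

lemma inverse_mats_det: "inverse_mats n g h \<Longrightarrow> det g \<noteq> (0::'a::field)"
  by (rule det_nonzero_of_inverse[of g n h]) (auto simp: inverse_mats_def)

lemma det_inverse_mats:
  assumes "g \<in> carrier_mat n n" "det g \<noteq> (0::'a::field)"
  obtains h where "inverse_mats n g h"
  using det_nonzero_inverse[OF assms] assms(1) by (auto simp: inverse_mats_def)

lemma mult_inverse_eq_iff: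
  assumes gh: "inverse_mats n g1 h1" and A: "A \<in> carrier_mat m n" and B: "(B :: 'a::field mat) \<in> carrier_mat m n"
  shows "A = B * g1 \<longleftrightarrow> A * h1 = B"
proof -
  have g: "g1 \<in> carrier_mat n n" "h1 \<in> carrier_mat n n" "g1 * h1 = 1\<^sub>m n" "h1 * g1 = 1\<^sub>m n"
    using gh by (auto simp: inverse_mats_def)
  have "B * g1 * h1 = B" "A * h1 * g1 = A"
    using g A B by (simp_all add: assoc_mult_mat[of _ m n _ n _ n])
  then show ?thesis by auto
qed

text \<open>Written without inverses, the orbit condition is linear in \<open>g\<close>; this is the
  shape required by \<open>linear_action\<close>.\<close>

lemma conj_orbit_eq:
  assumes x: "x \<in> mat_tuples r d d"
  shows "orbit (GL d) (conj_action d) x =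
    {y \<in> mat_tuples r d d. \<exists>g h. inverse_mats d g h \<and> (\<forall>a<r. g * x ! a = y ! a * (g :: 'a::field mat))}"
    (is "?O = ?R")
proof (intro subset_antisym subsetI)
  fix y assume "y \<in> ?O"
  then obtain g where g: "g \<in> carrier (GL d)" "y = conj_action d g x" unfolding orbit_def by blast
  note gh = GL_inv[OF g(1)]
  have gc: "g \<in> carrier_mat d d" "inv\<^bsub>GL d\<^esub> g \<in> carrier_mat d d" using gh by (auto simp: inverse_mats_def)
  have ya: "y ! a = g * x ! a * inv\<^bsub>GL d\<^esub> g" if "a < r" for a
    using that mat_tuplesD(1)[OF x] by (simp add: g(2) conj_action_def)
  have gx: "g * x ! a \<in> carrier_mat d d" if "a < r" for a by (rule mult_carrier_mat[OF gc(1) mat_tuplesD(2)[OF x that]])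
  have y: "y \<in> mat_tuples r d d"
  proof (rule mat_tuplesI)
    show "length y = r" using mat_tuplesD(1)[OF x] by (simp add: g(2) conj_action_def)
    show "y ! a \<in> carrier_mat d d" if "a < r" for a unfolding ya[OF that] by (rule mult_carrier_mat[OF gx[OF that] gc(2)])
  qed
  have "g * x ! a = y ! a * g" if "a < r" for a
    using mult_inverse_eq_iff[OF gh gx[OF that] mat_tuplesD(2)[OF y that]] ya[OF that] by simp
  then show "y \<in> ?R" using y gh by blast
next
  fix y assume "y \<in> ?R"
  then obtain g h where y: "y \<in> mat_tuples r d d" and gh: "inverse_mats d g h"
    and int: "\<And>a. a < r \<Longrightarrow> g * x ! a = y ! a * g" by blast
  have gc: "g \<in> carrier_mat d d" using gh by (auto simp: inverse_mats_def)
  have g: "g \<in> carrier (GL d)" using gc inverse_mats_det[OF gh] by (simp add: GL_carrier)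
  have "y = conj_action d g x"
  proof (rule nth_equalityI)
    show "length y = length (conj_action d g x)"
      using mat_tuplesD(1)[OF x] mat_tuplesD(1)[OF y] by (simp add: conj_action_def)
    fix a assume "a < length y"
    then have a: "a < r" using mat_tuplesD(1)[OF y] by simp
    show "y ! a = conj_action d g x ! a"
      using mult_inverse_eq_iff[OF GL_inv[OF g] mult_carrier_mat[OF gc mat_tuplesD(2)[OF x a]] mat_tuplesD(2)[OF y a]]
        int[OF a] a mat_tuplesD(1)[OF x] by (simp add: conj_action_def)
  qed
  then show "y \<in> ?O" unfolding orbit_def using g by blast
qed

lemma kronecker_orbit_eq:
  assumes x: "x \<in> mat_tuples r d2 d1"
  shows "orbit (GL d1 \<times>\<times> GL d2) (kronecker_action d1 d2) x =
    {y \<in> mat_tuples r d2 d1. \<exists>g2 h2 g1 h1. inverse_mats d2 g2 h2 \<and> inverse_mats d1 g1 h1 \<and>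
      (\<forall>a<r. g2 * x ! a = y ! a * (g1 :: 'a::field mat))}"
    (is "?O = ?R")
proof (intro subset_antisym subsetI)
  fix y assume "y \<in> ?O"
  then obtain g1 g2 where g: "g1 \<in> carrier (GL d1)" "g2 \<in> carrier (GL d2)" "y = kronecker_action d1 d2 (g1, g2) x"
    unfolding orbit_def by (auto simp: DirProd_def)
  note gh1 = GL_inv[OF g(1)] and gh2 = GL_inv[OF g(2)]
  have gc: "g2 \<in> carrier_mat d2 d2" "inv\<^bsub>GL d1\<^esub> g1 \<in> carrier_mat d1 d1" using gh1 gh2 by (auto simp: inverse_mats_def)
  have ya: "y ! a = g2 * x ! a * inv\<^bsub>GL d1\<^esub> g1" if "a < r" for a
    using that mat_tuplesD(1)[OF x] by (simp add: g(3) kronecker_action_def)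
  have gx: "g2 * x ! a \<in> carrier_mat d2 d1" if "a < r" for a by (rule mult_carrier_mat[OF gc(1) mat_tuplesD(2)[OF x that]])
  have y: "y \<in> mat_tuples r d2 d1"
  proof (rule mat_tuplesI)
    show "length y = r" using mat_tuplesD(1)[OF x] by (simp add: g(3) kronecker_action_def)
    show "y ! a \<in> carrier_mat d2 d1" if "a < r" for a unfolding ya[OF that] by (rule mult_carrier_mat[OF gx[OF that] gc(2)])
  qed
  have "g2 * x ! a = y ! a * g1" if "a < r" for a
    using mult_inverse_eq_iff[OF gh1 gx[OF that] mat_tuplesD(2)[OF y that]] ya[OF that] by simp
  then show "y \<in> ?R" using y gh1 gh2 by blast
next
  fix y assume "y \<in> ?R"
  then obtain g2 h2 g1 h1 where y: "y \<in> mat_tuples r d2 d1" and gh: "inverse_mats d2 g2 h2" "inverse_mats d1 g1 h1"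
    and int: "\<And>a. a < r \<Longrightarrow> g2 * x ! a = y ! a * g1" by blast
  have gc: "g2 \<in> carrier_mat d2 d2" "g1 \<in> carrier_mat d1 d1" using gh by (auto simp: inverse_mats_def)
  have g: "g2 \<in> carrier (GL d2)" "g1 \<in> carrier (GL d1)"
    using gc inverse_mats_det[OF gh(1)] inverse_mats_det[OF gh(2)] by (simp_all add: GL_carrier)
  have "y = kronecker_action d1 d2 (g1, g2) x"
  proof (rule nth_equalityI)
    show "length y = length (kronecker_action d1 d2 (g1, g2) x)"
      using mat_tuplesD(1)[OF x] mat_tuplesD(1)[OF y] by (simp add: kronecker_action_def)
    fix a assume "a < length y"
    then have a: "a < r" using mat_tuplesD(1)[OF y] by simp
    show "y ! a = kronecker_action d1 d2 (g1, g2) x ! a"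
      using mult_inverse_eq_iff[OF GL_inv[OF g(2)] mult_carrier_mat[OF gc(1) mat_tuplesD(2)[OF x a]] mat_tuplesD(2)[OF y a]]
        int[OF a] a mat_tuplesD(1)[OF x] by (simp add: kronecker_action_def)
  qed
  then show "y \<in> ?O" unfolding orbit_def using g by (force simp: DirProd_def)
qed

section \<open>The irreducible sets swept out by level tuples\<close>

text \<open>For the generic level function these conjugates are dense in the component; for a raised
  level function they form the locus that a general point avoids.\<close>

definition lvl_orbits :: "nat \<Rightarrow> nat \<Rightarrow> (nat \<Rightarrow> nat) \<Rightarrow> 'a::field mat list set" where
  "lvl_orbits r d lv = {x \<in> mat_tuples r d d. \<exists>p\<in>lvl_tuples r d lv. \<exists>g h.
     inverse_mats d g h \<and> (\<forall>a<r. g * p ! a = x ! a * g)}"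

lemma lvl_orbits_Rep:
  assumes "\<And>i. i < d \<Longrightarrow> lv i \<le> L"
  shows "lvl_orbits r d lv \<subseteq> Rep r L d"
proof
  fix x :: "'a mat list" assume "x \<in> lvl_orbits r d lv"
  then obtain p g h where x: "x \<in> mat_tuples r d d" and p: "p \<in> lvl_tuples r d lv" and gh: "inverse_mats d g h"
    and int: "\<And>a. a < r \<Longrightarrow> g * p ! a = x ! a * g"
    unfolding lvl_orbits_def by blast
  show "x \<in> Rep r L d" by (rule Rep_conj[OF lvl_tuples_Rep[OF p assms] x gh int])
qed

lemma lvl_tuples_subset_lvl_orbits: "lvl_tuples r d lv \<subseteq> lvl_orbits r d lv"
proof
  fix p :: "'a mat list" assume p: "p \<in> lvl_tuples r d lv"
  then have pm: "p \<in> mat_tuples r d d" by (simp add: lvl_tuples_def)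
  have "1\<^sub>m d * p ! a = p ! a * 1\<^sub>m d" if "a < r" for a using mat_tuplesD(2)[OF pm that] by simp
  moreover have "inverse_mats d (1\<^sub>m d) (1\<^sub>m d :: 'a mat)" by (simp add: inverse_mats_def)
  ultimately show "p \<in> lvl_orbits r d lv" unfolding lvl_orbits_def using p pm by blast
qed

text \<open>The triangular tuple and the conjugating matrix move along straight lines at the same
  time. Both curves are recorded, since conditions will be imposed on the tuple and on its conjugate
  together.\<close>

lemma lvl_line:
  fixes p0 p1 :: "'a::alg_closed_field mat list"
  assumes p: "p0 \<in> lvl_tuples r d lv" "p1 \<in> lvl_tuples r d lv"
    and x: "x0 \<in> mat_tuples r d d" "x1 \<in> mat_tuples r d d"
    and gh: "inverse_mats d g0 h0" "inverse_mats d g1 h1"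
    and int: "\<forall>a<r. g0 * p0 ! a = x0 ! a * g0" "\<forall>a<r. g1 * p1 ! a = x1 ! a * g1"
  shows "\<exists>\<delta>\<in>range poly. \<exists>p x. \<delta> 0 \<noteq> 0 \<and> \<delta> 1 \<noteq> 0 \<and> p 0 = p0 \<and> p 1 = p1 \<and> x 0 = x0 \<and> x 1 = x1 \<and>
    (\<forall>t. p t \<in> lvl_tuples r d lv) \<and>
    (\<forall>t. \<delta> t \<noteq> 0 \<longrightarrow> x t \<in> mat_tuples r d d \<and> (\<exists>g h. inverse_mats d g h \<and> (\<forall>a<r. g * p t ! a = x t ! a * g))) \<and>
    (\<forall>i<r. \<forall>j<d. \<forall>k<d. (\<lambda>t. (p t ! i) $$ (j, k)) \<in> range poly \<and> (\<lambda>t. (x t ! i) $$ (j, k)) \<in> localize (range poly) \<delta>)"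
proof -
  interpret linear_action r d d "\<lambda>i j. i * d + j" "\<lambda>i j. i * d + j" "TYPE('a)" by (rule linear_action_conj)
  let ?c = "\<lambda>M k. M $$ (k div d, k mod d) :: 'a"
  have H: "H2 (?c g0) = g0" "H2 (?c g1) = g1" using gh by (auto intro: coord_mat_square simp: inverse_mats_def)
  define p where "p t = map (\<lambda>i. mat d d (\<lambda>jk. (1 - t) * (p0 ! i) $$ jk + t * (p1 ! i) $$ jk)) [0..<r]" for t :: 'a
  define c where "c t k = (1 - t) * ?c g0 k + t * ?c g1 k" for t k
  let ?\<delta> = "\<lambda>t. det (H2 (c t)) * det (H1 (c t))"
  have pm: "p t \<in> X" for t by (rule mat_tuplesI) (auto simp: p_def)
  have p0m: "p0 \<in> X" and p1m: "p1 \<in> X" using p by (auto simp: lvl_tuples_def)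
  have pe: "(\<lambda>t. (p t ! i) $$ (j, k)) \<in> range poly" if "i < r" "j < d" "k < d" for i j k
    using that by (simp add: p_def)
  have cS: "(\<lambda>t. c t k) \<in> range poly" for k unfolding c_def by (rule line_polys_affine)
  have \<delta>: "?\<delta> \<in> range poly"
    by (rule line_polys.mult; rule line_polys.det) (rule coord_mat_carrier, simp add: cS)+
  have c01: "c 0 = ?c g0" "c 1 = ?c g1" by (simp_all add: c_def fun_eq_iff)
  have inv01: "invertible_param (c 0)" "invertible_param (c 1)"
    unfolding c01 invertible_param_def H using inverse_mats_det[OF gh(1)] inverse_mats_det[OF gh(2)] by simp_all
  have p01: "p 0 = p0" "p 1 = p1"
    by (rule mat_tuples_eqI[OF pm p0m], simp add: p_def) (rule mat_tuples_eqI[OF pm p1m], simp add: p_def)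
  have x01: "act (c 0) (p 0) = x0" "act (c 1) (p 1) = x1"
    using act_unique[OF p0m x(1) inv01(1)] act_unique[OF p1m x(2) inv01(2)]
      D_zero_iff[OF p0m x(1), of "c 0"] D_zero_iff[OF p1m x(2), of "c 1"] int
    unfolding c01 H p01 by auto
  show ?thesis
  proof (rule bexI[OF _ \<delta>], rule exI[of _ p], rule exI[of _ "\<lambda>t. act (c t) (p t)"], intro conjI allI impI)
    show "?\<delta> 0 \<noteq> 0" "?\<delta> 1 \<noteq> 0" using inv01 by (simp_all add: invertible_param_def)
    show "p 0 = p0" "p 1 = p1" "act (c 0) (p 0) = x0" "act (c 1) (p 1) = x1" by (fact p01 x01)+
    show "p t \<in> lvl_tuples r d lv" for t
    proof -
      have "lv k < lv i" if "a < r" "i < d" "k < d" "(p t ! a) $$ (i, k) \<noteq> 0" for a i k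
      proof -
        have "(p0 ! a) $$ (i, k) \<noteq> 0 \<or> (p1 ! a) $$ (i, k) \<noteq> 0" using that by (auto simp: p_def)
        then show ?thesis using p that by (auto simp: lvl_tuples_def)
      qed
      then show ?thesis using pm by (auto simp: lvl_tuples_def)
    qed
    show "act (c t) (p t) \<in> mat_tuples r d d" for t by (rule act_mem[OF pm])
    show "\<exists>g h. inverse_mats d g h \<and> (\<forall>a<r. g * p t ! a = act (c t) (p t) ! a * g)" if t: "?\<delta> t \<noteq> 0" for t
    proof -
      have inv: "invertible_param (c t)" using t by (simp add: invertible_param_def)
      then obtain h where "inverse_mats d (H2 (c t)) h"
        using det_inverse_mats[OF coord_mat_carrier, of d "\<lambda>i j. i * d + j" "c t"] unfolding invertible_param_def by blast
      then show ?thesis using act_intertwines[OF pm inv]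
        by - (rule exI[of _ "H2 (c t)"], rule exI[of _ h], simp)
    qed
    fix i j k assume ijk: "i < r" "j < d" "k < d"
    show "(\<lambda>t. (p t ! i) $$ (j, k)) \<in> range poly" by (rule pe[OF ijk])
    show "(\<lambda>t. (act (c t) (p t) ! i) $$ (j, k)) \<in> localize (range poly) ?\<delta>"
      by (rule act_localize_family(2)[OF line_polys.function_algebra_axioms cS pm pe ijk])
  qed
qed

lemma zirr_lvl_orbits: "zirr r d d (lvl_orbits r d lv :: 'a::alg_closed_field mat list set)"
proof (rule zirr_by_lines)
  have "replicate r (0\<^sub>m d d) \<in> lvl_tuples r d lv"
    by (auto simp: lvl_tuples_def intro!: mat_tuplesI)
  then show "lvl_orbits r d lv \<noteq> ({} :: 'a mat list set)" using lvl_tuples_subset_lvl_orbits by blast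
  show "lvl_orbits r d lv \<subseteq> (mat_tuples r d d :: 'a mat list set)" by (auto simp: lvl_orbits_def)
  fix x0 x1 :: "'a mat list" assume "x0 \<in> lvl_orbits r d lv" "x1 \<in> lvl_orbits r d lv"
  then obtain p0 g0 h0 p1 g1 h1 where *: "p0 \<in> lvl_tuples r d lv" "p1 \<in> lvl_tuples r d lv"
    "x0 \<in> mat_tuples r d d" "x1 \<in> mat_tuples r d d" "inverse_mats d g0 h0" "inverse_mats d g1 h1"
    "\<forall>a<r. g0 * p0 ! a = x0 ! a * g0" "\<forall>a<r. g1 * p1 ! a = x1 ! a * g1"
    unfolding lvl_orbits_def by blast
  obtain \<delta> p x where \<delta>: "\<delta> \<in> range poly" and l: "\<delta> 0 \<noteq> 0" "\<delta> 1 \<noteq> 0" "x 0 = x0" "x 1 = x1"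
    "\<forall>t. p t \<in> lvl_tuples r d lv"
    "\<forall>t. \<delta> t \<noteq> 0 \<longrightarrow> x t \<in> mat_tuples r d d \<and> (\<exists>g h. inverse_mats d g h \<and> (\<forall>a<r. g * p t ! a = x t ! a * g))"
    "\<forall>i<r. \<forall>j<d. \<forall>k<d. (\<lambda>t. (p t ! i) $$ (j, k)) \<in> range poly \<and> (\<lambda>t. (x t ! i) $$ (j, k)) \<in> localize (range poly) \<delta>"
    using lvl_line[OF *] by (elim bexE exE conjE) (rule that)
  show "\<exists>\<delta>\<in>range poly. \<exists>\<phi> s t. \<delta> s \<noteq> 0 \<and> \<delta> t \<noteq> 0 \<and> \<phi> s = x0 \<and> \<phi> t = x1 \<and>
      (\<forall>u. \<delta> u \<noteq> 0 \<longrightarrow> \<phi> u \<in> lvl_orbits r d lv) \<and>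
      (\<forall>i<r. \<forall>j<d. \<forall>k<d. (\<lambda>u. (\<phi> u ! i) $$ (j, k)) \<in> localize (range poly) \<delta>)"
  proof (rule bexI[OF _ \<delta>], rule exI[of _ x], rule exI[of _ 0], rule exI[of _ 1], intro conjI allI impI)
    show "x u \<in> lvl_orbits r d lv" if "\<delta> u \<noteq> 0" for u
      using l(5,6) that unfolding lvl_orbits_def by blast
    show "(\<lambda>u. (x u ! i) $$ (j, k)) \<in> localize (range poly) \<delta>" if "i < r" "j < d" "k < d" for i j k
      using l(7) that by blast
  qed (fact l)+
qed

text \<open>Pairs of a level tuple and a conjugate of it are joined by rational curves, so an open
  condition on the conjugate and an open condition on the tuple are compatible as soon as each can
  be met alone.\<close>

lemma lvl_orbits_common_point:
  fixes p1 :: "'a::alg_closed_field mat list"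
  assumes f: "f \<in> poly_funs r d d" "x0 \<in> lvl_orbits r d lv" "f x0 \<noteq> 0"
    and f': "f' \<in> poly_funs r d d" "p1 \<in> lvl_tuples r d lv" "f' p1 \<noteq> 0"
  shows "\<exists>p\<in>lvl_tuples r d lv. \<exists>x\<in>mat_tuples r d d. \<exists>g h. inverse_mats d g h \<and>
    (\<forall>a<r. g * p ! a = x ! a * g) \<and> f x \<noteq> 0 \<and> f' p \<noteq> 0"
proof -
  obtain p0 g0 h0 where *: "p0 \<in> lvl_tuples r d lv" "x0 \<in> mat_tuples r d d" "inverse_mats d g0 h0"
    "\<forall>a<r. g0 * p0 ! a = x0 ! a * g0"
    using f(2) unfolding lvl_orbits_def by blast
  have p1m: "p1 \<in> mat_tuples r d d" using f'(2) by (simp add: lvl_tuples_def)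
  have 1: "\<forall>a<r. 1\<^sub>m d * p1 ! a = p1 ! a * 1\<^sub>m d"
    using left_mult_one_mat[OF mat_tuplesD(2)[OF p1m]] right_mult_one_mat[OF mat_tuplesD(2)[OF p1m]] by auto
  have i1: "inverse_mats d (1\<^sub>m d) (1\<^sub>m d :: 'a mat)" by (simp add: inverse_mats_def)
  obtain \<delta> p x where \<delta>: "\<delta> \<in> range poly" and l: "\<delta> 0 \<noteq> 0" "\<delta> 1 \<noteq> 0" "p 1 = p1" "x 0 = x0"
    "\<forall>t. p t \<in> lvl_tuples r d lv"
    "\<forall>t. \<delta> t \<noteq> 0 \<longrightarrow> x t \<in> mat_tuples r d d \<and> (\<exists>g h. inverse_mats d g h \<and> (\<forall>a<r. g * p t ! a = x t ! a * g))"
    "\<forall>i<r. \<forall>j<d. \<forall>k<d. (\<lambda>t. (p t ! i) $$ (j, k)) \<in> range poly \<and> (\<lambda>t. (x t ! i) $$ (j, k)) \<in> localize (range poly) \<delta>"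
    using lvl_line[OF *(1) f'(2) *(2) p1m *(3) i1 *(4) 1] by (elim bexE exE conjE) (rule that)
  interpret A: function_algebra "localize (range poly) \<delta>" by (rule line_polys.function_algebra_localize[OF \<delta>])
  have "(\<lambda>u. f (x u)) \<in> localize (range poly) \<delta>"
    by (rule A.poly_fun_compose[OF f(1)]) (use l(7) in blast)
  moreover have "(\<lambda>u. f' (p u)) \<in> range poly"
    by (rule line_polys.poly_fun_compose[OF f'(1)]) (use l(7) in blast)
  ultimately obtain u where "\<delta> u \<noteq> 0" "f (x u) \<noteq> 0" "f' (p u) \<noteq> 0"
    using localize_line_common_nonzero[OF \<delta> _ line_polys.subset_localize, of "\<lambda>u. f (x u)" "\<lambda>u. f' (p u)" 0 1] l(1-4) f(3) f'(3)
    by auto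
  then show ?thesis using l(5,6) by blast
qed

section \<open>Charts\<close>

text \<open>An element of a radical power is an expression in the matrices applied to fixed vectors;
  letting the matrices vary gives a polynomial section through it. Hence radical powers cannot
  shrink under generisation.\<close>

lemma rad_chart:
  assumes x0: "x0 \<in> mat_tuples r d d" and v: "(v :: 'a::field vec) \<in> rad r d x0 j"
  shows "\<exists>V. V x0 = v \<and> (\<forall>x\<in>mat_tuples r d d. V x \<in> rad r d x j) \<and> (\<forall>i<d. (\<lambda>x. V x $ i) \<in> poly_funs r d d)"
  using v
proof (induction j arbitrary: v)
  case 0
  then show ?case by (intro exI[of _ "\<lambda>_. v"]) (simp add: poly_funs.const)
next
  case (Suc j)
  then obtain u where v: "v = vsum d (\<lambda>a. x0 ! a *\<^sub>v u a) {..<r}" and u: "\<forall>a<r. u a \<in> rad r d x0 j" by auto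
  have "\<forall>a. \<exists>V. a < r \<longrightarrow> V x0 = u a \<and> (\<forall>x\<in>mat_tuples r d d. V x \<in> rad r d x j) \<and> (\<forall>i<d. (\<lambda>x. V x $ i) \<in> poly_funs r d d)"
    using Suc.IH u by blast
  from choice[OF this] obtain V where V: "\<forall>a. a < r \<longrightarrow> V a x0 = u a \<and> (\<forall>x\<in>mat_tuples r d d. V a x \<in> rad r d x j) \<and>
    (\<forall>i<d. (\<lambda>x. V a x $ i) \<in> poly_funs r d d)" by (elim exE) (rule that)
  text \<open>On tuples outside \<open>mat_tuples\<close> the entries of \<open>V\<close> are unconstrained, so the product is written
    out with explicit sums in order to be a polynomial function everywhere.\<close>
  define W where "W x = vec d (\<lambda>i. \<Sum>a<r. \<Sum>k<d. (x ! a) $$ (i, k) * V a x $ k)" for x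
  have W: "W x = vsum d (\<lambda>a. x ! a *\<^sub>v V a x) {..<r}" if x: "x \<in> mat_tuples r d d" for x
  proof (rule eq_vecI)
    fix i assume "i < dim_vec (vsum d (\<lambda>a. x ! a *\<^sub>v V a x) {..<r})"
    then have i: "i < d" by simp
    have "(x ! a *\<^sub>v V a x) $ i = (\<Sum>k<d. (x ! a) $$ (i, k) * V a x $ k)" if "a < r" for a
      by (rule mult_mat_vec_index[OF mat_tuplesD(2)[OF x that] _ i]) (use V x that rad_subset in blast)
    then show "W x $ i = vsum d (\<lambda>a. x ! a *\<^sub>v V a x) {..<r} $ i" using i by (simp add: W_def)
  qed (simp add: W_def)
  show ?case
  proof (intro exI[of _ W] conjI ballI allI impI)
    show "W x0 = v" unfolding W[OF x0] v using V by (intro eq_vecI) simp_all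
    show "W x \<in> rad r d x (Suc j)" if x: "x \<in> mat_tuples r d d" for x
      unfolding W[OF x] rad.simps(2) mem_Collect_eq using V x by (intro exI[of _ "\<lambda>a. V a x"]) simp
    fix i assume i: "i < d"
    have "(\<lambda>x. \<Sum>a<r. \<Sum>k<d. (x ! a) $$ (i, k) * V a x $ k) \<in> poly_funs r d d"
      by (rule poly_funs.sum, rule poly_funs.sum, rule poly_funs.mult) (use V i in \<open>simp_all add: poly_funs.coord\<close>)
    then show "(\<lambda>x. W x $ i) \<in> poly_funs r d d" using i by (simp add: W_def)
  qed
qed

lemma lvl_space_expand:
  assumes G: "G \<in> carrier_mat d d" and v: "v \<in> lvl_space d lv j"
  shows "G *\<^sub>v v = vsum d (\<lambda>i. v $ i \<cdot>\<^sub>v col G i) {i. i < d \<and> j \<le> lv i}"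
proof (rule vec_combination)
  have vc: "v \<in> carrier_vec d" using v by (simp add: lvl_space_def)
  show "G *\<^sub>v v \<in> carrier_vec d" using G vc by simp
  show "col G i \<in> carrier_vec d" if "i \<in> {i. i < d \<and> j \<le> lv i}" for i using G by (metis carrier_matD(1) col_dim)
  fix q assume q: "q < d"
  have "(G *\<^sub>v v) $ q = (\<Sum>i<d. G $$ (q, i) * v $ i)" by (rule mult_mat_vec_index[OF G vc q])
  also have "\<dots> = (\<Sum>i\<in>{i. i < d \<and> j \<le> lv i}. v $ i * col G i $ q)"
    by (rule sum.mono_neutral_cong_right) (use v G q in \<open>auto simp: lvl_space_def\<close>)
  finally show "(G *\<^sub>v v) $ q = (\<Sum>i\<in>{i. i < d \<and> j \<le> lv i}. v $ i * col G i $ q)" .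
qed

lemma lvl_space_into_rad:
  assumes x: "x \<in> mat_tuples r d d" and G: "G \<in> carrier_mat d d"
    and col: "\<And>i. i < d \<Longrightarrow> col G i \<in> rad r d x (lv i)" and v: "v \<in> lvl_space d lv j"
  shows "G *\<^sub>v v \<in> rad r d x j"
  unfolding lvl_space_expand[OF G v]
proof (rule vec_subspace_vsum[OF rad_subspace[OF x]])
  fix i assume "i \<in> {i. i < d \<and> j \<le> lv i}"
  then show "v $ i \<cdot>\<^sub>v col G i \<in> rad r d x j"
    using col[of i] rad_antimono[OF x, of j "lv i"] by (intro vec_subspaceD(4)[OF rad_subspace[OF x]]) auto
qed

text \<open>Each column is extended separately by a section that stays in its own radical power.
  Linearity then carries the whole coordinate flag into the radical filtration at every
  point.\<close>

lemma chart_matrix: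
  fixes g :: "'a::field mat"
  assumes x0: "x0 \<in> mat_tuples r d d" and g: "g \<in> carrier_mat d d"
    and col: "\<And>i. i < d \<Longrightarrow> col g i \<in> rad r d x0 (lv i)"
  shows "\<exists>G. G x0 = g \<and> (\<forall>x. G x \<in> carrier_mat d d) \<and> (\<forall>i<d. \<forall>k<d. (\<lambda>x. G x $$ (i, k)) \<in> poly_funs r d d) \<and>
    (\<forall>x\<in>mat_tuples r d d. \<forall>j. \<forall>v\<in>lvl_space d lv j. G x *\<^sub>v v \<in> rad r d x j)"
proof -
  have "\<forall>k. \<exists>V. k < d \<longrightarrow> V x0 = col g k \<and> (\<forall>x\<in>mat_tuples r d d. V x \<in> rad r d x (lv k)) \<and> (\<forall>i<d. (\<lambda>x. V x $ i) \<in> poly_funs r d d)"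
    using rad_chart[OF x0 col] by blast
  from choice[OF this] obtain V where V: "\<forall>k. k < d \<longrightarrow> V k x0 = col g k \<and> (\<forall>x\<in>mat_tuples r d d. V k x \<in> rad r d x (lv k)) \<and>
    (\<forall>i<d. (\<lambda>x. V k x $ i) \<in> poly_funs r d d)" by (elim exE) (rule that)
  define G where "G x = mat d d (\<lambda>(i, k). V k x $ i)" for x
  have Gc: "G x \<in> carrier_mat d d" for x by (simp add: G_def)
  have "col (G x) k = V k x" if x: "x \<in> mat_tuples r d d" and k: "k < d" for x k
  proof -
    have "V k x \<in> carrier_vec d" using V x k rad_subset by blast
    then show ?thesis using k by (intro eq_vecI) (auto simp: G_def)
  qed
  then have "G x *\<^sub>v v \<in> rad r d x j" if "x \<in> mat_tuples r d d" "v \<in> lvl_space d lv j" for x v j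
    using lvl_space_into_rad[OF that(1) Gc _ that(2)] V that(1) by simp
  moreover have "G x0 = g" using V g by (intro eq_matI) (auto simp: G_def)
  moreover have "(\<lambda>x. G x $$ (i, k)) \<in> poly_funs r d d" if "i < d" "k < d" for i k
    using V that by (simp add: G_def)
  ultimately show ?thesis using Gc by (intro exI[of _ G]) blast
qed

text \<open>Inclusions become equalities by dimension: the known adapted basis at the point makes
  \<open>h * G\<close> preserve every level space, and an invertible matrix doing so has an inverse
  that does so too.\<close>

lemma chart_adapted:
  assumes ad: "adapted r d x lv g h" and G: "inverse_mats d G H"
    and sub: "\<And>j v. v \<in> lvl_space d lv j \<Longrightarrow> G *\<^sub>v v \<in> rad r d x j"
  shows "adapted r d x lv G H"
  unfolding adapted_def
proof (intro conjI allI)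
  have gh: "inverse_mats d g h" and R: "\<And>j. rad r d x j = (*\<^sub>v) g ` lvl_space d lv j" using ad by (auto simp: adapted_def)
  note c = gh[unfolded inverse_mats_def] G[unfolded inverse_mats_def]
  show "inverse_mats d G H" by fact
  fix j
  have hG: "inverse_mats d (h * G) (H * g)"
  proof -
    have carr: "g \<in> carrier_mat d d" "h \<in> carrier_mat d d" "G \<in> carrier_mat d d" "H \<in> carrier_mat d d"
      using c by simp_all
    have "h * G * (H * g) = h * (G * H) * g"
      using carr by (simp add: assoc_mult_mat[of _ d d _ d _ d] mult_carrier_mat[of _ d d _ d])
    then have 1: "h * G * (H * g) = 1\<^sub>m d" using c right_mult_one_mat[OF carr(2)] by simp
    have "H * g * (h * G) = H * (g * h) * G"
      using carr by (simp add: assoc_mult_mat[of _ d d _ d _ d] mult_carrier_mat[of _ d d _ d])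
    then have 2: "H * g * (h * G) = 1\<^sub>m d" using c right_mult_one_mat[OF carr(4)] by simp
    show ?thesis using 1 2 c by (auto simp: inverse_mats_def)
  qed
  have pres: "(h * G) *\<^sub>v v \<in> lvl_space d lv j" if v: "v \<in> lvl_space d lv j" for v
  proof -
    have vc: "v \<in> carrier_vec d" using v by (simp add: lvl_space_def)
    obtain w where w: "w \<in> lvl_space d lv j" "G *\<^sub>v v = g *\<^sub>v w" using sub[OF v] unfolding R by blast
    have "(h * G) *\<^sub>v v = h *\<^sub>v (g *\<^sub>v w)" using assoc_mult_mat_vec[of h d d G d v] c vc w by simp
    also have "\<dots> = w" using inverse_mats_vec[OF inverse_mats_sym[OF gh]] w(1) by (simp add: lvl_space_def)
    finally show ?thesis using w by simp
  qed
  show "rad r d x j = (*\<^sub>v) G ` lvl_space d lv j"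
  proof
    show "(*\<^sub>v) G ` lvl_space d lv j \<subseteq> rad r d x j" using sub by blast
    show "rad r d x j \<subseteq> (*\<^sub>v) G ` lvl_space d lv j"
    proof
      fix u assume "u \<in> rad r d x j"
      then obtain w where w: "w \<in> lvl_space d lv j" "u = g *\<^sub>v w" unfolding R by blast
      have wc: "w \<in> carrier_vec d" using w by (simp add: lvl_space_def)
      have "(H * g) *\<^sub>v w \<in> lvl_space d lv j" by (rule lvl_space_inverse[OF hG pres w(1)])
      moreover have "G *\<^sub>v ((H * g) *\<^sub>v w) = u"
        using assoc_mult_mat_vec[of H d d g d w] c wc w(2) inverse_mats_vec[OF G, of "g *\<^sub>v w"]
          mult_mat_vec_carrier[of g d d w] by simp
      ultimately show "u \<in> (*\<^sub>v) G ` lvl_space d lv j" by blast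
    qed
  qed
qed

definition filtered :: "nat \<Rightarrow> nat \<Rightarrow> (nat \<Rightarrow> nat) \<Rightarrow> 'a::field mat list \<Rightarrow> bool" where
  "filtered r d lv p \<longleftrightarrow> p \<in> lvl_tuples r d lv \<and> (\<forall>j. rad r d p j = lvl_space d lv j)"

lemma filteredI:
  assumes p: "p \<in> mat_tuples r d d" and R: "\<And>j. rad r d p j = lvl_space d lv j"
  shows "filtered r d lv p"
  unfolding filtered_def
proof (intro conjI allI R)
  have "lv k < lv i" if a: "a < r" and i: "i < d" and k: "k < d" and nz: "(p ! a) $$ (i, k) \<noteq> 0" for a i k
  proof -
    have "unit_vec d k \<in> rad r d p (lv k)" unfolding R by (rule unit_vec_lvl_space[OF k]) simp
    then have "p ! a *\<^sub>v unit_vec d k \<in> lvl_space d lv (Suc (lv k))" using rad_mult[OF p a] unfolding R by blast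
    moreover have "(p ! a *\<^sub>v unit_vec d k) $ i = (p ! a) $$ (i, k)"
      using mat_tuplesD(2)[OF p a] i k by (simp add: scalar_prod_right_unit)
    ultimately show ?thesis using nz i by (auto simp: lvl_space_def)
  qed
  then show "p \<in> lvl_tuples r d lv" using p by (auto simp: lvl_tuples_def)
qed

lemma adapted_filtered:
  assumes x: "x \<in> mat_tuples r d d" and ad: "adapted r d x lv g h"
  defines "p \<equiv> map (\<lambda>A. h * A * g) x"
  shows "p \<in> mat_tuples r d d" "\<And>a. a < r \<Longrightarrow> g * p ! a = x ! a * g" "filtered r d lv p"
proof -
  have gh: "inverse_mats d g h" and R: "\<And>j. rad r d x j = (*\<^sub>v) g ` lvl_space d lv j" using ad by (auto simp: adapted_def)
  note c = gh[unfolded inverse_mats_def]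
  have pa: "p ! a = h * x ! a * g" if "a < r" for a using that mat_tuplesD(1)[OF x] by (simp add: p_def)
  show pm: "p \<in> mat_tuples r d d"
  proof (rule mat_tuplesI)
    show "length p = r" using mat_tuplesD(1)[OF x] by (simp add: p_def)
    show "p ! a \<in> carrier_mat d d" if "a < r" for a
      unfolding pa[OF that] using c mat_tuplesD(2)[OF x that] by (intro mult_carrier_mat[of _ d d]) auto
  qed
  show int: "g * p ! a = x ! a * g" if a: "a < r" for a
  proof -
    have carr: "g \<in> carrier_mat d d" "h \<in> carrier_mat d d" using c by simp_all
    have "g * (h * x ! a * g) = (g * h) * (x ! a * g)"
      using carr mat_tuplesD(2)[OF x a] by (simp add: assoc_mult_mat[of _ d d _ d _ d] mult_carrier_mat[of _ d d _ d])
    then show ?thesis unfolding pa[OF a] using c mat_tuplesD(2)[OF x a] by simp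
  qed
  have int': "h * x ! a = p ! a * h" if a: "a < r" for a
  proof -
    have carr: "g \<in> carrier_mat d d" "h \<in> carrier_mat d d" using c by simp_all
    have "h * x ! a * g * h = h * x ! a * (g * h)"
      using carr mat_tuplesD(2)[OF x a] by (simp add: assoc_mult_mat[of _ d d _ d _ d] mult_carrier_mat[of _ d d _ d])
    then show ?thesis unfolding pa[OF a] using c mat_tuplesD(2)[OF x a] by simp
  qed
  have "rad r d p j = lvl_space d lv j" for j
  proof -
    have "rad r d p j = (*\<^sub>v) h ` (*\<^sub>v) g ` lvl_space d lv j"
      using rad_conj[OF x pm inverse_mats_sym[OF gh] int'] unfolding R .
    also have "\<dots> = (\<lambda>v. v) ` lvl_space d lv j"
      unfolding image_image using inverse_mats_vec[OF inverse_mats_sym[OF gh]]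
      by (intro image_cong) (auto simp: lvl_space_def)
    finally show ?thesis by simp
  qed
  then show "filtered r d lv p" by (rule filteredI[OF pm])
qed

lemma adapted_lvl_orbits:
  "x \<in> mat_tuples r d d \<Longrightarrow> adapted r d x lv g h \<Longrightarrow> x \<in> lvl_orbits r d lv"
  using adapted_filtered[of x r d lv g h] unfolding lvl_orbits_def filtered_def adapted_def by blast

section \<open>Level counts\<close>

abbreviation lvl_count :: "nat \<Rightarrow> (nat \<Rightarrow> nat) \<Rightarrow> nat \<Rightarrow> nat" where
  "lvl_count d lv j \<equiv> card {i. i < d \<and> lv i = j}"

lemma identity_factor_card:
  fixes a :: "'i \<Rightarrow> 'j \<Rightarrow> 'a::field"
  assumes "finite S" "finite J"
    and fac: "\<And>i k. i \<in> S \<Longrightarrow> k \<in> S \<Longrightarrow> (if i = k then 1 else 0) = (\<Sum>j\<in>J. a i j * w j k)"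
  shows "card S \<le> card J"
proof (rule ccontr)
  assume "\<not> ?thesis"
  then have "card J < card S" by simp
  from homogeneous_system[OF assms(2,1) this, of a] obtain c where
    c: "\<exists>i\<in>S. c i \<noteq> 0" "\<forall>j\<in>J. (\<Sum>i\<in>S. c i * a i j) = 0" by auto
  have "c k = 0" if k: "k \<in> S" for k
  proof -
    have "c k = (\<Sum>i\<in>S. c i * (if i = k then 1 else 0))" using k assms(1) by (simp add: sum_mult_delta)
    also have "\<dots> = (\<Sum>i\<in>S. \<Sum>j\<in>J. c i * a i j * w j k)"
      by (rule sum.cong) (simp_all add: fac k sum_distrib_left mult.assoc)
    also have "\<dots> = (\<Sum>j\<in>J. (\<Sum>i\<in>S. c i * a i j) * w j k)"
      unfolding sum_distrib_right by (rule sum.swap)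
    also have "\<dots> = 0" using c(2) by simp
    finally show ?thesis .
  qed
  then show False using c(1) by blast
qed

text \<open>In a row of level \<open>Suc j\<close> only columns of level at most \<open>j\<close>
  are nonzero, while vectors of the \<open>j\<close>-th term have no coordinates below level
  \<open>j\<close>. So exactly level \<open>j\<close> contributes to the generation of level
  \<open>Suc j\<close>.\<close>

lemma filtered_generation:
  assumes p: "filtered r d lv p" and i: "i < d" "lv i = Suc j"
  shows "\<exists>u. \<forall>k<d. lv k = Suc j \<longrightarrow> (if i = k then 1 else 0) = (\<Sum>a<r. \<Sum>c\<in>{c. c < d \<and> lv c = j}. (p ! a) $$ (k, c) * u a c)"
proof -
  have pm: "p \<in> mat_tuples r d d" and pl: "p \<in> lvl_tuples r d lv" and R: "\<And>j. rad r d p j = lvl_space d lv j"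
    using p by (auto simp: filtered_def lvl_tuples_def)
  have "unit_vec d i \<in> rad r d p (Suc j)" unfolding R using i by (intro unit_vec_lvl_space) auto
  then obtain u where u: "unit_vec d i = vsum d (\<lambda>a. p ! a *\<^sub>v u a) {..<r}" "\<forall>a<r. u a \<in> lvl_space d lv j"
    unfolding rad.simps(2) R by blast
  show ?thesis
  proof (intro exI[of _ "\<lambda>a c. u a $ c"] allI impI)
    fix k assume k: "k < d" "lv k = Suc j"
    have "(if i = k then 1 else 0) = unit_vec d i $ k" using i k by (simp add: unit_vec_def)
    also have "\<dots> = (\<Sum>a<r. (p ! a *\<^sub>v u a) $ k)" unfolding u(1) using k by simp
    also have "\<dots> = (\<Sum>a<r. \<Sum>c\<in>{c. c < d \<and> lv c = j}. (p ! a) $$ (k, c) * u a $ c)"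
    proof (rule sum.cong)
      fix a assume "a \<in> {..<r}"
      then have a: "a < r" by simp
      have uc: "u a \<in> carrier_vec d" using u(2) a by (auto simp: lvl_space_def)
      have "(p ! a *\<^sub>v u a) $ k = (\<Sum>c<d. (p ! a) $$ (k, c) * u a $ c)"
        by (rule mult_mat_vec_index[OF mat_tuplesD(2)[OF pm a] uc k(1)])
      also have "\<dots> = (\<Sum>c\<in>{c. c < d \<and> lv c = j}. (p ! a) $$ (k, c) * u a $ c)"
      proof (rule sum.mono_neutral_right)
        show "\<forall>c\<in>{..<d} - {c. c < d \<and> lv c = j}. (p ! a) $$ (k, c) * u a $ c = 0"
        proof
          fix c assume c: "c \<in> {..<d} - {c. c < d \<and> lv c = j}"
          show "(p ! a) $$ (k, c) * u a $ c = 0"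
          proof (rule ccontr)
            assume "(p ! a) $$ (k, c) * u a $ c \<noteq> 0"
            then have nz: "(p ! a) $$ (k, c) \<noteq> 0" "u a $ c \<noteq> 0" by simp_all
            have "lv c < lv k" using nz(1) c pl a k(1) unfolding lvl_tuples_def by blast
            moreover have "j \<le> lv c" using nz(2) c u(2) a by (simp add: lvl_space_def)
            ultimately show False using c k by simp
          qed
        qed
      qed auto
      finally show "(p ! a *\<^sub>v u a) $ k = (\<Sum>c\<in>{c. c < d \<and> lv c = j}. (p ! a) $$ (k, c) * u a $ c)" .
    qed simp
    finally show "(if i = k then 1 else 0) = (\<Sum>a<r. \<Sum>c\<in>{c. c < d \<and> lv c = j}. (p ! a) $$ (k, c) * u a $ c)" .
  qed
qed

text \<open>The identity on level \<open>Suc j\<close> factors through \<open>r\<close> copies of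
  level \<open>j\<close>, from which the indices of zero columns can be removed. The set
  \<open>Z\<close> is what later turns a zero column into a sharper inequality.\<close>

lemma filtered_count:
  assumes p: "filtered r d lv p" and Z: "\<And>a i c. a < r \<Longrightarrow> i < d \<Longrightarrow> c < d \<Longrightarrow> c \<in> Z \<Longrightarrow> (p ! a) $$ (i, c) = 0"
  shows "lvl_count d lv (Suc j) \<le> r * card ({c. c < d \<and> lv c = j} - Z)"
proof -
  let ?S = "{i. i < d \<and> lv i = Suc j}" and ?T = "{c. c < d \<and> lv c = j} - Z"
  have "\<forall>i. \<exists>u. i \<in> ?S \<longrightarrow> (\<forall>k<d. lv k = Suc j \<longrightarrow>
      (if i = k then 1 else 0) = (\<Sum>a<r. \<Sum>c\<in>{c. c < d \<and> lv c = j}. (p ! a) $$ (k, c) * u a c))"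
    using filtered_generation[OF p] by blast
  from choice[OF this] obtain u where u: "\<forall>i. i \<in> ?S \<longrightarrow> (\<forall>k<d. lv k = Suc j \<longrightarrow>
      (if i = k then 1 else 0) = (\<Sum>a<r. \<Sum>c\<in>{c. c < d \<and> lv c = j}. (p ! a) $$ (k, c) * u i a c))"
    by (elim exE) (rule that)
  have "card ?S \<le> card ({..<r} \<times> ?T)"
  proof (rule identity_factor_card[where a = "\<lambda>i (a, c). u i a c" and w = "\<lambda>(a, c) k. (p ! a) $$ (k, c)"])
    fix i k assume i: "i \<in> ?S" and k: "k \<in> ?S"
    have "(if i = k then 1 else 0) = (\<Sum>a<r. \<Sum>c\<in>{c. c < d \<and> lv c = j}. (p ! a) $$ (k, c) * u i a c)"
      using u i k by simp
    also have "\<dots> = (\<Sum>a<r. \<Sum>c\<in>?T. (p ! a) $$ (k, c) * u i a c)"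
      by (rule sum.cong, simp, rule sum.mono_neutral_right) (use Z k in auto)
    also have "\<dots> = (\<Sum>ac\<in>{..<r} \<times> ?T. (case ac of (a, c) \<Rightarrow> u i a c) * (case ac of (a, c) \<Rightarrow> (p ! a) $$ (k, c)))"
      by (simp add: sum.cartesian_product split_beta mult.commute)
    finally show "(if i = k then 1 else 0) = (\<Sum>ac\<in>{..<r} \<times> ?T. (case ac of (a, c) \<Rightarrow> u i a c) * (case ac of (a, c) \<Rightarrow> \<lambda>k. (p ! a) $$ (k, c)) k)"
      by (simp add: split_beta)
  qed auto
  then show ?thesis by (simp add: card_cartesian_product)
qed

text \<open>The necessary inequalities are sufficient: they allow each basis vector of level
  \<open>Suc j\<close> to be assigned its own pair of an arrow and a basis vector of level
  \<open>j\<close>, whose image it is declared to be.\<close>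

lemma realizable_levels:
  assumes cnt: "\<And>j. lvl_count d lv (Suc j) \<le> r * lvl_count d lv j"
  shows "\<exists>p. filtered r d lv (p :: 'a::field mat list)"
proof -
  have "\<forall>j. \<exists>f. f ` {i. i < d \<and> lv i = Suc j} \<subseteq> {..<r} \<times> {c. c < d \<and> lv c = j} \<and> inj_on f {i. i < d \<and> lv i = Suc j}"
    by (intro allI card_le_inj) (use cnt in \<open>auto simp: card_cartesian_product\<close>)
  from choice[OF this] obtain f where f: "\<And>j. f j ` {i. i < d \<and> lv i = Suc j} \<subseteq> {..<r} \<times> {c. c < d \<and> lv c = j}"
    "\<And>j. inj_on (f j) {i. i < d \<and> lv i = Suc j}" by blast
  define p where "p = map (\<lambda>a. mat d d (\<lambda>(i, c). if lv i \<noteq> 0 \<and> f (lv i - 1) i = (a, c) then 1 else 0 :: 'a)) [0..<r]"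
  have pm: "p \<in> mat_tuples r d d" by (rule mat_tuplesI) (auto simp: p_def)
  have fm: "lv c = lv i - 1" if "i < d" "lv i \<noteq> 0" "f (lv i - 1) i = (a, c)" for i a c
    using f(1)[of "lv i - 1"] that by (auto simp: image_subset_iff)
  have pl: "p \<in> lvl_tuples r d lv"
  proof -
    have "lv c < lv i" if ia: "a < r" "i < d" "c < d" and nz: "(p ! a) $$ (i, c) \<noteq> 0" for a i c
    proof -
      have "lv i \<noteq> 0" "f (lv i - 1) i = (a, c)" using nz ia by (simp_all add: p_def split: if_splits)
      then show ?thesis using fm[OF ia(2), of a c] by simp
    qed
    then show ?thesis using pm by (simp add: lvl_tuples_def)
  qed
  have e: "unit_vec d i \<in> rad r d p j" if "i < d" "lv i = j" for i j
    using that
  proof (induction j arbitrary: i)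
    case (Suc j)
    obtain a c where ac: "f j i = (a, c)" "a < r" "c < d" "lv c = j"
      using f(1)[of j] Suc.prems by (cases "f j i") (auto simp: image_subset_iff)
    have "p ! a *\<^sub>v unit_vec d c = unit_vec d i"
    proof (rule eq_vecI)
      fix k assume "k < dim_vec (unit_vec d i :: 'a vec)"
      then have k: "k < d" by simp
      have "(p ! a *\<^sub>v unit_vec d c) $ k = (p ! a) $$ (k, c)"
        using mat_tuplesD(2)[OF pm ac(2)] k ac(3) by (simp add: scalar_prod_right_unit)
      also have "\<dots> = (if lv k \<noteq> 0 \<and> f (lv k - 1) k = (a, c) then 1 else 0)"
        using ac k by (simp add: p_def)
      also have "(lv k \<noteq> 0 \<and> f (lv k - 1) k = (a, c)) \<longleftrightarrow> k = i"
      proof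
        assume *: "lv k \<noteq> 0 \<and> f (lv k - 1) k = (a, c)"
        then have "lv k = Suc j" using fm[of k a c] k ac by auto
        then show "k = i" using * inj_onD[OF f(2)[of j], of k i] ac Suc.prems k by simp
      qed (use ac Suc.prems in auto)
      finally show "(p ! a *\<^sub>v unit_vec d c) $ k = unit_vec d i $ k" using k Suc.prems by (simp add: unit_vec_def)
    qed (use mat_tuplesD(2)[OF pm ac(2)] in simp)
    then show ?case using rad_mult[OF pm ac(2) Suc.IH[OF ac(3,4)]] by simp
  qed simp
  have "rad r d p j = lvl_space d lv j" for j
  proof (rule subset_antisym[OF rad_lvl_tuples[OF pl]])
    show "lvl_space d lv j \<subseteq> rad r d p j"
    proof
      fix v :: "'a vec" assume v: "v \<in> lvl_space d lv j"
      have "col (1\<^sub>m d) i = (unit_vec d i :: 'a vec)" if "i < d" for i using that by simp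
      then have "1\<^sub>m d *\<^sub>v v \<in> rad r d p j"
        using e by (intro lvl_space_into_rad[OF pm one_carrier_mat _ v]) simp
      then show "v \<in> rad r d p j" using v by (simp add: lvl_space_def)
    qed
  qed
  then have "filtered r d lv p" using pl by (simp add: filtered_def)
  then show ?thesis by blast
qed

section \<open>Idempotents and splitting vectors\<close>

lemma filtered_endo_lvl_space:
  assumes p: "filtered r d lv p" and E: "E \<in> carrier_mat d d" and com: "\<And>a. a < r \<Longrightarrow> E * p ! a = p ! a * E"
    and v: "v \<in> lvl_space d lv j"
  shows "E *\<^sub>v v \<in> lvl_space d lv j"
proof -
  have pm: "p \<in> mat_tuples r d d" and R: "\<And>j. rad r d p j = lvl_space d lv j"
    using p by (auto simp: filtered_def lvl_tuples_def)
  have "v \<in> rad r d p j" using v unfolding R .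
  then have "E *\<^sub>v v \<in> rad r d p j" by (intro rad_hom[OF pm pm E com])
  then show ?thesis unfolding R .
qed

lemma filtered_endo_entry:
  assumes p: "filtered r d lv p" and E: "E \<in> carrier_mat d d" and com: "\<And>a. a < r \<Longrightarrow> E * p ! a = p ! a * E"
    and ik: "i < d" "k < d" "E $$ (i, k) \<noteq> 0"
  shows "lv k \<le> lv i"
proof -
  have "E *\<^sub>v unit_vec d k \<in> lvl_space d lv (lv k)"
    by (rule filtered_endo_lvl_space[OF p E com unit_vec_lvl_space[OF ik(2)]]) simp_all
  moreover have "(E *\<^sub>v unit_vec d k) $ i = E $$ (i, k)"
    using E ik by (simp add: scalar_prod_right_unit)
  ultimately show ?thesis using ik by (auto simp: lvl_space_def)
qed

text \<open>A vanishing diagonal block makes \<open>E\<close> raise levels from level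
  \<open>l\<close> on, so an idempotent \<open>E\<close> kills that whole term of the flag. A
  nonzero vector fixed by \<open>E\<close> and lying as deep as possible then has level below
  \<open>l\<close> and is annihilated by the arrows.\<close>

lemma split_vector:
  assumes p: "filtered r d lv p" and lvL: "\<And>i. i < d \<Longrightarrow> lv i \<le> L"
    and E: "E \<in> carrier_mat d d" and idem: "E * E = E" and com: "\<And>a. a < r \<Longrightarrow> E * p ! a = p ! a * E"
    and nz: "E \<noteq> 0\<^sub>m d d"
    and blk: "\<And>i k. i < d \<Longrightarrow> k < d \<Longrightarrow> lv i = l \<Longrightarrow> lv k = l \<Longrightarrow> E $$ (i, k) = 0"
  shows "\<exists>v i. i < d \<and> v \<in> lvl_space d lv (lv i) \<and> v $ i \<noteq> 0 \<and> lv i < l \<and> (\<forall>a<r. p ! a *\<^sub>v v = 0\<^sub>v d)"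
proof -
  have pm: "p \<in> mat_tuples r d d" and R: "\<And>j. rad r d p j = lvl_space d lv j"
    using p by (auto simp: filtered_def lvl_tuples_def)
  \<comment> \<open>On the term of level \<open>l\<close> this is the vanishing block; the deeper
    terms are generated by arrows, which commute with \<open>E\<close>.\<close>
  have shift: "E *\<^sub>v v \<in> lvl_space d lv (Suc (l + n))" if "v \<in> lvl_space d lv (l + n)" for v n
    using that
  proof (induction n arbitrary: v)
    case 0
    then have v: "v \<in> lvl_space d lv l" by simp
    have vc: "v \<in> carrier_vec d" using v by (simp add: lvl_space_def)
    have "Suc l \<le> lv i" if i: "i < d" and nzi: "(E *\<^sub>v v) $ i \<noteq> 0" for i
    proof -
      obtain k where k: "k < d" "E $$ (i, k) * v $ k \<noteq> 0"
        using nzi unfolding mult_mat_vec_index[OF E vc i] by (meson lessThan_iff sum.neutral)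
      then have "l \<le> lv k" using v by (auto simp: lvl_space_def)
      moreover have "lv k \<le> lv i" by (rule filtered_endo_entry[OF p E com i k(1)]) (use k in auto)
      ultimately show ?thesis using blk[OF i k(1)] k(2) by (cases "lv i = l") auto
    qed
    then show ?case using E vc by (auto simp: lvl_space_def)
  next
    case (Suc n)
    then have "v \<in> rad r d p (Suc (l + n))" unfolding R by simp
    then obtain u where v: "v = vsum d (\<lambda>a. p ! a *\<^sub>v u a) {..<r}" and u: "\<forall>a<r. u a \<in> lvl_space d lv (l + n)"
      unfolding rad.simps(2) R by blast
    have uc: "a < r \<Longrightarrow> u a \<in> carrier_vec d" for a using u by (auto simp: lvl_space_def)
    have "E *\<^sub>v v = vsum d (\<lambda>a. E *\<^sub>v (p ! a *\<^sub>v u a)) {..<r}"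
      unfolding v by (rule mult_mat_vsum[OF E]) (rule mult_mat_vec_carrier[OF mat_tuplesD(2)[OF pm] uc]; simp)
    also have "\<dots> \<in> lvl_space d lv (Suc (Suc (l + n)))"
    proof (rule vec_subspace_vsum[OF lvl_space_subspace])
      fix a assume "a \<in> {..<r}"
      then have a: "a < r" by simp
      have "E *\<^sub>v (p ! a *\<^sub>v u a) = p ! a *\<^sub>v (E *\<^sub>v u a)"
        using assoc_mult_mat_vec[OF E mat_tuplesD(2)[OF pm a] uc[OF a]]
          assoc_mult_mat_vec[OF mat_tuplesD(2)[OF pm a] E uc[OF a]] com[OF a] by simp
      moreover have "E *\<^sub>v u a \<in> rad r d p (Suc (l + n))" unfolding R using Suc.IH u a by blast
      ultimately show "E *\<^sub>v (p ! a *\<^sub>v u a) \<in> lvl_space d lv (Suc (Suc (l + n)))"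
        using rad_mult[OF pm a] unfolding R by simp
    qed
    finally show ?case by simp
  qed
  have EE: "E *\<^sub>v (E *\<^sub>v v) = E *\<^sub>v v" if "v \<in> carrier_vec d" for v
    using assoc_mult_mat_vec[OF E E that] idem by simp
  \<comment> \<open>The shift is iterated on the same vector \<open>E *\<^sub>v v\<close>, because
    \<open>E\<close> fixes it.\<close>
  have deep: "E *\<^sub>v v \<in> lvl_space d lv (l + n)" if "v \<in> lvl_space d lv l" for v n
  proof (induction n)
    case 0 then show ?case using filtered_endo_lvl_space[OF p E com that] by simp
  next
    case (Suc n)
    then show ?case using shift[OF Suc] EE[of v] that by (simp add: lvl_space_def)
  qed
  have kill: "E *\<^sub>v v = 0\<^sub>v d" if v: "v \<in> lvl_space d lv l" for v
  proof (rule eq_vecI)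
    fix i assume "i < dim_vec (0\<^sub>v d :: 'a vec)"
    then show "(E *\<^sub>v v) $ i = 0\<^sub>v d $ i" using deep[OF v, of "Suc L"] lvL[of i] by (force simp: lvl_space_def)
  qed (use E in simp)
  let ?Fix = "\<lambda>j v. v \<in> lvl_space d lv j \<and> E *\<^sub>v v = v \<and> v \<noteq> 0\<^sub>v d"
  have "\<exists>v\<in>carrier_vec d. E *\<^sub>v v \<noteq> 0\<^sub>v d" using nz mat_eq_zeroI[OF E] by blast
  then obtain v0 where v0: "v0 \<in> carrier_vec d" "E *\<^sub>v v0 \<noteq> 0\<^sub>v d" by blast
  have "?Fix 0 (E *\<^sub>v v0)" using v0 EE[OF v0(1)] E by (auto simp: lvl_space_def)
  then have ex: "\<exists>j. \<exists>v. ?Fix j v" by blast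
  have bound: "j \<le> l" if fixv: "\<exists>v. ?Fix j v" for j
  proof (rule ccontr)
    assume "\<not> j \<le> l"
    obtain v where v: "?Fix j v" using fixv by (elim exE) (rule that)
    then have "v \<in> lvl_space d lv l" using \<open>\<not> j \<le> l\<close> by (auto simp: lvl_space_def)
    then show False using kill v by auto
  qed
  \<comment> \<open>The greatest term of the flag containing a nonzero fixed vector. The arrows send
    such a vector to fixed vectors one term deeper, which must vanish by maximality.\<close>
  define j where "j = (GREATEST j. \<exists>v. ?Fix j v)"
  have "\<exists>v. ?Fix j v" unfolding j_def by (rule GreatestI_ex_nat[OF ex bound])
  then obtain v where v: "?Fix j v" by (elim exE) (rule that)
  have max: "i \<le> j" if "?Fix i w" for i w
    unfolding j_def by (rule Greatest_le_nat[OF _ bound]) (use that in blast)+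
  have vc: "v \<in> carrier_vec d" using v by (simp add: lvl_space_def)
  have zero: "p ! a *\<^sub>v v = 0\<^sub>v d" if a: "a < r" for a
  proof (rule ccontr)
    assume ne: "p ! a *\<^sub>v v \<noteq> 0\<^sub>v d"
    have "v \<in> rad r d p j" unfolding R using v by simp
    then have "p ! a *\<^sub>v v \<in> lvl_space d lv (Suc j)" using rad_mult[OF pm a] unfolding R by blast
    moreover have "E *\<^sub>v (p ! a *\<^sub>v v) = p ! a *\<^sub>v v"
      using assoc_mult_mat_vec[OF E mat_tuplesD(2)[OF pm a] vc]
        assoc_mult_mat_vec[OF mat_tuplesD(2)[OF pm a] E vc] com[OF a] v by simp
    ultimately have "Suc j \<le> j" using ne by (intro max) auto
    then show False by simp
  qed
  have "v \<notin> lvl_space d lv (Suc j)" using max[of v "Suc j"] v by auto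
  then obtain i where i: "i < d" "v $ i \<noteq> 0" "\<not> Suc j \<le> lv i" using vc by (auto simp: lvl_space_def)
  then have lvi: "lv i = j" using v by (force simp: lvl_space_def)
  have "j \<noteq> l" using kill v by auto
  moreover have "j \<le> l" by (rule bound, rule exI[of _ v], rule v)
  ultimately have "j < l" by simp
  then show ?thesis using i v zero lvi by blast
qed

text \<open>\<open>v\<close> replaces the unit vector of index \<open>i0\<close>. Its nonzero
  coordinate there keeps the matrix invertible, and its position in the flag keeps the basis
  adapted.\<close>

lemma kill_column:
  assumes p: "filtered r d lv p" and i0: "i0 < d" and v: "v \<in> lvl_space d lv (lv i0)" "v $ i0 \<noteq> 0"
    and z: "\<And>a. a < r \<Longrightarrow> p ! a *\<^sub>v v = 0\<^sub>v d"
  shows "\<exists>p' g h. filtered r d lv p' \<and> inverse_mats d g h \<and> (\<forall>a<r. g * p' ! a = p ! a * g) \<and>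
    (\<forall>a<r. \<forall>i<d. (p' ! a) $$ (i, i0) = 0)"
proof -
  have pm: "p \<in> mat_tuples r d d" and R: "\<And>j. rad r d p j = lvl_space d lv j"
    using p by (auto simp: filtered_def lvl_tuples_def)
  have vc: "v \<in> carrier_vec d" using v by (simp add: lvl_space_def)
  define g where "g = mat d d (\<lambda>(i, k). if k = i0 then v $ i else if i = k then 1 else 0)"
  define h where "h = mat d d (\<lambda>(i, k). if k = i0 then (if i = i0 then inverse (v $ i0) else - v $ i * inverse (v $ i0))
    else if i = k then 1 else 0)"
  have gc: "g \<in> carrier_mat d d" and hc: "h \<in> carrier_mat d d" by (simp_all add: g_def h_def)
  have gh: "g * h = 1\<^sub>m d"
  proof (rule eq_matI)
    fix i k assume ik: "i < dim_row (1\<^sub>m d :: 'a mat)" "k < dim_col (1\<^sub>m d :: 'a mat)"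
    then have ik: "i < d" "k < d" by simp_all
    have "(g * h) $$ (i, k) = (\<Sum>s<d. g $$ (i, s) * h $$ (s, k))" by (rule index_mult_mat_sum[OF gc hc ik])
    also have "\<dots> = g $$ (i, i0) * h $$ (i0, k) + (\<Sum>s\<in>{..<d} - {i0}. g $$ (i, s) * h $$ (s, k))"
      using i0 by (simp add: sum.remove)
    also have "(\<Sum>s\<in>{..<d} - {i0}. g $$ (i, s) * h $$ (s, k)) = (\<Sum>s\<in>{..<d} - {i0}. h $$ (s, k) * (if s = i then 1 else 0))"
      by (rule sum.cong) (use ik in \<open>auto simp: g_def\<close>)
    also have "\<dots> = (if i \<in> {..<d} - {i0} then h $$ (i, k) else 0)" by (rule sum_mult_delta) simp
    also have "g $$ (i, i0) * h $$ (i0, k) + \<dots> = 1\<^sub>m d $$ (i, k)"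
      using ik i0 v(2) by (auto simp: g_def h_def)
    finally show "(g * h) $$ (i, k) = 1\<^sub>m d $$ (i, k)" .
  qed (use gc hc in auto)
  have hg: "h * g = 1\<^sub>m d" by (rule mat_mult_left_right_inverse[OF gc hc gh])
  have inv: "inverse_mats d g h" using gc hc gh hg by (simp add: inverse_mats_def)
  have colg: "col g i = (if i = i0 then v else unit_vec d i)" if "i < d" for i
    using that vc by (intro eq_vecI) (auto simp: g_def unit_vec_def)
  have "g *\<^sub>v w \<in> rad r d p j" if w: "w \<in> lvl_space d lv j" for w j
    by (rule lvl_space_into_rad[OF pm gc _ w]) (use v(1) in \<open>simp add: colg R unit_vec_lvl_space\<close>)
  moreover have "adapted r d p lv (1\<^sub>m d) (1\<^sub>m d)"
    unfolding adapted_def R by (auto simp: inverse_mats_def lvl_space_def image_iff)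
  ultimately have ad: "adapted r d p lv g h" by (intro chart_adapted[OF _ inv])
  define p' where "p' = map (\<lambda>A. h * A * g) p"
  note ap = adapted_filtered[OF pm ad, folded p'_def]
  have "(p' ! a) $$ (i, i0) = 0" if a: "a < r" and i: "i < d" for a i
  proof -
    note pa = mat_tuplesD(2)[OF pm a]
    have "(p' ! a) $$ (i, i0) = col (p' ! a) i0 $ i" using mat_tuplesD(2)[OF ap(1) a] i i0 by simp
    also have "col (p' ! a) i0 = (h * p ! a) *\<^sub>v col g i0"
      using a mat_tuplesD(1)[OF pm] col_mult2[OF mult_carrier_mat[OF hc pa] gc i0] by (simp add: p'_def)
    also have "\<dots> = h *\<^sub>v (p ! a *\<^sub>v v)" using colg[OF i0] assoc_mult_mat_vec[OF hc pa vc] by simp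
    also have "\<dots> = 0\<^sub>v d" unfolding z[OF a] using hc by (intro eq_vecI) (auto simp: scalar_prod_def)
    finally show ?thesis using i by simp
  qed
  then show ?thesis using ap inv by blast
qed

text \<open>Once its column is zero, the index \<open>i0\<close> occurs in nonzero entries only as a
  row, where a higher level makes the condition weaker.\<close>

lemma lvl_tuples_raise:
  assumes p: "p \<in> lvl_tuples r d lv" and z: "\<And>a i. a < r \<Longrightarrow> i < d \<Longrightarrow> (p ! a) $$ (i, i0) = 0" and k: "lv i0 \<le> k"
  shows "p \<in> lvl_tuples r d (lv(i0 := k))"
  using p z k unfolding lvl_tuples_def by (fastforce simp: fun_upd_def)

section \<open>The Jacobson radical of the truncated path algebra\<close>

abbreviation const_path :: "'a::field \<Rightarrow> nat list \<Rightarrow> 'a" where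
  "const_path c \<equiv> (\<lambda>w. if w = [] then c else 0)"

abbreviation word_path :: "nat list \<Rightarrow> nat list \<Rightarrow> 'a::field" where
  "word_path u \<equiv> (\<lambda>w. if w = u then 1 else 0)"

lemma path_carrier: "p \<in> carrier (path_algebra r) \<longleftrightarrow> finite {w. p w \<noteq> 0} \<and> (\<forall>w. p w \<noteq> 0 \<longrightarrow> set w \<subseteq> {..<r})"
  by (simp add: path_algebra_def)

lemma path_add: "p \<oplus>\<^bsub>path_algebra r\<^esub> q = (\<lambda>w. p w + q w)"
  and path_mult: "p \<otimes>\<^bsub>path_algebra r\<^esub> q = (\<lambda>w. \<Sum>(u, v) \<in> {(u, v). u @ v = w}. p u * q v)"
  and path_zero: "\<zero>\<^bsub>path_algebra r\<^esub> = (\<lambda>w. 0)"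
  and path_one: "\<one>\<^bsub>path_algebra r\<^esub> = const_path 1"
  by (simp_all add: path_algebra_def)

lemma const_path_carrier: "const_path c \<in> carrier (path_algebra r)"
  by (auto simp: path_carrier intro: finite_subset[of _ "{[]}"])

lemma word_path_carrier: "set u \<subseteq> {..<r} \<Longrightarrow> word_path u \<in> carrier (path_algebra r)"
  by (auto simp: path_carrier intro: finite_subset[of _ "{u}"])

lemma path_minus_carrier:
  assumes p: "p \<in> carrier (path_algebra r)"
  shows "(\<lambda>w. - p w) \<in> carrier (path_algebra r)" "\<ominus>\<^bsub>path_algebra r\<^esub> p = (\<lambda>w. - p w :: 'a::field)"
proof -
  interpret A: ring "path_algebra r :: (nat list \<Rightarrow> 'a) ring" by (rule ring_path_algebra)
  show c: "(\<lambda>w. - p w) \<in> carrier (path_algebra r)" using p by (simp add: path_carrier)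
  show "\<ominus>\<^bsub>path_algebra r\<^esub> p = (\<lambda>w. - p w)"
    by (rule A.minus_equality[OF _ p c]) (simp add: path_add path_zero)
qed

lemma path_mult_at: "(p \<otimes>\<^bsub>path_algebra r\<^esub> q) w = (\<Sum>(u, v) \<in> {(u, v). u @ v = w}. p u * q v)"
  by (simp add: path_mult)

lemma path_mult_eq_zeroI:
  assumes "\<And>u v. u @ v = w \<Longrightarrow> p u = 0 \<or> q v = 0"
  shows "(p \<otimes>\<^bsub>path_algebra r\<^esub> q) w = 0"
  unfolding path_mult_at by (rule sum.neutral) (use assms in auto)

lemma path_mult_nil: "(p \<otimes>\<^bsub>path_algebra r\<^esub> q) [] = p [] * q []"
proof -
  have "{(u, v). u @ v = []} = {([], [])}" by auto
  then show ?thesis by (simp add: path_mult_at)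
qed

lemma const_path_mult: "(const_path c \<otimes>\<^bsub>path_algebra r\<^esub> q) = (\<lambda>w. c * q w)"
proof
  fix w
  have "(const_path c \<otimes>\<^bsub>path_algebra r\<^esub> q) w = (\<Sum>(u, v) \<in> {([], w)}. const_path c u * q v)"
    unfolding path_mult_at
    by (rule sum.mono_neutral_right) (auto simp: finite_splits split: if_splits)
  then show "(const_path c \<otimes>\<^bsub>path_algebra r\<^esub> q) w = c * q w" by simp
qed

lemma word_path_mult: "word_path u \<otimes>\<^bsub>path_algebra r\<^esub> word_path v = word_path (u @ v)"
proof
  fix w
  have "(word_path u \<otimes>\<^bsub>path_algebra r\<^esub> word_path v) w = (\<Sum>(u', v') \<in> {(u, v)} \<inter> {(u', v'). u' @ v' = w}. word_path u u' * word_path v v')"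
    unfolding path_mult_at
    by (rule sum.mono_neutral_right) (auto simp: finite_splits split: if_splits)
  also have "\<dots> = word_path (u @ v) w"
    by (cases "u @ v = w") auto
  finally show "(word_path u \<otimes>\<^bsub>path_algebra r\<^esub> word_path v) w = word_path (u @ v) w" .
qed

lemma path_idealI:
  assumes sub: "S \<subseteq> carrier (path_algebra r)" and zero: "(\<lambda>w. 0) \<in> S"
    and add: "\<And>p q. p \<in> S \<Longrightarrow> q \<in> S \<Longrightarrow> (\<lambda>w. p w + q w :: 'a::field) \<in> S"
    and l: "\<And>p q. p \<in> S \<Longrightarrow> q \<in> carrier (path_algebra r) \<Longrightarrow> q \<otimes>\<^bsub>path_algebra r\<^esub> p \<in> S"
    and rr: "\<And>p q. p \<in> S \<Longrightarrow> q \<in> carrier (path_algebra r) \<Longrightarrow> p \<otimes>\<^bsub>path_algebra r\<^esub> q \<in> S"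
  shows "ideal S (path_algebra r)"
proof -
  interpret A: ring "path_algebra r :: (nat list \<Rightarrow> 'a) ring" by (rule ring_path_algebra)
  have "subgroup S (add_monoid (path_algebra r))"
  proof (rule group.subgroupI[OF A.a_group])
    show "S \<subseteq> carrier (add_monoid (path_algebra r))" using sub by simp
    show "S \<noteq> {}" using zero by blast
    show "inv\<^bsub>add_monoid (path_algebra r)\<^esub> p \<in> S" if p: "p \<in> S" for p
    proof -
      have "inv\<^bsub>add_monoid (path_algebra r)\<^esub> p = (\<lambda>w. - p w)"
        using path_minus_carrier(2)[of p r] p sub by (auto simp: a_inv_def)
      also have "\<dots> = const_path (-1) \<otimes>\<^bsub>path_algebra r\<^esub> p" by (simp add: const_path_mult)
      finally show ?thesis using l[OF p const_path_carrier] by simp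
    qed
    show "p \<otimes>\<^bsub>add_monoid (path_algebra r)\<^esub> q \<in> S" if "p \<in> S" "q \<in> S" for p q
      using add[OF that] by (simp add: path_add)
  qed
  then show ?thesis using l rr by (intro idealI ring_path_algebra) auto
qed

text \<open>The span of the paths of length at least \<open>l\<close>: the arrow ideal for
  \<open>l = 1\<close> and, by \<open>trunc_ideal_eq\<close>, the truncation ideal for
  \<open>l = L + 1\<close>.\<close>

definition long_paths :: "nat \<Rightarrow> nat \<Rightarrow> (nat list \<Rightarrow> 'a::field) set" where
  "long_paths r l = {p \<in> carrier (path_algebra r). \<forall>w. length w < l \<longrightarrow> p w = 0}"

lemma long_paths_mult:
  assumes p: "p \<in> long_paths r k" and q: "(q :: nat list \<Rightarrow> 'a::field) \<in> long_paths r l"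
  shows "p \<otimes>\<^bsub>path_algebra r\<^esub> q \<in> long_paths r (k + l)"
proof -
  interpret A: ring "path_algebra r :: (nat list \<Rightarrow> 'a) ring" by (rule ring_path_algebra)
  have "(p \<otimes>\<^bsub>path_algebra r\<^esub> q) w = 0" if "length w < k + l" for w
  proof (rule path_mult_eq_zeroI)
    fix u v assume "u @ v = w"
    then have "length u < k \<or> length v < l" using that by auto
    then show "p u = 0 \<or> q v = 0" using p q by (auto simp: long_paths_def)
  qed
  then show ?thesis using p q by (auto simp: long_paths_def)
qed

lemma long_paths_add:
  assumes "p \<in> long_paths r l" "(q :: nat list \<Rightarrow> 'a::field) \<in> long_paths r l"
  shows "p \<oplus>\<^bsub>path_algebra r\<^esub> q \<in> long_paths r l"
proof -
  interpret A: ring "path_algebra r :: (nat list \<Rightarrow> 'a) ring" by (rule ring_path_algebra)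
  show ?thesis using assms A.a_closed[of p q] by (auto simp: long_paths_def path_add)
qed

lemma long_paths_0: "long_paths r 0 = carrier (path_algebra r)"
  by (simp add: long_paths_def)

lemma ideal_long_paths: "ideal (long_paths r l :: (nat list \<Rightarrow> 'a::field) set) (path_algebra r)"
proof (rule path_idealI)
  show "long_paths r l \<subseteq> carrier (path_algebra r)" by (auto simp: long_paths_def)
  show "(\<lambda>w. 0) \<in> long_paths r l" by (simp add: long_paths_def path_carrier)
  show "(\<lambda>w. p w + q w) \<in> long_paths r l" if "p \<in> long_paths r l" "q \<in> long_paths r l" for p q :: "nat list \<Rightarrow> 'a"
    using long_paths_add[OF that] by (simp add: path_add)
  show "q \<otimes>\<^bsub>path_algebra r\<^esub> p \<in> long_paths r l" "p \<otimes>\<^bsub>path_algebra r\<^esub> q \<in> long_paths r l"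
    if "p \<in> long_paths r l" "q \<in> carrier (path_algebra r)" for p q :: "nat list \<Rightarrow> 'a"
    using long_paths_mult[of q r 0 p l] long_paths_mult[of p r l q 0] that by (simp_all add: long_paths_0)
qed

lemma trunc_ideal_gens: "{word_path w | w. length w = L + 1 \<and> set w \<subseteq> {..<r}} \<subseteq> carrier (path_algebra r)"
  using word_path_carrier by blast

lemma ideal_trunc_ideal: "ideal (trunc_ideal r L :: (nat list \<Rightarrow> 'a::field) set) (path_algebra r)"
proof -
  interpret A: ring "path_algebra r :: (nat list \<Rightarrow> 'a) ring" by (rule ring_path_algebra)
  show ?thesis unfolding trunc_ideal_def by (rule A.genideal_ideal[OF trunc_ideal_gens])
qed

lemma trunc_ideal_minimal:
  assumes "ideal S (path_algebra r)" "\<And>w. length w = L + 1 \<Longrightarrow> set w \<subseteq> {..<r} \<Longrightarrow> word_path w \<in> S"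
  shows "(trunc_ideal r L :: (nat list \<Rightarrow> 'a::field) set) \<subseteq> S"
proof -
  interpret A: ring "path_algebra r :: (nat list \<Rightarrow> 'a) ring" by (rule ring_path_algebra)
  show ?thesis unfolding trunc_ideal_def by (rule A.genideal_minimal[OF assms(1)]) (use assms(2) in blast)
qed

text \<open>A long word is a generator, namely its prefix of length \<open>L + 1\<close>, multiplied
  by the remaining suffix. General elements follow by induction on the finite support.\<close>

lemma trunc_ideal_eq: "trunc_ideal r L = (long_paths r (L + 1) :: (nat list \<Rightarrow> 'a::field) set)"
proof
  show "trunc_ideal r L \<subseteq> (long_paths r (L + 1) :: (nat list \<Rightarrow> 'a::field) set)"
    by (rule trunc_ideal_minimal[OF ideal_long_paths]) (auto simp: long_paths_def word_path_carrier)
  interpret A: ring "path_algebra r :: (nat list \<Rightarrow> 'a) ring" by (rule ring_path_algebra)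
  interpret I: ideal "trunc_ideal r L :: (nat list \<Rightarrow> 'a) set" "path_algebra r" by (rule ideal_trunc_ideal)
  have word: "word_path w \<in> (trunc_ideal r L :: (nat list \<Rightarrow> 'a) set)" if w: "L + 1 \<le> length w" "set w \<subseteq> {..<r}" for w
  proof -
    have t: "set (take (L + 1) w) \<subseteq> {..<r}" "set (drop (L + 1) w) \<subseteq> {..<r}"
      using w(2) set_take_subset[of "L + 1" w] set_drop_subset[of "L + 1" w] by blast+
    have "word_path (take (L + 1) w) \<in> (trunc_ideal r L :: (nat list \<Rightarrow> 'a) set)"
      using A.genideal_self[OF trunc_ideal_gens[of L r]] t w(1) unfolding trunc_ideal_def by force
    from I.I_r_closed[OF this word_path_carrier[OF t(2)]] show ?thesis by (simp add: word_path_mult)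
  qed
  have "p \<in> trunc_ideal r L" if "finite W" "p \<in> long_paths r (L + 1)" "{w. p w \<noteq> 0} = W" for W and p :: "nat list \<Rightarrow> 'a"
    using that
  proof (induction W arbitrary: p rule: finite_induct)
    case empty
    then have "p = \<zero>\<^bsub>path_algebra r\<^esub>" by (auto simp: path_zero)
    then show ?case using I.additive_subgroup_axioms additive_subgroup.zero_closed by metis
  next
    case (insert w W)
    have pw: "p w \<noteq> 0" using insert.prems by blast
    have len: "L + 1 \<le> length w" using insert.prems(1) pw by (metis (mono_tags, lifting) long_paths_def mem_Collect_eq not_le)
    have sw: "set w \<subseteq> {..<r}" using insert.prems(1) pw by (auto simp: long_paths_def path_carrier)
    define q where "q = p(w := 0)"
    have sq: "{v. q v \<noteq> 0} = W" using insert.prems(2) insert.hyps(2) by (auto simp: q_def)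
    have qv: "q v \<noteq> 0 \<Longrightarrow> p v = q v" for v by (auto simp: q_def split: if_splits)
    have "q \<in> long_paths r (L + 1)"
      using insert.prems(1) insert.hyps(1) sq by (auto simp: long_paths_def path_carrier q_def split: if_splits)
    then have q: "q \<in> trunc_ideal r L" using insert.IH sq by blast
    have "const_path (p w) \<otimes>\<^bsub>path_algebra r\<^esub> word_path w \<in> trunc_ideal r L"
      by (rule I.I_l_closed[OF word[OF len sw] const_path_carrier])
    with q have "q \<oplus>\<^bsub>path_algebra r\<^esub> (const_path (p w) \<otimes>\<^bsub>path_algebra r\<^esub> word_path w) \<in> trunc_ideal r L"
      by (rule I.a_closed)
    also have "q \<oplus>\<^bsub>path_algebra r\<^esub> (const_path (p w) \<otimes>\<^bsub>path_algebra r\<^esub> word_path w) = p"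
      by (rule ext) (simp add: path_add const_path_mult q_def)
    finally show ?case .
  qed
  then show "(long_paths r (L + 1) :: (nat list \<Rightarrow> 'a) set) \<subseteq> trunc_ideal r L"
    by (auto simp: long_paths_def path_carrier)
qed

definition path_class :: "nat \<Rightarrow> nat \<Rightarrow> (nat list \<Rightarrow> 'a::field) \<Rightarrow> (nat list \<Rightarrow> 'a) set" where
  "path_class r L p = trunc_ideal r L +>\<^bsub>path_algebra r\<^esub> p"

lemma path_class_mem: "q \<in> path_class r L p \<longleftrightarrow> (\<exists>i\<in>trunc_ideal r L. q = (\<lambda>w. i w + p w))"
  by (auto simp: path_class_def a_r_coset_def r_coset_def path_add)

lemma trunc_algebra_ring: "ring (trunc_algebra r L :: (nat list \<Rightarrow> 'a::field) set ring)"
  unfolding trunc_algebra_def by (rule ideal.quotient_is_ring[OF ideal_trunc_ideal])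

lemma trunc_algebra_carrier: "carrier (trunc_algebra r L) = path_class r L ` carrier (path_algebra r)"
  by (auto simp: trunc_algebra_def FactRing_def A_RCOSETS_def RCOSETS_def path_class_def a_r_coset_def)

lemma trunc_algebra_mult:
  assumes "p \<in> carrier (path_algebra r)" "q \<in> carrier (path_algebra r)"
  shows "path_class r L p \<otimes>\<^bsub>trunc_algebra r L\<^esub> path_class r L q = path_class r L (p \<otimes>\<^bsub>path_algebra r\<^esub> (q :: nat list \<Rightarrow> 'a::field))"
  unfolding trunc_algebra_def path_class_def FactRing_def
  using ideal.rcoset_mult_add[OF ideal_trunc_ideal assms] by simp

lemma trunc_algebra_add:
  assumes "p \<in> carrier (path_algebra r)" "q \<in> carrier (path_algebra r)"
  shows "path_class r L p \<oplus>\<^bsub>trunc_algebra r L\<^esub> path_class r L q = path_class r L (p \<oplus>\<^bsub>path_algebra r\<^esub> (q :: nat list \<Rightarrow> 'a::field))"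
proof -
  interpret I: ideal "trunc_ideal r L :: (nat list \<Rightarrow> 'a) set" "path_algebra r" by (rule ideal_trunc_ideal)
  show ?thesis unfolding trunc_algebra_def path_class_def FactRing_def
    using I.a_rcos_sum[OF assms] by simp
qed

lemma trunc_algebra_one: "\<one>\<^bsub>trunc_algebra r L\<^esub> = path_class r L (const_path 1)"
  by (simp add: trunc_algebra_def path_class_def FactRing_def path_one)

lemma path_class_zero:
  assumes "p \<in> trunc_ideal r L"
  shows "path_class r L (p :: nat list \<Rightarrow> 'a::field) = \<zero>\<^bsub>trunc_algebra r L\<^esub>"
proof -
  interpret I: ideal "trunc_ideal r L :: (nat list \<Rightarrow> 'a) set" "path_algebra r" by (rule ideal_trunc_ideal)
  show ?thesis unfolding trunc_algebra_def path_class_def FactRing_def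
    using I.a_rcos_const[OF assms] by simp
qed

lemma path_class_eq_low:
  assumes "path_class r L p = path_class r L q" "length w \<le> L"
  shows "p w = (q w :: 'a::field)"
proof -
  have "p \<in> path_class r L p"
    unfolding path_class_mem by (rule bexI[of _ "\<lambda>w. 0"]) (simp_all add: trunc_ideal_eq long_paths_def path_carrier)
  then obtain i where "i \<in> trunc_ideal r L" "p = (\<lambda>w. i w + q w)" unfolding assms(1) path_class_mem by blast
  then show ?thesis using assms(2) by (simp add: trunc_ideal_eq long_paths_def)
qed

lemma left_ideal_long_classes: "left_ideal (trunc_algebra r L) (path_class r L ` long_paths r l :: (nat list \<Rightarrow> 'a::field) set set)"
proof -
  interpret T: ring "trunc_algebra r L :: (nat list \<Rightarrow> 'a) set ring" by (rule trunc_algebra_ring)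
  interpret A: ring "path_algebra r :: (nat list \<Rightarrow> 'a) ring" by (rule ring_path_algebra)
  let ?J = "path_class r L ` long_paths r l :: (nat list \<Rightarrow> 'a) set set"
  have lc: "p \<in> carrier (path_algebra r)" if "p \<in> long_paths r l" for p :: "nat list \<Rightarrow> 'a" and l
    using that by (simp add: long_paths_def)
  have mult: "a \<otimes>\<^bsub>trunc_algebra r L\<^esub> b \<in> ?J" if a: "a \<in> carrier (trunc_algebra r L)" and b: "b \<in> ?J" for a b
  proof -
    obtain p q where p: "a = path_class r L p" "p \<in> carrier (path_algebra r)" and q: "b = path_class r L q" "q \<in> long_paths r l"
      using a b unfolding trunc_algebra_carrier by blast
    then show ?thesis using trunc_algebra_mult[OF p(2) lc[OF q(2)]] long_paths_mult[of p r 0 q l]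
      by (simp add: long_paths_0)
  qed
  have sub: "?J \<subseteq> carrier (trunc_algebra r L)" unfolding trunc_algebra_carrier using lc by blast
  have "subgroup ?J (add_monoid (trunc_algebra r L))"
  proof (rule group.subgroupI[OF T.a_group])
    show "?J \<subseteq> carrier (add_monoid (trunc_algebra r L))" using sub by simp
    show "?J \<noteq> {}" using additive_subgroup.zero_closed[OF ideal.axioms(1)[OF ideal_long_paths[of r l]]] by blast
    fix a assume a: "a \<in> ?J"
    have "\<ominus>\<^bsub>trunc_algebra r L\<^esub> a = (\<ominus>\<^bsub>trunc_algebra r L\<^esub> \<one>\<^bsub>trunc_algebra r L\<^esub>) \<otimes>\<^bsub>trunc_algebra r L\<^esub> a"
      using a sub by (simp add: T.l_minus subset_iff)
    then have "\<ominus>\<^bsub>trunc_algebra r L\<^esub> a \<in> ?J" using mult[OF T.a_inv_closed[OF T.one_closed] a] by simp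
    then show "inv\<^bsub>add_monoid (trunc_algebra r L)\<^esub> a \<in> ?J" by (simp only: a_inv_def)
    fix b assume b: "b \<in> ?J"
    obtain p q where "a = path_class r L p" "p \<in> long_paths r l" "b = path_class r L q" "q \<in> long_paths r l" using a b by blast
    then show "a \<otimes>\<^bsub>add_monoid (trunc_algebra r L)\<^esub> b \<in> ?J"
      using trunc_algebra_add[of p r q L] long_paths_add[of p r l q] lc[of p l] lc[of q l] by simp
  qed
  then show ?thesis unfolding left_ideal_def additive_subgroup_def using mult by blast
qed

text \<open>The algebra is local: an element with nonzero constant term generates everything modulo
  paths of positive length, so these form a maximal left ideal. Nilpotency places this ideal inside
  every other maximal left ideal.\<close>

lemma jacobson_radical_trunc_algebra:
  "jacobson_radical (trunc_algebra r L) = (path_class r L ` long_paths r 1 :: (nat list \<Rightarrow> 'a::field) set set)"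
proof -
  interpret T: ring "trunc_algebra r L :: (nat list \<Rightarrow> 'a) set ring" by (rule trunc_algebra_ring)
  interpret A: ring "path_algebra r :: (nat list \<Rightarrow> 'a) ring" by (rule ring_path_algebra)
  let ?T = "trunc_algebra r L :: (nat list \<Rightarrow> 'a) set ring"
  let ?J = "path_class r L ` long_paths r 1 :: (nat list \<Rightarrow> 'a) set set"
  have lc: "p \<in> carrier (path_algebra r)" if "p \<in> long_paths r l" for p :: "nat list \<Rightarrow> 'a" and l
    using that by (simp add: long_paths_def)
  have JT: "?J \<subseteq> carrier ?T" unfolding trunc_algebra_carrier using lc by blast
  have whole: "I' = carrier ?T" if I': "left_ideal ?T I'" and one: "\<one>\<^bsub>?T\<^esub> \<in> I'" for I'
  proof
    show "I' \<subseteq> carrier ?T" using I' by (simp add: left_ideal_def additive_subgroup.a_subset)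
    show "carrier ?T \<subseteq> I'"
    proof
      fix a assume a: "a \<in> carrier ?T"
      then have "a \<otimes>\<^bsub>?T\<^esub> \<one>\<^bsub>?T\<^esub> \<in> I'" using I' one unfolding left_ideal_def by blast
      then show "a \<in> I'" unfolding T.r_one[OF a] .
    qed
  qed
  have nil0: "p [] = 0" if pJ: "path_class r L p \<in> ?J" for p
  proof -
    obtain q where "path_class r L p = path_class r L q" "q \<in> long_paths r 1" using pJ by blast
    then show ?thesis using path_class_eq_low[of r L p q "[]"] by (simp add: long_paths_def)
  qed
  have max: "maximal_left_ideal ?T ?J"
    unfolding maximal_left_ideal_def
  proof (intro conjI allI impI)
    show "left_ideal ?T ?J" by (rule left_ideal_long_classes)
    have "\<one>\<^bsub>?T\<^esub> \<notin> ?J" using nil0[of "const_path 1"] unfolding trunc_algebra_one by auto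
    then show "?J \<noteq> carrier ?T" using T.one_closed by metis
    fix I' assume I': "left_ideal ?T I' \<and> ?J \<subseteq> I'"
    then have sub: "I' \<subseteq> carrier ?T" by (simp add: left_ideal_def additive_subgroup.a_subset)
    show "I' = ?J \<or> I' = carrier ?T"
    proof (cases "I' = ?J")
      case False
      then obtain a where a: "a \<in> I'" "a \<notin> ?J" using I' by blast
      obtain p where p: "a = path_class r L p" "p \<in> carrier (path_algebra r)" using a sub unfolding trunc_algebra_carrier by blast
      have p0: "p [] \<noteq> 0"
      proof
        assume "p [] = 0"
        then have "p \<in> long_paths r 1" using p(2) by (auto simp: long_paths_def)
        then show False using a p by blast
      qed
      \<comment> \<open>Rescaled to constant term 1, the element outside the arrow ideal differs
        from the identity by an element \<open>s\<close> of that ideal; both lie in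
        \<open>I'\<close>.\<close>
      let ?q = "const_path (inverse (p [])) \<otimes>\<^bsub>path_algebra r\<^esub> p"
      have qc: "?q \<in> carrier (path_algebra r)" by (rule A.m_closed[OF const_path_carrier p(2)])
      have "path_class r L (const_path (inverse (p []))) \<otimes>\<^bsub>?T\<^esub> a \<in> I'"
        using I' a(1) const_path_carrier unfolding left_ideal_def trunc_algebra_carrier by blast
      then have qI: "path_class r L ?q \<in> I'" unfolding p(1) trunc_algebra_mult[OF const_path_carrier p(2)] .
      define s where "s = (\<lambda>w. const_path 1 w + - ?q w)"
      have sc: "s \<in> carrier (path_algebra r)"
        using A.a_closed[OF const_path_carrier path_minus_carrier(1)[OF qc], of 1] unfolding s_def path_add .
      have "s [] = 0" using p0 by (simp add: s_def path_mult_nil)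
      then have "s \<in> long_paths r 1" using sc by (auto simp: long_paths_def)
      then have sI: "path_class r L s \<in> I'" using I' by blast
      have "path_class r L s \<oplus>\<^bsub>?T\<^esub> path_class r L ?q \<in> I'"
        using I' sI qI unfolding left_ideal_def by (blast intro: additive_subgroup.a_closed)
      moreover have "s \<oplus>\<^bsub>path_algebra r\<^esub> ?q = const_path 1" by (rule ext) (simp add: s_def path_add)
      ultimately have "\<one>\<^bsub>?T\<^esub> \<in> I'" unfolding trunc_algebra_add[OF sc qc] trunc_algebra_one by simp
      then show ?thesis using whole I' by blast
    qed simp
  qed
  have contains: "?J \<subseteq> K" if K: "maximal_left_ideal ?T K" for K
  proof (rule ccontr)
    assume nsub: "\<not> ?J \<subseteq> K"
    have Kl: "left_ideal ?T K" and Kne: "K \<noteq> carrier ?T"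
      and Kmax: "\<And>I'. left_ideal ?T I' \<Longrightarrow> K \<subseteq> I' \<Longrightarrow> I' = K \<or> I' = carrier ?T"
      using K unfolding maximal_left_ideal_def by blast+
    have Ka: "additive_subgroup K ?T" and Km: "\<And>a x. a \<in> carrier ?T \<Longrightarrow> x \<in> K \<Longrightarrow> a \<otimes>\<^bsub>?T\<^esub> x \<in> K"
      using Kl unfolding left_ideal_def by blast+
    have Jl: "left_ideal ?T ?J" by (rule left_ideal_long_classes)
    then have Ja: "additive_subgroup ?J ?T" and Jm: "\<And>a x. a \<in> carrier ?T \<Longrightarrow> x \<in> ?J \<Longrightarrow> a \<otimes>\<^bsub>?T\<^esub> x \<in> ?J"
      unfolding left_ideal_def by blast+
    have KT: "K \<subseteq> carrier ?T" using additive_subgroup.a_subset[OF Ka] .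
    let ?S = "K <+>\<^bsub>?T\<^esub> ?J"
    have Smem: "s \<in> ?S \<longleftrightarrow> (\<exists>k\<in>K. \<exists>j\<in>?J. s = k \<oplus>\<^bsub>?T\<^esub> j)" for s
      by (auto simp: set_add_def set_mult_def)
    have "left_ideal ?T ?S"
      unfolding left_ideal_def
    proof (intro conjI ballI)
      show "additive_subgroup ?S ?T" by (rule T.add_additive_subgroups[OF Ka Ja])
      fix a s assume a: "a \<in> carrier ?T" and "s \<in> ?S"
      then obtain k j where kj: "k \<in> K" "j \<in> ?J" "s = k \<oplus>\<^bsub>?T\<^esub> j" unfolding Smem by blast
      then have "a \<otimes>\<^bsub>?T\<^esub> s = a \<otimes>\<^bsub>?T\<^esub> k \<oplus>\<^bsub>?T\<^esub> a \<otimes>\<^bsub>?T\<^esub> j"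
        using T.r_distr[of k j a] a KT JT by blast
      then show "a \<otimes>\<^bsub>?T\<^esub> s \<in> ?S" unfolding Smem using Km[OF a kj(1)] Jm[OF a kj(2)] by blast
    qed
    moreover have KS: "K \<subseteq> ?S"
    proof
      fix k assume k: "k \<in> K"
      then have "k = k \<oplus>\<^bsub>?T\<^esub> \<zero>\<^bsub>?T\<^esub>" using KT by (simp add: subset_iff)
      then show "k \<in> ?S" unfolding Smem using k additive_subgroup.zero_closed[OF Ja] by blast
    qed
    moreover have "?S \<noteq> K"
    proof
      assume eq: "?S = K"
      obtain j where j: "j \<in> ?J" "j \<notin> K" using nsub by blast
      have "j = \<zero>\<^bsub>?T\<^esub> \<oplus>\<^bsub>?T\<^esub> j" using j JT by (simp add: subset_iff)
      then have "j \<in> ?S" unfolding Smem using j additive_subgroup.zero_closed[OF Ka] by blast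
      then show False using eq j by simp
    qed
    ultimately have "?S = carrier ?T" using Kmax by blast
    then have "\<one>\<^bsub>?T\<^esub> \<in> ?S" by simp
    then obtain k p where k: "k \<in> K" and p: "p \<in> long_paths r 1" and one: "\<one>\<^bsub>?T\<^esub> = k \<oplus>\<^bsub>?T\<^esub> path_class r L p"
      unfolding Smem by blast
    text \<open>\<open>j ^ i = j ^ i * k + j ^ (i + 1)\<close> descends membership in \<open>K\<close> from \<open>j ^ (L + 1) = 0\<close> to \<open>j ^ 0 = 1\<close>.\<close>
    define j where "j = path_class r L p"
    have jT: "j \<in> carrier ?T" unfolding j_def trunc_algebra_carrier using lc[OF p] by blast
    have pow: "\<exists>q\<in>long_paths r i. j [^]\<^bsub>?T\<^esub> i = path_class r L q" for i :: nat
    proof (induction i)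
      case 0
      show ?case by (rule bexI[of _ "const_path 1"]) (simp_all add: trunc_algebra_one long_paths_0 const_path_carrier)
    next
      case (Suc i)
      then obtain q where q: "q \<in> long_paths r i" "j [^]\<^bsub>?T\<^esub> i = path_class r L q" by blast
      have "j [^]\<^bsub>?T\<^esub> Suc i = path_class r L (q \<otimes>\<^bsub>path_algebra r\<^esub> p)"
        using q trunc_algebra_mult[OF lc[OF q(1)] lc[OF p]] by (simp add: j_def)
      then show ?case using long_paths_mult[OF q(1) p] by auto
    qed
    have "j [^]\<^bsub>?T\<^esub> i \<in> K" if "i \<le> L + 1" for i
      using that
    proof (induction i rule: inc_induct)
      case base
      obtain q where "q \<in> long_paths r (L + 1)" "j [^]\<^bsub>?T\<^esub> (L + 1) = path_class r L q" using pow by blast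
      then show ?case using path_class_zero[of q r L] additive_subgroup.zero_closed[OF Ka] by (simp add: trunc_ideal_eq)
    next
      case (step i)
      have ji: "j [^]\<^bsub>?T\<^esub> i \<in> carrier ?T" using jT by simp
      have kT: "k \<in> carrier ?T" using k KT by blast
      have "j [^]\<^bsub>?T\<^esub> i = j [^]\<^bsub>?T\<^esub> i \<otimes>\<^bsub>?T\<^esub> (k \<oplus>\<^bsub>?T\<^esub> j)" using one ji unfolding j_def[symmetric] by (metis T.r_one)
      also have "\<dots> = j [^]\<^bsub>?T\<^esub> i \<otimes>\<^bsub>?T\<^esub> k \<oplus>\<^bsub>?T\<^esub> j [^]\<^bsub>?T\<^esub> Suc i" using T.r_distr[OF kT jT ji] by simp
      also have "\<dots> \<in> K" using Km[OF ji k] step.IH by (rule additive_subgroup.a_closed[OF Ka])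
      finally show ?case .
    qed
    from this[of 0] have "\<one>\<^bsub>?T\<^esub> \<in> K" by simp
    then show False using whole[OF Kl] Kne by blast
  qed
  show ?thesis unfolding jacobson_radical_def using contains max JT by blast
qed

text \<open>Only this inclusion is stated; the opposite direction is handled on the module, where
  \<open>radical_submodule_eq\<close> climbs one arrow at a time.\<close>

lemma ideal_power_jacobson:
  assumes "b \<in> ideal_power (trunc_algebra r L) (jacobson_radical (trunc_algebra r L)) l"
  shows "\<exists>p\<in>long_paths r l. b = path_class r L (p :: nat list \<Rightarrow> 'a::field)"
  using assms
proof (induction l arbitrary: b)
  case 0 then show ?case by (auto simp: trunc_algebra_carrier long_paths_0)
next
  case (Suc l)
  have lc: "p \<in> carrier (path_algebra r)" if "p \<in> long_paths r l" for p :: "nat list \<Rightarrow> 'a" and l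
    using that by (simp add: long_paths_def)
  from Suc.prems show ?case unfolding ideal_power.simps
  proof (induction b rule: ideal_prod.induct)
    case (prod i j)
    obtain p where p: "p \<in> long_paths r 1" "i = path_class r L p" using prod(1) unfolding jacobson_radical_trunc_algebra by blast
    obtain q where q: "q \<in> long_paths r l" "j = path_class r L q" using Suc.IH[OF prod(2)] by blast
    show ?case using trunc_algebra_mult[OF lc[OF p(1)] lc[OF q(1)]] long_paths_mult[OF p(1) q(1)] p q by auto
  next
    case (sum s1 s2)
    then obtain p q where p: "p \<in> long_paths r (Suc l)" "s1 = path_class r L p" and q: "q \<in> long_paths r (Suc l)" "s2 = path_class r L q" by blast
    show ?case using trunc_algebra_add[OF lc[OF p(1)] lc[OF q(1)]] long_paths_add[OF p(1) q(1)] p q by auto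
  qed
qed

section \<open>The module of a representation\<close>

lemma path_action_carrier [simp]: "path_action d x p v \<in> carrier_vec d"
  by (simp add: path_action_def)

lemma dim_path_action [simp]: "dim_vec (path_action d x p v) = d"
  by (simp add: path_action_def)

lemma smult_index: "u \<in> carrier_vec d \<Longrightarrow> i < d \<Longrightarrow> (c \<cdot>\<^sub>v u) $ i = c * u $ i"
  by auto

lemma path_action_vsum:
  assumes "finite W" "{w. p w \<noteq> 0} \<subseteq> W" and "\<And>w. w \<in> W \<Longrightarrow> word_mat d x w *\<^sub>v v \<in> carrier_vec d"
  shows "path_action d x p v = vsum d (\<lambda>w. p w \<cdot>\<^sub>v (word_mat d x w *\<^sub>v v)) W"
proof (rule eq_vecI)
  fix i assume "i < dim_vec (vsum d (\<lambda>w. p w \<cdot>\<^sub>v (word_mat d x w *\<^sub>v v)) W)"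
  then have i: "i < d" by simp
  have "(\<Sum>w | p w \<noteq> 0. p w * (word_mat d x w *\<^sub>v v) $ i) = (\<Sum>w\<in>W. p w * (word_mat d x w *\<^sub>v v) $ i)"
    by (rule sum.mono_neutral_left) (use assms in auto)
  also have "\<dots> = (\<Sum>w\<in>W. (p w \<cdot>\<^sub>v (word_mat d x w *\<^sub>v v)) $ i)"
    by (rule sum.cong) (use smult_index[OF assms(3) i] in auto)
  finally show "path_action d x p v $ i = vsum d (\<lambda>w. p w \<cdot>\<^sub>v (word_mat d x w *\<^sub>v v)) W $ i"
    using i by (simp add: path_action_def)
qed (simp add: path_action_def)

locale rep_point =
  fixes r L d :: nat and x :: "'a::field mat list"
  assumes xR: "x \<in> Rep r L d"
begin

lemma x: "x \<in> mat_tuples r d d"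
  using xR by (simp add: Rep_def)

abbreviation PA :: "(nat list \<Rightarrow> 'a) ring" where "PA \<equiv> path_algebra r"
abbreviation T :: "(nat list \<Rightarrow> 'a) set ring" where "T \<equiv> trunc_algebra r L"
abbreviation M :: "((nat list \<Rightarrow> 'a) set, 'a vec) module" where "M \<equiv> rep_module d x"

lemma word_vec: "set w \<subseteq> {..<r} \<Longrightarrow> v \<in> carrier_vec d \<Longrightarrow> word_mat d x w *\<^sub>v v \<in> carrier_vec d"
  by (rule mult_mat_vec_carrier[OF word_mat_carrier[OF x]])

lemma path_action_index:
  assumes p: "finite W" "{w. p w \<noteq> 0} \<subseteq> W" "\<And>w. w \<in> W \<Longrightarrow> set w \<subseteq> {..<r}" and v: "v \<in> carrier_vec d" and i: "i < d"
  shows "path_action d x p v $ i = (\<Sum>w\<in>W. p w * (word_mat d x w *\<^sub>v v) $ i)"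
proof -
  have "path_action d x p v = vsum d (\<lambda>w. p w \<cdot>\<^sub>v (word_mat d x w *\<^sub>v v)) W"
    by (rule path_action_vsum[OF p(1,2)]) (rule word_vec[OF p(3) v])
  moreover have "(p w \<cdot>\<^sub>v (word_mat d x w *\<^sub>v v)) $ i = p w * (word_mat d x w *\<^sub>v v) $ i" if "w \<in> W" for w
    by (rule smult_index[OF word_vec[OF p(3)[OF that] v] i])
  ultimately show ?thesis using i by simp
qed

lemma path_carrierD: "p \<in> carrier PA \<Longrightarrow> finite {w. p w \<noteq> 0}" "p \<in> carrier PA \<Longrightarrow> w \<in> {w. p w \<noteq> 0} \<Longrightarrow> set w \<subseteq> {..<r}"
  by (auto simp: path_carrier)

lemma path_action_add:
  assumes p: "p \<in> carrier PA" "q \<in> carrier PA" and v: "v \<in> carrier_vec d"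
  shows "path_action d x (\<lambda>w. p w + q w) v = path_action d x p v + path_action d x q v"
proof (rule eq_vecI)
  let ?W = "{w. p w \<noteq> 0} \<union> {w. q w \<noteq> 0}"
  have W: "finite ?W" "\<And>w. w \<in> ?W \<Longrightarrow> set w \<subseteq> {..<r}" using p by (auto simp: path_carrier)
  fix i assume "i < dim_vec (path_action d x p v + path_action d x q v)"
  then have i: "i < d" by (simp add: path_action_def)
  have "path_action d x (\<lambda>w. p w + q w) v $ i = (\<Sum>w\<in>?W. (p w + q w) * (word_mat d x w *\<^sub>v v) $ i)"
    by (rule path_action_index[OF W(1) _ W(2) v i]) auto
  moreover have "path_action d x p v $ i = (\<Sum>w\<in>?W. p w * (word_mat d x w *\<^sub>v v) $ i)"
    by (rule path_action_index[OF W(1) _ W(2) v i]) auto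
  moreover have "path_action d x q v $ i = (\<Sum>w\<in>?W. q w * (word_mat d x w *\<^sub>v v) $ i)"
    by (rule path_action_index[OF W(1) _ W(2) v i]) auto
  ultimately show "path_action d x (\<lambda>w. p w + q w) v $ i = (path_action d x p v + path_action d x q v) $ i"
    using i by (simp add: distrib_right sum.distrib)
qed (simp add: path_action_def)

lemma path_action_const: "v \<in> carrier_vec d \<Longrightarrow> path_action d x (const_path c) v = c \<cdot>\<^sub>v v"
proof (rule eq_vecI)
  fix i assume v: "v \<in> carrier_vec d" and "i < dim_vec (c \<cdot>\<^sub>v v)"
  then have i: "i < d" by simp
  have "path_action d x (const_path c) v $ i = (\<Sum>w\<in>{[]}. const_path c w * (word_mat d x w *\<^sub>v v) $ i)"
    by (rule path_action_index[OF _ _ _ v i]) (auto split: if_splits)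
  then show "path_action d x (const_path c) v $ i = (c \<cdot>\<^sub>v v) $ i" using i v by (simp add: word_mat_Nil)
qed (simp add: path_action_def)

lemma path_action_word: "set u \<subseteq> {..<r} \<Longrightarrow> v \<in> carrier_vec d \<Longrightarrow> path_action d x (word_path u) v = word_mat d x u *\<^sub>v v"
proof (rule eq_vecI)
  fix i assume u: "set u \<subseteq> {..<r}" and v: "v \<in> carrier_vec d" and "i < dim_vec (word_mat d x u *\<^sub>v v)"
  then have i: "i < d" using carrier_matD(1)[OF word_mat_carrier[OF x u]] by simp
  have "path_action d x (word_path u) v $ i = (\<Sum>w\<in>{u}. word_path u w * (word_mat d x w *\<^sub>v v) $ i)"
    by (rule path_action_index[OF _ _ _ v i]) (use u in \<open>auto split: if_splits\<close>)
  then show "path_action d x (word_path u) v $ i = (word_mat d x u *\<^sub>v v) $ i" by simp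
next
  assume u: "set u \<subseteq> {..<r}"
  show "dim_vec (path_action d x (word_path u) v) = dim_vec (word_mat d x u *\<^sub>v v)"
    using carrier_matD(1)[OF word_mat_carrier[OF x u]] by (simp add: path_action_def)
qed

lemma path_action_mult:
  assumes p: "p \<in> carrier PA" and q: "q \<in> carrier PA" and v: "v \<in> carrier_vec d"
  shows "path_action d x (p \<otimes>\<^bsub>PA\<^esub> q) v = path_action d x p (path_action d x q v)"
proof (rule eq_vecI)
  let ?P = "{w. p w \<noteq> 0}" and ?Q = "{w. q w \<noteq> 0}"
  let ?W = "(\<lambda>(u, v). u @ v) ` (?P \<times> ?Q)"
  note pf = path_carrierD[OF p] and qf = path_carrierD[OF q]
  have W: "finite ?W" "\<And>w. w \<in> ?W \<Longrightarrow> set w \<subseteq> {..<r}"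
  proof -
    show "finite ?W" using pf(1) qf(1) by simp
    fix w assume "w \<in> ?W"
    then obtain u v where uv: "u \<in> ?P" "v \<in> ?Q" "w = u @ v" by auto
    then show "set w \<subseteq> {..<r}" using pf(2)[OF uv(1)] qf(2)[OF uv(2)] by simp
  qed
  have prod: "(p \<otimes>\<^bsub>PA\<^esub> q) w = (\<Sum>uv\<in>{uv \<in> ?P \<times> ?Q. (case uv of (u, v) \<Rightarrow> u @ v) = w}. p (fst uv) * q (snd uv))" for w
    unfolding path_mult_at
    by (rule sum.mono_neutral_cong_right) (auto simp: finite_splits)
  have sup: "{w. (p \<otimes>\<^bsub>PA\<^esub> q) w \<noteq> 0} \<subseteq> ?W"
  proof
    fix w assume "w \<in> {w. (p \<otimes>\<^bsub>PA\<^esub> q) w \<noteq> 0}"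
    then have "{uv \<in> ?P \<times> ?Q. (case uv of (u, v) \<Rightarrow> u @ v) = w} \<noteq> {}" unfolding prod by force
    then show "w \<in> ?W" by auto
  qed
  fix i assume "i < dim_vec (path_action d x p (path_action d x q v))"
  then have i: "i < d" by (simp add: path_action_def)
  let ?f = "\<lambda>u v'. p u * q v' * (word_mat d x (u @ v') *\<^sub>v v) $ i"
  have "path_action d x (p \<otimes>\<^bsub>PA\<^esub> q) v $ i = (\<Sum>w\<in>?W. (p \<otimes>\<^bsub>PA\<^esub> q) w * (word_mat d x w *\<^sub>v v) $ i)"
    by (rule path_action_index[OF W(1) sup W(2) v i])
  also have "\<dots> = (\<Sum>w\<in>?W. \<Sum>uv\<in>{uv \<in> ?P \<times> ?Q. (case uv of (u, v) \<Rightarrow> u @ v) = w}. ?f (fst uv) (snd uv))"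
    unfolding prod sum_distrib_right by (intro sum.cong refl) auto
  also have "\<dots> = (\<Sum>uv\<in>?P \<times> ?Q. ?f (fst uv) (snd uv))"
    by (rule sum.group) (use pf qf W in auto)
  also have "\<dots> = (\<Sum>u\<in>?P. \<Sum>v'\<in>?Q. ?f u v')"
    by (simp add: sum.cartesian_product split_beta)
  also have "\<dots> = (\<Sum>u\<in>?P. p u * (word_mat d x u *\<^sub>v path_action d x q v) $ i)"
  proof (rule sum.cong)
    fix u assume u: "u \<in> ?P"
    have su: "set u \<subseteq> {..<r}" using pf(2)[OF u] .
    note uc = word_mat_carrier[OF x su]
    have qv: "path_action d x q v = vsum d (\<lambda>w. q w \<cdot>\<^sub>v (word_mat d x w *\<^sub>v v)) ?Q"
      by (rule path_action_vsum[OF qf(1)]) (auto intro: word_vec[OF qf(2) v])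
    have "word_mat d x u *\<^sub>v path_action d x q v = vsum d (\<lambda>w. word_mat d x u *\<^sub>v (q w \<cdot>\<^sub>v (word_mat d x w *\<^sub>v v))) ?Q"
      unfolding qv by (rule mult_mat_vsum[OF uc]) (auto intro: word_vec[OF qf(2) v])
    then have "(word_mat d x u *\<^sub>v path_action d x q v) $ i = (\<Sum>w\<in>?Q. (word_mat d x u *\<^sub>v (q w \<cdot>\<^sub>v (word_mat d x w *\<^sub>v v))) $ i)"
      using i by simp
    also have "\<dots> = (\<Sum>w\<in>?Q. q w * (word_mat d x (u @ w) *\<^sub>v v) $ i)"
    proof (rule sum.cong)
      fix w assume w: "w \<in> ?Q"
      have sw: "set w \<subseteq> {..<r}" using qf(2)[OF w] .
      have "word_mat d x u *\<^sub>v (q w \<cdot>\<^sub>v (word_mat d x w *\<^sub>v v)) = q w \<cdot>\<^sub>v (word_mat d x (u @ w) *\<^sub>v v)"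
        unfolding mult_mat_vec[OF uc word_vec[OF sw v]] word_mat_append[OF x su sw]
          assoc_mult_mat_vec[OF uc word_mat_carrier[OF x sw] v] ..
      moreover have "word_mat d x (u @ w) *\<^sub>v v \<in> carrier_vec d" by (rule word_vec) (use su sw v in auto)
      ultimately show "(word_mat d x u *\<^sub>v (q w \<cdot>\<^sub>v (word_mat d x w *\<^sub>v v))) $ i = q w * (word_mat d x (u @ w) *\<^sub>v v) $ i"
        by (simp only: smult_index i)
    qed simp
    finally show "(\<Sum>v'\<in>?Q. ?f u v') = p u * (word_mat d x u *\<^sub>v path_action d x q v) $ i"
      by (simp add: sum_distrib_left mult.assoc)
  qed simp
  also have "\<dots> = path_action d x p (path_action d x q v) $ i"
    by (rule path_action_index[symmetric, OF pf(1) _ pf(2) path_action_carrier i]) auto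
  finally show "path_action d x (p \<otimes>\<^bsub>PA\<^esub> q) v $ i = path_action d x p (path_action d x q v) $ i" .
qed (simp add: path_action_def)

lemma path_action_long:
  assumes p: "p \<in> long_paths r l" and v: "v \<in> carrier_vec d"
  shows "path_action d x p v \<in> rad r d x l"
proof -
  have pc: "p \<in> carrier PA" using p by (simp add: long_paths_def)
  have "path_action d x p v = vsum d (\<lambda>w. p w \<cdot>\<^sub>v (word_mat d x w *\<^sub>v v)) {w. p w \<noteq> 0}"
    by (rule path_action_vsum[OF path_carrierD(1)[OF pc]]) (auto intro: word_vec[OF path_carrierD(2)[OF pc] v])
  also have "\<dots> \<in> rad r d x l"
  proof (rule vec_subspace_vsum[OF rad_subspace[OF x]], rule vec_subspaceD(4)[OF rad_subspace[OF x]])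
    fix w assume w: "w \<in> {w. p w \<noteq> 0}"
    have "l \<le> length w" using p w by (metis (mono_tags, lifting) long_paths_def mem_Collect_eq not_le)
    moreover have "word_mat d x w *\<^sub>v v \<in> rad r d x (length w + 0)"
      by (rule word_mat_rad[OF x path_carrierD(2)[OF pc w]]) (simp add: v)
    ultimately show "word_mat d x w *\<^sub>v v \<in> rad r d x l" using rad_antimono[OF x, of l "length w"] by auto
  qed
  finally show ?thesis .
qed

lemma trunc_ideal_acts_zero:
  assumes "p \<in> trunc_ideal r L" "v \<in> carrier_vec d"
  shows "path_action d x p v = 0\<^sub>v d"
proof -
  have "path_action d x p v \<in> rad r d x (L + 1)"
    using assms unfolding trunc_ideal_eq by (rule path_action_long)
  then show ?thesis using xR unfolding Rep_iff_rad[OF x] by blast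
qed

text \<open>The chosen representative differs from \<open>p\<close> by an element of the truncation
  ideal, and that ideal acts as zero at a point of \<open>Rep r L d\<close>.\<close>

lemma smult_class:
  assumes p: "p \<in> carrier PA" and v: "v \<in> carrier_vec d"
  shows "path_class r L p \<odot>\<^bsub>M\<^esub> v = path_action d x p v"
proof -
  have "p \<in> path_class r L p"
    unfolding path_class_mem by (rule bexI[of _ "\<lambda>w. 0"]) (simp_all add: trunc_ideal_eq long_paths_def path_carrier)
  then have "(SOME q. q \<in> path_class r L p) \<in> path_class r L p" by (rule someI[where P = "\<lambda>q. q \<in> path_class r L p"])
  then obtain i where i: "i \<in> trunc_ideal r L" "(SOME q. q \<in> path_class r L p) = (\<lambda>w. i w + p w)"
    unfolding path_class_mem by blast
  have ic: "i \<in> carrier PA" using i(1) by (simp add: trunc_ideal_eq long_paths_def)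
  have "path_class r L p \<odot>\<^bsub>M\<^esub> v = path_action d x (\<lambda>w. i w + p w) v"
    using i(2) by (simp add: rep_module_def)
  also have "\<dots> = path_action d x p v"
    using path_action_add[OF ic p v] trunc_ideal_acts_zero[OF i(1) v] by simp
  finally show ?thesis .
qed

lemma M_simps: "carrier M = carrier_vec d" "\<zero>\<^bsub>M\<^esub> = 0\<^sub>v d" "add M = (+)"
  by (simp_all add: rep_module_def)

lemma abelian_group_M: "abelian_group M"
proof (rule abelian_groupI)
  show "\<exists>v\<in>carrier M. v \<oplus>\<^bsub>M\<^esub> u = \<zero>\<^bsub>M\<^esub>" if "u \<in> carrier M" for u
    using that by (intro bexI[of _ "- u"]) (auto simp: M_simps)
qed (auto simp: M_simps comm_add_vec)

lemma minus_M:
  assumes u: "u \<in> carrier_vec d"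
  shows "inv\<^bsub>add_monoid M\<^esub> u = (-1) \<cdot>\<^sub>v u"
proof -
  interpret V: abelian_group M by (rule abelian_group_M)
  have "\<ominus>\<^bsub>M\<^esub> u = (-1) \<cdot>\<^sub>v u"
    by (rule V.minus_equality) (use u in \<open>auto simp: M_simps intro!: eq_vecI\<close>)
  then show ?thesis by (simp only: a_inv_def)
qed

lemma subspace_subgroup:
  assumes U: "vec_subspace d U"
  shows "subgroup U (add_monoid M)"
proof -
  interpret V: abelian_group M by (rule abelian_group_M)
  show ?thesis
  proof (rule group.subgroupI[OF V.a_group])
    show "U \<subseteq> carrier (add_monoid M)" using U by (auto simp: M_simps vec_subspace_def)
    show "U \<noteq> {}" using vec_subspaceD(2)[OF U] by blast
    fix u assume u: "u \<in> U"
    show "inv\<^bsub>add_monoid M\<^esub> u \<in> U"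
      unfolding minus_M[OF vec_subspaceD(1)[OF U u]] by (rule vec_subspaceD(4)[OF U u])
    show "u \<otimes>\<^bsub>add_monoid M\<^esub> v \<in> U" if "v \<in> U" for v
      using vec_subspaceD(3)[OF U u that] by (simp add: M_simps)
  qed
qed

lemma arrow_class: "a < r \<Longrightarrow> v \<in> carrier_vec d \<Longrightarrow> path_class r L (word_path [a]) \<odot>\<^bsub>M\<^esub> v = x ! a *\<^sub>v v"
  using smult_class[OF word_path_carrier, of "[a]" v] path_action_word[of "[a]" v] mat_tuplesD(2)[OF x, of a]
  by (simp add: word_mat_Cons word_mat_Nil)

lemma path_action_smult:
  assumes p: "p \<in> carrier PA" and v: "v \<in> carrier_vec d"
  shows "path_action d x p (c \<cdot>\<^sub>v v) = c \<cdot>\<^sub>v path_action d x p v"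
proof -
  have "const_path c \<otimes>\<^bsub>PA\<^esub> p = p \<otimes>\<^bsub>PA\<^esub> const_path c"
  proof
    fix w
    have "(p \<otimes>\<^bsub>PA\<^esub> const_path c) w = (\<Sum>(u, v) \<in> {(w, [])}. p u * const_path c v)"
      unfolding path_mult_at
      by (rule sum.mono_neutral_right) (auto simp: finite_splits split: if_splits)
    then show "(const_path c \<otimes>\<^bsub>PA\<^esub> p) w = (p \<otimes>\<^bsub>PA\<^esub> const_path c) w" by (simp add: const_path_mult)
  qed
  then show ?thesis
    using path_action_mult[OF p const_path_carrier v, of c] path_action_mult[OF const_path_carrier p v, of c]
      path_action_const[OF v, of c] path_action_const[OF path_action_carrier, of c] by simp
qed

text \<open>One inclusion holds because elements of the \<open>l\<close>-th ideal power are classes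
  of paths of length at least \<open>l\<close>. The other is an induction: the arrows lie in the
  radical and send generators for \<open>l\<close> to generators for \<open>Suc l\<close>.\<close>

lemma radical_submodule_eq: "radical_submodule T M l = rad r d x l"
proof -
  let ?J = "jacobson_radical T"
  let ?S = "\<lambda>l. {a \<odot>\<^bsub>M\<^esub> m | a m. a \<in> ideal_power T ?J l \<and> m \<in> carrier M}"
  let ?G = "\<lambda>l. generate (add_monoid M) (?S l)"
  interpret V: abelian_group M by (rule abelian_group_M)
  have gen: "\<exists>p m. h = path_action d x p m \<and> p \<in> long_paths r l \<and> p \<in> carrier PA \<and> m \<in> carrier_vec d \<and>
      path_class r L p \<in> ideal_power T ?J l" if hS: "h \<in> ?S l" for h l
  proof -
    obtain b m where h: "h = b \<odot>\<^bsub>M\<^esub> m" "b \<in> ideal_power T ?J l" "m \<in> carrier_vec d" using hS by (auto simp: M_simps)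
    obtain p where p: "p \<in> long_paths r l" "b = path_class r L p" using ideal_power_jacobson[OF h(2)] by blast
    have pc: "p \<in> carrier PA" using p by (simp add: long_paths_def)
    show ?thesis using h p pc smult_class[OF pc h(3)] by (intro exI[of _ p] exI[of _ m]) simp
  qed
  have genI: "path_action d x p m \<in> ?S l"
    if "path_class r L p \<in> ideal_power T ?J l" "p \<in> carrier PA" "m \<in> carrier_vec d" for p m l
    using that(1,3) smult_class[OF that(2,3)] by (auto simp: M_simps intro!: exI[of _ "path_class r L p"] exI[of _ m])
  \<comment> \<open>\<open>generate\<close> yields only an additive subgroup; it is a subspace
    because the set of generators is stable under scalars.\<close>
  have scale: "c \<cdot>\<^sub>v h \<in> ?S l" if hS: "h \<in> ?S l" for c h l
  proof -
    obtain p m where h: "h = path_action d x p m" "p \<in> carrier PA" "m \<in> carrier_vec d" "path_class r L p \<in> ideal_power T ?J l"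
      using gen[OF hS] by (elim exE conjE) (rule that)
    show ?thesis unfolding h(1) path_action_smult[OF h(2,3), symmetric] by (rule genI[OF h(4,2)]) (simp add: h(3))
  qed
  have Sc: "h \<in> carrier_vec d" if hS: "h \<in> ?S l" for h l
    using gen[OF hS] by auto
  have arrow0: "x ! a *\<^sub>v h \<in> ?S (Suc l)" if a: "a < r" and hS: "h \<in> ?S l" for a h l
  proof -
    obtain p m where h: "h = path_action d x p m" "p \<in> carrier PA" "m \<in> carrier_vec d" "path_class r L p \<in> ideal_power T ?J l"
      using gen[OF hS] by (elim exE conjE) (rule that)
    have wc: "word_path [a] \<in> carrier PA" by (rule word_path_carrier) (simp add: a)
    have "path_class r L (word_path [a]) \<in> ?J"
      unfolding jacobson_radical_trunc_algebra using wc by (auto simp: long_paths_def)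
    then have "path_class r L (word_path [a]) \<otimes>\<^bsub>T\<^esub> path_class r L p \<in> ideal_power T ?J (Suc l)"
      using ideal_prod.prod[OF _ h(4)] by simp
    then have bP: "path_class r L (word_path [a] \<otimes>\<^bsub>PA\<^esub> p) \<in> ideal_power T ?J (Suc l)"
      unfolding trunc_algebra_mult[OF wc h(2)] .
    have mc: "word_path [a] \<otimes>\<^bsub>PA\<^esub> p \<in> carrier PA"
      by (rule monoid.m_closed[OF ring.is_monoid[OF ring_path_algebra] wc h(2)])
    have "x ! a *\<^sub>v h = path_action d x (word_path [a] \<otimes>\<^bsub>PA\<^esub> p) m"
      using path_action_mult[OF wc h(2,3)] h(1) path_action_word[of "[a]" "path_action d x p m"] a mat_tuplesD(2)[OF x a]
      by (simp add: word_mat_Cons word_mat_Nil)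
    then show ?thesis using genI[OF bP mc h(3)] by simp
  qed
  have up: "?G l \<subseteq> rad r d x l" for l
  proof (rule group.generate_subgroup_incl[OF V.a_group _ subspace_subgroup[OF rad_subspace[OF x]]], rule subsetI)
    fix h assume hS: "h \<in> ?S l"
    obtain p m where h: "h = path_action d x p m" "p \<in> long_paths r l" "m \<in> carrier_vec d"
      using gen[OF hS] by (elim exE conjE) (rule that)
    show "h \<in> rad r d x l" unfolding h(1) by (rule path_action_long[OF h(2,3)])
  qed
  have Gc: "?G l \<subseteq> carrier_vec d" for l using up rad_subset by blast
  have inv_gen: "inv\<^bsub>add_monoid M\<^esub> h \<in> ?S l" if "h \<in> ?S l" for h l
    unfolding minus_M[OF Sc[OF that]] by (rule scale[OF that])
  have sub: "vec_subspace d (?G l)" for l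
    unfolding vec_subspace_def
  proof (intro conjI ballI allI)
    show "?G l \<subseteq> carrier_vec d" by (rule Gc)
    show "0\<^sub>v d \<in> ?G l" using generate.one[of "add_monoid M"] by (simp add: M_simps)
    show "u + v \<in> ?G l" if "u \<in> ?G l" "v \<in> ?G l" for u v
      using generate.eng[OF that] by (simp add: M_simps)
    fix c u assume "u \<in> ?G l"
    then show "c \<cdot>\<^sub>v u \<in> ?G l"
    proof (induction u rule: generate.induct)
      case one
      have "c \<cdot>\<^sub>v 0\<^sub>v d = 0\<^sub>v d" by (intro eq_vecI) auto
      then show ?case using generate.one[of "add_monoid M"] by (simp add: M_simps)
    next
      case (incl h) show ?case by (rule generate.incl[OF scale[OF incl]])
    next
      case (inv h) show ?case by (rule generate.incl[OF scale[OF inv_gen[OF inv]]])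
    next
      case (eng h1 h2)
      have "h1 \<in> carrier_vec d" "h2 \<in> carrier_vec d" using eng.hyps Gc by blast+
      then have "c \<cdot>\<^sub>v (h1 \<otimes>\<^bsub>add_monoid M\<^esub> h2) = (c \<cdot>\<^sub>v h1) \<otimes>\<^bsub>add_monoid M\<^esub> (c \<cdot>\<^sub>v h2)"
        by (simp add: M_simps smult_add_distrib_vec)
      then show ?case using generate.eng[OF eng.IH] by simp
    qed
  qed
  have down: "rad r d x l \<subseteq> ?G l" for l
  proof (induction l)
    case 0
    show ?case
    proof
      fix v assume v: "v \<in> rad r d x 0"
      have "path_action d x (const_path 1) v \<in> ?S 0"
        by (rule genI) (use v in \<open>simp_all add: trunc_algebra_carrier const_path_carrier\<close>)
      then show "v \<in> ?G 0" using v path_action_const[of v 1] by (intro generate.incl) simp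
    qed
  next
    case (Suc l)
    have arrow: "x ! a *\<^sub>v u \<in> ?G (Suc l)" if a: "a < r" and u: "u \<in> ?G l" for a u
      using u
    proof (induction u rule: generate.induct)
      case one
      have "x ! a *\<^sub>v 0\<^sub>v d = 0\<^sub>v d" using mat_tuplesD(2)[OF x a] by (intro eq_vecI) (auto simp: scalar_prod_def)
      moreover have "\<one>\<^bsub>add_monoid M\<^esub> = 0\<^sub>v d" by (simp add: M_simps)
      ultimately show ?case using vec_subspaceD(2)[OF sub[of "Suc l"]] by (simp only:)
    next
      case (incl h) show ?case by (rule generate.incl[OF arrow0[OF a incl]])
    next
      case (inv h) show ?case by (rule generate.incl[OF arrow0[OF a inv_gen[OF inv]]])
    next
      case (eng h1 h2)
      have c: "h1 \<in> carrier_vec d" "h2 \<in> carrier_vec d" using eng.hyps Gc by blast+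
      then have "x ! a *\<^sub>v (h1 \<otimes>\<^bsub>add_monoid M\<^esub> h2) = x ! a *\<^sub>v h1 + x ! a *\<^sub>v h2"
        using mult_add_distrib_mat_vec[OF mat_tuplesD(2)[OF x a] c] by (simp add: M_simps)
      then show ?case using vec_subspaceD(3)[OF sub eng.IH] by (simp only:)
    qed
    show ?case
    proof
      fix v assume "v \<in> rad r d x (Suc l)"
      then obtain u where v: "v = vsum d (\<lambda>a. x ! a *\<^sub>v u a) {..<r}" and u: "\<forall>a<r. u a \<in> rad r d x l" by auto
      show "v \<in> ?G (Suc l)" unfolding v
        by (rule vec_subspace_vsum[OF sub]) (use u Suc arrow in blast)
    qed
  qed
  show ?thesis unfolding radical_submodule_def ideal_smult_def using up down by blast
qed


end

section \<open>Dimensions of the radical layers\<close>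

text \<open>The entries of \<open>\<S>\<close> are known only through an isomorphism with a radical
  layer, so the vector space axioms themselves are transported along \<open>f\<close> before
  dimensions are compared.\<close>

lemma vectorspace_dim_transfer:
  fixes V :: "('a::field, 'm) module"
  assumes bij: "bij_betw f (carrier_vec n) (carrier V)" and zero: "f (0\<^sub>v n) = \<zero>\<^bsub>V\<^esub>"
    and add: "\<And>u v. u \<in> carrier_vec n \<Longrightarrow> v \<in> carrier_vec n \<Longrightarrow> f (u + v) = f u \<oplus>\<^bsub>V\<^esub> f v"
    and smult: "\<And>c u. u \<in> carrier_vec n \<Longrightarrow> f (c \<cdot>\<^sub>v u) = c \<odot>\<^bsub>V\<^esub> f u"
  shows "vectorspace.dim class_ring V = n"
proof -
  have fc: "f u \<in> carrier V" if "u \<in> carrier_vec n" for u using bij that by (auto simp: bij_betw_def)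
  have ex: "\<exists>u\<in>carrier_vec n. v = f u" if "v \<in> carrier V" for v using bij that by (auto simp: bij_betw_def)
  have ab: "abelian_group V"
  proof (rule abelian_groupI)
    fix v w assume "v \<in> carrier V" "w \<in> carrier V"
    then obtain u1 u2 where u: "u1 \<in> carrier_vec n" "v = f u1" "u2 \<in> carrier_vec n" "w = f u2" using ex by metis
    show "v \<oplus>\<^bsub>V\<^esub> w \<in> carrier V" unfolding u using add[OF u(1,3)] fc[of "u1 + u2"] u by simp
    show "v \<oplus>\<^bsub>V\<^esub> w = w \<oplus>\<^bsub>V\<^esub> v" unfolding u using add[OF u(1,3)] add[OF u(3,1)] comm_add_vec[OF u(1,3)] by simp
    fix z assume "z \<in> carrier V"
    then obtain u3 where u3: "u3 \<in> carrier_vec n" "z = f u3" using ex by metis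
    have "f (u1 + u2 + u3) = f (u1 + (u2 + u3))" using assoc_add_vec[OF u(1,3) u3(1)] by simp
    then show "v \<oplus>\<^bsub>V\<^esub> w \<oplus>\<^bsub>V\<^esub> z = v \<oplus>\<^bsub>V\<^esub> (w \<oplus>\<^bsub>V\<^esub> z)"
      using add[of "u1 + u2" u3] add[of u1 "u2 + u3"] add[of u1 u2] add[of u2 u3] u u3 by simp
  next
    show "\<zero>\<^bsub>V\<^esub> \<in> carrier V" using fc[of "0\<^sub>v n"] zero by simp
    fix v assume "v \<in> carrier V"
    then obtain u where u: "u \<in> carrier_vec n" "v = f u" using ex by metis
    show "\<zero>\<^bsub>V\<^esub> \<oplus>\<^bsub>V\<^esub> v = v" using add[of "0\<^sub>v n" u] u zero by simp
    have "f (- u + u) = \<zero>\<^bsub>V\<^esub>" using u zero by simp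
    then show "\<exists>y\<in>carrier V. y \<oplus>\<^bsub>V\<^esub> v = \<zero>\<^bsub>V\<^esub>"
      using add[of "- u" u] u fc[of "- u"] by (intro bexI[of _ "f (- u)"]) auto
  qed
  have mod: "module class_ring V"
  proof (rule moduleI[OF class_cring.is_cring ab])
    fix a b :: 'a and v w assume "v \<in> carrier V" "w \<in> carrier V"
    then obtain u1 u2 where u: "u1 \<in> carrier_vec n" "v = f u1" "u2 \<in> carrier_vec n" "w = f u2" using ex by metis
    show "a \<odot>\<^bsub>V\<^esub> v \<in> carrier V" using smult[OF u(1), of a] fc[of "a \<cdot>\<^sub>v u1"] u by simp
    show "(a \<oplus>\<^bsub>class_ring\<^esub> b) \<odot>\<^bsub>V\<^esub> v = a \<odot>\<^bsub>V\<^esub> v \<oplus>\<^bsub>V\<^esub> b \<odot>\<^bsub>V\<^esub> v"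
      using smult[OF u(1), of a] smult[OF u(1), of b] smult[OF u(1), of "a + b"] add[of "a \<cdot>\<^sub>v u1" "b \<cdot>\<^sub>v u1"] u
      by (simp add: add_smult_distrib_vec)
    show "a \<odot>\<^bsub>V\<^esub> (v \<oplus>\<^bsub>V\<^esub> w) = a \<odot>\<^bsub>V\<^esub> v \<oplus>\<^bsub>V\<^esub> a \<odot>\<^bsub>V\<^esub> w"
      using smult[OF u(1), of a] smult[OF u(3), of a] smult[of "u1 + u2" a] add[OF u(1,3)] add[of "a \<cdot>\<^sub>v u1" "a \<cdot>\<^sub>v u2"] u
      by (simp add: smult_add_distrib_vec)
    show "(a \<otimes>\<^bsub>class_ring\<^esub> b) \<odot>\<^bsub>V\<^esub> v = a \<odot>\<^bsub>V\<^esub> (b \<odot>\<^bsub>V\<^esub> v)"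
      using smult[OF u(1), of "a * b"] smult[of "b \<cdot>\<^sub>v u1" a] smult[OF u(1), of b] u
      by (simp add: smult_smult_assoc)
    show "\<one>\<^bsub>class_ring\<^esub> \<odot>\<^bsub>V\<^esub> v = v" using smult[OF u(1), of 1] u by simp
  qed
  interpret W: vectorspace class_ring V
    unfolding vectorspace_def using mod class_field by blast
  interpret N: vec_space "TYPE('a)" n .
  have hom: "mod_hom class_ring (module_vec TYPE('a) n) V f"
    unfolding mod_hom_def mod_hom_axioms_def module_hom_def
    using mod N.module_axioms fc add smult by (auto simp: module_vec_simps)
  interpret lm: linear_map class_ring "module_vec TYPE('a) n" V f
    unfolding linear_map_def using N.vectorspace_axioms W.vectorspace_axioms hom by blast
  have "N.dim = W.dim"
    by (rule lm.dim_eq[OF N.fin_dim]) (use bij in \<open>auto simp: bij_betw_def module_vec_simps\<close>)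
  then show ?thesis using N.dim_is_n by simp
qed


lemma translate_eq_iff:
  assumes N: "vec_subspace d N" and u: "u \<in> carrier_vec d" and v: "v \<in> carrier_vec d"
  shows "(\<lambda>h. h + u) ` N = (\<lambda>h. h + v) ` N \<longleftrightarrow> (\<exists>h\<in>N. u = h + v)"
proof
  assume eq: "(\<lambda>h. h + u) ` N = (\<lambda>h. h + v) ` N"
  have "0\<^sub>v d + u \<in> (\<lambda>h. h + u) ` N" using vec_subspaceD(2)[OF N] by blast
  then show "\<exists>h\<in>N. u = h + v" unfolding eq using u by auto
next
  assume "\<exists>h\<in>N. u = h + v"
  then obtain k where k: "k \<in> N" "u = k + v" by blast
  have kc: "k \<in> carrier_vec d" by (rule vec_subspaceD(1)[OF N k(1)])
  show "(\<lambda>h. h + u) ` N = (\<lambda>h. h + v) ` N"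
  proof (intro subset_antisym image_subsetI)
    fix h assume h: "h \<in> N"
    have hc: "h \<in> carrier_vec d" by (rule vec_subspaceD(1)[OF N h])
    show "h + u \<in> (\<lambda>h. h + v) ` N"
      by (rule image_eqI[of _ _ "h + k"]) (use k kc hc v vec_subspaceD(3)[OF N h k(1)] in auto)
    show "h + v \<in> (\<lambda>h. h + u) ` N"
      by (rule image_eqI[of _ _ "h + (-1) \<cdot>\<^sub>v k"])
        (use k kc hc v vec_subspaceD(3)[OF N h vec_subspaceD(4)[OF N k(1)]] in \<open>auto intro!: eq_vecI\<close>)
  qed
qed

context rep_point
begin

text \<open>The scalar action of \<open>quot_module\<close> is a union over all representatives of a
  coset; its rule contains the fact that all of them give the same coset.\<close>

lemma radical_layer_simps:
  fixes l :: nat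
  defines "N \<equiv> rad r d x (Suc l)"
  defines "cs \<equiv> \<lambda>v. (\<lambda>h. h + v) ` N"
  shows "carrier (radical_layer T M l) = cs ` rad r d x l"
    and "\<zero>\<^bsub>radical_layer T M l\<^esub> = cs (0\<^sub>v d)"
    and "u \<in> carrier_vec d \<Longrightarrow> v \<in> carrier_vec d \<Longrightarrow> cs u \<oplus>\<^bsub>radical_layer T M l\<^esub> cs v = cs (u + v)"
    and "v \<in> carrier_vec d \<Longrightarrow> path_class r L (const_path c) \<odot>\<^bsub>radical_layer T M l\<^esub> cs v = cs (c \<cdot>\<^sub>v v)"
proof -
  have N: "vec_subspace d N" unfolding N_def by (rule rad_subspace[OF x])
  have Nc: "h \<in> carrier_vec d" if "h \<in> N" for h by (rule vec_subspaceD(1)[OF N that])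
  show "carrier (radical_layer T M l) = cs ` rad r d x l"
    unfolding radical_layer_def quot_module_def radical_submodule_eq
    by (auto simp: A_RCOSETS_def RCOSETS_def r_coset_def cs_def N_def M_simps)
  show "\<zero>\<^bsub>radical_layer T M l\<^esub> = cs (0\<^sub>v d)"
    unfolding radical_layer_def quot_module_def radical_submodule_eq
    using Nc by (force simp: cs_def N_def)
  show "cs u \<oplus>\<^bsub>radical_layer T M l\<^esub> cs v = cs (u + v)" if u: "u \<in> carrier_vec d" and v: "v \<in> carrier_vec d" for u v
  proof -
    have "cs u \<oplus>\<^bsub>radical_layer T M l\<^esub> cs v = {a + b | a b. a \<in> cs u \<and> b \<in> cs v}"
      unfolding radical_layer_def quot_module_def radical_submodule_eq
      by (auto simp: set_add_def set_mult_def M_simps)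
    also have "\<dots> = cs (u + v)"
    proof (intro subset_antisym subsetI)
      fix z assume "z \<in> {a + b | a b. a \<in> cs u \<and> b \<in> cs v}"
      then obtain h k where hk: "h \<in> N" "k \<in> N" "z = h + u + (k + v)" unfolding cs_def by blast
      have "z = (h + k) + (u + v)" using Nc[OF hk(1)] Nc[OF hk(2)] u v unfolding hk(3) by (intro eq_vecI) auto
      then show "z \<in> cs (u + v)" unfolding cs_def using vec_subspaceD(3)[OF N hk(1,2)] by blast
    next
      fix z assume "z \<in> cs (u + v)"
      then obtain h where h: "h \<in> N" "z = h + (u + v)" unfolding cs_def by blast
      have "z = (h + u) + (0\<^sub>v d + v)" using Nc[OF h(1)] u v unfolding h(2) by (intro eq_vecI) auto
      then show "z \<in> {a + b | a b. a \<in> cs u \<and> b \<in> cs v}" unfolding cs_def using h(1) vec_subspaceD(2)[OF N] by blast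
    qed
    finally show ?thesis .
  qed
  show "path_class r L (const_path c) \<odot>\<^bsub>radical_layer T M l\<^esub> cs v = cs (c \<cdot>\<^sub>v v)" if v: "v \<in> carrier_vec d" for v c
  proof -
    have sm: "path_class r L (const_path c) \<odot>\<^bsub>M\<^esub> m = c \<cdot>\<^sub>v m" if "m \<in> carrier_vec d" for m
      using smult_class[OF const_path_carrier that] path_action_const[OF that] by simp
    have csc: "m \<in> carrier_vec d" if "m \<in> cs v" for m using that Nc v unfolding cs_def by auto
    have "path_class r L (const_path c) \<odot>\<^bsub>radical_layer T M l\<^esub> cs v = (\<Union>m\<in>cs v. (\<lambda>h. h + path_class r L (const_path c) \<odot>\<^bsub>M\<^esub> m) ` N)"
      unfolding radical_layer_def quot_module_def radical_submodule_eq
      by (simp add: a_r_coset_def r_coset_def M_simps N_def UN_singleton image_def) blast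
    also have "\<dots> = (\<Union>m\<in>cs v. cs (c \<cdot>\<^sub>v m))"
      by (rule SUP_cong[OF refl]) (simp only: sm[OF csc], simp only: cs_def)
    also have "\<dots> = (\<Union>m\<in>cs v. cs (c \<cdot>\<^sub>v v))"
    proof (rule SUP_cong[OF refl])
      fix m assume "m \<in> cs v"
      then obtain h where h: "h \<in> N" "m = h + v" unfolding cs_def by blast
      show "cs (c \<cdot>\<^sub>v m) = cs (c \<cdot>\<^sub>v v)" unfolding cs_def
        by (subst translate_eq_iff[OF N])
          (use h Nc[OF h(1)] v vec_subspaceD(4)[OF N h(1)] in \<open>auto simp: smult_add_distrib_vec intro!: bexI[of _ "c \<cdot>\<^sub>v h"]\<close>)
    qed
    also have "\<dots> = cs (c \<cdot>\<^sub>v v)"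
    proof -
      have "cs v \<noteq> {}" unfolding cs_def using vec_subspaceD(2)[OF N] by blast
      then show ?thesis by simp
    qed
    finally show ?thesis .
  qed
qed

text \<open>In an adapted basis the vectors of level exactly \<open>l\<close> represent a basis of
  the \<open>l\<close>-th layer. The map \<open>\<phi>\<close> places coordinate vectors at these
  positions and passes to cosets.\<close>

lemma radical_layer_dim:
  fixes S :: "((nat list \<Rightarrow> 'a) set, 'm) module"
  assumes ad: "adapted r d x lv g h" and iso: "isomorphic_modules T (radical_layer T M l) S"
  shows "module_dim r L S = lvl_count d lv l"
proof -
  define N where "N = rad r d x (Suc l)"
  define cs where "cs v = (\<lambda>h. h + v) ` N" for v
  define n where "n = lvl_count d lv l"
  note layer = radical_layer_simps[where l = l, folded N_def, folded cs_def]
  have N: "vec_subspace d N" unfolding N_def by (rule rad_subspace[OF x])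
  have gh: "inverse_mats d g h" and rd: "\<And>j. rad r d x j = (*\<^sub>v) g ` lvl_space d lv j"
    using ad by (auto simp: adapted_def)
  have gc: "g \<in> carrier_mat d d" using gh by (simp add: inverse_mats_def)
  have "finite {i. i < d \<and> lv i = l}" by simp
  from ex_bij_betw_finite_nat[OF this] obtain en where en: "bij_betw en {i. i < d \<and> lv i = l} {..<n}"
    unfolding n_def by (auto simp: atLeast0LessThan)
  have enlt: "en i < n" if "i < d" "lv i = l" for i using en that by (auto simp: bij_betw_def)
  have ensurj: "\<exists>i. i < d \<and> lv i = l \<and> en i = k" if "k < n" for k
  proof -
    have "k \<in> en ` {i. i < d \<and> lv i = l}" using en that by (simp add: bij_betw_def)
    then show ?thesis by auto
  qed
  define emb where "emb u = vec d (\<lambda>i. if lv i = l then u $ en i else 0)" for u :: "'a vec"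
  have embc: "emb u \<in> carrier_vec d" for u by (simp add: emb_def)
  have emb_lvl: "emb u \<in> lvl_space d lv l" for u by (auto simp: emb_def lvl_space_def)
  define \<phi> where "\<phi> u = cs (g *\<^sub>v emb u)" for u
  have gemb: "g *\<^sub>v emb u \<in> carrier_vec d" for u by (rule mult_mat_vec_carrier[OF gc embc])
  have \<phi>c: "\<phi> u \<in> carrier (radical_layer T M l)" for u
    unfolding layer(1) \<phi>_def rd by (intro imageI emb_lvl)
  have \<phi>add: "\<phi> (u + v) = \<phi> u \<oplus>\<^bsub>radical_layer T M l\<^esub> \<phi> v" if "u \<in> carrier_vec n" "v \<in> carrier_vec n" for u v
  proof -
    have "emb (u + v) = emb u + emb v" using that enlt by (intro eq_vecI) (auto simp: emb_def)
    then show ?thesis unfolding \<phi>_def layer(3)[OF gemb gemb] by (simp add: mult_add_distrib_mat_vec[OF gc embc embc])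
  qed
  have \<phi>smult: "\<phi> (c \<cdot>\<^sub>v u) = path_class r L (const_path c) \<odot>\<^bsub>radical_layer T M l\<^esub> \<phi> u" if "u \<in> carrier_vec n" for u c
  proof -
    have "emb (c \<cdot>\<^sub>v u) = c \<cdot>\<^sub>v emb u" using that enlt by (intro eq_vecI) (auto simp: emb_def)
    then show ?thesis unfolding \<phi>_def layer(4)[OF gemb] by (simp add: mult_mat_vec[OF gc embc])
  qed
  have \<phi>zero: "\<phi> (0\<^sub>v n) = \<zero>\<^bsub>radical_layer T M l\<^esub>"
  proof -
    have "emb (0\<^sub>v n) = 0\<^sub>v d" using enlt by (intro eq_vecI) (auto simp: emb_def)
    moreover have "g *\<^sub>v 0\<^sub>v d = 0\<^sub>v d" using gc by (intro eq_vecI) (auto simp: scalar_prod_def)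
    ultimately show ?thesis unfolding \<phi>_def layer(2) by simp
  qed
  have inj: "inj_on \<phi> (carrier_vec n)"
  proof (rule inj_onI)
    fix u v assume u: "u \<in> carrier_vec n" and v: "v \<in> carrier_vec n" and eq: "\<phi> u = \<phi> v"
    then obtain k where k: "k \<in> N" "g *\<^sub>v emb u = k + g *\<^sub>v emb v"
      unfolding \<phi>_def cs_def translate_eq_iff[OF N gemb gemb] by blast
    obtain w where w: "w \<in> lvl_space d lv (Suc l)" "k = g *\<^sub>v w" using k(1) unfolding N_def rd by blast
    have wc: "w \<in> carrier_vec d" using w(1) by (simp add: lvl_space_def)
    have "g *\<^sub>v emb u = g *\<^sub>v (w + emb v)" unfolding k(2) w(2) by (rule mult_add_distrib_mat_vec[OF gc wc embc, symmetric])
    then have "h *\<^sub>v (g *\<^sub>v emb u) = h *\<^sub>v (g *\<^sub>v (w + emb v))" by simp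
    then have e: "emb u = w + emb v"
      using inverse_mats_vec[OF inverse_mats_sym[OF gh]] embc wc by (metis add_carrier_vec)
    show "u = v"
    proof (rule eq_vecI)
      fix k assume "k < dim_vec v"
      then have "k < n" using v by simp
      then obtain i where i: "i < d" "lv i = l" "en i = k" using ensurj by blast
      have "emb u $ i = w $ i + emb v $ i" unfolding e using i(1) embc[of v] by (simp add: emb_def)
      moreover have "w $ i = 0" using w(1) i by (auto simp: lvl_space_def)
      ultimately show "u $ k = v $ k" using i by (simp add: emb_def)
    qed (use u v in simp)
  qed
  have surj: "\<phi> ` carrier_vec n = carrier (radical_layer T M l)"
  proof (intro subset_antisym image_subsetI subsetI \<phi>c)
    fix X assume "X \<in> carrier (radical_layer T M l)"
    then obtain z where z: "z \<in> lvl_space d lv l" "X = cs (g *\<^sub>v z)" unfolding layer(1) rd by blast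
    have zc: "z \<in> carrier_vec d" using z(1) by (simp add: lvl_space_def)
    define u where "u = vec n (\<lambda>k. z $ inv_into {i. i < d \<and> lv i = l} en k)"
    define w where "w = vec d (\<lambda>i. if lv i = l then 0 else z $ i)"
    have w: "w \<in> lvl_space d lv (Suc l)"
      unfolding w_def lvl_space_def
    proof (clarsimp, intro Suc_leI)
      fix i assume i: "i < d" "lv i \<noteq> l" "z $ i \<noteq> 0"
      then have "l \<le> lv i" using z(1) by (simp add: lvl_space_def)
      then show "l < lv i" using i(2) by simp
    qed
    have wc: "w \<in> carrier_vec d" by (simp add: w_def)
    have "inv_into {i. i < d \<and> lv i = l} en (en i) = i" if "i < d" "lv i = l" for i
      by (rule inv_into_f_f) (use en that in \<open>auto simp: bij_betw_def\<close>)
    then have "emb u $ i = (if lv i = l then z $ i else 0)" if "i < d" for i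
      using that enlt by (simp add: emb_def u_def)
    then have "z = w + emb u" using zc embc[of u] by (intro eq_vecI) (auto simp: w_def)
    then have "g *\<^sub>v z = g *\<^sub>v w + g *\<^sub>v emb u" using mult_add_distrib_mat_vec[OF gc wc embc] by simp
    moreover have "g *\<^sub>v w \<in> N" unfolding N_def rd using w by blast
    ultimately have "X = \<phi> u"
      unfolding z(2) \<phi>_def cs_def translate_eq_iff[OF N mult_mat_vec_carrier[OF gc zc] gemb] by blast
    then show "X \<in> \<phi> ` carrier_vec n" by (auto simp: u_def)
  qed
  have Tc: "path_class r L (const_path c) \<in> carrier T" for c
    unfolding trunc_algebra_carrier by (intro imageI const_path_carrier)
  obtain f where f: "bij_betw f (carrier (radical_layer T M l)) (carrier S)" "f \<zero>\<^bsub>radical_layer T M l\<^esub> = \<zero>\<^bsub>S\<^esub>"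
    "\<And>X Y. X \<in> carrier (radical_layer T M l) \<Longrightarrow> Y \<in> carrier (radical_layer T M l) \<Longrightarrow> f (X \<oplus>\<^bsub>radical_layer T M l\<^esub> Y) = f X \<oplus>\<^bsub>S\<^esub> f Y"
    "\<And>b X. b \<in> carrier T \<Longrightarrow> X \<in> carrier (radical_layer T M l) \<Longrightarrow> f (b \<odot>\<^bsub>radical_layer T M l\<^esub> X) = b \<odot>\<^bsub>S\<^esub> f X"
    using iso unfolding isomorphic_modules_def by blast
  have "bij_betw (f \<circ> \<phi>) (carrier_vec n) (carrier S)"
    by (rule bij_betw_trans[OF _ f(1)]) (simp add: bij_betw_def inj surj)
  then have "vectorspace.dim class_ring (ground_field_space r L S) = n"
    by (intro vectorspace_dim_transfer[where f = "f \<circ> \<phi>"])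
      (simp_all add: ground_field_space_def \<phi>add \<phi>smult \<phi>zero f \<phi>c Tc flip: path_class_def)
  then show ?thesis by (simp add: module_dim_def n_def)
qed

end

section \<open>Direct sum decompositions and idempotents\<close>

lemma mat_eq_by_vec:
  fixes A B :: "'a::field mat"
  assumes A: "A \<in> carrier_mat m n" and B: "B \<in> carrier_mat m n" and eq: "\<And>v. v \<in> carrier_vec n \<Longrightarrow> A *\<^sub>v v = B *\<^sub>v v"
  shows "A = B"
proof (rule eq_matI)
  fix i j assume ij: "i < dim_row B" "j < dim_col B"
  have "(A *\<^sub>v unit_vec n j) $ i = (B *\<^sub>v unit_vec n j) $ i" using eq[of "unit_vec n j"] by simp
  then show "A $$ (i, j) = B $$ (i, j)" using A B ij by (simp add: scalar_prod_right_unit)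
qed (use A B in auto)

text \<open>The columns of the projection are the components in \<open>U\<close> of the unit
  vectors; the remaining properties follow by linear combination and from the trivial
  intersection.\<close>

lemma direct_sum_projection:
  assumes U: "vec_subspace n U" and V: "vec_subspace n V" and int: "U \<inter> V = {0\<^sub>v n}"
    and sum: "\<And>w. w \<in> carrier_vec n \<Longrightarrow> \<exists>u\<in>U. \<exists>v\<in>V. w = u + v"
  obtains E :: "'a::field mat" where "E \<in> carrier_mat n n" "E * E = E"
    "\<And>w. w \<in> carrier_vec n \<Longrightarrow> E *\<^sub>v w \<in> U" "\<And>w. w \<in> carrier_vec n \<Longrightarrow> w - E *\<^sub>v w \<in> V"
    "\<And>u. u \<in> U \<Longrightarrow> E *\<^sub>v u = u" "\<And>v. v \<in> V \<Longrightarrow> E *\<^sub>v v = 0\<^sub>v n"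
proof -
  have "\<exists>u. u \<in> U \<and> unit_vec n j - u \<in> V" for j
  proof -
    obtain u v where u: "u \<in> U" "v \<in> V" "unit_vec n j = u + v" using sum[of "unit_vec n j"] by auto
    have "unit_vec n j - u = v" unfolding u(3) using vec_subspaceD(1)[OF U u(1)] vec_subspaceD(1)[OF V u(2)] by (intro eq_vecI) auto
    then show ?thesis using u(1,2) by auto
  qed
  then obtain p where p: "\<And>j. p j \<in> U" "\<And>j. unit_vec n j - p j \<in> V" by metis
  have pc: "p j \<in> carrier_vec n" for j by (rule vec_subspaceD(1)[OF U p(1)])
  have dp [simp]: "dim_vec (p j) = n" for j using pc[of j] by simp
  define E where "E = mat n n (\<lambda>(i, j). p j $ i)"
  have Ec: "E \<in> carrier_mat n n" by (simp add: E_def)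
  have Ew: "E *\<^sub>v w = vsum n (\<lambda>j. w $ j \<cdot>\<^sub>v p j) {..<n}" if "w \<in> carrier_vec n" for w
  proof (rule eq_vecI)
    fix i assume "i < dim_vec (vsum n (\<lambda>j. w $ j \<cdot>\<^sub>v p j) {..<n})"
    then have i: "i < n" by simp
    have "(\<Sum>k<n. p k $ i * w $ k) = (\<Sum>j<n. (w $ j \<cdot>\<^sub>v p j) $ i)"
      by (rule sum.cong) (simp_all only: smult_index[OF pc i] mult.commute)
    then show "(E *\<^sub>v w) $ i = vsum n (\<lambda>j. w $ j \<cdot>\<^sub>v p j) {..<n} $ i"
      using mult_mat_vec_index[OF Ec that i] i by (simp add: E_def)
  qed (use Ec in simp)
  have EU: "E *\<^sub>v w \<in> U" if "w \<in> carrier_vec n" for w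
    unfolding Ew[OF that] by (rule vec_subspace_vsum[OF U vec_subspaceD(4)[OF U p(1)]])
  have EV: "w - E *\<^sub>v w \<in> V" if w: "w \<in> carrier_vec n" for w
  proof -
    have "w - E *\<^sub>v w = vsum n (\<lambda>j. w $ j \<cdot>\<^sub>v (unit_vec n j - p j)) {..<n}"
    proof (rule eq_vecI)
      fix i assume "i < dim_vec (vsum n (\<lambda>j. w $ j \<cdot>\<^sub>v (unit_vec n j - p j)) {..<n})"
      then have i: "i < n" by simp
      have "(\<Sum>j<n. (w $ j \<cdot>\<^sub>v (unit_vec n j - p j)) $ i) = (\<Sum>j<n. w $ j * (if i = j then 1 else 0) - w $ j * p j $ i)"
        by (rule sum.cong) (use i in \<open>auto simp: algebra_simps\<close>)
      also have "\<dots> = w $ i - (\<Sum>j<n. w $ j * p j $ i)" using i by (simp add: sum_subtractf if_distrib[of "\<lambda>z. _ * z"] cong: if_cong)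
      finally show "(w - E *\<^sub>v w) $ i = vsum n (\<lambda>j. w $ j \<cdot>\<^sub>v (unit_vec n j - p j)) {..<n} $ i"
        using i w pc unfolding Ew[OF w] by simp
    qed (use w Ec in simp)
    then show ?thesis using vec_subspace_vsum[OF V vec_subspaceD(4)[OF V p(2)]] by simp
  qed
  have diff: "u + (-1) \<cdot>\<^sub>v v = u - v" if "u \<in> carrier_vec n" "v \<in> carrier_vec n" for u v :: "'a vec"
    using that by (intro eq_vecI) auto
  have fixU: "E *\<^sub>v u = u" if u: "u \<in> U" for u
  proof -
    have uc: "u \<in> carrier_vec n" by (rule vec_subspaceD(1)[OF U u])
    have Euc: "E *\<^sub>v u \<in> carrier_vec n" by (rule mult_mat_vec_carrier[OF Ec uc])
    have "u - E *\<^sub>v u \<in> U" unfolding diff[OF uc Euc, symmetric] by (rule vec_subspaceD(3)[OF U u vec_subspaceD(4)[OF U EU[OF uc]]])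
    then have "u - E *\<^sub>v u = 0\<^sub>v n" using EV[OF uc] int by blast
    then have "(u - E *\<^sub>v u) $ i = 0" if "i < n" for i using that by simp
    moreover have "(u - E *\<^sub>v u) $ i = u $ i - (E *\<^sub>v u) $ i" if "i < n" for i
      by (rule index_minus_vec(1)) (use that Ec in simp)
    ultimately show ?thesis using uc Euc Ec by (intro eq_vecI) (simp_all del: index_minus_vec index_mult_mat_vec)
  qed
  have killV: "E *\<^sub>v v = 0\<^sub>v n" if v: "v \<in> V" for v
  proof -
    have vc: "v \<in> carrier_vec n" by (rule vec_subspaceD(1)[OF V v])
    have Evc: "E *\<^sub>v v \<in> carrier_vec n" by (rule mult_mat_vec_carrier[OF Ec vc])
    have "v + (-1) \<cdot>\<^sub>v (v - E *\<^sub>v v) \<in> V" by (rule vec_subspaceD(3)[OF V v vec_subspaceD(4)[OF V EV[OF vc]]])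
    moreover have "v + (-1) \<cdot>\<^sub>v (v - E *\<^sub>v v) = E *\<^sub>v v" using vc Ec by (intro eq_vecI) auto
    ultimately show ?thesis using EU[OF vc] int by auto
  qed
  have "E * E = E"
  proof (rule mat_eq_by_vec[OF mult_carrier_mat[OF Ec Ec] Ec])
    fix v :: "'a vec" assume v: "v \<in> carrier_vec n"
    then show "E * E *\<^sub>v v = E *\<^sub>v v" using assoc_mult_mat_vec[OF Ec Ec v] fixU[OF EU[OF v]] by simp
  qed
  then show ?thesis by (rule that[OF Ec _ EU EV fixU killV])
qed

text \<open>The projection along a decomposition into submodules commutes with the arrows, since
  these preserve both summands. Absence of nontrivial idempotent endomorphisms thus leaves one
  summand zero.\<close>

lemma (in rep_point) indecomposable_rep_module:
  assumes d: "0 < d"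
    and idem: "\<And>E. E \<in> carrier_mat d d \<Longrightarrow> E * E = E \<Longrightarrow> (\<And>a. a < r \<Longrightarrow> E * x ! a = x ! a * E) \<Longrightarrow> E = 0\<^sub>m d d \<or> E = 1\<^sub>m d"
  shows "indecomposable_module T M"
  unfolding indecomposable_module_def
proof (intro conjI allI impI, goal_cases)
  case 1
  have "unit_vec d 0 \<in> carrier M" by (simp add: M_simps)
  moreover have "unit_vec d 0 \<noteq> (0\<^sub>v d :: 'a vec)" 
  proof
    assume "unit_vec d 0 = (0\<^sub>v d :: 'a vec)"
    from arg_cong[OF this, of "\<lambda>v. v $ 0"] show False using d by simp
  qed
  ultimately show ?case unfolding M_simps(2) by blast
next
  case (2 U V)
  have sub: "vec_subspace d W" "\<And>a w. a < r \<Longrightarrow> w \<in> W \<Longrightarrow> x ! a *\<^sub>v w \<in> W" if W: "Module.submodule W T M" for W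
  proof -
    interpret W: Module.submodule W T M by (rule W)
    have Wc: "w \<in> carrier_vec d" if "w \<in> W" for w using W.subset that by (auto simp: M_simps)
    have sm: "c \<cdot>\<^sub>v w \<in> W" if w: "w \<in> W" for c w
    proof -
      have "path_class r L (const_path c) \<in> carrier T" unfolding trunc_algebra_carrier by (intro imageI const_path_carrier)
      from W.smult_closed[OF this w] show ?thesis
        unfolding smult_class[OF const_path_carrier Wc[OF w]] path_action_const[OF Wc[OF w]] .
    qed
    show "vec_subspace d W" unfolding vec_subspace_def
      using Wc sm W.one_closed W.m_closed by (auto simp: M_simps)
    show "x ! a *\<^sub>v w \<in> W" if a: "a < r" and w: "w \<in> W" for a w
    proof -
      have "path_class r L (word_path [a]) \<in> carrier T" unfolding trunc_algebra_carrier
        by (intro imageI word_path_carrier) (use a in simp)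
      from W.smult_closed[OF this w] show ?thesis unfolding arrow_class[OF a Wc[OF w]] .
    qed
  qed
  have U: "vec_subspace d U" and V: "vec_subspace d V" using 2 sub(1) by auto
  have int: "U \<inter> V = {0\<^sub>v d}" using 2 by (simp add: internal_direct_sum_def M_simps)
  have "\<exists>u\<in>U. \<exists>v\<in>V. w = u + v" if "w \<in> carrier_vec d" for w
  proof -
    have "w \<in> U <+>\<^bsub>M\<^esub> V" using 2 that by (simp add: internal_direct_sum_def M_simps)
    then show ?thesis by (auto simp: set_add_def set_mult_def M_simps)
  qed
  from direct_sum_projection[OF U V int this] obtain E where E: "E \<in> carrier_mat d d" "E * E = E"
    "\<And>w. w \<in> carrier_vec d \<Longrightarrow> E *\<^sub>v w \<in> U" "\<And>w. w \<in> carrier_vec d \<Longrightarrow> w - E *\<^sub>v w \<in> V"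
    "\<And>u. u \<in> U \<Longrightarrow> E *\<^sub>v u = u" "\<And>v. v \<in> V \<Longrightarrow> E *\<^sub>v v = 0\<^sub>v d"
    by blast
  have "E * x ! a = x ! a * E" if a: "a < r" for a
  proof (rule mat_eq_by_vec)
    note xc = mat_tuplesD(2)[OF x a]
    show "E * x ! a \<in> carrier_mat d d" "x ! a * E \<in> carrier_mat d d" using E(1) xc by auto
    fix w :: "'a vec" assume w: "w \<in> carrier_vec d"
    let ?u = "E *\<^sub>v w" and ?v = "w - E *\<^sub>v w"
    have uc: "?u \<in> carrier_vec d" "?v \<in> carrier_vec d" using E(1) w by auto
    have "w = ?u + ?v" using E(1) w by (intro eq_vecI) auto
    then have "x ! a *\<^sub>v w = x ! a *\<^sub>v ?u + x ! a *\<^sub>v ?v" using mult_add_distrib_mat_vec[OF xc uc] by simp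
    then have "E *\<^sub>v (x ! a *\<^sub>v w) = E *\<^sub>v (x ! a *\<^sub>v ?u) + E *\<^sub>v (x ! a *\<^sub>v ?v)"
      using mult_add_distrib_mat_vec[OF E(1) mult_mat_vec_carrier[OF xc uc(1)] mult_mat_vec_carrier[OF xc uc(2)]] by simp
    also have "\<dots> = x ! a *\<^sub>v ?u + 0\<^sub>v d"
      using E(5)[OF sub(2)[OF _ a E(3)[OF w]]] E(6)[OF sub(2)[OF _ a E(4)[OF w]]] 2 by simp
    also have "\<dots> = x ! a *\<^sub>v ?u" using xc uc by simp
    finally show "E * x ! a *\<^sub>v w = x ! a * E *\<^sub>v w"
      using assoc_mult_mat_vec[OF E(1) xc w] assoc_mult_mat_vec[OF xc E(1) w] by simp
  qed
  from idem[OF E(1,2) this] show ?case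
  proof
    assume z: "E = 0\<^sub>m d d"
    have "0\<^sub>m d d *\<^sub>v u = 0\<^sub>v d" if "u \<in> carrier_vec d" for u :: "'a vec"
      using that by (intro eq_vecI) (auto simp: scalar_prod_def)
    then have "u = 0\<^sub>v d" if "u \<in> U" for u using E(5)[OF that] vec_subspaceD(1)[OF U that] by (simp add: z)
    then have "U = {0\<^sub>v d}" using vec_subspaceD(2)[OF U] by blast
    then show ?thesis unfolding M_simps(2) by blast
  next
    assume o: "E = 1\<^sub>m d"
    have "v = 0\<^sub>v d" if "v \<in> V" for v using E(6)[OF that] vec_subspaceD(1)[OF V that] by (simp add: o)
    then have "V = {0\<^sub>v d}" using vec_subspaceD(2)[OF V] by blast
    then show ?thesis unfolding M_simps(2) by blast
  qed
qed

lemma vec_subspace_VS: "vec_subspace n U \<Longrightarrow> VectorSpace.subspace class_ring U (module_vec TYPE('a::field) n)"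
proof -
  assume U: "vec_subspace n U"
  interpret N: vec_space "TYPE('a)" n .
  show ?thesis
    unfolding VectorSpace.subspace_def LinearCombinations.submodule_def
    using N.vectorspace_axioms N.module_axioms U by (auto simp: module_vec_simps vec_subspace_def)
qed

lemma idempotent_decomposition:
  fixes e :: "'a::field mat"
  assumes e: "e \<in> carrier_mat n n" and ee: "e * e = e"
  defines "U \<equiv> (*\<^sub>v) e ` carrier_vec n" and "V \<equiv> {v \<in> carrier_vec n. e *\<^sub>v v = 0\<^sub>v n}"
  shows "vec_subspace n U" "vec_subspace n V" "internal_direct_sum (module_vec TYPE('a) n) U V"
    and "U = {0\<^sub>v n} \<Longrightarrow> e = 0\<^sub>m n n" "V = {0\<^sub>v n} \<Longrightarrow> e = 1\<^sub>m n"
proof -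
  have ec: "e *\<^sub>v v \<in> carrier_vec n" if "v \<in> carrier_vec n" for v by (rule mult_mat_vec_carrier[OF e that])
  have eev: "e *\<^sub>v (e *\<^sub>v v) = e *\<^sub>v v" if "v \<in> carrier_vec n" for v
    using assoc_mult_mat_vec[OF e e that] by (simp add: ee)
  have e0: "e *\<^sub>v 0\<^sub>v n = 0\<^sub>v n" using e by (intro eq_vecI) (auto simp: scalar_prod_def)
  show U: "vec_subspace n U" unfolding vec_subspace_def
  proof (intro conjI ballI allI)
    show "U \<subseteq> carrier_vec n" using ec by (auto simp: U_def)
    show "0\<^sub>v n \<in> U" unfolding U_def by (rule image_eqI[of _ _ "0\<^sub>v n"]) (simp_all add: e0)
    fix u assume "u \<in> U"
    then obtain u' where u: "u = e *\<^sub>v u'" "u' \<in> carrier_vec n" by (auto simp: U_def)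
    show "c \<cdot>\<^sub>v u \<in> U" for c unfolding U_def
      by (rule image_eqI[of _ _ "c \<cdot>\<^sub>v u'"]) (use u mult_mat_vec[OF e u(2)] in auto)
    fix v assume "v \<in> U"
    then obtain v' where v: "v = e *\<^sub>v v'" "v' \<in> carrier_vec n" by (auto simp: U_def)
    show "u + v \<in> U" unfolding U_def
      by (rule image_eqI[of _ _ "u' + v'"]) (use u v mult_add_distrib_mat_vec[OF e u(2) v(2)] in auto)
  qed
  show V: "vec_subspace n V" unfolding vec_subspace_def V_def
    using e0 e by (auto simp: mult_add_distrib_mat_vec[OF e] mult_mat_vec[OF e])
  have sub: "v - e *\<^sub>v v \<in> V" if v: "v \<in> carrier_vec n" for v
    using v ec[OF v] mult_minus_distrib_mat_vec[OF e v ec[OF v]] eev[OF v] by (simp add: V_def)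
  have split: "v = e *\<^sub>v v + (v - e *\<^sub>v v)" if v: "v \<in> carrier_vec n" for v
    using v e by (intro eq_vecI) auto
  have "U <+>\<^bsub>module_vec TYPE('a) n\<^esub> V = carrier_vec n"
  proof (intro subset_antisym subsetI)
    fix w assume "w \<in> U <+>\<^bsub>module_vec TYPE('a) n\<^esub> V"
    then show "w \<in> carrier_vec n"
      using vec_subspaceD(1)[OF U] vec_subspaceD(1)[OF V] by (auto simp: set_add_def set_mult_def module_vec_simps)
  next
    fix w :: "'a vec" assume w: "w \<in> carrier_vec n"
    have "e *\<^sub>v w \<in> U" using w by (auto simp: U_def)
    then show "w \<in> U <+>\<^bsub>module_vec TYPE('a) n\<^esub> V"
      using sub[OF w] split[OF w] by (auto simp: set_add_def set_mult_def module_vec_simps)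
  qed
  moreover have "U \<inter> V = {0\<^sub>v n}"
    using vec_subspaceD(2)[OF U] vec_subspaceD(2)[OF V] eev ec by (auto simp: U_def V_def)
  ultimately show "internal_direct_sum (module_vec TYPE('a) n) U V"
    by (simp add: internal_direct_sum_def module_vec_simps)
  show "e = 0\<^sub>m n n" if "U = {0\<^sub>v n}"
    by (rule mat_eq_zeroI[OF e]) (use that in \<open>auto simp: U_def\<close>)
  show "e = 1\<^sub>m n" if V0: "V = {0\<^sub>v n}"
  proof (rule mat_eq_by_vec[OF e one_carrier_mat])
    fix v :: "'a vec" assume v: "v \<in> carrier_vec n"
    have "v - e *\<^sub>v v = 0\<^sub>v n" using sub[OF v] V0 by simp
    then have "e *\<^sub>v v = v" using split[OF v] ec[OF v] by simp
    then show "e *\<^sub>v v = 1\<^sub>m n *\<^sub>v v" using v by simp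
  qed
qed

text \<open>The images of the two idempotents form one subrepresentation and their kernels a
  complementary one, so one of the two is zero at both vertices simultaneously.\<close>

lemma kronecker_indecomposable_idempotent:
  fixes B :: "'a::field mat list"
  assumes B: "B \<in> mat_tuples r d2 d1" and ind: "kronecker_indecomposable d1 d2 B"
    and e1: "e1 \<in> carrier_mat d1 d1" "e1 * e1 = e1" and e2: "e2 \<in> carrier_mat d2 d2" "e2 * e2 = e2"
    and comm: "\<And>a. a < r \<Longrightarrow> B ! a * e1 = e2 * B ! a"
  shows "e1 = 0\<^sub>m d1 d1 \<and> e2 = 0\<^sub>m d2 d2 \<or> e1 = 1\<^sub>m d1 \<and> e2 = 1\<^sub>m d2"
proof -
  let ?U1 = "(*\<^sub>v) e1 ` carrier_vec d1" and ?V1 = "{v \<in> carrier_vec d1. e1 *\<^sub>v v = 0\<^sub>v d1}"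
  let ?U2 = "(*\<^sub>v) e2 ` carrier_vec d2" and ?V2 = "{v \<in> carrier_vec d2. e2 *\<^sub>v v = 0\<^sub>v d2}"
  note s1 = idempotent_decomposition[OF e1] and s2 = idempotent_decomposition[OF e2]
  have com: "A \<in> carrier_mat d2 d1" "\<And>v. v \<in> carrier_vec d1 \<Longrightarrow> A *\<^sub>v (e1 *\<^sub>v v) = e2 *\<^sub>v (A *\<^sub>v v)" if "A \<in> set B" for A
  proof -
    obtain a where a: "a < r" "A = B ! a" using \<open>A \<in> set B\<close> mat_tuplesD(1)[OF B] by (metis in_set_conv_nth)
    show A: "A \<in> carrier_mat d2 d1" unfolding a(2) by (rule mat_tuplesD(2)[OF B a(1)])
    fix v :: "'a vec" assume v: "v \<in> carrier_vec d1"
    show "A *\<^sub>v (e1 *\<^sub>v v) = e2 *\<^sub>v (A *\<^sub>v v)"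
      using comm[OF a(1)] assoc_mult_mat_vec[OF A e1(1) v] assoc_mult_mat_vec[OF e2(1) A v] by (simp add: a(2))
  qed
  have "kronecker_subrep d1 d2 B (?U1, ?U2)" unfolding kronecker_subrep_def fst_conv snd_conv
  proof (intro conjI ballI vec_subspace_VS s1(1) s2(1))
    fix A v assume A: "A \<in> set B" and "v \<in> ?U1"
    then obtain u where u: "u \<in> carrier_vec d1" "v = e1 *\<^sub>v u" by blast
    show "A *\<^sub>v v \<in> ?U2" unfolding u(2) com(2)[OF A u(1)]
      by (intro imageI mult_mat_vec_carrier[OF com(1)[OF A] u(1)])
  qed
  moreover have "kronecker_subrep d1 d2 B (?V1, ?V2)" unfolding kronecker_subrep_def fst_conv snd_conv
  proof (intro conjI ballI vec_subspace_VS s1(2) s2(2))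
    fix A v assume A: "A \<in> set B" and v: "v \<in> ?V1"
    have "A *\<^sub>v 0\<^sub>v d1 = 0\<^sub>v d2" using com(1)[OF A] by (intro eq_vecI) (auto simp: scalar_prod_def)
    then show "A *\<^sub>v v \<in> ?V2" using com(1)[OF A] com(2)[OF A, of v] v by auto
  qed
  ultimately have "(?U1, ?U2) = ({0\<^sub>v d1}, {0\<^sub>v d2}) \<or> (?V1, ?V2) = ({0\<^sub>v d1}, {0\<^sub>v d2})"
    using conjunct2[OF ind[unfolded kronecker_indecomposable_def], rule_format, of "(?U1, ?U2)" "(?V1, ?V2)"] s1(3) s2(3)
    by (simp only: fst_conv snd_conv)
  then show ?thesis using s1(4,5) s2(4,5) by auto
qed

section \<open>Blocks of filtered tuples\<close>

text \<open>Numbers the indices of a level consecutively, so that blocks become matrices whose sizes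
  are level counts, the format of Kronecker representations.\<close>

definition level_index :: "nat \<Rightarrow> (nat \<Rightarrow> nat) \<Rightarrow> nat \<Rightarrow> nat \<Rightarrow> nat" where
  "level_index d lv j t = filter (\<lambda>i. lv i = j) [0..<d] ! t"

lemma level_index_bij: "bij_betw (level_index d lv j) {..<lvl_count d lv j} {i. i < d \<and> lv i = j}"
proof -
  let ?xs = "filter (\<lambda>i. lv i = j) [0..<d]"
  have s: "set ?xs = {i. i < d \<and> lv i = j}" by auto
  have "length ?xs = lvl_count d lv j" using distinct_card[of ?xs] unfolding s by simp
  then show ?thesis unfolding level_index_def
    by (intro bij_betw_nth) (simp_all add: s)
qed

lemma level_index_less:
  assumes "t < lvl_count d lv j"
  shows "level_index d lv j t < d" "lv (level_index d lv j t) = j"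
  using level_index_bij[of d lv j] assms by (auto simp: bij_betw_def)

lemma level_index_surj:
  assumes "i < d" "lv i = j"
  shows "\<exists>t<lvl_count d lv j. level_index d lv j t = i"
proof -
  have "i \<in> level_index d lv j ` {..<lvl_count d lv j}" using level_index_bij[of d lv j] assms by (simp add: bij_betw_def)
  then show ?thesis by auto
qed

lemma level_index_eq_iff:
  "s < lvl_count d lv j \<Longrightarrow> t < lvl_count d lv j \<Longrightarrow> level_index d lv j s = level_index d lv j t \<longleftrightarrow> s = t"
  by (rule inj_on_eq_iff[OF bij_betw_imp_inj_on[OF level_index_bij]]) simp_all

lemma sum_level_index:
  "(\<Sum>c | c < d \<and> lv c = j. F c) = (\<Sum>t<lvl_count d lv j. F (level_index d lv j t))"
  by (rule sum.reindex_bij_betw[symmetric, OF level_index_bij])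

definition level_block :: "nat \<Rightarrow> (nat \<Rightarrow> nat) \<Rightarrow> nat \<Rightarrow> nat \<Rightarrow> 'a mat \<Rightarrow> 'a mat" where
  "level_block d lv j k A = mat (lvl_count d lv j) (lvl_count d lv k)
     (\<lambda>(s, t). A $$ (level_index d lv j s, level_index d lv k t))"

lemma level_block_carrier [simp]: "level_block d lv j k A \<in> carrier_mat (lvl_count d lv j) (lvl_count d lv k)"
  by (simp add: level_block_def)

text \<open>Block multiplication with a single intermediate level \<open>m\<close>. It covers
  products of level-preserving matrices as well as products with a strictly raising tuple.\<close>

lemma level_block_mult:
  fixes A B :: "'a::field mat"
  assumes A: "A \<in> carrier_mat d d" and B: "B \<in> carrier_mat d d"
    and z: "\<And>i c k. i < d \<Longrightarrow> c < d \<Longrightarrow> k < d \<Longrightarrow> lv i = j \<Longrightarrow> lv k = j' \<Longrightarrow> A $$ (i, c) * B $$ (c, k) \<noteq> 0 \<Longrightarrow> lv c = m"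
  shows "level_block d lv j j' (A * B) = level_block d lv j m A * level_block d lv m j' B"
proof (rule eq_matI)
  let ?n = "lvl_count d lv"
  fix s t assume "s < dim_row (level_block d lv j m A * level_block d lv m j' B)"
    "t < dim_col (level_block d lv j m A * level_block d lv m j' B)"
  then have st: "s < ?n j" "t < ?n j'" by (simp_all add: level_block_def)
  let ?i = "level_index d lv j s" and ?k = "level_index d lv j' t"
  note il = level_index_less[OF st(1)] and kl = level_index_less[OF st(2)]
  have "level_block d lv j j' (A * B) $$ (s, t) = (A * B) $$ (?i, ?k)" using st by (simp add: level_block_def)
  also have "\<dots> = (\<Sum>c<d. A $$ (?i, c) * B $$ (c, ?k))" by (rule index_mult_mat_sum[OF A B il(1) kl(1)])
  also have "\<dots> = (\<Sum>c | c < d \<and> lv c = m. A $$ (?i, c) * B $$ (c, ?k))"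
    by (rule sum.mono_neutral_right) (use z[OF il(1) _ kl(1) il(2) kl(2)] in auto)
  also have "\<dots> = (\<Sum>q<?n m. A $$ (?i, level_index d lv m q) * B $$ (level_index d lv m q, ?k))"
    by (rule sum_level_index)
  also have "\<dots> = (\<Sum>q<?n m. level_block d lv j m A $$ (s, q) * level_block d lv m j' B $$ (q, t))"
    by (rule sum.cong) (simp_all add: level_block_def st)
  also have "\<dots> = (level_block d lv j m A * level_block d lv m j' B) $$ (s, t)"
    by (rule index_mult_mat_sum[symmetric, OF level_block_carrier level_block_carrier st])
  finally show "level_block d lv j j' (A * B) $$ (s, t) = (level_block d lv j m A * level_block d lv m j' B) $$ (s, t)" .
qed (simp_all add: level_block_def)

lemma level_block_one: "level_block d lv j j (1\<^sub>m d) = (1\<^sub>m (lvl_count d lv j) :: 'a::field mat)"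
proof (rule eq_matI)
  fix s t assume "s < dim_row (1\<^sub>m (lvl_count d lv j) :: 'a mat)" "t < dim_col (1\<^sub>m (lvl_count d lv j) :: 'a mat)"
  then have st: "s < lvl_count d lv j" "t < lvl_count d lv j" by simp_all
  show "level_block d lv j j (1\<^sub>m d) $$ (s, t) = (1\<^sub>m (lvl_count d lv j) :: 'a mat) $$ (s, t)"
    using level_index_less(1)[OF st(1)] level_index_less(1)[OF st(2)] level_index_eq_iff[OF st] st
    by (simp add: level_block_def)
qed (simp_all add: level_block_def)

definition block_tuple :: "nat \<Rightarrow> nat \<Rightarrow> (nat \<Rightarrow> nat) \<Rightarrow> nat \<Rightarrow> nat \<Rightarrow> 'a mat list \<Rightarrow> 'a mat list" where
  "block_tuple r d lv j k x = map (\<lambda>a. level_block d lv j k (x ! a)) [0..<r]"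

lemma block_tuple_mem: "block_tuple r d lv j k x \<in> mat_tuples r (lvl_count d lv j) (lvl_count d lv k)"
  and block_tuple_nth: "a < r \<Longrightarrow> block_tuple r d lv j k x ! a = level_block d lv j k (x ! a)"
  by (auto simp: block_tuple_def mat_tuples_def)

text \<open>A tuple supported only between levels \<open>j\<close> and \<open>Suc j\<close> strictly
  raises levels, whatever its entries. It need not be filtered; that is regained after passing to a
  general conjugate.\<close>

lemma block_tuple_surj:
  fixes B :: "'a::field mat list"
  assumes B: "B \<in> mat_tuples r (lvl_count d lv (Suc j)) (lvl_count d lv j)"
  shows "\<exists>p\<in>lvl_tuples r d lv. block_tuple r d lv (Suc j) j p = B"
proof -
  define ix where "ix j i = inv_into {..<lvl_count d lv j} (level_index d lv j) i" for j i
  define p where "p = map (\<lambda>a. mat d d (\<lambda>(i, k). if lv i = Suc j \<and> lv k = j then (B ! a) $$ (ix (Suc j) i, ix j k) else 0)) [0..<r]"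
  have ix: "ix j' (level_index d lv j' t) = t" if "t < lvl_count d lv j'" for j' t
    unfolding ix_def by (rule inv_into_f_f[OF bij_betw_imp_inj_on[OF level_index_bij]]) (use that in simp)
  have "p \<in> lvl_tuples r d lv"
    unfolding lvl_tuples_def by (auto simp: p_def mat_tuples_def split: if_splits)
  moreover have "block_tuple r d lv (Suc j) j p = B"
  proof (rule mat_tuples_eqI[OF block_tuple_mem B])
    fix a s t assume a: "a < r" and st: "s < lvl_count d lv (Suc j)" "t < lvl_count d lv j"
    show "(block_tuple r d lv (Suc j) j p ! a) $$ (s, t) = (B ! a) $$ (s, t)"
      using level_index_less[OF st(1)] level_index_less[OF st(2)] ix[OF st(1)] ix[OF st(2)] a st
      by (simp add: block_tuple_nth level_block_def p_def)
  qed
  ultimately show ?thesis by blast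
qed

lemma block_tuple_poly:
  assumes "f \<in> poly_funs r (lvl_count d lv j) (lvl_count d lv k)"
  shows "(\<lambda>x. f (block_tuple r d lv j k x)) \<in> poly_funs r d d"
proof (rule poly_funs.poly_fun_compose[OF assms])
  fix a s t assume "a < r" and st: "s < lvl_count d lv j" "t < lvl_count d lv k"
  then show "(\<lambda>x. (block_tuple r d lv j k x ! a) $$ (s, t)) \<in> poly_funs r d d"
    using poly_funs.coord[OF _ level_index_less(1)[OF st(1)] level_index_less(1)[OF st(2)]]
    by (simp add: block_tuple_nth level_block_def)
qed

definition lvl_matrix :: "nat \<Rightarrow> (nat \<Rightarrow> nat) \<Rightarrow> 'a::field mat \<Rightarrow> bool" where
  "lvl_matrix d lv g \<longleftrightarrow> g \<in> carrier_mat d d \<and> (\<forall>i<d. \<forall>k<d. g $$ (i, k) \<noteq> 0 \<longrightarrow> lv k \<le> lv i)"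

lemma lvl_matrix_block_mult:
  assumes "lvl_matrix d lv g" "lvl_matrix d lv h"
  shows "level_block d lv j j (g * h) = level_block d lv j j g * level_block d lv j j h"
proof (rule level_block_mult)
  show "g \<in> carrier_mat d d" "h \<in> carrier_mat d d" using assms by (simp_all add: lvl_matrix_def)
  fix i c k assume ick: "i < d" "c < d" "k < d" "lv i = j" "lv k = j" "g $$ (i, c) * h $$ (c, k) \<noteq> 0"
  then have nz: "g $$ (i, c) \<noteq> 0" "h $$ (c, k) \<noteq> 0" by auto
  have "lv c \<le> lv i" using assms(1) ick(1,2) nz(1) unfolding lvl_matrix_def by blast
  moreover have "lv k \<le> lv c" using assms(2) ick(2,3) nz(2) unfolding lvl_matrix_def by blast
  ultimately show "lv c = j" using ick by simp
qed

lemma lvl_matrix_block_inverse: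
  assumes gh: "inverse_mats d g h" and "lvl_matrix d lv g" "lvl_matrix d lv h"
  shows "inverse_mats (lvl_count d lv j) (level_block d lv j j g) (level_block d lv j j h)"
  using lvl_matrix_block_mult[OF assms(2,3), of j] lvl_matrix_block_mult[OF assms(3,2), of j] gh
  by (simp add: inverse_mats_def level_block_one)

text \<open>Consecutive levels leave no room in between: in either product only a diagonal block of
  \<open>g\<close> meets the block of the tuple.\<close>

lemma block_tuple_intertwine:
  assumes g: "lvl_matrix d lv g" and p: "p \<in> lvl_tuples r d lv" and p': "p' \<in> lvl_tuples r d lv"
    and int: "\<And>a. a < r \<Longrightarrow> g * p ! a = p' ! a * g" and a: "a < r"
  shows "level_block d lv (Suc j) (Suc j) g * block_tuple r d lv (Suc j) j p ! a
    = block_tuple r d lv (Suc j) j p' ! a * level_block d lv j j g"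
proof -
  have gc: "g \<in> carrier_mat d d" using g by (simp add: lvl_matrix_def)
  have pc: "p ! a \<in> carrier_mat d d" "p' ! a \<in> carrier_mat d d" using p p' a mat_tuplesD(2) by (auto simp: lvl_tuples_def)
  have pe: "lv k < lv i" if "(p ! a) $$ (i, k) \<noteq> 0" "i < d" "k < d" for i k using p a that by (auto simp: lvl_tuples_def)
  have pe': "lv k < lv i" if "(p' ! a) $$ (i, k) \<noteq> 0" "i < d" "k < d" for i k using p' a that by (auto simp: lvl_tuples_def)
  have ge: "lv k \<le> lv i" if "g $$ (i, k) \<noteq> 0" "i < d" "k < d" for i k using g that by (auto simp: lvl_matrix_def)
  have "level_block d lv (Suc j) j (g * p ! a) = level_block d lv (Suc j) (Suc j) g * level_block d lv (Suc j) j (p ! a)"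
  proof (rule level_block_mult[OF gc pc(1)])
    fix i c k assume "i < d" "c < d" "k < d" "lv i = Suc j" "lv k = j" and "g $$ (i, c) * (p ! a) $$ (c, k) \<noteq> 0"
    then show "lv c = Suc j" using ge[of i c] pe[of c k] by simp
  qed
  moreover have "level_block d lv (Suc j) j (p' ! a * g) = level_block d lv (Suc j) j (p' ! a) * level_block d lv j j g"
  proof (rule level_block_mult[OF pc(2) gc])
    fix i c k assume "i < d" "c < d" "k < d" "lv i = Suc j" "lv k = j" and "(p' ! a) $$ (i, c) * g $$ (c, k) \<noteq> 0"
    then show "lv c = j" using ge[of c k] pe'[of i c] by simp
  qed
  ultimately show ?thesis using int[OF a] by (simp add: block_tuple_nth a)
qed

lemma filtered_hom_lvl_matrix:
  assumes p: "filtered r d lv p" and p': "filtered r d lv p'" and g: "g \<in> carrier_mat d d"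
    and int: "\<And>a. a < r \<Longrightarrow> g * p ! a = p' ! a * g"
  shows "lvl_matrix d lv g"
  unfolding lvl_matrix_def
proof (intro conjI allI impI g)
  fix i k assume ik: "i < d" "k < d" and nz: "g $$ (i, k) \<noteq> 0"
  have x: "p \<in> mat_tuples r d d" "p' \<in> mat_tuples r d d" using p p' by (auto simp: filtered_def lvl_tuples_def)
  have "(unit_vec d k :: 'a vec) \<in> lvl_space d lv (lv k)" by (rule unit_vec_lvl_space[OF ik(2) order_refl])
  then have "unit_vec d k \<in> rad r d p (lv k)" using p by (simp add: filtered_def)
  then have "g *\<^sub>v unit_vec d k \<in> lvl_space d lv (lv k)"
    using rad_hom[OF x g int] p' by (simp add: filtered_def)
  moreover have "(g *\<^sub>v unit_vec d k) $ i = g $$ (i, k)" using g ik by (simp add: scalar_prod_right_unit)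
  ultimately show "lv k \<le> lv i" using nz ik by (auto simp: lvl_space_def)
qed

lemma inverse_mats_intertwine:
  fixes A B :: "'a::field mat"
  assumes gh: "inverse_mats d g h" and c: "A \<in> carrier_mat d d" "B \<in> carrier_mat d d" and int: "g * A = B * g"
  shows "h * B = A * h"
proof -
  have g: "g \<in> carrier_mat d d" and h: "h \<in> carrier_mat d d" and gh1: "g * h = 1\<^sub>m d" and hg1: "h * g = 1\<^sub>m d"
    using gh by (auto simp: inverse_mats_def)
  note assoc = assoc_mult_mat[of _ d d _ d _ d] mult_carrier_mat[of _ d d _ d]
  have "h * B = h * (B * (g * h))" using c h by (simp add: gh1)
  also have "\<dots> = h * (B * g * h)" by (simp add: assoc c g h)
  also have "\<dots> = h * (g * A * h)" by (simp add: int)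
  also have "\<dots> = (h * g) * A * h" by (simp add: assoc c g h)
  also have "\<dots> = A * h" using c h by (simp add: hg1)
  finally show ?thesis .
qed

text \<open>An isomorphism of filtered tuples preserves the radical filtration in both directions,
  so its diagonal blocks are invertible. Hence all filtered points of one conjugation orbit have
  blocks in one Kronecker orbit.\<close>

lemma block_tuple_conjugate:
  assumes p: "filtered r d lv p" and p': "filtered r d lv p'" and gh: "inverse_mats d g h"
    and int: "\<And>a. a < r \<Longrightarrow> g * p ! a = p' ! a * g"
  shows "\<exists>g2 h2 g1 h1. inverse_mats (lvl_count d lv (Suc j)) g2 h2 \<and> inverse_mats (lvl_count d lv j) g1 h1 \<and>
    (\<forall>a<r. g2 * block_tuple r d lv (Suc j) j p ! a = block_tuple r d lv (Suc j) j p' ! a * g1)"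
proof -
  have t: "p \<in> lvl_tuples r d lv" "p' \<in> lvl_tuples r d lv" using p p' by (auto simp: filtered_def)
  then have x: "p \<in> mat_tuples r d d" "p' \<in> mat_tuples r d d" by (auto simp: lvl_tuples_def)
  have g: "g \<in> carrier_mat d d" and h: "h \<in> carrier_mat d d" using gh by (auto simp: inverse_mats_def)
  have "h * p' ! a = p ! a * h" if "a < r" for a
    by (rule inverse_mats_intertwine[OF gh mat_tuplesD(2)[OF x(1) that] mat_tuplesD(2)[OF x(2) that] int[OF that]])
  then have lh: "lvl_matrix d lv h" by (rule filtered_hom_lvl_matrix[OF p' p h])
  have lg: "lvl_matrix d lv g" by (rule filtered_hom_lvl_matrix[OF p p' g int])
  show ?thesis
    by (intro exI[of _ "level_block d lv (Suc j) (Suc j) g"] exI[of _ "level_block d lv (Suc j) (Suc j) h"]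
        exI[of _ "level_block d lv j j g"] exI[of _ "level_block d lv j j h"] conjI allI impI
        lvl_matrix_block_inverse[OF gh lg lh] block_tuple_intertwine[OF lg t int])
qed

lemma inverse_mats_mult:
  fixes a :: "'a::field mat"
  assumes ab: "inverse_mats d a b" and ce: "inverse_mats d c e"
  shows "inverse_mats d (a * c) (e * b)"
proof -
  have m: "a \<in> carrier_mat d d" "b \<in> carrier_mat d d" "c \<in> carrier_mat d d" "e \<in> carrier_mat d d"
    and one: "a * b = 1\<^sub>m d" "b * a = 1\<^sub>m d" "c * e = 1\<^sub>m d" "e * c = 1\<^sub>m d"
    using ab ce by (auto simp: inverse_mats_def)
  note assoc = assoc_mult_mat[of _ d d _ d _ d] mult_carrier_mat[of _ d d _ d]
  have "a * c * (e * b) = a * ((c * e) * b)" "e * b * (a * c) = e * ((b * a) * c)"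
    by (simp_all add: assoc m)
  then show ?thesis unfolding one using m one by (simp add: inverse_mats_def)
qed

text \<open>For a level tuple the radical powers lie in the level spaces. That a conjugate has an
  adapted basis with the same \<open>lv\<close> makes the dimensions agree.\<close>

lemma adapted_level_tuple_filtered:
  assumes p: "p \<in> lvl_tuples r d lv" and x: "x \<in> mat_tuples r d d" and gh: "inverse_mats d g h"
    and int: "\<And>a. a < r \<Longrightarrow> g * p ! a = x ! a * g" and ad: "adapted r d x lv g0 h0"
  shows "filtered r d lv p"
proof (rule filteredI)
  show pm: "p \<in> mat_tuples r d d" using p by (simp add: lvl_tuples_def)
  have g: "g \<in> carrier_mat d d" and h: "h \<in> carrier_mat d d" using gh by (auto simp: inverse_mats_def)
  have gh0: "inverse_mats d g0 h0" and r0: "\<And>j. rad r d x j = (*\<^sub>v) g0 ` lvl_space d lv j" using ad by (auto simp: adapted_def)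
  have g0: "g0 \<in> carrier_mat d d" and h0: "h0 \<in> carrier_mat d d" using gh0 by (auto simp: inverse_mats_def)
  have inv: "inverse_mats d (h * g0) (h0 * g)" by (rule inverse_mats_mult[OF inverse_mats_sym[OF gh] gh0])
  have int': "h * x ! a = p ! a * h" if "a < r" for a
    by (rule inverse_mats_intertwine[OF gh mat_tuplesD(2)[OF pm that] mat_tuplesD(2)[OF x that] int[OF that]])
  have rp: "rad r d p j = (*\<^sub>v) h ` rad r d x j" for j
    by (rule rad_conj[OF x pm inverse_mats_sym[OF gh] int'])
  have sub: "(h * g0) *\<^sub>v v \<in> lvl_space d lv j" if v: "v \<in> lvl_space d lv j" for v j
  proof -
    have vc: "v \<in> carrier_vec d" using v by (simp add: lvl_space_def)
    have "h *\<^sub>v (g0 *\<^sub>v v) \<in> rad r d p j" unfolding rp r0 using v by blast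
    then show ?thesis using rad_lvl_tuples[OF p] assoc_mult_mat_vec[OF h g0 vc] by auto
  qed
  show "rad r d p j = lvl_space d lv j" for j
  proof
    show "rad r d p j \<subseteq> lvl_space d lv j" by (rule rad_lvl_tuples[OF p])
    show "lvl_space d lv j \<subseteq> rad r d p j"
    proof
      fix v :: "'a vec" assume v: "v \<in> lvl_space d lv j"
      have vc: "v \<in> carrier_vec d" using v by (simp add: lvl_space_def)
      let ?w = "(h0 * g) *\<^sub>v v"
      have w: "?w \<in> lvl_space d lv j" by (rule lvl_space_inverse[OF inv sub v])
      then have wc: "?w \<in> carrier_vec d" by (simp add: lvl_space_def)
      have "v = h *\<^sub>v (g0 *\<^sub>v ?w)" using inverse_mats_vec[OF inv vc] assoc_mult_mat_vec[OF h g0 wc] by simp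
      then show "v \<in> rad r d p j" unfolding rp r0 using w by blast
    qed
  qed
qed

section \<open>A square Kronecker representation of full rank is decomposable\<close>

lemma sum_div_mod:
  fixes F :: "nat \<Rightarrow> nat \<Rightarrow> 'a::comm_monoid_add"
  shows "(\<Sum>q<r * n. F (q div n) (q mod n)) = (\<Sum>a<r. \<Sum>t<n. F a t)"
proof (cases "n = 0")
  case False
  then have n: "0 < n" by simp
  have "(\<Sum>q<r * n. F (q div n) (q mod n)) = (\<Sum>z\<in>{..<r} \<times> {..<n}. F (fst z) (snd z))"
  proof (rule sum.reindex_bij_witness[of _ "\<lambda>z. fst z * n + snd z" "\<lambda>q. (q div n, q mod n)"])
    fix q assume "q \<in> {..<r * n}"
    then show "(q div n, q mod n) \<in> {..<r} \<times> {..<n}" using n by (simp add: less_mult_imp_div_less)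
  next
    fix z assume z: "z \<in> {..<r} \<times> {..<n}"
    then have "fst z * n + snd z < Suc (fst z) * n" by auto
    also have "\<dots> \<le> r * n" using z by (intro mult_le_mono1) auto
    finally show "fst z * n + snd z \<in> {..<r * n}" by simp
  qed (use n in auto)
  also have "\<dots> = (\<Sum>a<r. \<Sum>t<n. F a t)" by (simp add: sum.cartesian_product split_beta)
  finally show ?thesis .
qed simp

text \<open>The arrows collected into one square matrix \<open>T\<close> are invertible with inverse
  \<open>W\<close>, so the representation consists of \<open>n\<close> copies of one with dimension
  vector \<open>(1, r)\<close>. For \<open>n \<ge> 2\<close> the projection onto the first copy is a
  nontrivial idempotent.\<close>

lemma square_kronecker_decomposable:
  fixes B :: "'a::field mat list"
  assumes B: "B \<in> mat_tuples r (r * n) n" and n: "2 \<le> n" and r: "0 < r" and W: "W \<in> carrier_mat (r * n) (r * n)"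
    and TW: "\<And>s s'. s < r * n \<Longrightarrow> s' < r * n \<Longrightarrow>
      (\<Sum>a<r. \<Sum>t<n. (B ! a) $$ (s, t) * W $$ (a * n + t, s')) = (if s = s' then 1 else 0)"
  shows "\<not> kronecker_indecomposable n (r * n) B"
proof
  assume ind: "kronecker_indecomposable n (r * n) B"
  let ?m = "r * n"
  define T where "T = mat ?m ?m (\<lambda>(s, q). (B ! (q div n)) $$ (s, q mod n))"
  define e1 where "e1 = mat n n (\<lambda>(t, t'). if t = t' \<and> t = 0 then 1 else 0 :: 'a)"
  \<comment> \<open>\<open>D\<close> acts as \<open>e1\<close> on each of the \<open>r\<close>
    copies of the first space, \<open>I a\<close> includes the copy belonging to arrow
    \<open>a\<close>, and conjugation of \<open>D\<close> by \<open>T\<close> gives the companion of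
    \<open>e1\<close> at the second vertex.\<close>
  define D where "D = mat ?m ?m (\<lambda>(q, q'). if q = q' \<and> q mod n = 0 then 1 else 0 :: 'a)"
  define I where "I a = mat ?m n (\<lambda>(q, t). if q = a * n + t then 1 else 0 :: 'a)" for a
  have T: "T \<in> carrier_mat ?m ?m" and e1: "e1 \<in> carrier_mat n n" and D: "D \<in> carrier_mat ?m ?m" and I: "I a \<in> carrier_mat ?m n" for a
    by (simp_all add: T_def e1_def D_def I_def)
  have less: "a * n + t < ?m" if "a < r" "t < n" for a t
  proof -
    have "a * n + t < Suc a * n" using that by simp
    also have "\<dots> \<le> ?m" using that by (intro mult_le_mono1) auto
    finally show ?thesis .
  qed
  have "T * W = 1\<^sub>m ?m"
  proof (rule eq_matI)
    fix s s' assume "s < dim_row (1\<^sub>m ?m :: 'a mat)" "s' < dim_col (1\<^sub>m ?m :: 'a mat)"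
    then have s: "s < ?m" "s' < ?m" by simp_all
    have "(T * W) $$ (s, s') = (\<Sum>q<?m. T $$ (s, q) * W $$ (q, s'))" by (rule index_mult_mat_sum[OF T W s])
    also have "\<dots> = (\<Sum>q<?m. (B ! (q div n)) $$ (s, q mod n) * W $$ (q div n * n + q mod n, s'))"
      by (rule sum.cong) (simp_all add: T_def s)
    also have "\<dots> = (\<Sum>a<r. \<Sum>t<n. (B ! a) $$ (s, t) * W $$ (a * n + t, s'))"
      by (rule sum_div_mod[of "\<lambda>a t. (B ! a) $$ (s, t) * W $$ (a * n + t, s')"])
    finally show "(T * W) $$ (s, s') = 1\<^sub>m ?m $$ (s, s')" using TW[OF s] s by simp
  qed (use T W in auto)
  then have WT: "W * T = 1\<^sub>m ?m" by (rule mat_mult_left_right_inverse[OF T W])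
  have TI: "T * I a = B ! a" if a: "a < r" for a
  proof (rule eq_matI)
    note Ba = mat_tuplesD(2)[OF B a]
    fix s t assume "s < dim_row (B ! a)" "t < dim_col (B ! a)"
    then have st: "s < ?m" "t < n" using Ba by auto
    have "(T * I a) $$ (s, t) = (\<Sum>q<?m. T $$ (s, q) * I a $$ (q, t))" by (rule index_mult_mat_sum[OF T I st])
    also have "\<dots> = (\<Sum>q<?m. T $$ (s, q) * (if q = a * n + t then 1 else 0))"
      by (rule sum.cong) (simp_all add: I_def st)
    also have "\<dots> = T $$ (s, a * n + t)" using less[OF a st(2)] by (simp only: sum_mult_delta finite_lessThan lessThan_iff if_True)
    finally show "(T * I a) $$ (s, t) = B ! a $$ (s, t)" using st less[OF a st(2)] by (simp add: T_def)
  qed (use T I[of a] mat_tuplesD(2)[OF B a] in auto)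
  have DI: "D * I a = I a * e1" if a: "a < r" for a
  proof (rule eq_matI)
    fix q t assume "q < dim_row (I a * e1)" "t < dim_col (I a * e1)"
    then have qt: "q < ?m" "t < n" using I[of a] e1 by auto
    have "(D * I a) $$ (q, t) = (\<Sum>q'<?m. D $$ (q, q') * I a $$ (q', t))" by (rule index_mult_mat_sum[OF D I qt])
    also have "\<dots> = (\<Sum>q'<?m. D $$ (q, q') * (if q' = a * n + t then 1 else 0))"
      by (rule sum.cong) (simp_all add: I_def qt)
    also have "\<dots> = D $$ (q, a * n + t)" using less[OF a qt(2)] by (simp only: sum_mult_delta finite_lessThan lessThan_iff if_True)
    also have "\<dots> = (if q = a * n + t \<and> t = 0 then 1 else 0)" using qt less[OF a qt(2)] by (cases "q = a * n + t") (auto simp: D_def)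
    also have "\<dots> = (\<Sum>t'<n. I a $$ (q, t') * (if t' = t then (if t = 0 then 1 else 0) else 0))"
      using qt by (simp add: I_def if_distrib[of "\<lambda>z. _ * z"] cong: if_cong)
    also have "\<dots> = (\<Sum>t'<n. I a $$ (q, t') * e1 $$ (t', t))"
      by (rule sum.cong) (use qt in \<open>auto simp: e1_def\<close>)
    also have "\<dots> = (I a * e1) $$ (q, t)" by (rule index_mult_mat_sum[symmetric, OF I e1 qt])
    finally show "(D * I a) $$ (q, t) = (I a * e1) $$ (q, t)" .
  qed (use D I[of a] e1 in auto)
  have e11: "e1 * e1 = e1"
  proof (rule eq_matI)
    fix s t assume "s < dim_row e1" "t < dim_col e1"
    then have st: "s < n" "t < n" using e1 by auto
    have "(e1 * e1) $$ (s, t) = (\<Sum>q<n. e1 $$ (s, q) * e1 $$ (q, t))" by (rule index_mult_mat_sum[OF e1 e1 st])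
    also have "\<dots> = (\<Sum>q<n. if q = s then (if s = t \<and> s = 0 then 1 else 0) else 0)"
      by (rule sum.cong) (use st in \<open>auto simp: e1_def\<close>)
    finally show "(e1 * e1) $$ (s, t) = e1 $$ (s, t)" using st by (simp add: e1_def)
  qed (use e1 in auto)
  have DD: "D * D = D"
  proof (rule eq_matI)
    fix s t assume "s < dim_row D" "t < dim_col D"
    then have st: "s < ?m" "t < ?m" using D by auto
    have "(D * D) $$ (s, t) = (\<Sum>q<?m. D $$ (s, q) * D $$ (q, t))" by (rule index_mult_mat_sum[OF D D st])
    also have "\<dots> = (\<Sum>q<?m. if q = s then (if s = t \<and> s mod n = 0 then 1 else 0) else 0)"
      by (rule sum.cong) (use st in \<open>auto simp: D_def\<close>)
    finally show "(D * D) $$ (s, t) = D $$ (s, t)" using st by (simp add: D_def)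
  qed (use D in auto)
  define e2 where "e2 = T * D * W"
  note assoc = assoc_mult_mat[of _ ?m ?m _ ?m _ ?m] assoc_mult_mat[of _ ?m ?m _ ?m _ n] mult_carrier_mat[of _ ?m ?m _ ?m] mult_carrier_mat[of _ ?m ?m _ n]
  have e2: "e2 \<in> carrier_mat ?m ?m" using T D W by (auto simp: e2_def)
  have e22: "e2 * e2 = e2"
  proof -
    have "e2 * e2 = T * (D * ((W * T) * (D * W)))" by (simp add: e2_def assoc T D W)
    also have "\<dots> = T * ((D * D) * W)" by (simp add: WT assoc left_mult_one_mat[OF mult_carrier_mat[OF D W]] T D W)
    also have "\<dots> = e2" by (simp add: DD e2_def assoc T D W)
    finally show ?thesis .
  qed
  have comm: "B ! a * e1 = e2 * B ! a" if a: "a < r" for a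
  proof -
    have "e2 * B ! a = e2 * (T * I a)" by (simp only: TI[OF a])
    also have "\<dots> = T * (D * ((W * T) * I a))" by (simp add: e2_def assoc T D W I)
    also have "\<dots> = T * (I a * e1)" unfolding WT using I[of a] DI[OF a] by simp
    also have "\<dots> = T * I a * e1" using assoc_mult_mat[OF T I e1] by simp
    finally show ?thesis unfolding TI[OF a] by simp
  qed
  have "e1 $$ (0, 0) = 1" "e1 $$ (1, 1) = 0" using n by (simp_all add: e1_def)
  then have "e1 \<noteq> 0\<^sub>m n n" "e1 \<noteq> 1\<^sub>m n" using n by auto
  then show False using kronecker_indecomposable_idempotent[OF B ind e1 e11 e2 e22 comm] by blast
qed

section \<open>Components whose general modules share their level counts\<close>

lemma inverse_mats_adj:
  fixes A :: "'a::field mat"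
  assumes A: "A \<in> carrier_mat n n" and nz: "det A \<noteq> 0"
  shows "inverse_mats n A (inverse (det A) \<cdot>\<^sub>m adj_mat A)"
proof -
  note adj = adj_mat[OF A]
  have "A * (inverse (det A) \<cdot>\<^sub>m adj_mat A) = inverse (det A) \<cdot>\<^sub>m (A * adj_mat A)"
    by (rule mult_smult_distrib[OF A adj(1)])
  moreover have "(inverse (det A) \<cdot>\<^sub>m adj_mat A) * A = inverse (det A) \<cdot>\<^sub>m (adj_mat A * A)"
    by (rule mult_smult_assoc_mat[OF adj(1) A])
  moreover have "inverse (det A) \<cdot>\<^sub>m (det A \<cdot>\<^sub>m 1\<^sub>m n) = 1\<^sub>m n" using nz by (intro eq_matI) auto
  ultimately show ?thesis using A adj by (simp add: inverse_mats_def)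
qed

lemma conj_mult:
  fixes A B :: "'a::field mat"
  assumes gh: "inverse_mats d g h" and A: "A \<in> carrier_mat d d" and B: "B \<in> carrier_mat d d"
  shows "(h * A * g) * (h * B * g) = h * (A * B) * g"
proof -
  have c: "g \<in> carrier_mat d d" "h \<in> carrier_mat d d" and gh1: "g * h = 1\<^sub>m d" using gh by (auto simp: inverse_mats_def)
  note assoc = assoc_mult_mat[of _ d d _ d _ d] mult_carrier_mat[of _ d d _ d]
  have "(h * A * g) * (h * B * g) = h * (A * ((g * h) * (B * g)))" by (simp add: assoc A B c)
  also have "\<dots> = h * (A * B) * g" by (simp add: gh1 assoc left_mult_one_mat[OF mult_carrier_mat[OF B c(1)]] A B c)
  finally show ?thesis .
qed

lemma conj_back:
  fixes A :: "'a::field mat"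
  assumes gh: "inverse_mats d g h" and A: "A \<in> carrier_mat d d"
  shows "g * (h * A * g) * h = A"
proof -
  have c: "g \<in> carrier_mat d d" "h \<in> carrier_mat d d" and gh1: "g * h = 1\<^sub>m d" using gh by (auto simp: inverse_mats_def)
  note assoc = assoc_mult_mat[of _ d d _ d _ d] mult_carrier_mat[of _ d d _ d]
  have "g * (h * A * g) * h = (g * h) * (A * (g * h))" by (simp add: assoc A c)
  then show ?thesis using A by (simp add: gh1)
qed

lemma lvl_orbits_conj:
  fixes y :: "'a::field mat list"
  assumes p: "p \<in> lvl_orbits r d lv" and y: "y \<in> mat_tuples r d d" and gh: "inverse_mats d g h"
    and int: "\<And>a. a < r \<Longrightarrow> g * p ! a = y ! a * g"
  shows "y \<in> lvl_orbits r d lv"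
proof -
  obtain q k l where q: "q \<in> lvl_tuples r d lv" "inverse_mats d k l" "\<forall>a<r. k * q ! a = p ! a * k" and pm: "p \<in> mat_tuples r d d"
    using p unfolding lvl_orbits_def by blast
  have qm: "q \<in> mat_tuples r d d" using q(1) by (simp add: lvl_tuples_def)
  have c: "g \<in> carrier_mat d d" "k \<in> carrier_mat d d" using gh q(2) by (auto simp: inverse_mats_def)
  note assoc = assoc_mult_mat[of _ d d _ d _ d]
  have "g * k * q ! a = y ! a * (g * k)" if a: "a < r" for a
  proof -
    note m = mat_tuplesD(2)[OF qm a] mat_tuplesD(2)[OF pm a] mat_tuplesD(2)[OF y a]
    have "g * k * q ! a = g * (p ! a * k)" using q(3) a assoc[OF c m(1)] by simp
    also have "\<dots> = y ! a * g * k" using assoc[OF c(1) m(2) c(2)] int[OF a] by simp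
    also have "\<dots> = y ! a * (g * k)" by (rule assoc[OF m(3) c])
    finally show ?thesis .
  qed
  then show ?thesis unfolding lvl_orbits_def using q(1) y inverse_mats_mult[OF gh q(2)] by blast
qed

lemma lvl_count_raise:
  assumes i0: "i0 < d" and k: "k \<noteq> lv i0"
  shows "lvl_count d (lv(i0 := k)) j =
    (if j = k then Suc (lvl_count d lv j) else if j = lv i0 then lvl_count d lv j - 1 else lvl_count d lv j)"
proof -
  have "{i. i < d \<and> (lv(i0 := k)) i = j} =
    (if j = k then insert i0 {i. i < d \<and> lv i = j} else {i. i < d \<and> lv i = j} - {i0})"
    using i0 k by auto
  moreover have "{i. i < d \<and> lv i = j} - {i0} = {i. i < d \<and> lv i = j}" if "j \<noteq> lv i0" using that by auto
  ultimately show ?thesis using i0 k by (cases "j = k"; cases "j = lv i0") simp_all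
qed

lemma filtered_count_Suc:
  assumes "filtered r d lv p"
  shows "lvl_count d lv (Suc j) \<le> r * lvl_count d lv j"
  using filtered_count[OF assms, of "{}" j] by simp

text \<open>A zero column of a filtered tuple allows its index to be raised to any higher level, unless the
  resulting level counts are no longer those of a filtered tuple; this happens only if the levels in
  question are free over their predecessors.\<close>

lemma zero_column_counts:
  assumes p: "filtered r d lv p" and i0: "i0 < d" and z: "\<And>a i. a < r \<Longrightarrow> i < d \<Longrightarrow> (p ! a) $$ (i, i0) = 0"
    and k: "lv i0 < k" and nr: "\<not> (\<forall>j. lvl_count d (lv(i0 := k)) (Suc j) \<le> r * lvl_count d (lv(i0 := k)) j)"
  shows "lvl_count d lv k = r * (if k = Suc (lv i0) then lvl_count d lv (lv i0) - 1 else lvl_count d lv (k - 1))"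
proof -
  note base = filtered_count_Suc[OF p]
  \<comment> \<open>Raising lowers the count at \<open>lv i0\<close> and increases the one at
    \<open>k\<close>. The loss is harmless, since the zero column generates nothing; so only the
    inequality between \<open>k - 1\<close> and \<open>k\<close> can fail, and failing by the single
    added vector means equality before.\<close>
  have "lvl_count d lv (Suc (lv i0)) \<le> r * card ({c. c < d \<and> lv c = lv i0} - {i0})"
    by (rule filtered_count[OF p]) (use z in auto)
  then have zc: "lvl_count d lv (Suc (lv i0)) \<le> r * (lvl_count d lv (lv i0) - 1)" using i0 by simp
  obtain j where j: "\<not> lvl_count d (lv(i0 := k)) (Suc j) \<le> r * lvl_count d (lv(i0 := k)) j" using nr by blast
  have k0: "k \<noteq> lv i0" using k by simp
  note cnt = lvl_count_raise[of i0 d k lv, OF i0 k0]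
  show ?thesis
  proof (cases "Suc j = k")
    case True
    then show ?thesis using j base[of j] zc k unfolding cnt by (auto split: if_splits)
  next
    case False
    have "lvl_count d (lv(i0 := k)) (Suc j) \<le> lvl_count d lv (Suc j)" unfolding cnt using False by auto
    moreover have "lvl_count d lv (Suc j) \<le> r * lvl_count d (lv(i0 := k)) j"
    proof (cases "j = lv i0")
      case True then show ?thesis unfolding cnt using zc k by simp
    next
      case False
      then have "lvl_count d lv j \<le> lvl_count d (lv(i0 := k)) j" unfolding cnt by simp
      then show ?thesis using base[of j] by (meson le_trans mult_le_mono2)
    qed
    ultimately show ?thesis using j by simp
  qed
qed

text \<open>When a level attains the maximal count allowed by the previous one, the collected matrix
  of the block is square, and \<open>filtered_generation\<close> provides its right inverse.\<close>

lemma free_level_decomposable: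
  fixes p :: "'a::field mat list"
  assumes p: "filtered r d lv p" and r: "0 < r" and n: "2 \<le> lvl_count d lv j" and free: "lvl_count d lv (Suc j) = r * lvl_count d lv j"
  shows "\<not> kronecker_indecomposable (lvl_count d lv j) (lvl_count d lv (Suc j)) (block_tuple r d lv (Suc j) j p)"
proof -
  define n where "n = lvl_count d lv j"
  have n2: "lvl_count d lv (Suc j) = r * n" using free by (simp add: n_def)
  let ?B = "block_tuple r d lv (Suc j) j p"
  have B: "?B \<in> mat_tuples r (r * n) n" using block_tuple_mem[of r d lv "Suc j" j p] unfolding n2 n_def[symmetric] .
  have "\<forall>s'. \<exists>u. s' < r * n \<longrightarrow> (\<forall>k<d. lv k = Suc j \<longrightarrow> (if level_index d lv (Suc j) s' = k then 1 else 0) =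
      (\<Sum>a<r. \<Sum>c\<in>{c. c < d \<and> lv c = j}. (p ! a) $$ (k, c) * u a c))"
  proof (intro allI)
    fix s'
    show "\<exists>u. s' < r * n \<longrightarrow> (\<forall>k<d. lv k = Suc j \<longrightarrow> (if level_index d lv (Suc j) s' = k then 1 else 0) =
      (\<Sum>a<r. \<Sum>c\<in>{c. c < d \<and> lv c = j}. (p ! a) $$ (k, c) * u a c))"
    proof (cases "s' < r * n")
      case True
      then have s': "s' < lvl_count d lv (Suc j)" by (simp only: n2)
      show ?thesis using filtered_generation[OF p level_index_less[OF s']] by (elim exE) (rule exI, rule impI)
    qed simp
  qed
  from choice[OF this] obtain u where u: "\<And>s' k. s' < r * n \<Longrightarrow> k < d \<Longrightarrow> lv k = Suc j \<Longrightarrow>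
      (if level_index d lv (Suc j) s' = k then 1 else 0) = (\<Sum>a<r. \<Sum>c\<in>{c. c < d \<and> lv c = j}. (p ! a) $$ (k, c) * u s' a c)"
    by (elim exE) (rule that, simp)
  \<comment> \<open>The generation coefficients arranged as a matrix: the row index \<open>q\<close>
    encodes an arrow by \<open>q div n\<close> and a vector of level \<open>j\<close> by
    \<open>q mod n\<close>.\<close>
  define W where "W = mat (r * n) (r * n) (\<lambda>(q, s'). u s' (q div n) (level_index d lv j (q mod n)))"
  have less: "a * n + t < r * n" if "a < r" "t < n" for a t
  proof -
    have "a * n + t < Suc a * n" using that by simp
    also have "\<dots> \<le> r * n" using that by (intro mult_le_mono1) auto
    finally show ?thesis .
  qed
  have "(\<Sum>a<r. \<Sum>t<n. (?B ! a) $$ (s, t) * W $$ (a * n + t, s')) = (if s = s' then 1 else 0)"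
    if s: "s < r * n" and s': "s' < r * n" for s s'
  proof -
    have sl: "s < lvl_count d lv (Suc j)" "s' < lvl_count d lv (Suc j)" using s s' by (simp_all only: n2)
    have "(\<Sum>t<n. (?B ! a) $$ (s, t) * W $$ (a * n + t, s')) =
        (\<Sum>c | c < d \<and> lv c = j. (p ! a) $$ (level_index d lv (Suc j) s, c) * u s' a c)" if a: "a < r" for a
      unfolding sum_level_index n_def[symmetric]
      by (rule sum.cong) (use sl s' less[OF a] a in \<open>simp_all add: W_def block_tuple_nth level_block_def n_def[symmetric]\<close>)
    then have "(\<Sum>a<r. \<Sum>t<n. (?B ! a) $$ (s, t) * W $$ (a * n + t, s')) =
        (\<Sum>a<r. \<Sum>c | c < d \<and> lv c = j. (p ! a) $$ (level_index d lv (Suc j) s, c) * u s' a c)"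
      by (intro sum.cong[OF refl]) simp
    also have "\<dots> = (if level_index d lv (Suc j) s' = level_index d lv (Suc j) s then 1 else 0)"
      by (rule u[OF s' level_index_less[OF sl(1)], symmetric])
    also have "\<dots> = (if s = s' then 1 else 0)" using level_index_eq_iff[OF sl(2,1)] by auto
    finally show ?thesis .
  qed
  moreover have "W \<in> carrier_mat (r * n) (r * n)" by (simp add: W_def)
  ultimately have "\<not> kronecker_indecomposable n (r * n) ?B"
    using n by (intro square_kronecker_decomposable[OF B _ r]) (auto simp: n_def)
  then show ?thesis unfolding n2 n_def[symmetric] .
qed

lemma block_idempotent_trivial:
  fixes p :: "'a::field mat list"
  assumes p: "filtered r d lv p" and lvL: "\<And>i. i < d \<Longrightarrow> lv i \<le> L" and r: "2 \<le> r" and j: "Suc j \<le> L"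
    and ind: "kronecker_indecomposable (lvl_count d lv j) (lvl_count d lv (Suc j)) (block_tuple r d lv (Suc j) j p)"
    and avoid: "\<And>i0 k. i0 < d \<Longrightarrow> lv i0 < k \<Longrightarrow> k \<le> L \<Longrightarrow>
      (\<forall>j. lvl_count d (lv(i0 := k)) (Suc j) \<le> r * lvl_count d (lv(i0 := k)) j) \<Longrightarrow> p \<notin> lvl_orbits r d (lv(i0 := k))"
    and E: "E \<in> carrier_mat d d" "E * E = E" "\<And>a. a < r \<Longrightarrow> E * p ! a = p ! a * E"
    and blk: "level_block d lv j j E = 0\<^sub>m (lvl_count d lv j) (lvl_count d lv j)"
  shows "E = 0\<^sub>m d d"
proof (rule ccontr)
  assume nz: "E \<noteq> 0\<^sub>m d d"
  have blk0: "E $$ (i, k) = 0" if ik: "i < d" "k < d" "lv i = j" "lv k = j" for i k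
  proof -
    obtain s t where st: "s < lvl_count d lv j" "level_index d lv j s = i" "t < lvl_count d lv j" "level_index d lv j t = k"
      using level_index_surj[of i d lv j] level_index_surj[of k d lv j] ik by blast
    have "level_block d lv j j E $$ (s, t) = E $$ (i, k)" using st by (simp add: level_block_def)
    then show ?thesis using blk st by simp
  qed
  have "\<exists>v i. i < d \<and> v \<in> lvl_space d lv (lv i) \<and> v $ i \<noteq> 0 \<and> lv i < j \<and> (\<forall>a<r. p ! a *\<^sub>v v = 0\<^sub>v d)"
    by (rule split_vector[OF p _ E(1,2) _ nz]) (use lvL E(3) blk0 in auto)
  then obtain v i0 where v: "i0 < d" "v \<in> lvl_space d lv (lv i0)" "v $ i0 \<noteq> 0" "lv i0 < j" "\<forall>a<r. p ! a *\<^sub>v v = 0\<^sub>v d"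
    by (elim exE conjE) (rule that)
  have v5: "p ! a *\<^sub>v v = 0\<^sub>v d" if "a < r" for a using v(5) that by simp
  have "\<exists>p' g h. filtered r d lv p' \<and> inverse_mats d g h \<and> (\<forall>a<r. g * p' ! a = p ! a * g) \<and>
      (\<forall>a<r. \<forall>i<d. (p' ! a) $$ (i, i0) = 0)"
    by (rule kill_column[OF p v(1,2,3)]) (rule v5)
  then obtain p' g h where p': "filtered r d lv p'" and gh: "inverse_mats d g h" and int: "\<forall>a<r. g * p' ! a = p ! a * g"
    and z: "\<forall>a<r. \<forall>i<d. (p' ! a) $$ (i, i0) = 0"
    by (elim exE conjE) (rule that)
  have pm: "p \<in> mat_tuples r d d" using p by (simp add: filtered_def lvl_tuples_def)
  have pt': "p' \<in> lvl_tuples r d lv" using p' by (simp add: filtered_def)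
  have nr: "\<not> (\<forall>j. lvl_count d (lv(i0 := k)) (Suc j) \<le> r * lvl_count d (lv(i0 := k)) j)" if k: "lv i0 < k" "k \<le> L" for k
  proof
    assume real: "\<forall>j. lvl_count d (lv(i0 := k)) (Suc j) \<le> r * lvl_count d (lv(i0 := k)) j"
    have "p' \<in> lvl_tuples r d (lv(i0 := k))" by (rule lvl_tuples_raise[OF pt']) (use z k in auto)
    then have "p' \<in> lvl_orbits r d (lv(i0 := k))" using lvl_tuples_subset_lvl_orbits by blast
    then have "p \<in> lvl_orbits r d (lv(i0 := k))" by (rule lvl_orbits_conj[OF _ pm gh]) (use int in simp)
    then show False using avoid[OF v(1) k real] by simp
  qed
  have zz: "(p' ! a) $$ (i, i0) = 0" if "a < r" "i < d" for a i using z that by simp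
  \<comment> \<open>Raising \<open>i0\<close> to \<open>Suc j\<close> and raising it to
    \<open>j\<close> must both be impossible. As \<open>lv i0 < j\<close>, the first gives freeness
    of level \<open>Suc j\<close> over level \<open>j\<close>; the second makes the count at
    \<open>j\<close> a multiple of \<open>r\<close>, so it is 0 or at least 2. Count 0 would give
    the excluded dimension vector \<open>(0, 0)\<close>.\<close>
  have "lvl_count d lv (Suc j) = r * lvl_count d lv j"
    using zero_column_counts[OF p' v(1) zz _ nr, of "Suc j"] v(4) j by simp
  moreover obtain y where "lvl_count d lv j = r * y"
    using zero_column_counts[OF p' v(1) zz _ nr, of j] v(4) j by auto
  ultimately have n: "lvl_count d lv (Suc j) = r * lvl_count d lv j" "lvl_count d lv j = 0 \<or> 2 \<le> lvl_count d lv j"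
    using r by (auto intro: le_trans[of 2 r])
  then show False
    using ind free_level_decomposable[OF p _ _ n(1)] r by (auto simp: kronecker_indecomposable_def)
qed

text \<open>One level function serves the whole principal open set of \<open>f0\<close>, while the
  adapted basis may vary with the point.\<close>

locale filtered_component =
  fixes r L d :: nat and C :: "'a::alg_closed_field mat list set" and lv :: "nat \<Rightarrow> nat" and f0 :: "'a mat list \<Rightarrow> 'a"
  assumes CR: "C \<subseteq> Rep r L d" and Cirr: "zirr r d d C"
    and Cmax: "\<And>D. zirr r d d D \<Longrightarrow> D \<subseteq> Rep r L d \<Longrightarrow> C \<subseteq> zcl r d d D \<Longrightarrow> D \<subseteq> C"
    and lvL: "\<And>i. i < d \<Longrightarrow> lv i \<le> L"
    and f0: "f0 \<in> poly_funs r d d" "\<exists>x\<in>C. f0 x \<noteq> 0"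
    and ad: "\<And>x. x \<in> C \<Longrightarrow> f0 x \<noteq> 0 \<Longrightarrow> \<exists>g h. adapted r d x lv g h"
begin

lemma C_tuples: "x \<in> C \<Longrightarrow> x \<in> mat_tuples r d d"
  using CR by (auto simp: Rep_def)

lemma lvl_orbits_subset:
  assumes lv': "\<And>i. i < d \<Longrightarrow> lv' i \<le> L"
    and dense: "\<And>f. f \<in> poly_funs r d d \<Longrightarrow> \<forall>y\<in>lvl_orbits r d lv'. f y = 0 \<Longrightarrow> \<forall>x\<in>C. f x = 0"
  shows "lvl_orbits r d lv' \<subseteq> C"
proof (rule Cmax[OF zirr_lvl_orbits lvl_orbits_Rep[OF lv']])
  show "C \<subseteq> zcl r d d (lvl_orbits r d lv')"
  proof
    fix x assume x: "x \<in> C"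
    show "x \<in> zcl r d d (lvl_orbits r d lv')" unfolding zcl_def using C_tuples[OF x] dense x by simp
  qed
qed

text \<open>Every point of \<open>C\<close> with \<open>f0\<close> nonzero is conjugate to a level
  tuple, so these orbits are dense over \<open>C\<close>. Being irreducible and inside
  \<open>Rep r L d\<close>, they lie in \<open>C\<close> by maximality.\<close>

lemma generic_lvl_orbits: "lvl_orbits r d lv \<subseteq> C"
proof (rule lvl_orbits_subset[OF lvL])
  fix f :: "'a mat list \<Rightarrow> 'a" assume f: "f \<in> poly_funs r d d" "\<forall>y\<in>lvl_orbits r d lv. f y = 0"
  show "\<forall>x\<in>C. f x = 0"
  proof (rule ccontr)
    assume "\<not> (\<forall>x\<in>C. f x = 0)"
    then have ex: "\<exists>x\<in>C. f x \<noteq> 0" by simp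
    obtain x where x: "x \<in> C" "f x \<noteq> 0" "f0 x \<noteq> 0" using zirrD[OF Cirr f(1) f0(1) ex f0(2)] by (elim bexE conjE) (rule that)
    obtain g h where "adapted r d x lv g h" using ad[OF x(1,3)] by (elim exE) (rule that)
    then have "x \<in> lvl_orbits r d lv" by (rule adapted_lvl_orbits[OF C_tuples[OF x(1)]])
    then show False using f(2) x(2) by simp
  qed
qed

text \<open>If these orbits were dense in \<open>C\<close>, then \<open>C\<close> would contain a tuple filtered by \<open>lv'\<close>, and by
  semicontinuity the \<open>k\<close>-th radical power at a general point of \<open>C\<close> would be at least as large as there.\<close>

lemma lvl_orbits_not_dense:
  assumes lv': "\<And>i. i < d \<Longrightarrow> lv' i \<le> L" and cnt: "\<And>j. lvl_count d lv' (Suc j) \<le> r * lvl_count d lv' j"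
    and more: "card {i. i < d \<and> k \<le> lv i} < card {i. i < d \<and> k \<le> lv' i}"
  shows "\<exists>f\<in>poly_funs r d d. (\<forall>y\<in>lvl_orbits r d lv'. f y = 0) \<and> (\<exists>x\<in>C. f x \<noteq> 0)"
proof (rule ccontr)
  assume neg: "\<not> ?thesis"
  have sub: "lvl_orbits r d lv' \<subseteq> C"
  proof (rule lvl_orbits_subset[OF lv'])
    fix f :: "'a mat list \<Rightarrow> 'a" assume "f \<in> poly_funs r d d" "\<forall>y\<in>lvl_orbits r d lv'. f y = 0"
    then show "\<forall>x\<in>C. f x = 0" using neg by blast
  qed
  obtain p :: "'a mat list" where p: "filtered r d lv' p" using realizable_levels[OF cnt] by (elim exE) (rule that)
  have pt: "p \<in> lvl_tuples r d lv'" and pr: "\<And>j. rad r d p j = lvl_space d lv' j" using p by (auto simp: filtered_def)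
  have pm: "p \<in> mat_tuples r d d" using pt by (simp add: lvl_tuples_def)
  have pC: "p \<in> C" using sub lvl_tuples_subset_lvl_orbits pt by blast
  have col: "col (1\<^sub>m d) i \<in> rad r d p (lv' i)" if "i < d" for i
    unfolding pr using that unit_vec_lvl_space[OF that order_refl] by simp
  have "\<exists>G. G p = 1\<^sub>m d \<and> (\<forall>x. G x \<in> carrier_mat d d) \<and> (\<forall>i<d. \<forall>k<d. (\<lambda>x. G x $$ (i, k)) \<in> poly_funs r d d) \<and>
      (\<forall>x\<in>mat_tuples r d d. \<forall>j. \<forall>v\<in>lvl_space d lv' j. G x *\<^sub>v v \<in> rad r d x j)"
    by (rule chart_matrix[OF pm one_carrier_mat]) (rule col)
  then obtain G where G0: "G p = 1\<^sub>m d" "\<forall>x. G x \<in> carrier_mat d d" "\<forall>i<d. \<forall>k<d. (\<lambda>x. G x $$ (i, k)) \<in> poly_funs r d d"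
    "\<forall>x\<in>mat_tuples r d d. \<forall>j. \<forall>v\<in>lvl_space d lv' j. G x *\<^sub>v v \<in> rad r d x j"
    by (elim exE conjE) (rule that)
  note G = G0(1) G0(2,3,4)[rule_format]
  have dp: "(\<lambda>x. det (G x)) \<in> poly_funs r d d" by (rule poly_funs.det[OF G(2,3)])
  have "\<exists>x\<in>C. det (G x) \<noteq> 0" by (rule bexI[OF _ pC]) (simp add: G(1))
  from zirrD[OF Cirr dp f0(1) this f0(2)] obtain x where x: "x \<in> C" "det (G x) \<noteq> 0" "f0 x \<noteq> 0"
    by (elim bexE conjE) (rule that)
  obtain g h where "adapted r d x lv g h" using ad[OF x(1,3)] by (elim exE) (rule that)
  then have gh: "inverse_mats d g h" and xr: "\<And>j. rad r d x j = (*\<^sub>v) g ` lvl_space d lv j" by (auto simp: adapted_def)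
  have hc: "h \<in> carrier_mat d d" using gh by (simp add: inverse_mats_def)
  note inv = inverse_mats_mult[OF inverse_mats_sym[OF gh] inverse_mats_adj[OF G(2) x(2)]]
  have into: "(h * G x) *\<^sub>v v \<in> lvl_space d lv k" if v: "v \<in> lvl_space d lv' k" for v
  proof -
    have vc: "v \<in> carrier_vec d" using v by (simp add: lvl_space_def)
    obtain w where w: "w \<in> lvl_space d lv k" "G x *\<^sub>v v = g *\<^sub>v w" using G(4)[OF C_tuples[OF x(1)] v] unfolding xr by blast
    have wc: "w \<in> carrier_vec d" using w(1) by (simp add: lvl_space_def)
    have "(h * G x) *\<^sub>v v = w"
      using assoc_mult_mat_vec[OF hc G(2) vc] w(2) inverse_mats_vec[OF inverse_mats_sym[OF gh] wc] by simp
    then show ?thesis using w(1) by simp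
  qed
  have "card {i. i < d \<and> k \<le> lv' i} \<le> card {i. i < d \<and> k \<le> lv i}"
    by (rule lvl_space_card_le[OF inv]) (rule into)
  then show False using more by simp
qed

text \<open>The raised index joins the term of level \<open>k\<close> of the flag, enlarging exactly
  the dimension that semicontinuity forbids to grow.\<close>

lemma raised_not_dense:
  assumes i0: "i0 < d" and k: "lv i0 < k" "k \<le> L"
    and cnt: "\<forall>j. lvl_count d (lv(i0 := k)) (Suc j) \<le> r * lvl_count d (lv(i0 := k)) j"
  shows "\<exists>f\<in>poly_funs r d d. (\<forall>y\<in>lvl_orbits r d (lv(i0 := k)). f y = 0) \<and> (\<exists>x\<in>C. f x \<noteq> 0)"
proof (rule lvl_orbits_not_dense)
  show "(lv(i0 := k)) i \<le> L" if "i < d" for i using lvL[OF that] k by simp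
  show "lvl_count d (lv(i0 := k)) (Suc j) \<le> r * lvl_count d (lv(i0 := k)) j" for j using cnt by simp
  have "{i. i < d \<and> k \<le> (lv(i0 := k)) i} = insert i0 {i. i < d \<and> k \<le> lv i}" using i0 k by auto
  then show "card {i. i < d \<and> k \<le> lv i} < card {i. i < d \<and> k \<le> (lv(i0 := k)) i}" using k by simp
qed

text \<open>Conditions on the point of the component and on the block of its triangular form are met
  together. The block is first prescribed on an arbitrary level tuple; after moving to a general
  pair, nonvanishing of \<open>f0\<close> makes the tuple filtered.\<close>

lemma generic_filtered_point:
  assumes f: "f \<in> poly_funs r d d" "\<exists>x\<in>C. f x \<noteq> 0"
    and F: "F \<in> poly_funs r (lvl_count d lv (Suc j)) (lvl_count d lv j)"
    and B: "B \<in> mat_tuples r (lvl_count d lv (Suc j)) (lvl_count d lv j)" "F B \<noteq> 0"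
  shows "\<exists>x p g h. x \<in> C \<and> f0 x \<noteq> 0 \<and> f x \<noteq> 0 \<and> filtered r d lv p \<and> inverse_mats d g h \<and>
    (\<forall>a<r. g * p ! a = x ! a * g) \<and> F (block_tuple r d lv (Suc j) j p) \<noteq> 0"
proof -
  obtain x0 where x0: "x0 \<in> C" "f0 x0 \<noteq> 0" "f x0 \<noteq> 0" using zirrD[OF Cirr f0(1) f(1) f0(2) f(2)] by (elim bexE conjE) (rule that)
  obtain g0 h0 where "adapted r d x0 lv g0 h0" using ad[OF x0(1,2)] by (elim exE) (rule that)
  then have x0o: "x0 \<in> lvl_orbits r d lv" by (rule adapted_lvl_orbits[OF C_tuples[OF x0(1)]])
  obtain p1 where p1: "p1 \<in> lvl_tuples r d lv" "block_tuple r d lv (Suc j) j p1 = B" using block_tuple_surj[OF B(1)] by (elim bexE) (rule that)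
  have nz1: "F (block_tuple r d lv (Suc j) j p1) \<noteq> 0" using B(2) p1(2) by simp
  have nz2: "f0 x0 * f x0 \<noteq> 0" using x0 by simp
  obtain p x g h where *: "p \<in> lvl_tuples r d lv" "x \<in> mat_tuples r d d" "inverse_mats d g h" "\<forall>a<r. g * p ! a = x ! a * g"
    "f0 x * f x \<noteq> 0" "F (block_tuple r d lv (Suc j) j p) \<noteq> 0"
    using lvl_orbits_common_point[OF poly_funs.mult[OF f0(1) f(1)] x0o nz2 block_tuple_poly[OF F] p1(1) nz1]
    by (elim bexE exE conjE) (rule that)
  have "x \<in> lvl_orbits r d lv" unfolding lvl_orbits_def using * by blast
  then have xC: "x \<in> C" using generic_lvl_orbits by blast
  have "f0 x \<noteq> 0" using *(5) by simp
  then obtain g1 h1 where ad1: "adapted r d x lv g1 h1" using ad[OF xC] by blast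
  have "filtered r d lv p" by (rule adapted_level_tuple_filtered[OF *(1,2,3) _ ad1]) (use *(4) in simp)
  with * xC show ?thesis by (intro exI[of _ x] exI[of _ p] exI[of _ g] exI[of _ h]) simp
qed

end

section \<open>Generic indecomposability\<close>

context filtered_component
begin

text \<open>The required open set is cut out by four kinds of conditions: generic layers
  (\<open>f0\<close>), invertibility of a chart (\<open>\<delta>\<close>), an indecomposable
  Kronecker block in that chart (\<open>F\<close>), and distance from the finitely many raised loci
  (\<open>\<psi>\<close>).\<close>

lemma generically_indecomposable_of_schur_root:
  assumes r: "2 \<le> r" and d: "0 < d" and j: "Suc j \<le> L"
    and schur: "schur_root TYPE('a) r (lvl_count d lv j) (lvl_count d lv (Suc j))"
  shows "generically_indecomposable r L d C"
proof -
  let ?s = "lvl_count d lv"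
  let ?b = "block_tuple r d lv (Suc j) j"
  have "generically (subtopology (zariski r (?s (Suc j)) (?s j) :: 'a mat list topology) (mat_tuples r (?s (Suc j)) (?s j)))
      (kronecker_indecomposable (?s j) (?s (Suc j)))"
    using schur unfolding schur_root_def topspace_zariski[symmetric] subtopology_topspace .
  then obtain fV :: "'a mat list \<Rightarrow> 'a" and B where fV: "fV \<in> poly_funs r (?s (Suc j)) (?s j)"
    and B: "B \<in> mat_tuples r (?s (Suc j)) (?s j)" "fV B \<noteq> 0"
    and ind: "\<And>B. B \<in> mat_tuples r (?s (Suc j)) (?s j) \<Longrightarrow> fV B \<noteq> 0 \<Longrightarrow> kronecker_indecomposable (?s j) (?s (Suc j)) B"
    unfolding generically_iff[OF zirr_mat_tuples] by blast
  obtain x p g h where x: "x \<in> C" "f0 x \<noteq> 0" and p: "filtered r d lv p" and gh: "inverse_mats d g h"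
    and int: "\<forall>a<r. g * p ! a = x ! a * g" and fVp: "fV (?b p) \<noteq> 0"
    using generic_filtered_point[OF f0 fV B] by (elim exE conjE) (rule that)
  note xm = C_tuples[OF x(1)]
  have pm: "p \<in> mat_tuples r d d" and pr: "\<And>j. rad r d p j = lvl_space d lv j" using p by (auto simp: filtered_def lvl_tuples_def)
  have gc: "g \<in> carrier_mat d d" and hc: "h \<in> carrier_mat d d" and dg: "det g \<noteq> 0"
  proof -
    show g: "g \<in> carrier_mat d d" and h: "h \<in> carrier_mat d d" using gh by (auto simp: inverse_mats_def)
    have "det g * det h = 1" using gh det_mult[OF g h] by (simp add: inverse_mats_def)
    then show "det g \<noteq> 0" by auto
  qed
  have col: "col g i \<in> rad r d x (lv i)" if i: "i < d" for i
  proof -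
    have "unit_vec d i \<in> rad r d p (lv i)" unfolding pr by (rule unit_vec_lvl_space[OF i order_refl])
    then have "g *\<^sub>v unit_vec d i \<in> rad r d x (lv i)" by (rule rad_hom[OF pm xm gc, rotated]) (use int in simp)
    moreover have "g *\<^sub>v unit_vec d i = col g i" using gc i by (intro eq_vecI) (auto simp: scalar_prod_right_unit)
    ultimately show ?thesis by simp
  qed
  have "\<exists>G. G x = g \<and> (\<forall>x. G x \<in> carrier_mat d d) \<and> (\<forall>i<d. \<forall>k<d. (\<lambda>x. G x $$ (i, k)) \<in> poly_funs r d d) \<and>
      (\<forall>x\<in>mat_tuples r d d. \<forall>j. \<forall>v\<in>lvl_space d lv j. G x *\<^sub>v v \<in> rad r d x j)"
    by (rule chart_matrix[OF xm gc]) (rule col)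
  then obtain G where G0: "G x = g" "\<forall>x. G x \<in> carrier_mat d d" "\<forall>i<d. \<forall>k<d. (\<lambda>x. G x $$ (i, k)) \<in> poly_funs r d d"
    "\<forall>x\<in>mat_tuples r d d. \<forall>j. \<forall>v\<in>lvl_space d lv j. G x *\<^sub>v v \<in> rad r d x j"
    by (elim exE conjE) (rule that)
  note G = G0(1) G0(2,3,4)[rule_format]
  define \<delta> where "\<delta> y = det (G y)" for y
  define H where "H y = inverse (\<delta> y) \<cdot>\<^sub>m adj_mat (G y)" for y
  have \<delta>: "\<delta> \<in> poly_funs r d d" unfolding \<delta>_def by (rule poly_funs.det[OF G(2,3)])
  have Hc: "H y \<in> carrier_mat d d" for y unfolding H_def using adj_mat(1)[OF G(2)] by simp
  have GH: "inverse_mats d (G y) (H y)" if "\<delta> y \<noteq> 0" for y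
    using inverse_mats_adj[OF G(2)[of y]] that by (simp add: H_def \<delta>_def)
  \<comment> \<open>The triangular form as a rational function of the point. Rereading the entries
    with \<open>mat d d\<close> gives the factors the right size also at lists outside
    \<open>mat_tuples r d d\<close>.\<close>
  define pt where "pt y = map (\<lambda>a. H y * mat d d (\<lambda>ik. (y ! a) $$ ik) * G y) [0..<r]" for y
  have pt: "pt y = map (\<lambda>A. H y * A * G y) y" if y: "y \<in> mat_tuples r d d" for y
  proof (rule nth_equalityI)
    show "length (pt y) = length (map (\<lambda>A. H y * A * G y) y)" using mat_tuplesD(1)[OF y] by (simp add: pt_def)
    fix a assume "a < length (pt y)"
    then have a: "a < r" by (simp add: pt_def)
    have "mat d d (\<lambda>ik. (y ! a) $$ ik) = y ! a" using mat_tuplesD(2)[OF y a] by (intro eq_matI) auto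
    then show "pt y ! a = map (\<lambda>A. H y * A * G y) y ! a" using a mat_tuplesD(1)[OF y] by (simp add: pt_def)
  qed
  interpret A: function_algebra "localize (poly_funs r d d) \<delta>" by (rule poly_funs.function_algebra_localize[OF \<delta>])
  have "(\<lambda>y. fV (?b (pt y))) \<in> localize (poly_funs r d d) \<delta>"
  proof (rule A.poly_fun_compose[OF fV])
    fix a s t assume a: "a < r" and st: "s < ?s (Suc j)" "t < ?s j"
    have Ge: "(\<lambda>y. G y $$ (i, k)) \<in> localize (poly_funs r d d) \<delta>" if "i < d" "k < d" for i k
      by (rule poly_funs.subset_localize[OF G(3)[OF that]])
    have He: "(\<lambda>y. H y $$ (i, k)) \<in> localize (poly_funs r d d) \<delta>" if ik: "i < d" "k < d" for i k
    proof -
      have "(\<lambda>y. inverse (\<delta> y) * adj_mat (G y) $$ (i, k)) \<in> localize (poly_funs r d d) \<delta>"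
        by (rule A.mult[OF poly_funs.inverse_localize poly_funs.subset_localize[OF poly_funs.adj_mat[OF G(2,3) ik]]])
      moreover have "H y $$ (i, k) = inverse (\<delta> y) * adj_mat (G y) $$ (i, k)" for y
        unfolding H_def using ik adj_mat(1)[OF G(2)[of y]] by simp
      ultimately show ?thesis by simp
    qed
    have Ye: "(\<lambda>y. mat d d (\<lambda>ik. (y ! a) $$ ik) $$ (i, k)) \<in> localize (poly_funs r d d) \<delta>" if ik: "i < d" "k < d" for i k
      using poly_funs.subset_localize[OF poly_funs.coord[OF a ik]] ik by simp
    have "(\<lambda>y. (H y * mat d d (\<lambda>ik. (y ! a) $$ ik)) $$ (i, k)) \<in> localize (poly_funs r d d) \<delta>" if ik: "i < d" "k < d" for i k
      by (rule A.mult_mat[OF Hc mat_carrier He Ye ik])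
    then have "(\<lambda>y. (H y * mat d d (\<lambda>ik. (y ! a) $$ ik) * G y) $$ (level_index d lv (Suc j) s, level_index d lv j t)) \<in> localize (poly_funs r d d) \<delta>"
      by (rule A.mult_mat[OF mult_carrier_mat[OF Hc mat_carrier] G(2) _ Ge level_index_less(1)[OF st(1)] level_index_less(1)[OF st(2)]])
    then show "(\<lambda>y. (?b (pt y) ! a) $$ (s, t)) \<in> localize (poly_funs r d d) \<delta>"
      using a st by (simp add: block_tuple_nth level_block_def pt_def)
  qed
  \<comment> \<open>\<open>F\<close> is the numerator of the pulled-back condition on the block,
    hence a polynomial function on the component.\<close>
  then obtain N F where F: "F \<in> poly_funs r d d" "\<And>y. \<delta> y \<noteq> 0 \<Longrightarrow> fV (?b (pt y)) * \<delta> y ^ N = F y"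
    unfolding localize_def by blast
  have \<delta>x: "\<delta> x \<noteq> 0" using dg by (simp add: \<delta>_def G(1))
  have ptx: "pt x = p"
  proof (rule nth_equalityI)
    show "length (pt x) = length p" using mat_tuplesD(1)[OF pm] by (simp add: pt_def)
    fix a assume "a < length (pt x)"
    then have a: "a < r" by (simp add: pt_def)
    have Hg: "H x * g = 1\<^sub>m d" using GH[OF \<delta>x] by (simp add: inverse_mats_def G(1))
    note m = mat_tuplesD(2)[OF pm a] mat_tuplesD(2)[OF xm a]
    have "pt x ! a = H x * x ! a * g" unfolding pt[OF xm] using a mat_tuplesD(1)[OF xm] by (simp add: G(1))
    also have "\<dots> = H x * (g * p ! a)" using int a assoc_mult_mat[OF Hc m(2) gc] by simp
    also have "\<dots> = p ! a" using assoc_mult_mat[OF Hc gc m(1), of x] Hg m by simp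
    finally show "pt x ! a = p ! a" .
  qed
  have Fx: "F x \<noteq> 0" using F(2)[OF \<delta>x] \<delta>x fVp by (auto simp: ptx)
  \<comment> \<open>The realisable ways of raising one index; there are finitely many, so their
    avoidance conditions can be multiplied.\<close>
  define I where "I = {(i0, k). i0 < d \<and> k \<le> L \<and> lv i0 < k \<and>
    (\<forall>j. lvl_count d (lv(i0 := k)) (Suc j) \<le> r * lvl_count d (lv(i0 := k)) j)}"
  have finI: "finite I" by (rule finite_subset[of _ "{..<d} \<times> {..L}"]) (auto simp: I_def)
  have "\<forall>q. \<exists>f. q \<in> I \<longrightarrow> f \<in> poly_funs r d d \<and> (\<forall>y\<in>lvl_orbits r d (lv(fst q := snd q)). f y = 0) \<and> (\<exists>x\<in>C. f x \<noteq> 0)"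
  proof
    fix q
    show "\<exists>f. q \<in> I \<longrightarrow> f \<in> poly_funs r d d \<and> (\<forall>y\<in>lvl_orbits r d (lv(fst q := snd q)). f y = 0) \<and> (\<exists>x\<in>C. f x \<noteq> 0)"
    proof (cases "q \<in> I")
      case True
      obtain i0 k where q: "q = (i0, k)" by fastforce
      have "i0 < d" "lv i0 < k" "k \<le> L" "\<forall>j. lvl_count d (lv(i0 := k)) (Suc j) \<le> r * lvl_count d (lv(i0 := k)) j"
        using True unfolding I_def q mem_Collect_eq prod.case by blast+
      from raised_not_dense[OF this] show ?thesis unfolding q fst_conv snd_conv by (elim bexE) (rule exI, rule impI, rule conjI)
    qed simp
  qed
  from choice[OF this] obtain f where fA: "\<forall>q. q \<in> I \<longrightarrow> f q \<in> poly_funs r d d \<and> (\<forall>y\<in>lvl_orbits r d (lv(fst q := snd q)). f q y = 0) \<and> (\<exists>x\<in>C. f q x \<noteq> 0)"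
    by (elim exE) (rule that)
  have f: "f q \<in> poly_funs r d d" "y \<in> lvl_orbits r d (lv(fst q := snd q)) \<Longrightarrow> f q y = 0" "\<exists>x\<in>C. f q x \<noteq> 0"
    if q: "q \<in> I" for q y
  proof -
    note * = mp[OF spec[OF fA] q]
    show "f q \<in> poly_funs r d d" by (rule conjunct1[OF *])
    show "f q y = 0" if "y \<in> lvl_orbits r d (lv(fst q := snd q))" by (rule bspec[OF conjunct1[OF conjunct2[OF *]] that])
    show "\<exists>x\<in>C. f q x \<noteq> 0" by (rule conjunct2[OF conjunct2[OF *]])
  qed
  define \<psi> where "\<psi> y = (\<Prod>q\<in>I. f q y)" for y
  have \<psi>: "\<psi> \<in> poly_funs r d d" unfolding \<psi>_def by (rule poly_funs.prod[OF f(1)])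
  have \<psi>C: "\<exists>y\<in>C. \<psi> y \<noteq> 0" unfolding \<psi>_def by (rule zirr_prod[OF Cirr finI f(1,3)])
  define \<Phi> where "\<Phi> y = f0 y * \<delta> y * F y" for y
  have \<Phi>: "\<Phi> \<in> poly_funs r d d" unfolding \<Phi>_def by (intro poly_funs.mult f0(1) \<delta> F(1))
  have \<Phi>C: "\<exists>y\<in>C. \<Phi> y \<noteq> 0" by (rule bexI[OF _ x(1)]) (simp add: \<Phi>_def x(2) \<delta>x Fx)
  have main: "indecomposable_module (trunc_algebra r L) (rep_module d y)" if y: "y \<in> C" and nz: "\<Phi> y * \<psi> y \<noteq> 0" for y
  proof -
    have nz': "f0 y \<noteq> 0" "\<delta> y \<noteq> 0" "F y \<noteq> 0" "\<And>q. q \<in> I \<Longrightarrow> f q y \<noteq> 0"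
      using nz finI by (auto simp: \<Phi>_def \<psi>_def)
    note ym = C_tuples[OF y] and GHy = GH[OF nz'(2)]
    obtain g' h' where "adapted r d y lv g' h'" using ad[OF y nz'(1)] by (elim exE) (rule that)
    then have ady: "adapted r d y lv (G y) (H y)" by (rule chart_adapted[OF _ GHy G(4)[OF ym]])
    note py = adapted_filtered[OF ym ady, folded pt[OF ym]]
    have "fV (?b (pt y)) \<noteq> 0" using F(2)[OF nz'(2)] nz'(3) by auto
    then have kin: "kronecker_indecomposable (?s j) (?s (Suc j)) (?b (pt y))" by (rule ind[OF block_tuple_mem])
    have avoid: "pt y \<notin> lvl_orbits r d (lv(i0 := k))" if "i0 < d" "lv i0 < k" "k \<le> L"
      "\<forall>j. lvl_count d (lv(i0 := k)) (Suc j) \<le> r * lvl_count d (lv(i0 := k)) j" for i0 k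
    proof
      assume "pt y \<in> lvl_orbits r d (lv(i0 := k))"
      then have "y \<in> lvl_orbits r d (lv(i0 := k))" by (rule lvl_orbits_conj[OF _ ym GHy py(2)])
      moreover have "(i0, k) \<in> I" using that unfolding I_def mem_Collect_eq prod.case by blast
      ultimately show False using nz'(4)[of "(i0, k)"] f(2)[of "(i0, k)" y] by simp
    qed
    have triv: "E = 0\<^sub>m d d" if "E \<in> carrier_mat d d" "E * E = E" "\<And>a. a < r \<Longrightarrow> E * pt y ! a = pt y ! a * E"
      "level_block d lv j j E = 0\<^sub>m (?s j) (?s j)" for E
      by (rule block_idempotent_trivial[OF py(3) lvL r j kin avoid that])
    interpret rep_point r L d y by unfold_locales (use y CR in blast)
    show ?thesis
    proof (rule indecomposable_rep_module[OF d])
      fix E assume E: "E \<in> carrier_mat d d" "E * E = E" "\<And>a. a < r \<Longrightarrow> E * y ! a = y ! a * E"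
      \<comment> \<open>The endomorphism in the coordinates of the triangular form, where its
        diagonal blocks give an idempotent pair on the Kronecker block.\<close>
      define E' where "E' = H y * E * G y"
      have Eback: "G y * E' * H y = E" unfolding E'_def by (rule conj_back[OF GHy E(1)])
      have E'c: "E' \<in> carrier_mat d d" unfolding E'_def by (rule mult_carrier_mat[OF mult_carrier_mat[OF Hc E(1)] G(2)])
      have E'i: "E' * E' = E'" unfolding E'_def conj_mult[OF GHy E(1) E(1)] E(2) ..
      have E'p: "E' * pt y ! a = pt y ! a * E'" if a: "a < r" for a
      proof -
        note ya = mat_tuplesD(2)[OF ym a]
        have "pt y ! a = H y * y ! a * G y" unfolding pt[OF ym] using a mat_tuplesD(1)[OF ym] by simp
        then show ?thesis unfolding E'_def using conj_mult[OF GHy E(1) ya] conj_mult[OF GHy ya E(1)] E(3)[OF a] by simp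
      qed
      have lE: "lvl_matrix d lv E'" by (rule filtered_hom_lvl_matrix[OF py(3) py(3) E'c E'p])
      let ?e = "\<lambda>j. level_block d lv j j E'"
      have ei: "?e k * ?e k = ?e k" for k using lvl_matrix_block_mult[OF lE lE, of k] by (simp add: E'i)
      have pty: "pt y \<in> lvl_tuples r d lv" using py(3) by (simp add: filtered_def)
      have eb: "?b (pt y) ! a * ?e j = ?e (Suc j) * ?b (pt y) ! a" if "a < r" for a
        by (rule block_tuple_intertwine[OF lE pty pty E'p that, symmetric])
      from kronecker_indecomposable_idempotent[OF block_tuple_mem kin level_block_carrier ei level_block_carrier ei eb]
      consider "?e j = 0\<^sub>m (?s j) (?s j)" | "?e j = 1\<^sub>m (?s j)" by blast
      then show "E = 0\<^sub>m d d \<or> E = 1\<^sub>m d"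
      proof cases
        case 1
        have "E' = 0\<^sub>m d d" by (rule triv[OF E'c E'i E'p 1])
        then have "E = 0\<^sub>m d d" using Eback G(2)[of y] Hc[of y] by simp
        then show ?thesis ..
      next
        case 2
        \<comment> \<open>The complementary idempotent is the one whose block at level
          \<open>j\<close> vanishes in this case.\<close>
        let ?D = "1\<^sub>m d - E'"
        have Dc: "?D \<in> carrier_mat d d" by (rule minus_carrier_mat[OF E'c])
        have "?D * ?D = ?D"
        proof -
          have "?D * ?D = 1\<^sub>m d * ?D - E' * ?D" by (rule minus_mult_distrib_mat[OF one_carrier_mat E'c Dc])
          also have "E' * ?D = E' * 1\<^sub>m d - E' * E'" by (rule mult_minus_distrib_mat[OF E'c one_carrier_mat E'c])
          also have "\<dots> = 0\<^sub>m d d" using E'c by (simp add: E'i)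
          also have "1\<^sub>m d * ?D - 0\<^sub>m d d = ?D" unfolding left_mult_one_mat[OF Dc] by (rule eq_matI) (use E'c in auto)
          finally show ?thesis .
        qed
        moreover have "?D * pt y ! a = pt y ! a * ?D" if a: "a < r" for a
          using minus_mult_distrib_mat[OF one_carrier_mat E'c mat_tuplesD(2)[OF py(1) a]]
            mult_minus_distrib_mat[OF mat_tuplesD(2)[OF py(1) a] one_carrier_mat E'c] mat_tuplesD(2)[OF py(1) a] E'p[OF a] by simp
        moreover have "level_block d lv j j ?D = 0\<^sub>m (?s j) (?s j)"
        proof (rule eq_matI)
          fix s t assume "s < dim_row (0\<^sub>m (?s j) (?s j) :: 'a mat)" "t < dim_col (0\<^sub>m (?s j) (?s j) :: 'a mat)"
          then have st: "s < ?s j" "t < ?s j" by simp_all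
          have "level_block d lv j j ?D $$ (s, t) = level_block d lv j j (1\<^sub>m d) $$ (s, t) - ?e j $$ (s, t)"
            using level_index_less(1)[OF st(1)] level_index_less(1)[OF st(2)] st E'c by (simp add: level_block_def)
          then show "level_block d lv j j ?D $$ (s, t) = 0\<^sub>m (?s j) (?s j) $$ (s, t)"
            using st by (simp add: level_block_one 2)
        qed (simp_all add: level_block_def)
        ultimately have D0: "?D = 0\<^sub>m d d" by (rule triv[OF Dc])
        have "E' = 1\<^sub>m d"
        proof (rule eq_matI)
          fix i k assume "i < dim_row (1\<^sub>m d :: 'a mat)" "k < dim_col (1\<^sub>m d :: 'a mat)"
          then have ik: "i < d" "k < d" by simp_all
          then show "E' $$ (i, k) = 1\<^sub>m d $$ (i, k)" using arg_cong[OF D0, of "\<lambda>A. A $$ (i, k)"] E'c by simp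
        qed (use E'c in auto)
        then have "E = 1\<^sub>m d" using Eback G(2)[of y] GHy by (simp add: inverse_mats_def)
        then show ?thesis ..
      qed
    qed
  qed
  show ?thesis unfolding generically_indecomposable_def generically_iff[OF Cirr]
  proof (intro bexI[of _ "\<lambda>y. \<Phi> y * \<psi> y"] conjI ballI impI)
    show "(\<lambda>y. \<Phi> y * \<psi> y) \<in> poly_funs r d d" by (rule poly_funs.mult[OF \<Phi> \<psi>])
    show "\<exists>y\<in>C. \<Phi> y * \<psi> y \<noteq> 0" using zirrD[OF Cirr \<Phi> \<psi> \<Phi>C \<psi>C] by simp
  qed (rule main)
qed

end

section \<open>Orbits of maximal dimension\<close>

lemma (in linear_action) infinite_max_orbits_rk:
  assumes inf: "infinite (max_dim_orbits (zariski r m n) (orb ` X))" and x: "x \<in> X"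
  shows "rk x < card Q"
proof (rule ccontr)
  assume "\<not> rk x < card Q"
  then have full: "rk x = card Q" using rk_le[of x] by simp
  \<comment> \<open>A point of full rank would force every orbit of maximal dimension to have full
    rank, and there is only one such orbit.\<close>
  have "max_dim_orbits (zariski r m n) (orb ` X) \<subseteq> {orb x}"
  proof
    fix Z assume Z: "Z \<in> max_dim_orbits (zariski r m n) (orb ` X)"
    then obtain y where y: "y \<in> X" "Z = orb y" unfolding max_dim_orbits_def by blast
    have "krull_dim (subtopology (zariski r m n) (orb x)) \<le> krull_dim (subtopology (zariski r m n) Z)"
      using Z x unfolding max_dim_orbits_def by blast
    then have "rk x \<le> rk y" unfolding y(2) krull_dim_orb[OF x] krull_dim_orb[OF y(1)] by simp
    then have "rk y = card Q" using full rk_le[of y] by simp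
    then show "Z \<in> {orb x}" using full_rank_orbs_eq[OF y(1) _ x full] y(2) by simp
  qed
  then show False using inf finite_subset by blast
qed

lemma (in linear_action) max_orbitI:
  assumes C: "C \<subseteq> X" and x: "x \<in> C" and max: "\<And>y. y \<in> C \<Longrightarrow> rk y \<le> rk x"
  shows "orb x \<in> max_dim_orbits (zariski r m n) (orb ` C)"
  unfolding max_dim_orbits_def
proof (intro CollectI conjI ballI imageI x)
  fix Y assume "Y \<in> orb ` C"
  then obtain y where y: "y \<in> C" "Y = orb y" by blast
  have "x \<in> X" "y \<in> X" using C x y(1) by blast+
  then show "krull_dim (subtopology (zariski r m n) Y) \<le> krull_dim (subtopology (zariski r m n) (orb x))"
    using max[OF y(1)] unfolding y(2) by (simp add: krull_dim_orb)
qed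

context filtered_component
begin

text \<open>By contradiction: points of maximal rank fill an open part of \<open>C\<close>, so
  finitely many maximal orbits would cover the general points. Each contributes at most one
  Kronecker orbit of blocks, and none of these is dense.\<close>

theorem infinite_max_dim_orbits:
  assumes inf: "infinite (max_dim_orbits (zariski r (lvl_count d lv (Suc j)) (lvl_count d lv j) :: 'a mat list topology)
      (orbits (GL (lvl_count d lv j) \<times>\<times> GL (lvl_count d lv (Suc j))) (mat_tuples r (lvl_count d lv (Suc j)) (lvl_count d lv j))
        (kronecker_action (lvl_count d lv j) (lvl_count d lv (Suc j)))))"
  shows "infinite (max_dim_orbits (zariski r d d) (orbits (GL d) C (conj_action d)))"
proof
  define n1 where "n1 = lvl_count d lv j"
  define n2 where "n2 = lvl_count d lv (Suc j)"
  let ?b = "block_tuple r d lv (Suc j) j"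
  interpret A: linear_action r d d "\<lambda>i j. i * d + j" "\<lambda>i j. i * d + j" "TYPE('a)" by (rule linear_action_conj)
  interpret K: linear_action r n2 n1 "\<lambda>i j. i * n2 + j" "\<lambda>i j. n2 * n2 + (i * n1 + j)" "TYPE('a)" by (rule linear_action_kronecker)
  have bmem: "?b p \<in> K.X" for p unfolding n1_def n2_def by (rule block_tuple_mem)
  have conj: "\<exists>c. A.invertible_param c \<and> A.H2 c = g" if "inverse_mats d g h" for g h :: "'a mat"
  proof -
    have g: "g \<in> carrier_mat d d" using that by (simp add: inverse_mats_def)
    obtain c where "A.H2 c = g" using coord_mat_pair[OF g g] by (elim exE conjE) (rule that)
    then show ?thesis using inverse_mats_det[OF that] by (intro exI[of _ c]) (simp add: A.invertible_param_def)
  qed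
  have Korb: "orbit (GL n1 \<times>\<times> GL n2) (kronecker_action n1 n2) x = K.orb x" if x: "x \<in> K.X" for x
  proof (intro subset_antisym subsetI)
    fix y assume "y \<in> orbit (GL n1 \<times>\<times> GL n2) (kronecker_action n1 n2) x"
    then obtain g2 h2 g1 h1 where y: "y \<in> K.X" and g2: "inverse_mats n2 g2 h2" and g1: "inverse_mats n1 g1 h1"
      and int: "\<forall>a<r. g2 * x ! a = y ! a * g1"
      unfolding kronecker_orbit_eq[OF x] mem_Collect_eq by (elim exE conjE) (rule that)
    have c: "g2 \<in> carrier_mat n2 n2" "g1 \<in> carrier_mat n1 n1" using g1 g2 by (auto simp: inverse_mats_def)
    obtain c where c: "K.H2 c = g2" "K.H1 c = g1" using coord_mat_pair[OF c] by (elim exE conjE) (rule that)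
    show "y \<in> K.orb x"
      by (rule K.mem_orbI[OF x y, of c]) (use int inverse_mats_det[OF g2] inverse_mats_det[OF g1] in \<open>simp_all add: c K.invertible_param_def\<close>)
  next
    fix y assume "y \<in> K.orb x"
    then obtain c where c: "K.invertible_param c" "\<And>i. i < r \<Longrightarrow> K.H2 c * x ! i = y ! i * K.H1 c" and y: "y \<in> K.X"
      using K.mem_orbE[OF _ x] by blast
    have cc: "K.H2 c \<in> carrier_mat n2 n2" "K.H1 c \<in> carrier_mat n1 n1" by (simp_all add: coord_mat_def)
    have "inverse_mats n2 (K.H2 c) (inverse (det (K.H2 c)) \<cdot>\<^sub>m adj_mat (K.H2 c))" "inverse_mats n1 (K.H1 c) (inverse (det (K.H1 c)) \<cdot>\<^sub>m adj_mat (K.H1 c))"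
      using c(1) by (auto simp: K.invertible_param_def intro: inverse_mats_adj cc)
    then show "y \<in> orbit (GL n1 \<times>\<times> GL n2) (kronecker_action n1 n2) x"
      unfolding kronecker_orbit_eq[OF x] using y c(2) by blast
  qed
  have Ainv: "inverse_mats d (A.H2 c) (inverse (det (A.H2 c)) \<cdot>\<^sub>m adj_mat (A.H2 c))" if "A.invertible_param c" for c
    by (rule inverse_mats_adj) (use that in \<open>simp_all add: A.invertible_param_def coord_mat_def\<close>)
  have Aorb: "orbit (GL d) (conj_action d) x = A.orb x" if x: "x \<in> A.X" for x
  proof (intro subset_antisym subsetI)
    fix y assume "y \<in> orbit (GL d) (conj_action d) x"
    then obtain g h where y: "y \<in> A.X" and gh: "inverse_mats d g h" and int: "\<forall>a<r. g * x ! a = y ! a * g"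
      unfolding conj_orbit_eq[OF x] mem_Collect_eq by (elim exE conjE) (rule that)
    obtain c where c: "A.invertible_param c" "A.H2 c = g" using conj[OF gh] by (elim exE conjE) (rule that)
    show "y \<in> A.orb x" by (rule A.mem_orbI[OF x y c(1)]) (use int in \<open>simp add: c(2)\<close>)
  next
    fix y assume "y \<in> A.orb x"
    then obtain c where c: "A.invertible_param c" "\<And>i. i < r \<Longrightarrow> A.H2 c * x ! i = y ! i * A.H2 c" and y: "y \<in> A.X"
      using A.mem_orbE[OF _ x] by blast
    then show "y \<in> orbit (GL d) (conj_action d) x" unfolding conj_orbit_eq[OF x] using Ainv[OF c(1)] by blast
  qed
  have "orbits (GL n1 \<times>\<times> GL n2) K.X (kronecker_action n1 n2) = K.orb ` K.X"
    unfolding orbits_def using Korb by (auto simp: image_def)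
  then have "infinite (max_dim_orbits (zariski r n2 n1) (K.orb ` K.X))" using inf unfolding n1_def[symmetric] n2_def[symmetric] by simp
  note small = K.infinite_max_orbits_rk[OF this]
  have CX: "C \<subseteq> A.X" using C_tuples by blast
  have "orbits (GL d) C (conj_action d) = A.orb ` C"
    unfolding orbits_def using Aorb C_tuples by (auto simp: image_def)
  moreover assume "finite (max_dim_orbits (zariski r d d) (orbits (GL d) C (conj_action d)))"
  ultimately have fin: "finite (max_dim_orbits (zariski r d d) (A.orb ` C))" by simp
  define S where "S = max_dim_orbits (zariski r d d) (A.orb ` C)"
  obtain c0 where c0: "c0 \<in> C" using f0(2) by blast
  have "\<exists>x. x \<in> C \<and> (\<forall>y. y \<in> C \<longrightarrow> A.rk y \<le> A.rk x)"
    by (rule ex_has_greatest_nat[of "\<lambda>x. x \<in> C" c0 A.rk "Suc (card A.Q)"]) (use c0 A.rk_le in \<open>auto simp: less_Suc_eq_le\<close>)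
  then obtain x0 where x0: "x0 \<in> C" "\<And>y. y \<in> C \<Longrightarrow> A.rk y \<le> A.rk x0" by blast
  \<comment> \<open>The maximal rank persists where \<open>fa\<close> is nonzero, so the orbits of
    all those points of \<open>C\<close> belong to \<open>S\<close>.\<close>
  obtain fa where fa: "fa \<in> poly_funs r d d" "fa x0 \<noteq> 0" "\<And>y. fa y \<noteq> 0 \<Longrightarrow> A.rk x0 \<le> A.rk y"
    using A.rk_semicontinuous[of x0] by blast
  \<comment> \<open>A polynomial obstruction for each maximal orbit \<open>Z\<close>: it vanishes on
    the single Kronecker orbit containing the blocks of the filtered points of \<open>Z\<close>. If
    there are no such points, the constant 1 serves.\<close>
  have "\<forall>Z. \<exists>F. Z \<in> S \<longrightarrow> F \<in> poly_funs r n2 n1 \<and> (\<exists>B\<in>K.X. F B \<noteq> 0) \<and> (\<forall>p\<in>Z. filtered r d lv p \<longrightarrow> F (?b p) = 0)"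
  proof
    fix Z
    show "\<exists>F. Z \<in> S \<longrightarrow> F \<in> poly_funs r n2 n1 \<and> (\<exists>B\<in>K.X. F B \<noteq> 0) \<and> (\<forall>p\<in>Z. filtered r d lv p \<longrightarrow> F (?b p) = 0)"
    proof (cases "Z \<in> S \<and> (\<exists>p\<in>Z. filtered r d lv p)")
      case True
      then obtain p0 where p0: "p0 \<in> Z" "filtered r d lv p0" by blast
      obtain x where x: "x \<in> C" "Z = A.orb x" using True unfolding S_def max_dim_orbits_def by blast
      have p0x: "p0 \<in> A.orb x" using p0(1) x(2) by simp
      have p0X: "p0 \<in> A.X" using p0(2) by (simp add: filtered_def lvl_tuples_def)
      have Z: "Z = A.orb p0" using A.orb_eq[OF C_tuples[OF x(1)] p0x] x(2) by simp
      obtain F where F: "F \<in> poly_funs r n2 n1" "\<forall>y\<in>K.orb (?b p0). F y = 0" "\<exists>y\<in>K.X. F y \<noteq> 0"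
        using K.small_orb_not_dense[OF bmem[of p0] small[OF bmem[of p0]]] by (rule bexE) (elim conjE, rule that)
      have "F (?b p) = 0" if p: "p \<in> Z" "filtered r d lv p" for p
      proof -
        obtain c where c: "A.invertible_param c" "\<And>i. i < r \<Longrightarrow> A.H2 c * p0 ! i = p ! i * A.H2 c"
          using p(1) A.mem_orbE[OF _ p0X] unfolding Z by blast
        have "?b p \<in> orbit (GL n1 \<times>\<times> GL n2) (kronecker_action n1 n2) (?b p0)"
          unfolding kronecker_orbit_eq[OF bmem] mem_Collect_eq
          using bmem block_tuple_conjugate[OF p0(2) p(2) Ainv[OF c(1)] c(2), of j, folded n1_def n2_def] by (intro conjI)
        then show ?thesis using F(2) unfolding Korb[OF bmem] by simp
      qed
      then show ?thesis using F(1,3) by (intro exI[of _ F] impI conjI ballI)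
    next
      case False
      have "\<exists>B. B \<in> K.X" using zirr_mat_tuples[where 'a = 'a, of r n2 n1] by (auto simp: zirr_def)
      then have "\<exists>B\<in>K.X. (1 :: 'a) \<noteq> 0" by auto
      moreover have "\<forall>p\<in>Z. filtered r d lv p \<longrightarrow> (1 :: 'a) = 0" if "Z \<in> S" using False that by blast
      ultimately show ?thesis by (intro exI[of _ "\<lambda>_. 1"] impI conjI poly_funs.const) simp_all
    qed
  qed
  from choice[OF this] obtain F where FA: "\<forall>Z. Z \<in> S \<longrightarrow> F Z \<in> poly_funs r n2 n1 \<and> (\<exists>B\<in>K.X. F Z B \<noteq> 0) \<and> (\<forall>p\<in>Z. filtered r d lv p \<longrightarrow> F Z (?b p) = 0)"
    by (elim exE) (rule that)
  have F: "F Z \<in> poly_funs r n2 n1" "\<exists>B\<in>K.X. F Z B \<noteq> 0" "p \<in> Z \<Longrightarrow> filtered r d lv p \<Longrightarrow> F Z (?b p) = 0"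
    if Z: "Z \<in> S" for Z p
  proof -
    note * = mp[OF spec[OF FA] Z]
    show "F Z \<in> poly_funs r n2 n1" by (rule conjunct1[OF *])
    show "\<exists>B\<in>K.X. F Z B \<noteq> 0" by (rule conjunct1[OF conjunct2[OF *]])
    show "F Z (?b p) = 0" if "p \<in> Z" "filtered r d lv p" by (rule mp[OF bspec[OF conjunct2[OF conjunct2[OF *]] that(1)] that(2)])
  qed
  have finS: "finite S" using fin by (simp add: S_def)
  define \<psi> where "\<psi> B = (\<Prod>Z\<in>S. F Z B)" for B
  have \<psi>: "\<psi> \<in> poly_funs r n2 n1" unfolding \<psi>_def by (rule poly_funs.prod[OF F(1)])
  have "\<exists>B\<in>K.X. \<psi> B \<noteq> 0" unfolding \<psi>_def by (rule zirr_prod[OF zirr_mat_tuples finS F(1,2)])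
  then obtain B where B: "B \<in> K.X" "\<psi> B \<noteq> 0" by (elim bexE) (rule that)
  have faC: "\<exists>x\<in>C. fa x \<noteq> 0" using x0(1) fa(2) by blast
  \<comment> \<open>A point whose orbit is maximal, while the block of its triangular form escapes
    all obstructions at once: the contradiction.\<close>
  obtain x p g h where x: "x \<in> C" "fa x \<noteq> 0" and p: "filtered r d lv p" and gh: "inverse_mats d g h"
    and int: "\<forall>a<r. g * p ! a = x ! a * g" and nz: "\<psi> (?b p) \<noteq> 0"
    using generic_filtered_point[OF fa(1) faC, of \<psi> j B, folded n1_def n2_def, OF \<psi> B] by (elim exE conjE) (rule that)
  have pX: "p \<in> A.X" using p by (simp add: filtered_def lvl_tuples_def)
  have "A.orb x \<in> S" unfolding S_def
    by (rule A.max_orbitI[OF CX x(1)]) (rule le_trans[OF x0(2) fa(3)[OF x(2)]])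
  moreover have "p \<in> A.orb x"
  proof (rule A.orb_sym[OF pX])
    obtain c where c: "A.invertible_param c" "A.H2 c = g" using conj[OF gh] by (elim exE conjE) (rule that)
    show "x \<in> A.orb p" by (rule A.mem_orbI[OF pX C_tuples[OF x(1)] c(1)]) (use int in \<open>simp add: c(2)\<close>)
  qed
  ultimately have "\<exists>Z\<in>S. F Z (?b p) = 0" using F(3)[OF _ _ p] by blast
  then show False using nz finS by (auto simp: \<psi>_def)
qed

end

text \<open>The dimensions of the generic layers are the level counts of an adapted basis at any
  general point. A level function taken from one such point turns \<open>C\<close> into a
  \<open>filtered_component\<close>, with the index \<open>l\<close> of the statement being
  \<open>Suc j\<close>.\<close>

theorem corollaryE:
  fixes r L d :: nat
    and C :: "'a::alg_closed_field mat list set"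
    and \<S> :: "nat \<Rightarrow> ((nat list \<Rightarrow> 'a) set, 'm) module"
  assumes "r \<ge> 2" and "L \<ge> 1" and "d > L + 1"
    and "irreducible_component (subtopology (zariski r d d) (Rep r L d)) C"
    and "generic_radical_layering r L d C \<S>"
  shows "((\<exists>l\<in>{1..L}.
             schur_root TYPE('a) r (module_dim r L (\<S> (l - 1))) (module_dim r L (\<S> l)))
           \<longrightarrow> generically_indecomposable r L d C)
       \<and> ((\<exists>l\<in>{1..L}. let d1 = module_dim r L (\<S> (l - 1)); d2 = module_dim r L (\<S> l) in
             infinite (max_dim_orbits (zariski r d2 d1 :: 'a mat list topology)
               (orbits (GL d1 \<times>\<times> GL d2) (mat_tuples r d2 d1) (kronecker_action d1 d2))))
           \<longrightarrow> infinite (max_dim_orbits (zariski r d d) (orbits (GL d) C (conj_action d))))"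
proof -
  have R: "(Rep r L d :: 'a mat list set) \<subseteq> mat_tuples r d d" by (auto simp: Rep_def)
  note C = irreducible_component_iff_zirr[OF R assms(4)]
  obtain f0 where f0: "f0 \<in> poly_funs r d d" "\<exists>x\<in>C. f0 x \<noteq> 0"
    and layers: "\<forall>x\<in>C. f0 x \<noteq> 0 \<longrightarrow> (\<forall>l\<le>L. isomorphic_modules (trunc_algebra r L)
      (radical_layer (trunc_algebra r L) (rep_module d x) l) (\<S> l))"
    using assms(5) unfolding generic_radical_layering_def generically_iff[OF C(2)]
    by (rule bexE) (elim conjE, rule that)
  have dims: "module_dim r L (\<S> l) = lvl_count d lv l"
    if xC: "x \<in> C" "f0 x \<noteq> 0" and ad: "adapted r d x lv g h" and l: "l \<le> L" for x lv g h l
  proof -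
    have "x \<in> Rep r L d" using xC(1) C(1) by blast
    then interpret rep_point r L d x by unfold_locales
    show ?thesis by (rule radical_layer_dim[OF ad layers[rule_format, OF xC l]])
  qed
  obtain x1 where x1: "x1 \<in> C" "f0 x1 \<noteq> 0" using f0(2) by (elim bexE) (rule that)
  have "x1 \<in> Rep r L d" using x1(1) C(1) by blast
  from adapted_exists[OF this] obtain lv g1 h1 where ad1: "adapted r d x1 lv g1 h1" and lvL: "\<forall>i<d. lv i \<le> L"
    by (elim exE conjE) (rule that)
  note s = dims[OF x1 ad1]
  \<comment> \<open>Another general point has a level function of its own, but isomorphic layers
    give equal counts up to level \<open>L\<close> and both counts are zero beyond; permuting the
    basis then aligns it with \<open>lv\<close>.\<close>
  have ad: "\<exists>g h. adapted r d x lv g h" if x: "x \<in> C" "f0 x \<noteq> 0" for x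
  proof -
    have "x \<in> Rep r L d" using x(1) C(1) by blast
    from adapted_exists[OF this] obtain lv' g h where ad': "adapted r d x lv' g h" and lvL': "\<forall>i<d. lv' i \<le> L"
      by (elim exE conjE) (rule that)
    have "lvl_count d lv j = lvl_count d lv' j" for j
    proof (cases "j \<le> L")
      case True then show ?thesis using s dims[OF x ad'] by simp
    next
      case False
      then have "{i. i < d \<and> lv i = j} = {}" "{i. i < d \<and> lv' i = j} = {}" using lvL lvL' by auto
      then show ?thesis by (simp only:)
    qed
    then show ?thesis by (rule adapted_permute[OF ad'])
  qed
  interpret filtered_component r L d C lv f0
  proof
    show "C \<subseteq> Rep r L d" "zirr r d d C" by (rule C)+
    show "D \<subseteq> C" if "zirr r d d D" "D \<subseteq> Rep r L d" "C \<subseteq> zcl r d d D" for D by (rule C(3)[OF that])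
    show "lv i \<le> L" if "i < d" for i using lvL that by simp
  qed (fact f0, fact f0, rule ad)
  show ?thesis
  proof (intro conjI impI)
    assume "\<exists>l\<in>{1..L}. schur_root TYPE('a) r (module_dim r L (\<S> (l - 1))) (module_dim r L (\<S> l))"
    then obtain l where l: "l \<in> {1..L}" "schur_root TYPE('a) r (module_dim r L (\<S> (l - 1))) (module_dim r L (\<S> l))" by blast
    then obtain j where j: "l = Suc j" "Suc j \<le> L" by (cases l) auto
    have "schur_root TYPE('a) r (lvl_count d lv j) (lvl_count d lv (Suc j))" using l(2) j s[of j] s[of "Suc j"] by simp
    then show "generically_indecomposable r L d C"
      using assms(3) by (intro generically_indecomposable_of_schur_root[OF assms(1) _ j(2)]) auto
  next
    assume "\<exists>l\<in>{1..L}. let d1 = module_dim r L (\<S> (l - 1)); d2 = module_dim r L (\<S> l) in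
      infinite (max_dim_orbits (zariski r d2 d1 :: 'a mat list topology)
        (orbits (GL d1 \<times>\<times> GL d2) (mat_tuples r d2 d1) (kronecker_action d1 d2)))"
    then obtain l where l: "l \<in> {1..L}" "infinite (max_dim_orbits (zariski r (module_dim r L (\<S> l)) (module_dim r L (\<S> (l - 1))) :: 'a mat list topology)
        (orbits (GL (module_dim r L (\<S> (l - 1))) \<times>\<times> GL (module_dim r L (\<S> l)))
          (mat_tuples r (module_dim r L (\<S> l)) (module_dim r L (\<S> (l - 1))))
          (kronecker_action (module_dim r L (\<S> (l - 1))) (module_dim r L (\<S> l)))))"
      unfolding Let_def by blast
    then obtain j where j: "l = Suc j" "Suc j \<le> L" by (cases l) auto
    have n: "module_dim r L (\<S> (l - 1)) = lvl_count d lv j" "module_dim r L (\<S> l) = lvl_count d lv (Suc j)"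
      using j s[of j] s[of "Suc j"] by simp_all
    show "infinite (max_dim_orbits (zariski r d d) (orbits (GL d) C (conj_action d)))"
      by (rule infinite_max_dim_orbits[of j]) (rule l(2)[unfolded n])
  qed
qed

end
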